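(* Say that a countable group $\Gamma$ satisfies $(\ast)$ if it admits a normal series $\Gamma=\Gamma_0\rhd\Gamma_1\rhd\cdots\rhd\Gamma_n=\{1_\Gamma\}$ such that each quotient of consecutive terms is a finite group, an increasing union of finite characteristic subgroups, or a torsion-free abelian group with finite $\mathbb{Q}$-rank, except that the top quotient $\Gamma_0/\Gamma_1$ can alternatively be any group of uniform local polynomial volume-growth or the lamplighter group $\mathbb{Z}_2\wr\mathbb{Z}$. If $G$ is the union of an increasing sequence of countable groups each satisfying $(\ast)$, $X$ is a standard Borel space, and $G\curvearrowright X$ is a free Borel action, then the orbit equivalence relation $E_G^X$ is hyperfinite.
   Context: A normal series of $\Gamma$ is a finite sequence as displayed of subgroups each of which is normal in $\Gamma$. The $\mathbb{Q}$-rank of an abelian group $A$ is $\dim_{\mathbb{Q}}(\mathbb{Q}\otimes A)$. A finitely generated group has polynomial volume-growth of degree $d$ if $d\in\mathbb{N}$ is least such that for any (equivalently every) finite symmetric generating set $B$ containing the identity there is $c>0$ with $|B^r|\le cr^d$ for all $r\ge1$. A group has uniform local polynomial volume-growth if there is $d\in\mathbb{N}$ such that every finitely generated subgroup has polynomial volume-growth of degree at most $d$. An action is free if $g\cdot x\ne x$ for all $x$ and all $g\ne1_G$. $E_G^X=\{(x,y)\in X\times X:\exists g\in G\ g\cdot x=y\}$. An equivalence relation on $X$ is Borel if it is a Borel subset of $X\times X$, finite if all its classes are finite, and hyperfinite if it is the union of an increasing sequence of finite Borel equivalence relations. *)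

theory Defs
  imports
    "HOL-Analysis.Analysis"
    "HOL-Algebra.Group_Action"
    "HOL-Algebra.Free_Abelian_Groups"
    "Jordan_Normal_Form.Missing_VectorSpace"
begin

text \<open>A standard Borel space is given as a \<^typ>\<open>'x measure\<close> of which only the underlying set and
  the sigma-algebra are used.\<close>

definition standard_borel :: "'x measure \<Rightarrow> bool" where
  "standard_borel X \<longleftrightarrow>
     (\<exists>T. completely_metrizable_space T \<and> second_countable T \<and> topspace T = space X \<and>
          sets X = sigma_sets (topspace T) {U. openin T U})"

text \<open>For a standard Borel space the Borel sigma-algebra of the square is the product
  sigma-algebra.\<close>

definition borel_equivalence :: "'x measure \<Rightarrow> ('x \<times> 'x) set \<Rightarrow> bool" where
  "borel_equivalence X E \<longleftrightarrow> equiv (space X) E \<and> E \<in> sets (X \<Otimes>\<^sub>M X)"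

definition finite_classes :: "('x \<times> 'x) set \<Rightarrow> bool" where
  "finite_classes E \<longleftrightarrow> (\<forall>x. finite (E `` {x}))"

definition hyperfinite :: "'x measure \<Rightarrow> ('x \<times> 'x) set \<Rightarrow> bool" where
  "hyperfinite X E \<longleftrightarrow> equiv (space X) E \<and>
     (\<exists>F. incseq F \<and> (\<forall>n::nat. borel_equivalence X (F n) \<and> finite_classes (F n)) \<and>
          E = (\<Union>n. F n))"

text \<open>All groups acting here are countable and carry the discrete Borel structure.\<close>

definition borel_action ::
    "('g, 'm) monoid_scheme \<Rightarrow> 'x measure \<Rightarrow> ('g \<Rightarrow> 'x \<Rightarrow> 'x) \<Rightarrow> bool" where
  "borel_action G X \<phi> \<longleftrightarrow> group_action G (space X) \<phi> \<and>
     (\<lambda>(g, x). \<phi> g x) \<in> measurable (count_space (carrier G) \<Otimes>\<^sub>M X) X"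

definition free_action ::
    "('g, 'm) monoid_scheme \<Rightarrow> 'x measure \<Rightarrow> ('g \<Rightarrow> 'x \<Rightarrow> 'x) \<Rightarrow> bool" where
  "free_action G X \<phi> \<longleftrightarrow>
     (\<forall>x\<in>space X. \<forall>g\<in>carrier G. g \<noteq> \<one>\<^bsub>G\<^esub> \<longrightarrow> \<phi> g x \<noteq> x)"

definition orbit_equivalence ::
    "('g, 'm) monoid_scheme \<Rightarrow> 'x measure \<Rightarrow> ('g \<Rightarrow> 'x \<Rightarrow> 'x) \<Rightarrow> ('x \<times> 'x) set" where
  "orbit_equivalence G X \<phi> =
     {(x, y) \<in> space X \<times> space X. \<exists>g\<in>carrier G. \<phi> g x = y}"

definition finitely_generated_group :: "('g, 'm) monoid_scheme \<Rightarrow> bool" where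
  "finitely_generated_group G \<longleftrightarrow>
     (\<exists>S. finite S \<and> S \<subseteq> carrier G \<and> generate G S = carrier G)"

primrec set_power :: "('g, 'm) monoid_scheme \<Rightarrow> 'g set \<Rightarrow> nat \<Rightarrow> 'g set" where
  "set_power G B 0 = {\<one>\<^bsub>G\<^esub>}"
| "set_power G B (Suc r) = set_power G B r <#>\<^bsub>G\<^esub> B"

text \<open>Degree bounds are required for every symmetric generating set; whether a bound holds does
  not depend on the generating set. The definition is only used for finitely generated groups.\<close>

definition volume_growth_le :: "('g, 'm) monoid_scheme \<Rightarrow> nat \<Rightarrow> bool" where
  "volume_growth_le G d \<longleftrightarrow>
     (\<forall>B. finite B \<and> B \<subseteq> carrier G \<and> \<one>\<^bsub>G\<^esub> \<in> B \<and> (\<forall>b\<in>B. inv\<^bsub>G\<^esub> b \<in> B) \<and>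
          generate G B = carrier G \<longrightarrow>
          (\<exists>c>0::real. \<forall>r\<ge>1. real (card (set_power G B r)) \<le> c * real r ^ d))"

definition polynomial_volume_growth :: "('g, 'm) monoid_scheme \<Rightarrow> nat \<Rightarrow> bool" where
  "polynomial_volume_growth G d \<longleftrightarrow>
     finitely_generated_group G \<and> volume_growth_le G d \<and> (\<forall>d'<d. \<not> volume_growth_le G d')"

definition uniform_local_polynomial_growth :: "('g, 'm) monoid_scheme \<Rightarrow> bool" where
  "uniform_local_polynomial_growth G \<longleftrightarrow>
     (\<exists>d. \<forall>K. subgroup K G \<and> finitely_generated_group (G\<lparr>carrier := K\<rparr>) \<longrightarrow>
          (\<exists>d'\<le>d. polynomial_volume_growth (G\<lparr>carrier := K\<rparr>) d'))"

definition rat_ring :: "rat ring" where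
  "rat_ring = \<lparr>carrier = UNIV, mult = (*), one = 1, zero = 0, add = (+)\<rparr>"

text \<open>The tensor product of the rationals with a (multiplicatively written) abelian group
  \<open>A\<close>: the free abelian group on the symbols \<open>(p, a)\<close>, modulo biadditivity. Rational scalars act
  on the first components of the symbols.\<close>

definition rat_tensor_relations ::
    "('a, 'm) monoid_scheme \<Rightarrow> ((rat \<times> 'a) \<Rightarrow>\<^sub>0 int) set" where
  "rat_tensor_relations A = generate (free_Abelian_group (UNIV \<times> carrier A))
     ({frag_of (p + q, a) - frag_of (p, a) - frag_of (q, a) | p q a. a \<in> carrier A} \<union>
      {frag_of (p, a \<otimes>\<^bsub>A\<^esub> b) - frag_of (p, a) - frag_of (p, b) | p a b.
         a \<in> carrier A \<and> b \<in> carrier A})"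

definition rat_tensor_group ::
    "('a, 'm) monoid_scheme \<Rightarrow> ((rat \<times> 'a) \<Rightarrow>\<^sub>0 int) set monoid" where
  "rat_tensor_group A = free_Abelian_group (UNIV \<times> carrier A) Mod rat_tensor_relations A"

text \<open>The ring multiplication and unit that the record type of modules carries play no role.\<close>

definition rat_tensor ::
    "('a, 'm) monoid_scheme \<Rightarrow> (rat, ((rat \<times> 'a) \<Rightarrow>\<^sub>0 int) set) module" where
  "rat_tensor A =
     \<lparr>carrier = carrier (rat_tensor_group A),
      mult = undefined, one = undefined,
      zero = \<one>\<^bsub>rat_tensor_group A\<^esub>,
      add = monoid.mult (rat_tensor_group A),
      smult = (\<lambda>q C. \<Union>x\<in>C. rat_tensor_relations A
                 #>\<^bsub>free_Abelian_group (UNIV \<times> carrier A)\<^esub>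
                   frag_extend (\<lambda>(p, a). frag_of (q * p, a)) x)\<rparr>"

definition finite_rat_rank :: "('a, 'm) monoid_scheme \<Rightarrow> bool" where
  "finite_rat_rank A \<longleftrightarrow> vectorspace.fin_dim rat_ring (rat_tensor A)"

text \<open>The restricted wreath product of \<open>A\<close> by \<open>B\<close>: \<open>B\<close> acts by left translation of the argument
  on the finitely supported functions from \<open>B\<close> to \<open>A\<close>.\<close>

definition wreath_product ::
    "('a, 'm) monoid_scheme \<Rightarrow> ('b, 'n) monoid_scheme \<Rightarrow> (('b \<Rightarrow> 'a) \<times> 'b) monoid" where
  "wreath_product A B =
     \<lparr>carrier = {f \<in> carrier B \<rightarrow>\<^sub>E carrier A. finite {x \<in> carrier B. f x \<noteq> \<one>\<^bsub>A\<^esub>}} \<times> carrier B,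
      mult = (\<lambda>(f, b) (f', b').
        (\<lambda>x\<in>carrier B. f x \<otimes>\<^bsub>A\<^esub> f' (inv\<^bsub>B\<^esub> b \<otimes>\<^bsub>B\<^esub> x), b \<otimes>\<^bsub>B\<^esub> b')),
      one = (\<lambda>x\<in>carrier B. \<one>\<^bsub>A\<^esub>, \<one>\<^bsub>B\<^esub>)\<rparr>"

definition lamplighter_group :: "((int \<Rightarrow> int) \<times> int) monoid" where
  "lamplighter_group = wreath_product (integer_mod_group 2) integer_group"

definition characteristic_subgroup :: "'g set \<Rightarrow> ('g, 'm) monoid_scheme \<Rightarrow> bool" where
  "characteristic_subgroup K G \<longleftrightarrow> subgroup K G \<and> (\<forall>f\<in>iso G G. f ` K = K)"

definition union_of_finite_characteristic :: "('g, 'm) monoid_scheme \<Rightarrow> bool" where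
  "union_of_finite_characteristic G \<longleftrightarrow>
     (\<exists>K. incseq K \<and> (\<forall>n::nat. finite (K n) \<and> characteristic_subgroup (K n) G) \<and>
          carrier G = (\<Union>n. K n))"

definition torsion_free_abelian :: "('g, 'm) monoid_scheme \<Rightarrow> bool" where
  "torsion_free_abelian G \<longleftrightarrow> comm_group G \<and>
     (\<forall>a\<in>carrier G. \<forall>n::nat. n > 0 \<and> a [^]\<^bsub>G\<^esub> n = \<one>\<^bsub>G\<^esub> \<longrightarrow> a = \<one>\<^bsub>G\<^esub>)"

definition star_quotient :: "('g, 'm) monoid_scheme \<Rightarrow> bool" where
  "star_quotient Q \<longleftrightarrow> finite (carrier Q) \<or> union_of_finite_characteristic Q \<or>
     (torsion_free_abelian Q \<and> finite_rat_rank Q)"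

definition star_top_quotient :: "('g, 'm) monoid_scheme \<Rightarrow> bool" where
  "star_top_quotient Q \<longleftrightarrow> star_quotient Q \<or> uniform_local_polynomial_growth Q \<or>
     Q \<cong> lamplighter_group"

text \<open>Condition \<open>star\<close>. The terms of the series are normal in the whole group, not just in their
  predecessors; only the top quotient \<open>N 0 / N 1\<close> may be of the additional kinds.\<close>

definition star_group :: "('g, 'm) monoid_scheme \<Rightarrow> bool" where
  "star_group \<Gamma> \<longleftrightarrow> group \<Gamma> \<and> countable (carrier \<Gamma>) \<and>
     (\<exists>n N. N 0 = carrier \<Gamma> \<and> N n = {\<one>\<^bsub>\<Gamma>\<^esub>} \<and> (\<forall>i\<le>n. N i \<lhd> \<Gamma>) \<and>
        (\<forall>i<n. N (Suc i) \<subseteq> N i \<and>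
           (if i = 0 then star_top_quotient (\<Gamma>\<lparr>carrier := N i\<rparr> Mod N (Suc i))
            else star_quotient (\<Gamma>\<lparr>carrier := N i\<rparr> Mod N (Suc i)))))"

end

(*
  Hyperfiniteness is deduced from finite Borel asymptotic dimension: for every finite scale, X is
  covered by a fixed number of Borel sets whose components at that scale are bounded by a finite
  set of group elements.

  Finiteness of this dimension passes from N to M for consecutive terms N <= M of the series. Suppose
  that finitely many elements of M can be separated modulo N F only boundedly often within a block
  F B S F, with F depending on S but the bound not. Given a Borel colouring for N whose number of
  colours does not depend on the scale, a greedy choice in the order of the colours then produces
  boundedly many Borel families of nets of F-translates, each family being coherent along N, and the
  pieces for N cut along these nets give the pieces for M. The packing condition is trivial for finite
  and locally finite quotients; for torsion-free abelian quotients of finite rank one counts boxes in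
  rational coordinates, on which conjugation acts linearly; for quotients of polynomial growth some
  scale is doubling; and the lamplighter group is treated in two steps, lamps first.

  For an increasing union of groups H n, Borel sets of level n with bounded components are built in
  stages, treating each level infinitely often. Each set is saturated under a relation that glues
  together the neighbourhoods of the boundaries built earlier at higher levels, so the boundaries of
  different levels stay disjoint. A pair x, g x is then cut by at most one of the level partitions,
  and the tails of the sequence of partitions intersect to finite Borel equivalence relations
  increasing to the orbit equivalence relation.
*)
theory Submission
  imports Defs
begin

section \<open>Borel asymptotic dimension\<close>

text \<open>The obstacle in the extension step is that a net for the quotient is of no use unless
  nearby points of one \<open>N\<close>-orbit choose alike. The greedy choice is therefore driven by
  a colour that is constant on the components of a bounded piece for \<open>N\<close>. Two points of
  one component then make the same choice as long as the piece reaches far enough around them, and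
  the distance required grows with the number of rounds. Two invariants are carried along the
  series, \<open>adim\<close> and the colourings of \<open>chrom\<close>. The colouring for
  \<open>N\<close> must tell apart displacements in the groups above \<open>N\<close>, so
  \<open>chrom\<close> tests elements of all of \<Gamma>, and passing it from \<open>N\<close> to
  \<open>M\<close> asks for packing bounds in which finite subsets of \<Gamma> conjugate the
  quotient. No colouring is built for the whole group: the last step takes only the bound for
  \<open>B = {\<one>}\<close>, where conjugation does not enter.\<close>

definition step :: "('a \<Rightarrow> 'x \<Rightarrow> 'x) \<Rightarrow> 'a set \<Rightarrow> 'x set \<Rightarrow> ('x \<times> 'x) set" where
  "step \<phi> S U = {(x, y). x \<in> U \<and> y \<in> U \<and> (\<exists>s\<in>S. y = \<phi> s x)}"

definition bdd :: "('a \<Rightarrow> 'x \<Rightarrow> 'x) \<Rightarrow> 'a set \<Rightarrow> 'x set \<Rightarrow> 'a set \<Rightarrow> bool" where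
  "bdd \<phi> S U T \<longleftrightarrow> (\<forall>x y. x \<in> U \<and> (x, y) \<in> (step \<phi> S U)\<^sup>* \<longrightarrow> (\<exists>t\<in>T. y = \<phi> t x))"

text \<open>For a subgroup \<open>K\<close> this says that its action has Borel asymptotic dimension less than \<open>k\<close>: the
  connected components of the pieces at scale \<open>S\<close> are uniformly bounded.\<close>

definition adim :: "'x measure \<Rightarrow> ('a \<Rightarrow> 'x \<Rightarrow> 'x) \<Rightarrow> 'a set \<Rightarrow> nat \<Rightarrow> bool" where
  "adim X \<phi> K k \<longleftrightarrow> (\<forall>S. finite S \<and> S \<subseteq> K \<longrightarrow>
     (\<exists>T V. finite T \<and> T \<subseteq> K \<and> (\<forall>j<k. V j \<in> sets X \<and> bdd \<phi> S (V j) T) \<and>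
        (\<forall>x\<in>space X. \<exists>j<k. x \<in> V j)))"

lemma bddD: "bdd \<phi> S U T \<Longrightarrow> x \<in> U \<Longrightarrow> (x, y) \<in> (step \<phi> S U)\<^sup>* \<Longrightarrow> \<exists>t\<in>T. y = \<phi> t x"
  by (auto simp: bdd_def)

lemma stepI: "x \<in> U \<Longrightarrow> y \<in> U \<Longrightarrow> s \<in> S \<Longrightarrow> y = \<phi> s x \<Longrightarrow> (x, y) \<in> step \<phi> S U"
  by (auto simp: step_def)

lemma step_mono: "S \<subseteq> S' \<Longrightarrow> U \<subseteq> U' \<Longrightarrow> step \<phi> S U \<subseteq> step \<phi> S' U'"
  by (auto simp: step_def)

lemma bdd_mono:
  assumes "bdd \<phi> S U T" "S' \<subseteq> S" "U' \<subseteq> U" "T \<subseteq> T'"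
  shows "bdd \<phi> S' U' T'"
  using assms rtrancl_mono[OF step_mono[OF assms(2,3)]] unfolding bdd_def by blast

lemma step_rtrancl_in: "(x, y) \<in> (step \<phi> S U)\<^sup>* \<Longrightarrow> x \<in> U \<Longrightarrow> y \<in> U"
  by (induction rule: rtrancl_induct) (auto simp: step_def)

lemma adimE:
  assumes "adim X \<phi> K k" "finite S" "S \<subseteq> K"
  obtains T V where "finite T" "T \<subseteq> K" "\<And>j. j < k \<Longrightarrow> V j \<in> sets X"
    "\<And>j. j < k \<Longrightarrow> bdd \<phi> S (V j) T" "\<And>x. x \<in> space X \<Longrightarrow> \<exists>j<k. x \<in> V j"
proof -
  have "\<exists>T V. finite T \<and> T \<subseteq> K \<and> (\<forall>j<k. V j \<in> sets X \<and> bdd \<phi> S (V j) T) \<and>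
        (\<forall>x\<in>space X. \<exists>j<k. x \<in> V j)"
    by (rule assms(1)[unfolded adim_def, rule_format]) (use assms in simp)
  then obtain T V where "finite T" "T \<subseteq> K" "\<forall>j<k. V j \<in> sets X \<and> bdd \<phi> S (V j) T"
      "\<forall>x\<in>space X. \<exists>j<k. x \<in> V j"
    by (elim exE conjE) (rule that)
  then show ?thesis by (intro that[of T V]) simp_all
qed

text \<open>Only the number of pieces matters, so they may carry any finite index set of size at
  most \<open>k\<close>; surplus indices get the empty set, which is bounded vacuously.\<close>

lemma adim_indexed:
  assumes "\<And>S. finite S \<Longrightarrow> S \<subseteq> K \<Longrightarrow>
     \<exists>T (I::'i set) V. finite T \<and> T \<subseteq> K \<and> finite I \<and> card I \<le> k \<and>
        (\<forall>j\<in>I. V j \<in> sets X \<and> bdd \<phi> S (V j) T) \<and> (\<forall>x\<in>space X. \<exists>j\<in>I. x \<in> V j)"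
  shows "adim X \<phi> K k"
  unfolding adim_def
proof (intro allI impI)
  fix S assume S: "finite S \<and> S \<subseteq> K"
  obtain T I V where *: "finite T" "T \<subseteq> K" "finite (I::'i set)" "card I \<le> k"
     "\<forall>j\<in>I. V j \<in> sets X \<and> bdd \<phi> S (V j) T" "\<forall>x\<in>space X. \<exists>j\<in>I. x \<in> V j"
    using assms[of S] S by metis
  obtain h where h: "bij_betw h {0..<card I} I"
    using ex_bij_betw_nat_finite[OF *(3)] by blast
  define V' where "V' j = (if j < card I then V (h j) else {})" for j
  have "V' j \<in> sets X \<and> bdd \<phi> S (V' j) T" for j
  proof (cases "j < card I")
    case True
    then have "h j \<in> I" using bij_betwE[OF h] by simp
    then show ?thesis using *(5) True by (simp add: V'_def)
  qed (simp add: V'_def bdd_def)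
  moreover have "\<exists>j<k. x \<in> V' j" if "x \<in> space X" for x
  proof -
    obtain i where i: "i \<in> I" "x \<in> V i" using *(6) \<open>x \<in> space X\<close> by blast
    then obtain j where "j < card I" "h j = i" using h unfolding bij_betw_def by (metis imageE atLeastLessThan_iff)
    then show ?thesis using i *(4) by (intro exI[of _ j]) (auto simp: V'_def)
  qed
  ultimately show "\<exists>T V. finite T \<and> T \<subseteq> K \<and> (\<forall>j<k. V j \<in> sets X \<and> bdd \<phi> S (V j) T) \<and>
        (\<forall>x\<in>space X. \<exists>j<k. x \<in> V j)"
    using *(1,2) by blast
qed

text \<open>\<open>separation\<close> is how the standard Borel hypothesis enters: it yields the
  Borel colouring of \<open>chrom_trivial\<close> and the measurability of graphs in
  \<open>bor_pair_sets\<close>. The other measurability arguments rest on the countability of the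
  group and on \<open>act_measurable\<close>.\<close>

locale free_borel_action = group \<Gamma> for \<Gamma> (structure) +
  fixes X :: "'x measure" and \<phi> :: "'a \<Rightarrow> 'x \<Rightarrow> 'x"
  assumes countable_carrier: "countable (carrier \<Gamma>)"
    and act_closed [simp]: "g \<in> carrier \<Gamma> \<Longrightarrow> x \<in> space X \<Longrightarrow> \<phi> g x \<in> space X"
    and act_one [simp]: "x \<in> space X \<Longrightarrow> \<phi> \<one> x = x"
    and act_mult: "g \<in> carrier \<Gamma> \<Longrightarrow> h \<in> carrier \<Gamma> \<Longrightarrow> x \<in> space X \<Longrightarrow> \<phi> (g \<otimes> h) x = \<phi> g (\<phi> h x)"
    and act_free: "g \<in> carrier \<Gamma> \<Longrightarrow> x \<in> space X \<Longrightarrow> \<phi> g x = x \<Longrightarrow> g = \<one>"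
    and act_measurable: "g \<in> carrier \<Gamma> \<Longrightarrow> \<phi> g \<in> measurable X X"
    and separation: "\<exists>A :: nat \<Rightarrow> 'x set. (\<forall>n. A n \<in> sets X) \<and>
          (\<forall>x\<in>space X. \<forall>F. finite F \<and> F \<subseteq> space X \<and> x \<notin> F \<longrightarrow> (\<exists>n. x \<in> A n \<and> A n \<inter> F = {}))"
begin

lemma inv_cancel [simp]:
  assumes "f \<in> carrier \<Gamma>" "r \<in> carrier \<Gamma>"
  shows "f \<otimes> (inv f \<otimes> r) = r" "inv f \<otimes> (f \<otimes> r) = r"
  using assms by (simp_all flip: m_assoc)

lemma set_multI: "a \<in> A \<Longrightarrow> b \<in> B \<Longrightarrow> a \<otimes> b \<in> A <#> B"
  by (auto simp: set_mult_def)

lemma set_multE: "x \<in> A <#> B \<Longrightarrow> (\<And>a b. a \<in> A \<Longrightarrow> b \<in> B \<Longrightarrow> x = a \<otimes> b \<Longrightarrow> P) \<Longrightarrow> P"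
  by (auto simp: set_mult_def)

lemma set_mult_subset:
  assumes "subgroup N \<Gamma>" "A \<subseteq> N" "B \<subseteq> N"
  shows "A <#> B \<subseteq> N"
proof
  fix x assume "x \<in> A <#> B"
  then obtain a b where "a \<in> A" "b \<in> B" "x = a \<otimes> b" by (auto simp: set_mult_def)
  then show "x \<in> N" using assms subgroup.m_closed[OF assms(1), of a b] by blast
qed

lemma act_act [simp]:
  "g \<in> carrier \<Gamma> \<Longrightarrow> h \<in> carrier \<Gamma> \<Longrightarrow> x \<in> space X \<Longrightarrow> \<phi> g (\<phi> h x) = \<phi> (g \<otimes> h) x"
  by (simp add: act_mult)

lemma act_eqD:
  assumes "g \<in> carrier \<Gamma>" "h \<in> carrier \<Gamma>" "x \<in> space X" "\<phi> g x = \<phi> h x"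
  shows "g = h"
proof -
  have "\<phi> (inv h \<otimes> g) x = \<phi> (inv h) (\<phi> g x)" using assms(1-3) by simp
  also have "\<dots> = x" unfolding assms(4) using assms(1-3) by simp
  finally have "inv h \<otimes> g = \<one>" using assms act_free[of "inv h \<otimes> g" x] by simp
  then show ?thesis using assms inv_solve_left'[of \<one> h g] by simp
qed

lemma act_eq_iff [simp]:
  "g \<in> carrier \<Gamma> \<Longrightarrow> h \<in> carrier \<Gamma> \<Longrightarrow> x \<in> space X \<Longrightarrow> \<phi> g x = \<phi> h x \<longleftrightarrow> g = h"
  using act_eqD by blast

section \<open>Borel sets and Borel relations inside the orbit equivalence relation\<close>

lemma act_vimage [measurable]:
  "A \<in> sets X \<Longrightarrow> g \<in> carrier \<Gamma> \<Longrightarrow> {x \<in> space X. \<phi> g x \<in> A} \<in> sets X"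
  using measurable_sets[OF act_measurable, of g A] by (auto simp: vimage_def Int_def conj_commute)

lemma act_image:
  assumes "A \<subseteq> space X" "g \<in> carrier \<Gamma>"
  shows "\<phi> g ` A = {x \<in> space X. \<phi> (inv g) x \<in> A}"
proof safe
  fix x assume "x \<in> space X" "\<phi> (inv g) x \<in> A"
  then show "x \<in> \<phi> g ` A" using assms
    by (intro image_eqI[of _ _ "\<phi> (inv g) x"]) (auto simp del: act_act simp: act_mult[symmetric])
qed (use assms in \<open>auto simp del: act_act simp: act_mult[symmetric] subset_iff\<close>)

lemma act_image_sets: "A \<in> sets X \<Longrightarrow> g \<in> carrier \<Gamma> \<Longrightarrow> \<phi> g ` A \<in> sets X"
  using act_image[OF sets.sets_into_space, of A g] by simp

text \<open>A relation contained in the orbit equivalence relation is Borel as soon as the sets of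
  points related to their translate by a fixed group element are.\<close>

definition bor :: "('x \<times> 'x) set \<Rightarrow> bool" where
  "bor E \<longleftrightarrow> (\<forall>(x, y)\<in>E. x \<in> space X \<and> (\<exists>g\<in>carrier \<Gamma>. y = \<phi> g x)) \<and>
     (\<forall>g\<in>carrier \<Gamma>. {x \<in> space X. (x, \<phi> g x) \<in> E} \<in> sets X)"

lemma borD:
  assumes "bor E" "(x, y) \<in> E"
  shows "x \<in> space X" "y \<in> space X" "\<exists>g\<in>carrier \<Gamma>. y = \<phi> g x"
  using assms unfolding bor_def by auto

lemma bor_sets: "bor E \<Longrightarrow> g \<in> carrier \<Gamma> \<Longrightarrow> {x \<in> space X. (x, \<phi> g x) \<in> E} \<in> sets X"
  unfolding bor_def by auto

text \<open>The intermediate point is a translate \<open>\<phi> h x\<close>, so the quantifier over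
  it is a union over the countable group.\<close>

lemma bor_comp:
  assumes "bor E" "bor F"
  shows "bor (E O F)"
  unfolding bor_def
proof (intro conjI ballI)
  fix p assume "p \<in> E O F"
  then obtain x y z where p: "p = (x, z)" "(x, y) \<in> E" "(y, z) \<in> F" by auto
  then obtain g h where "g \<in> carrier \<Gamma>" "h \<in> carrier \<Gamma>" "y = \<phi> g x" "z = \<phi> h y" "x \<in> space X"
    using borD[OF assms(1), of x y] borD[OF assms(2), of y z] by auto
  then show "case p of (x, y) \<Rightarrow> x \<in> space X \<and> (\<exists>g\<in>carrier \<Gamma>. y = \<phi> g x)"
    using p by (auto intro!: bexI[of _ "h \<otimes> g"])
next
  fix g assume g: "g \<in> carrier \<Gamma>"
  have "{x \<in> space X. (x, \<phi> g x) \<in> E O F} =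
     (\<Union>h\<in>carrier \<Gamma>. {x \<in> space X. (x, \<phi> h x) \<in> E} \<inter>
        {x \<in> space X. \<phi> h x \<in> {y \<in> space X. (y, \<phi> (g \<otimes> inv h) y) \<in> F}})" (is "?L = ?R")
  proof (rule Set.set_eqI, rule iffI)
    fix x assume "x \<in> ?L"
    then obtain y where x: "x \<in> space X" "(x, y) \<in> E" "(y, \<phi> g x) \<in> F" by auto
    then obtain h where h: "h \<in> carrier \<Gamma>" "y = \<phi> h x" using borD(3)[OF assms(1)] by blast
    then show "x \<in> ?R" using x g by (auto simp: m_assoc intro!: bexI[of _ h])
  next
    fix x assume "x \<in> ?R"
    then show "x \<in> ?L" using g by (auto simp: m_assoc)
  qed
  also have "\<dots> \<in> sets X"
    using g
    by (intro sets.countable_UN''[OF countable_carrier] sets.Int[OF bor_sets[OF assms(1)] act_vimage[OF bor_sets[OF assms(2)]]]) simp_all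
  finally show "{x \<in> space X. (x, \<phi> g x) \<in> E O F} \<in> sets X" .
qed

lemma bor_UN:
  assumes "countable I" "\<And>i. i \<in> I \<Longrightarrow> bor (E i)"
  shows "bor (\<Union>i\<in>I. E i)"
  unfolding bor_def
proof (intro conjI ballI)
  fix g assume g: "g \<in> carrier \<Gamma>"
  have "{x \<in> space X. (x, \<phi> g x) \<in> (\<Union>i\<in>I. E i)} = (\<Union>i\<in>I. {x \<in> space X. (x, \<phi> g x) \<in> E i})" by auto
  also have "\<dots> \<in> sets X" using assms g by (intro sets.countable_UN') (auto intro: bor_sets)
  finally show "{x \<in> space X. (x, \<phi> g x) \<in> (\<Union>i\<in>I. E i)} \<in> sets X" .
qed (use borD[OF assms(2)] in fastforce)

lemma bor_INT:
  assumes "countable I" "I \<noteq> {}" "\<And>i. i \<in> I \<Longrightarrow> bor (E i)"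
  shows "bor (\<Inter>i\<in>I. E i)"
  unfolding bor_def
proof (intro conjI ballI)
  fix g assume g: "g \<in> carrier \<Gamma>"
  have "{x \<in> space X. (x, \<phi> g x) \<in> (\<Inter>i\<in>I. E i)} = (\<Inter>i\<in>I. {x \<in> space X. (x, \<phi> g x) \<in> E i})"
    using assms(2) by auto
  also have "\<dots> \<in> sets X" using assms g by (intro sets.countable_INT') (auto intro: bor_sets)
  finally show "{x \<in> space X. (x, \<phi> g x) \<in> (\<Inter>i\<in>I. E i)} \<in> sets X" .
qed (use borD[OF assms(3)] assms(2) in fastforce)

lemma bor_Un: "bor E \<Longrightarrow> bor F \<Longrightarrow> bor (E \<union> F)"
  using bor_UN[of "{True, False}" "\<lambda>b. if b then E else F"] by (simp add: Un_commute)

lemma bor_Id: "bor (Id_on (space X))"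
  unfolding bor_def
proof (intro conjI ballI)
  fix g assume g: "g \<in> carrier \<Gamma>"
  have "{x \<in> space X. (x, \<phi> g x) \<in> Id_on (space X)} = (if g = \<one> then space X else {})"
    using act_free[OF g] by (auto simp: Id_on_iff dest: sym)
  then show "{x \<in> space X. (x, \<phi> g x) \<in> Id_on (space X)} \<in> sets X" by simp
qed (auto intro!: bexI[of _ \<one>])

lemma bor_converse:
  assumes "bor E" shows "bor (E\<inverse>)"
  unfolding bor_def
proof (intro conjI ballI)
  fix p assume "p \<in> E\<inverse>"
  then obtain x y where p: "p = (y, x)" "(x, y) \<in> E" by auto
  then obtain g where "g \<in> carrier \<Gamma>" "y = \<phi> g x" "x \<in> space X"
    using borD[OF assms p(2)] by blast
  then show "case p of (x, y) \<Rightarrow> x \<in> space X \<and> (\<exists>g\<in>carrier \<Gamma>. y = \<phi> g x)"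
    using p by (auto intro!: bexI[of _ "inv g"])
next
  fix g assume g: "g \<in> carrier \<Gamma>"
  have "{x \<in> space X. (x, \<phi> g x) \<in> E\<inverse>} =
      {x \<in> space X. \<phi> g x \<in> {y \<in> space X. (y, \<phi> (inv g) y) \<in> E}}"
    using g by auto
  then show "{x \<in> space X. (x, \<phi> g x) \<in> E\<inverse>} \<in> sets X"
    using g assms by (simp only: act_vimage bor_sets inv_closed)
qed

text \<open>\<open>E\<^sup>*\<close> relates every element of the type to itself; composing with
  \<open>Id_on (space X)\<close> confines it to the space.\<close>

lemma bor_rtrancl:
  assumes "bor E" shows "bor (Id_on (space X) O E\<^sup>*)"
proof -
  have "bor (Id_on (space X) O E ^^ n)" for n
  proof (induction n)
    case 0 then show ?case using bor_Id by simp
  next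
    case (Suc n)
    have "Id_on (space X) O E ^^ Suc n = (Id_on (space X) O E ^^ n) O E" by auto
    then show ?case using bor_comp[OF Suc assms] by simp
  qed
  then have "bor (\<Union>n. Id_on (space X) O E ^^ n)" by (intro bor_UN) auto
  moreover have "(\<Union>n. Id_on (space X) O E ^^ n) = Id_on (space X) O E\<^sup>*"
    by (auto simp: rtrancl_is_UN_relpow)
  ultimately show ?thesis by simp
qed

lemma bor_vimage:
  assumes "bor E" "A \<in> sets X"
  shows "{x \<in> space X. \<exists>y\<in>A. (x, y) \<in> E} \<in> sets X"
proof -
  have "{x \<in> space X. \<exists>y\<in>A. (x, y) \<in> E} =
    (\<Union>g\<in>carrier \<Gamma>. {x \<in> space X. (x, \<phi> g x) \<in> E} \<inter> {x \<in> space X. \<phi> g x \<in> A})"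
    using borD(3)[OF assms(1)] by fastforce
  also have "\<dots> \<in> sets X"
    by (intro sets.countable_UN''[OF countable_carrier] sets.Int[OF bor_sets[OF assms(1)] act_vimage[OF assms(2)]])
  finally show ?thesis .
qed

lemma bor_graph:
  assumes "A \<in> sets X" "B \<in> sets X" "S \<subseteq> carrier \<Gamma>"
  shows "bor {(x, y). x \<in> A \<and> y \<in> B \<and> (\<exists>s\<in>S. y = \<phi> s x)}"
  unfolding bor_def
proof (intro conjI ballI)
  have sub: "A \<subseteq> space X" using assms sets.sets_into_space by auto
  show "case p of (x, y) \<Rightarrow> x \<in> space X \<and> (\<exists>g\<in>carrier \<Gamma>. y = \<phi> g x)"
    if "p \<in> {(x, y). x \<in> A \<and> y \<in> B \<and> (\<exists>s\<in>S. y = \<phi> s x)}" for p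
    using that assms sub by auto
  fix g assume g: "g \<in> carrier \<Gamma>"
  \<comment> \<open>By freeness \<open>g\<close> is the only element that moves \<open>x\<close> to
    \<open>\<phi> g x\<close>, so the quantifier over \<open>S\<close> collapses to
    \<open>g \<in> S\<close>.\<close>
  have "{x \<in> space X. (x, \<phi> g x) \<in> {(x, y). x \<in> A \<and> y \<in> B \<and> (\<exists>s\<in>S. y = \<phi> s x)}} =
    (if g \<in> S then A \<inter> {x \<in> space X. \<phi> g x \<in> B} else {})"
    using g assms(3) sub act_eqD[OF g] by (auto 0 3)
  then show "{x \<in> space X. (x, \<phi> g x) \<in> {(x, y). x \<in> A \<and> y \<in> B \<and> (\<exists>s\<in>S. y = \<phi> s x)}} \<in> sets X"
    using assms g act_vimage[OF assms(2) g] by (simp del: space_borel)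
qed

lemma bor_step: "U \<in> sets X \<Longrightarrow> S \<subseteq> carrier \<Gamma> \<Longrightarrow> bor (step \<phi> S U)"
  unfolding step_def by (rule bor_graph)

text \<open>A path in the union that leaves \<open>V\<close> for \<open>U\<close> and comes back
  moves by an element of \<open>S <#> T <#> S\<close> in between. The visits to \<open>V\<close>
  thus form a path at the coarser scale, at which \<open>V\<close> is assumed bounded, and only an
  initial and a final stretch inside \<open>U\<close> remain.\<close>

lemma bdd_union:
  assumes U: "U \<subseteq> space X" "bdd \<phi> S U T" and V: "V \<subseteq> space X"
    and bV: "bdd \<phi> (S \<union> (S <#> T <#> S)) V T'"
    and S: "S \<subseteq> carrier \<Gamma>" and T: "T \<subseteq> carrier \<Gamma>" and T': "T' \<subseteq> carrier \<Gamma>"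
  shows "bdd \<phi> S (U \<union> V) (T \<union> (insert \<one> (T <#> S) <#> T' <#> insert \<one> (S <#> T)))" (is "bdd _ _ _ ?T")
proof -
  let ?S = "S \<union> (S <#> T <#> S)"
  \<comment> \<open>Here \<open>a\<close> is the first and \<open>v\<close> the last visit to
    \<open>V\<close>. At most one stretch in \<open>U\<close> precedes \<open>a\<close>, which
    accounts for the factor in \<open>S <#> T\<close>.\<close>
  define ok where "ok x y \<longleftrightarrow> (x \<in> U \<and> (x, y) \<in> (step \<phi> S U)\<^sup>*) \<or>
     (\<exists>a v. a \<in> V \<and> (\<exists>w\<in>insert \<one> (S <#> T). a = \<phi> w x) \<and> (a, v) \<in> (step \<phi> ?S V)\<^sup>* \<and>
        (y = v \<or> (\<exists>s\<in>S. \<phi> s v \<in> U \<and> (\<phi> s v, y) \<in> (step \<phi> S U)\<^sup>*)))" for x y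
  have okU: "ok x y" if "x \<in> U" "(x, y) \<in> (step \<phi> S U)\<^sup>*" for x y
    using that by (simp add: ok_def)
  have okV: "ok x v" if "a \<in> V" "w \<in> insert \<one> (S <#> T)" "a = \<phi> w x" "(a, v) \<in> (step \<phi> ?S V)\<^sup>*" for x a w v
    unfolding ok_def using that by blast
  have okVU: "ok x y" if "a \<in> V" "w \<in> insert \<one> (S <#> T)" "a = \<phi> w x" "(a, v) \<in> (step \<phi> ?S V)\<^sup>*"
      "r \<in> S" "\<phi> r v \<in> U" "(\<phi> r v, y) \<in> (step \<phi> S U)\<^sup>*" for x a w v r y
    unfolding ok_def using that by blast
  have okE [consumes 1, case_names 1 2 3]: "\<lbrakk>ok x y; \<lbrakk>x \<in> U; (x, y) \<in> (step \<phi> S U)\<^sup>*\<rbrakk> \<Longrightarrow> P;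
      \<And>a w. \<lbrakk>a \<in> V; w \<in> insert \<one> (S <#> T); a = \<phi> w x; (a, y) \<in> (step \<phi> ?S V)\<^sup>*\<rbrakk> \<Longrightarrow> P;
      \<And>a v w r. \<lbrakk>a \<in> V; w \<in> insert \<one> (S <#> T); a = \<phi> w x; (a, v) \<in> (step \<phi> ?S V)\<^sup>*;
        r \<in> S; \<phi> r v \<in> U; (\<phi> r v, y) \<in> (step \<phi> S U)\<^sup>*\<rbrakk> \<Longrightarrow> P\<rbrakk> \<Longrightarrow> P" for x y P
    unfolding ok_def by blast
  have ST: "insert \<one> (S <#> T) \<subseteq> carrier \<Gamma>" "insert \<one> (T <#> S) \<subseteq> carrier \<Gamma>"
    using S T by (auto simp: set_mult_closed)
  have sc: "\<And>s. s \<in> S \<Longrightarrow> s \<in> carrier \<Gamma>" and tc: "\<And>s. s \<in> T \<Longrightarrow> s \<in> carrier \<Gamma>" using S T by auto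
  have *: "ok x y" if "x \<in> U \<union> V" "(x, y) \<in> (step \<phi> S (U \<union> V))\<^sup>*" for x y
    using that(2)
  proof (induction rule: rtrancl_induct)
    case base
    show ?case
    proof (cases "x \<in> U")
      case False
      then have "x \<in> V" "x = \<phi> \<one> x" using that(1) V by auto
      then show ?thesis unfolding ok_def by blast
    qed (simp add: ok_def)
  next
    case (step y z)
    have x: "x \<in> space X" using that U V by auto
    obtain s where s: "s \<in> S" "z = \<phi> s y" "y \<in> U \<union> V" "z \<in> U \<union> V" using step(2) by (auto simp: step_def)
    have ys: "y \<in> space X" using s U V by auto
    show ?case
    proof (cases "z \<in> V")
      case zV: True
      from step(3) show ?thesis
      proof (cases rule: okE)
        case 1
        obtain t where t: "t \<in> T" "y = \<phi> t x" using bddD[OF U(2) 1] by blast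
        have "z = \<phi> (s \<otimes> t) x" using s t x sc tc by simp
        moreover have "s \<otimes> t \<in> insert \<one> (S <#> T)" using s t by (auto simp: set_mult_def)
        ultimately show ?thesis using zV by (intro okV[of z "s \<otimes> t" x z]) auto
      next
        case (2 a w)
        have v: "y \<in> V" by (rule step_rtrancl_in[OF 2(4,1)])
        have "(y, z) \<in> step \<phi> ?S V" by (rule stepI[where s=s]) (use v zV s in simp_all)
        with 2(4) have "(a, z) \<in> (step \<phi> ?S V)\<^sup>*" by (rule rtrancl_into_rtrancl)
        then show ?thesis by (rule okV[OF 2(1-3)])
      next
        case (3 a v w r)
        obtain t where t: "t \<in> T" "y = \<phi> t (\<phi> r v)" using bddD[OF U(2) 3(6,7)] by blast
        have v: "v \<in> V" by (rule step_rtrancl_in[OF 3(4,1)])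
        have "z = \<phi> (s \<otimes> t \<otimes> r) v" using t s(1,2) 3(5) v sc tc V by (auto simp: m_assoc)
        moreover have "s \<otimes> t \<otimes> r \<in> ?S" using s t 3 by (auto simp: set_mult_def)
        ultimately have "(v, z) \<in> step \<phi> ?S V" using zV v by (intro stepI[where s="s \<otimes> t \<otimes> r"]) auto
        with 3(4) have "(a, z) \<in> (step \<phi> ?S V)\<^sup>*" by (rule rtrancl_into_rtrancl)
        then show ?thesis by (rule okV[OF 3(1-3)])
      qed
    next
      case False
      then have zU: "z \<in> U" using s by auto
      from step(3) show ?thesis
      proof (cases rule: okE)
        case 1
        have y: "y \<in> U" by (rule step_rtrancl_in[OF 1(2,1)])
        have "(y, z) \<in> step \<phi> S U" by (rule stepI[where s=s]) (use y zU s in simp_all)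
        with 1(2) have "(x, z) \<in> (step \<phi> S U)\<^sup>*" by (rule rtrancl_into_rtrancl)
        then show ?thesis by (rule okU[OF 1(1)])
      next
        case (2 a w)
        show ?thesis by (rule okVU[OF 2 s(1)]) (use zU s in simp_all)
      next
        case (3 a v w r)
        have y: "y \<in> U" by (rule step_rtrancl_in[OF 3(7,6)])
        have "(y, z) \<in> step \<phi> S U" by (rule stepI[where s=s]) (use y zU s in simp_all)
        with 3(7) have "(\<phi> r v, z) \<in> (step \<phi> S U)\<^sup>*" by (rule rtrancl_into_rtrancl)
        then show ?thesis by (rule okVU[OF 3(1-6)])
      qed
    qed
  qed
  show ?thesis unfolding bdd_def
  proof (intro allI impI)
    fix x y assume xy: "x \<in> U \<union> V \<and> (x, y) \<in> (step \<phi> S (U \<union> V))\<^sup>*"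
    then have x: "x \<in> space X" using U V by auto
    have "ok x y" using * xy by blast
    then show "\<exists>t\<in>?T. y = \<phi> t x"
    proof (cases rule: okE)
      case 1 show ?thesis using bddD[OF U(2) 1] by blast
    next
      case (2 a w)
      obtain t where t: "t \<in> T'" "y = \<phi> t a" using bddD[OF bV 2(1,4)] by blast
      have w: "w \<in> carrier \<Gamma>" using 2(2) ST by blast
      have "y = \<phi> (\<one> \<otimes> t \<otimes> w) x" using t 2 x w T' by (simp add: subset_iff)
      then show ?thesis using t(1) 2(2) unfolding set_mult_def by blast
    next
      case (3 a v w r)
      obtain t where t: "t \<in> T'" "v = \<phi> t a" using bddD[OF bV 3(1,4)] by blast
      obtain u where u: "u \<in> T" "y = \<phi> u (\<phi> r v)" using bddD[OF U(2) 3(6,7)] by blast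
      have w: "w \<in> carrier \<Gamma>" using 3(2) ST by blast
      have "y = \<phi> ((u \<otimes> r) \<otimes> t \<otimes> w) x" using t u 3 x w T' sc tc by (simp add: subset_iff m_assoc)
      then show ?thesis using t(1) u(1) 3(2,5) unfolding set_mult_def by blast
    qed
  qed
qed

text \<open>Applying \<open>f\<close> carries an edge labelled \<open>s\<close> to an edge labelled
  by the conjugate of \<open>s\<close>, so translating a set conjugates its scale and its bound. In
  a normal subgroup both stay inside.\<close>

lemma bdd_translate:
  assumes V: "V \<subseteq> space X" "bdd \<phi> S V T" and f: "f \<in> carrier \<Gamma>" and "S \<subseteq> carrier \<Gamma>" "T \<subseteq> carrier \<Gamma>"
  shows "bdd \<phi> ((\<lambda>s. f \<otimes> s \<otimes> inv f) ` S) (\<phi> f ` V) ((\<lambda>s. f \<otimes> s \<otimes> inv f) ` T)"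
  unfolding bdd_def
proof (intro allI impI)
  let ?S = "(\<lambda>s. f \<otimes> s \<otimes> inv f) ` S"
  fix x y assume xy: "x \<in> \<phi> f ` V \<and> (x, y) \<in> (step \<phi> ?S (\<phi> f ` V))\<^sup>*"
  then obtain v where v: "v \<in> V" "x = \<phi> f v" by auto
  have "(x, y) \<in> (step \<phi> ?S (\<phi> f ` V))\<^sup>*" using xy by simp
  then have "\<exists>w. y = \<phi> f w \<and> (v, w) \<in> (step \<phi> S V)\<^sup>*"
  proof (induction rule: rtrancl_induct)
    case base then show ?case using v by auto
  next
    case (step y z)
    then obtain w where w: "y = \<phi> f w" "(v, w) \<in> (step \<phi> S V)\<^sup>*" by blast
    have wV: "w \<in> V" by (rule step_rtrancl_in[OF w(2) v(1)])
    obtain s z' where s: "s \<in> S" "z = \<phi> (f \<otimes> s \<otimes> inv f) y" "z' \<in> V" "z = \<phi> f z'"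
      using step(2) by (auto simp: step_def)
    have "z' \<in> space X" using s V by blast
    then have "\<phi> (inv f) z = z'" unfolding s(4) using f by simp
    moreover have "\<phi> (inv f) z = \<phi> s w"
    proof -
      have c: "s \<in> carrier \<Gamma>" "w \<in> space X" using s assms wV by auto
      then have "\<phi> (inv f) z = \<phi> (inv f \<otimes> (f \<otimes> s \<otimes> inv f \<otimes> f)) w" using s w f by (simp add: m_assoc)
      also have "inv f \<otimes> (f \<otimes> s \<otimes> inv f \<otimes> f) = s" using c f by (simp add: m_assoc)
      finally show ?thesis .
    qed
    ultimately have "(w, z') \<in> step \<phi> S V" using s wV by (auto simp: step_def)
    then show ?case using w s by (meson rtrancl_into_rtrancl)
  qed
  then obtain w where w: "y = \<phi> f w" "(v, w) \<in> (step \<phi> S V)\<^sup>*" by blast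
  obtain t where t: "t \<in> T" "w = \<phi> t v" using bddD[OF V(2) v(1) w(2)] by blast
  have "y = \<phi> (f \<otimes> t \<otimes> inv f) x"
  proof -
    have "t \<in> carrier \<Gamma>" "v \<in> space X" using t(1) v(1) assms by auto
    then show ?thesis using t(2) w(1) v(2) f by (simp add: m_assoc)
  qed
  then show "\<exists>t\<in>(\<lambda>s. f \<otimes> s \<otimes> inv f) ` T. y = \<phi> t x" using t by blast
qed

lemma finite_set_mult: "finite A \<Longrightarrow> finite B \<Longrightarrow> finite (A <#> B)"
  by (simp add: set_mult_def)

text \<open>The translates of a point by \<open>F\<close> lie in one piece unless some function picks, for each of the \<open>k\<close>
  pieces, a translate outside it. There are finitely many such functions, and they are defeated one
  after the other, at increasing scales.\<close>

lemma adim_cover_sequences: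
  assumes N: "N \<lhd> \<Gamma>" and ad: "adim X \<phi> N k" and S: "finite S" "S \<subseteq> N"
    and I: "finite I" "\<And>i j. i \<in> I \<Longrightarrow> j < k \<Longrightarrow> i j \<in> carrier \<Gamma>"
  shows "\<exists>T V. finite T \<and> T \<subseteq> N \<and> (\<forall>j<k. V j \<in> sets X \<and> bdd \<phi> S (V j) T) \<and>
      (\<forall>x\<in>space X. \<forall>i\<in>I. \<exists>j<k. \<phi> (i j) x \<in> V j)"
  using I
proof (induction I)
  case empty
  obtain T V where "finite T" "T \<subseteq> N" "\<And>j. j < k \<Longrightarrow> V j \<in> sets X"
      "\<And>j. j < k \<Longrightarrow> bdd \<phi> S (V j) T"
    by (rule adimE[OF ad S]) (rule that)
  then show ?case by (intro exI[of _ T] exI[of _ V]) simp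
next
  case (insert i I)
  interpret N: normal N \<Gamma> by fact
  have Nc: "N \<subseteq> carrier \<Gamma>" by (rule N.subset)
  obtain T V where T: "finite T" "T \<subseteq> N" "\<forall>j<k. V j \<in> sets X \<and> bdd \<phi> S (V j) T"
      "\<forall>x\<in>space X. \<forall>i\<in>I. \<exists>j<k. \<phi> (i j) x \<in> V j"
  proof -
    have "\<exists>T V. finite T \<and> T \<subseteq> N \<and> (\<forall>j<k. V j \<in> sets X \<and> bdd \<phi> S (V j) T) \<and>
        (\<forall>x\<in>space X. \<forall>i\<in>I. \<exists>j<k. \<phi> (i j) x \<in> V j)"
      by (rule insert.IH) (use insert.prems in blast)
    then show ?thesis by (elim exE conjE) (rule that)
  qed
  let ?R = "S \<union> (S <#> T <#> S)"
  have RN: "?R \<subseteq> N" using S(2) T(2) by (intro Un_least set_mult_subset N.subgroup_axioms)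
  \<comment> \<open>Conjugated backwards, so that translating \<open>V' j\<close> by
    \<open>i j\<close> restores the scale \<open>?R\<close> that \<open>bdd_union\<close>
    requires.\<close>
  define S' where "S' = (\<Union>j<k. (\<lambda>s. inv (i j) \<otimes> s \<otimes> i j) ` ?R)"
  have ij: "j < k \<Longrightarrow> i j \<in> carrier \<Gamma>" for j using insert by auto
  have S': "finite S'" "S' \<subseteq> N"
    using S T RN ij by (auto simp: S'_def finite_set_mult intro!: N.inv_op_closed1)
  obtain T' V' where T': "finite T'" "T' \<subseteq> N" "\<And>j. j < k \<Longrightarrow> V' j \<in> sets X"
      "\<And>j. j < k \<Longrightarrow> bdd \<phi> S' (V' j) T'" "\<And>x. x \<in> space X \<Longrightarrow> \<exists>j<k. x \<in> V' j"
    by (rule adimE[OF ad S']) (rule that)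
  define T1 where "T1 = (\<Union>j<k. (\<lambda>s. i j \<otimes> s \<otimes> inv (i j)) ` T')"
  have T1: "finite T1" "T1 \<subseteq> N"
    using T' ij by (auto simp: T1_def intro!: N.inv_op_closed2)
  define T2 where "T2 = T \<union> (insert \<one> (T <#> S) <#> T1 <#> insert \<one> (S <#> T))"
  have T2: "finite T2" using T T1 S by (auto simp: T2_def finite_set_mult)
  have T2N: "T2 \<subseteq> N" unfolding T2_def
    using T T1 S N.subgroup_axioms by (intro Un_least set_mult_subset insert_subsetI N.one_closed) auto
  \<comment> \<open>If \<open>x\<close> lies in \<open>V' j\<close>, then
    \<open>\<phi> (i j) x\<close> lies in the enlarged piece \<open>j\<close>: this is what defeats
    the function \<open>i\<close>.\<close>
  define V2 where "V2 j = V j \<union> \<phi> (i j) ` V' j" for j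
  have "V2 j \<in> sets X \<and> bdd \<phi> S (V2 j) T2" if j: "j < k" for j
  proof
    have VX: "V j \<in> sets X" "V' j \<in> sets X" using T(3) T'(3) j by blast+
    then show "V2 j \<in> sets X" unfolding V2_def using act_image_sets ij j by blast
    have V'S: "V' j \<subseteq> space X" "V j \<subseteq> space X" using VX sets.sets_into_space by auto
    have "bdd \<phi> ((\<lambda>s. i j \<otimes> s \<otimes> inv (i j)) ` S') (\<phi> (i j) ` V' j) ((\<lambda>s. i j \<otimes> s \<otimes> inv (i j)) ` T')"
      using T'(4) j V'S ij S' T'(2) Nc by (intro bdd_translate) auto
    moreover have "?R \<subseteq> (\<lambda>s. i j \<otimes> s \<otimes> inv (i j)) ` S'"
    proof
      fix r assume r: "r \<in> ?R"
      then have rc: "r \<in> carrier \<Gamma>" using RN Nc by blast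
      have "inv (i j) \<otimes> r \<otimes> i j \<in> S'" using r j by (auto simp: S'_def)
      moreover have "r = i j \<otimes> (inv (i j) \<otimes> r \<otimes> i j) \<otimes> inv (i j)"
        using rc ij[OF j] by (simp add: m_assoc)
      ultimately show "r \<in> (\<lambda>s. i j \<otimes> s \<otimes> inv (i j)) ` S'" by blast
    qed
    ultimately have "bdd \<phi> ?R (\<phi> (i j) ` V' j) T1"
      by (rule bdd_mono) (use j in \<open>auto simp: T1_def\<close>)
    moreover have "\<phi> (i j) ` V' j \<subseteq> space X" using V'S ij[OF j] by auto
    moreover have "bdd \<phi> S (V j) T" using T(3) j by blast
    moreover have "S \<subseteq> carrier \<Gamma>" "T \<subseteq> carrier \<Gamma>" "T1 \<subseteq> carrier \<Gamma>"
      using S(2) T(2) T1(2) Nc by auto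
    ultimately show "bdd \<phi> S (V2 j) T2"
      unfolding V2_def T2_def using V'S(2) bdd_union by metis
  qed
  moreover have "\<exists>j<k. \<phi> (l j) x \<in> V2 j" if "x \<in> space X" "l \<in> insert i I" for x l
  proof (cases "l = i")
    case True
    then show ?thesis using T'(5)[OF that(1)] unfolding V2_def by blast
  next
    case False
    then show ?thesis using T(4) that unfolding V2_def by blast
  qed
  ultimately show ?case using T2 T2N by (intro exI[of _ T2] exI[of _ V2]) simp
qed

text \<open>The greedy choice at a point looks at a finite window of its translates; this puts the
  whole window into one piece.\<close>

lemma adim_cover_translates:
  assumes N: "N \<lhd> \<Gamma>" and ad: "adim X \<phi> N k" and S: "finite S" "S \<subseteq> N"
    and F: "finite F" "F \<subseteq> carrier \<Gamma>"
  obtains T V where "finite T" "T \<subseteq> N" "\<And>j. j < k \<Longrightarrow> V j \<in> sets X"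
    "\<And>j. j < k \<Longrightarrow> bdd \<phi> S (V j) T"
    "\<And>x. x \<in> space X \<Longrightarrow> \<exists>j<k. \<forall>f\<in>F. \<phi> f x \<in> V j"
proof -
  have "finite ({..<k} \<rightarrow>\<^sub>E F)" using F by (intro finite_PiE) auto
  then have "\<exists>T V. finite T \<and> T \<subseteq> N \<and> (\<forall>j<k. V j \<in> sets X \<and> bdd \<phi> S (V j) T) \<and>
      (\<forall>x\<in>space X. \<forall>i\<in>{..<k} \<rightarrow>\<^sub>E F. \<exists>j<k. \<phi> (i j) x \<in> V j)"
    by (rule adim_cover_sequences[OF N ad S]) (use F in \<open>auto simp: PiE_def Pi_def\<close>)
  then obtain T V where T: "finite T" "T \<subseteq> N" "\<forall>j<k. V j \<in> sets X \<and> bdd \<phi> S (V j) T"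
      "\<forall>x\<in>space X. \<forall>i\<in>{..<k} \<rightarrow>\<^sub>E F. \<exists>j<k. \<phi> (i j) x \<in> V j"
    by (elim exE conjE) (rule that)
  have "\<exists>j<k. \<forall>f\<in>F. \<phi> f x \<in> V j" if x: "x \<in> space X" for x
  proof (rule ccontr)
    assume "\<not> ?thesis"
    then have "\<forall>j\<in>{..<k}. \<exists>f\<in>F. \<phi> f x \<notin> V j" by auto
    then obtain i where i: "\<forall>j\<in>{..<k}. i j \<in> F \<and> \<phi> (i j) x \<notin> V j" by metis
    then have "restrict i {..<k} \<in> {..<k} \<rightarrow>\<^sub>E F" by auto
    then obtain j where "j < k" "\<phi> (restrict i {..<k} j) x \<in> V j" using T(4) x by blast
    then show False using i by simp
  qed
  then show ?thesis using T by (intro that[of T V]) simp_all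
qed

end

section \<open>Extension by a quotient\<close>

text \<open>The index \<open>j\<close> encodes a colour \<open>j div K\<close> and a class \<open>j mod K\<close>. A point of that colour is chosen
  for that class unless it has a \<open>\<Phi>\<close>-neighbour chosen earlier at all, or a \<open>\<Psi>\<close>-neighbour chosen
  earlier for the same class. If no \<open>\<Phi>\<close>-neighbour of \<open>x\<close> were ever chosen, every class would be
  blocked by a \<open>\<Psi>\<close>-neighbour, and these neighbours would be too many for the packing bound.\<close>

fun greedy :: "('a \<Rightarrow> 'x \<Rightarrow> 'x) \<Rightarrow> 'a set \<Rightarrow> 'a set \<Rightarrow> nat \<Rightarrow> 'x set \<Rightarrow> ('x \<Rightarrow> nat) \<Rightarrow> nat \<Rightarrow> 'x \<Rightarrow> bool"
where
  "greedy \<phi> \<Phi> \<Psi> K V ch j x \<longleftrightarrow> x \<in> V \<and> ch x = j div K \<and>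
     (\<forall>i. i < j \<longrightarrow> (\<forall>f\<in>\<Phi>. \<not> greedy \<phi> \<Phi> \<Psi> K V ch i (\<phi> f x)) \<and>
        (i mod K = j mod K \<longrightarrow> (\<forall>p\<in>\<Psi>. \<not> greedy \<phi> \<Phi> \<Psi> K V ch i (\<phi> p x))))"

declare greedy.simps [simp del]

context free_borel_action
begin

primrec win :: "'a set \<Rightarrow> nat \<Rightarrow> 'a set" where
  "win \<Psi> 0 = {\<one>}"
| "win \<Psi> (Suc l) = \<Psi> <#> win \<Psi> l"

lemma finite_win: "finite \<Psi> \<Longrightarrow> finite (win \<Psi> l)"
  by (induction l) (auto intro: finite_set_mult)

lemma win_subset: "\<Psi> \<subseteq> carrier \<Gamma> \<Longrightarrow> win \<Psi> l \<subseteq> carrier \<Gamma>"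
  by (induction l) (auto simp: set_mult_closed)

lemma pred_act: "g \<in> carrier \<Gamma> \<Longrightarrow> Measurable.pred X P \<Longrightarrow> Measurable.pred X (\<lambda>x. P (\<phi> g x))"
  by (rule measurable_compose[OF act_measurable])

end

text \<open>\<open>V\<close> is one piece for \<open>N\<close>, and \<open>U\<close> is the
  colouring. \<Phi> is the radius at which chosen points should be found, \<Psi> the range at which
  two of them compete. By \<open>conj\<close>, moving two nearby points of one
  \<open>N\<close>-orbit by the same window element leaves them adjacent at scale \<open>S'\<close>.
  The second factor in \<open>U_sep\<close> absorbs the moves \<open>t\<close> and \<open>t'\<close>
  inside the components of \<open>V\<close>.\<close>

locale colour_step = free_borel_action \<Gamma> X \<phi>
  for \<Gamma> :: "('a, 'm) monoid_scheme" (structure) and X :: "'x measure" and \<phi> +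
  fixes N \<Phi> \<Psi> S' T' :: "'a set" and V :: "'x set" and U :: "nat \<Rightarrow> 'x set" and C K :: nat
  assumes N: "N \<lhd> \<Gamma>"
    and Psi: "finite \<Psi>" "\<Psi> \<subseteq> carrier \<Gamma>" "\<And>p. p \<in> \<Psi> \<Longrightarrow> inv p \<in> \<Psi>"
    and Phi: "\<Phi> \<subseteq> \<Psi>" "\<one> \<in> \<Phi>" "\<And>p. p \<in> \<Phi> \<Longrightarrow> inv p \<in> \<Phi>"
    and V: "V \<in> sets X"
    and U: "\<And>c. c < C \<Longrightarrow> U c \<in> sets X" "\<And>x. x \<in> space X \<Longrightarrow> \<exists>c<C. x \<in> U c"
    and S': "S' \<subseteq> carrier \<Gamma>" "\<And>s. s \<in> S' \<Longrightarrow> inv s \<in> S'"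
    and T': "T' \<subseteq> carrier \<Gamma>" "bdd \<phi> S' V T'"
    and U_sep: "\<And>c x p t t'. \<lbrakk>c < C; x \<in> U c; p \<in> \<Psi>; t \<in> T'; t' \<in> T'; \<phi> (p \<otimes> (inv p \<otimes> t' \<otimes> p \<otimes> inv t)) x \<in> U c\<rbrakk>
        \<Longrightarrow> p \<in> N"
    and K: "K > 0"
    and conj: "\<And>l w a a'. \<lbrakk>l \<le> C * K; w \<in> win \<Psi> l; a \<in> win \<Psi> 2; a' \<in> win \<Psi> 2; a' \<otimes> inv a \<in> N\<rbrakk>
        \<Longrightarrow> w \<otimes> (a' \<otimes> inv a) \<otimes> inv w \<in> S'"
begin

text \<open>The least colour that occurs in the component of \<open>x\<close>. Unlike
  \<open>U\<close> it is constant on components, and it still separates cosets of \<open>N\<close>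
  because \<open>U_sep\<close> allows for the size \<open>T'\<close> of the components.\<close>

definition chi :: "'x \<Rightarrow> nat" where
  "chi x = (LEAST c. c < C \<and> (\<exists>y. (x, y) \<in> (step \<phi> S' V)\<^sup>* \<and> y \<in> U c))"

abbreviation "gr \<equiv> greedy \<phi> \<Phi> \<Psi> K V chi"

definition P :: "'x set" where
  "P = {x \<in> space X. \<forall>l\<le>C * K. \<forall>w\<in>win \<Psi> l. \<forall>a\<in>win \<Psi> 2. \<phi> (w \<otimes> a) x \<in> V}"

text \<open>For \<open>x\<close> in this set, the translate \<open>\<phi> f x\<close> serves as a
  centre of \<open>x\<close> in class \<open>c\<close>.\<close>

definition R :: "nat \<Rightarrow> 'a \<Rightarrow> 'x set" where
  "R c f = {x \<in> P. \<exists>j<C * K. j mod K = c \<and> gr j (\<phi> f x)}"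

text \<open>Points related by \<open>sim j\<close> are not distinguished by the first \<open>j + 1\<close> rounds of the greedy choice.\<close>

primrec sim :: "nat \<Rightarrow> 'x \<Rightarrow> 'x \<Rightarrow> bool" where
  "sim 0 u u' \<longleftrightarrow> u \<in> V \<and> u' \<in> V \<and> chi u = chi u'"
| "sim (Suc j) u u' \<longleftrightarrow> u \<in> V \<and> u' \<in> V \<and> chi u = chi u' \<and> (\<forall>p\<in>\<Psi>. sim j (\<phi> p u) (\<phi> p u'))"

lemma V_space: "V \<subseteq> space X"
  using V sets.sets_into_space by blast

lemma chi_ex: "x \<in> V \<Longrightarrow> \<exists>c<C. \<exists>y. (x, y) \<in> (step \<phi> S' V)\<^sup>* \<and> y \<in> U c"
  using U(2)[of x] V_space by blast

lemma chi_less: "x \<in> V \<Longrightarrow> chi x < C"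
  unfolding chi_def using LeastI_ex[of "\<lambda>c. c < C \<and> (\<exists>y. (x, y) \<in> (step \<phi> S' V)\<^sup>* \<and> y \<in> U c)"]
    chi_ex[of x] by blast

lemma chi_witness:
  assumes "x \<in> V" obtains t where "t \<in> T'" "\<phi> t x \<in> U (chi x)"
proof -
  have "\<exists>y. (x, y) \<in> (step \<phi> S' V)\<^sup>* \<and> y \<in> U (chi x)"
    unfolding chi_def using LeastI_ex[of "\<lambda>c. c < C \<and> (\<exists>y. (x, y) \<in> (step \<phi> S' V)\<^sup>* \<and> y \<in> U c)"]
      chi_ex[OF assms] by blast
  then show ?thesis using bddD[OF T'(2) assms] that by blast
qed

lemma sym_step: "sym ((step \<phi> S' V)\<^sup>*)"
proof (intro sym_rtrancl symI)
  fix x y assume "(x, y) \<in> step \<phi> S' V"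
  then obtain s where s: "x \<in> V" "y \<in> V" "s \<in> S'" "y = \<phi> s x" by (auto simp: step_def)
  then have "\<phi> (inv s) y = x" using S' V_space by (auto simp: subset_iff)
  then show "(y, x) \<in> step \<phi> S' V" using s S'(2) by (intro stepI[where s="inv s"]) auto
qed

lemma chi_step:
  assumes "x \<in> V" "s \<in> S'" "\<phi> s x \<in> V"
  shows "chi (\<phi> s x) = chi x"
proof -
  have 1: "(x, \<phi> s x) \<in> (step \<phi> S' V)\<^sup>*" using assms by (intro r_into_rtrancl stepI) auto
  then have 2: "(\<phi> s x, x) \<in> (step \<phi> S' V)\<^sup>*" using sym_step by (rule symD[rotated])
  have "(\<phi> s x, y) \<in> (step \<phi> S' V)\<^sup>* \<longleftrightarrow> (x, y) \<in> (step \<phi> S' V)\<^sup>*" for y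
    using rtrancl_trans[OF 1] rtrancl_trans[OF 2] by blast
  then show ?thesis by (simp add: chi_def)
qed

text \<open>Both components meet the same colour set, at \<open>\<phi> t x\<close> and at
  \<open>\<phi> t' (\<phi> p x)\<close>. The displacement from the first point to the second is
  \<open>p\<close> times the correction that \<open>U_sep\<close> anticipates.\<close>

lemma chi_sep:
  assumes "x \<in> V" "p \<in> \<Psi>" "\<phi> p x \<in> V" "chi (\<phi> p x) = chi x"
  shows "p \<in> N"
proof -
  obtain t where t: "t \<in> T'" "\<phi> t x \<in> U (chi x)" by (rule chi_witness[OF assms(1)])
  obtain t' where t': "t' \<in> T'" "\<phi> t' (\<phi> p x) \<in> U (chi x)"
    using chi_witness[OF assms(3)] assms(4) by metis
  have c: "t \<in> carrier \<Gamma>" "t' \<in> carrier \<Gamma>" "p \<in> carrier \<Gamma>" "x \<in> space X"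
    using t t' T'(1) Psi(2) assms V_space by auto
  then have "\<phi> (p \<otimes> (inv p \<otimes> t' \<otimes> p \<otimes> inv t)) (\<phi> t x) = \<phi> t' (\<phi> p x)"
    by (simp add: m_assoc)
  then show ?thesis using U_sep[OF chi_less[OF assms(1)] t(2) assms(2) t(1) t'(1)] t'(2) by simp
qed

lemma chi_sets: "{x \<in> V. chi x = c} \<in> sets X"
proof -
  define A where "A c = {x \<in> V. \<exists>y\<in>U c. (x, y) \<in> (step \<phi> S' V)\<^sup>*}" for c
  have A: "A c \<in> sets X" if "c < C" for c
  proof -
    have "A c = V \<inter> {x \<in> space X. \<exists>y\<in>U c. (x, y) \<in> Id_on (space X) O (step \<phi> S' V)\<^sup>*}"
      using V_space by (auto simp: A_def)
    also have "\<dots> \<in> sets X"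
      using V U(1)[OF that] S'(1) by (intro sets.Int bor_vimage bor_rtrancl bor_step)
    finally show ?thesis .
  qed
  show ?thesis
  proof (cases "c < C")
    case True
    have "{x \<in> V. chi x = c} = A c - (\<Union>c'<c. A c')"
    proof (rule Set.set_eqI, rule iffI)
      fix x assume "x \<in> {x \<in> V. chi x = c}"
      then have x: "x \<in> V" "chi x = c" by auto
      have "c < C \<and> (\<exists>y. (x, y) \<in> (step \<phi> S' V)\<^sup>* \<and> y \<in> U c)"
        using LeastI_ex[of "\<lambda>c. c < C \<and> (\<exists>y. (x, y) \<in> (step \<phi> S' V)\<^sup>* \<and> y \<in> U c)"]
        chi_ex[OF x(1)] unfolding x(2)[symmetric] chi_def by blast
      moreover have "x \<notin> A c'" if "c' < c" for c'
        using not_less_Least[of c' "\<lambda>c. c < C \<and> (\<exists>y. (x, y) \<in> (step \<phi> S' V)\<^sup>* \<and> y \<in> U c)"] that True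
        unfolding x(2)[symmetric] chi_def A_def using order_less_trans by blast
      ultimately show "x \<in> A c - (\<Union>c'<c. A c')" using x by (auto simp: A_def)
    next
      fix x assume x: "x \<in> A c - (\<Union>c'<c. A c')"
      have "chi x = c" unfolding chi_def
        by (rule Least_equality) (use x True in \<open>auto simp: A_def not_less[symmetric]\<close>)
      then show "x \<in> {x \<in> V. chi x = c}" using x by (auto simp: A_def)
    qed
    then show ?thesis using A True by auto
  next
    case False
    then have "{x \<in> V. chi x = c} = {}" using chi_less by auto
    then show ?thesis by (simp only: sets.empty_sets)
  qed
qed

lemma greedy_pred: "Measurable.pred X (gr j)"
proof (induction j rule: less_induct)
  case (less j)
  have a: "Measurable.pred X (\<lambda>x. x \<in> V \<and> chi x = j div K)"
    unfolding pred_def using chi_sets V_space by (simp add: subset_iff Collect_conj_eq)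
  have b: "Measurable.pred X (\<lambda>x. \<not> gr i (\<phi> p x))" if "i < j" "p \<in> \<Psi>" for i p
    using pred_act[OF _ less[OF that(1)], of p] that Psi(2) by auto
  have fP: "finite \<Phi>" using Psi(1) Phi(1) finite_subset by blast
  have "gr j = (\<lambda>x. (x \<in> V \<and> chi x = j div K) \<and>
     (\<forall>i\<in>{..<j}. (\<forall>f\<in>\<Phi>. \<not> gr i (\<phi> f x)) \<and> (\<forall>p\<in>(if i mod K = j mod K then \<Psi> else {}). \<not> gr i (\<phi> p x))))"
    by (rule ext, subst greedy.simps) auto
  moreover have "Measurable.pred X \<dots>"
    using b Psi(1) fP Phi(1)
    by (intro pred_intros_logic(3)[OF a] pred_intros_finite(3) pred_intros_logic(3)) (auto split: if_splits)
  ultimately show ?case by simp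
qed

lemma P_sets: "P \<in> sets X"
proof -
  have eq: "P = {x \<in> space X. \<forall>l\<in>{..C * K}. \<forall>w\<in>win \<Psi> l. \<forall>a\<in>win \<Psi> 2. \<phi> (w \<otimes> a) x \<in> V}"
    by (auto simp: P_def)
  have "{x \<in> space X. x \<in> V} = V" using V_space by blast
  then have "Measurable.pred X (\<lambda>x. x \<in> V)" using V by (simp add: pred_def)
  then have V': "Measurable.pred X (\<lambda>x. \<phi> g x \<in> V)" if "g \<in> carrier \<Gamma>" for g
    using pred_act[OF that] by blast
  have "Measurable.pred X (\<lambda>x. \<forall>l\<in>{..C * K}. \<forall>w\<in>win \<Psi> l. \<forall>a\<in>win \<Psi> 2. \<phi> (w \<otimes> a) x \<in> V)"
  proof (intro pred_intros_finite(3) finite_win Psi(1))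
    fix l w a assume "w \<in> win \<Psi> l" "a \<in> win \<Psi> 2"
    then have "w \<otimes> a \<in> carrier \<Gamma>" using win_subset[OF Psi(2)] by blast
    then show "Measurable.pred X (\<lambda>x. \<phi> (w \<otimes> a) x \<in> V)" by (rule V')
  qed simp
  then show ?thesis unfolding eq pred_def .
qed

lemma R_sets:
  assumes "f \<in> \<Phi>" shows "R c f \<in> sets X"
proof -
  have f: "f \<in> carrier \<Gamma>" using assms Phi(1) Psi(2) by blast
  have "Measurable.pred X (\<lambda>x. \<exists>j\<in>{..<C * K}. j mod K = c \<and> gr j (\<phi> f x))"
  proof (rule pred_intros_finite(4))
    fix j show "Measurable.pred X (\<lambda>x. j mod K = c \<and> gr j (\<phi> f x))"
      by (rule pred_intros_logic(3)[OF _ pred_act[OF f greedy_pred]]) simp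
  qed simp
  then have "{x \<in> space X. \<exists>j\<in>{..<C * K}. j mod K = c \<and> gr j (\<phi> f x)} \<in> sets X"
    unfolding pred_def .
  moreover have "R c f = P \<inter> {x \<in> space X. \<exists>j\<in>{..<C * K}. j mod K = c \<and> gr j (\<phi> f x)}"
    unfolding R_def P_def by blast
  ultimately show ?thesis using P_sets by (simp only: sets.Int)
qed

lemma sim_antimono: "sim (Suc j) u u' \<Longrightarrow> sim j u u'"
  by (induction j arbitrary: u u') auto

lemma sim_le:
  assumes "sim j u u'" "i \<le> j" shows "sim i u u'"
  using assms(2) by (induction rule: inc_induct) (use assms(1) in \<open>blast intro: sim_antimono\<close>)+

lemma sim_greedy: "sim i u u' \<Longrightarrow> gr i u = gr i u'"
proof (induction i arbitrary: u u' rule: less_induct)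
  case (less j)
  have *: "gr i (\<phi> p u) = gr i (\<phi> p u')" if i: "i < j" and p: "p \<in> \<Psi>" for i p
  proof -
    obtain j' where j: "j = Suc j'" using i by (cases j) auto
    then have "sim j' (\<phi> p u) (\<phi> p u')" using less.prems p by simp
    then have "sim i (\<phi> p u) (\<phi> p u')" using sim_le i j by (metis less_Suc_eq_le)
    then show ?thesis using less.IH i by blast
  qed
  have "u \<in> V \<and> u' \<in> V \<and> chi u = chi u'" using less.prems by (cases j) auto
  moreover have "\<And>i p. i < j \<Longrightarrow> p \<in> \<Phi> \<Longrightarrow> gr i (\<phi> p u) = gr i (\<phi> p u')" using * Phi(1) by blast
  ultimately show ?case
    by (subst (1 2) greedy.simps) (simp add: * cong: ball_cong)
qed

text \<open>Moving both points by a window element \<open>w\<close> leaves them related by a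
  conjugate of \<open>a' \<otimes> inv a\<close>, which lies in \<open>S'\<close>; as both stay in
  \<open>V\<close>, their colours agree. One layer of the window is spent on each of the
  \<open>C * K\<close> rounds.\<close>

lemma sim_translate:
  assumes x: "x \<in> P" and a: "a \<in> win \<Psi> 2" "a' \<in> win \<Psi> 2" "a' \<otimes> inv a \<in> N"
  shows "sim (C * K) (\<phi> a x) (\<phi> a' x)"
proof -
  have ac: "a \<in> carrier \<Gamma>" "a' \<in> carrier \<Gamma>" "x \<in> space X" using a win_subset[OF Psi(2)] x P_def by auto
  have *: "\<phi> w (\<phi> a x) \<in> V \<and> \<phi> w (\<phi> a' x) \<in> V \<and> chi (\<phi> w (\<phi> a x)) = chi (\<phi> w (\<phi> a' x))"
    if w: "w \<in> win \<Psi> l" "l \<le> C * K" for w l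
  proof -
    have wc: "w \<in> carrier \<Gamma>" using w win_subset[OF Psi(2)] by blast
    have V1: "\<phi> (w \<otimes> a) x \<in> V" "\<phi> (w \<otimes> a') x \<in> V" using x w a by (auto simp: P_def)
    have e: "w \<otimes> (a' \<otimes> inv a) \<otimes> inv w \<otimes> (w \<otimes> a) = w \<otimes> a'" using wc ac by (simp add: m_assoc)
    have "chi (\<phi> (w \<otimes> (a' \<otimes> inv a) \<otimes> inv w) (\<phi> (w \<otimes> a) x)) = chi (\<phi> (w \<otimes> a) x)"
      using conj[OF w(2,1) a] V1 wc ac e by (intro chi_step) simp_all
    then show ?thesis using wc ac V1 e by simp
  qed
  have "sim j (\<phi> w (\<phi> a x)) (\<phi> w (\<phi> a' x))" if "w \<in> win \<Psi> l" "l + j \<le> C * K" for j l w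
    using that
  proof (induction j arbitrary: l w)
    case (0 l w)
    then show ?case using *[of w l] by simp
  next
    case (Suc j l w)
    have "sim j (\<phi> p (\<phi> w (\<phi> a x))) (\<phi> p (\<phi> w (\<phi> a' x)))" if p: "p \<in> \<Psi>" for p
    proof -
      have "p \<otimes> w \<in> win \<Psi> (Suc l)" using p Suc.prems by (auto simp: set_mult_def)
      then have "sim j (\<phi> (p \<otimes> w) (\<phi> a x)) (\<phi> (p \<otimes> w) (\<phi> a' x))" using Suc.prems by (intro Suc.IH[where l="Suc l"]) auto
      moreover have "p \<in> carrier \<Gamma>" "w \<in> carrier \<Gamma>" using p Psi(2) win_subset[OF Psi(2)] Suc.prems by auto
      ultimately show ?thesis using ac by (simp add: m_assoc)
    qed
    then show ?case using *[of w l] Suc.prems by simp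
  qed
  from this[of \<one> 0 "C * K"] show ?thesis using ac by simp
qed

lemma Phi_block: "gr j x \<Longrightarrow> i < j \<Longrightarrow> f \<in> \<Phi> \<Longrightarrow> \<not> gr i (\<phi> f x)"
  by (subst (asm) greedy.simps) blast

lemma Psi_block: "gr j x \<Longrightarrow> i < j \<Longrightarrow> i mod K = j mod K \<Longrightarrow> p \<in> \<Psi> \<Longrightarrow> \<not> gr i (\<phi> p x)"
  by (subst (asm) greedy.simps) blast

lemma greedyD: "gr j x \<Longrightarrow> x \<in> V \<and> chi x = j div K"
  by (subst (asm) greedy.simps) blast

lemma greedyI:
  assumes "x \<in> V" "chi x = j div K" "\<And>i f. i < j \<Longrightarrow> f \<in> \<Phi> \<Longrightarrow> \<not> gr i (\<phi> f x)"
    "\<And>i p. i < j \<Longrightarrow> i mod K = j mod K \<Longrightarrow> p \<in> \<Psi> \<Longrightarrow> \<not> gr i (\<phi> p x)"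
  shows "gr j x"
  by (subst greedy.simps) (use assms in simp)

text \<open>Two points chosen for one class within \<Psi> of each other cannot belong to different
  rounds, since \<Psi> is symmetric and the earlier would block the later. In a common round they
  share the colour, and \<open>chi_sep\<close> applies.\<close>

lemma R_adjacent:
  assumes x: "x \<in> R c f" and y: "\<phi> g x \<in> R c f'" and g: "g \<in> carrier \<Gamma>"
    and f: "f \<in> \<Phi>" "f' \<in> \<Phi>" and p: "f' \<otimes> g \<otimes> inv f \<in> \<Psi>"
  shows "f' \<otimes> g \<otimes> inv f \<in> N"
proof -
  let ?p = "f' \<otimes> g \<otimes> inv f"
  obtain j where j: "j mod K = c" "gr j (\<phi> f x)" using x by (auto simp: R_def)
  obtain j' where j': "j' mod K = c" "gr j' (\<phi> f' (\<phi> g x))" using y by (auto simp: R_def)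
  have c: "f \<in> carrier \<Gamma>" "f' \<in> carrier \<Gamma>" "x \<in> space X" using f Phi(1) Psi(2) x by (auto simp: R_def P_def)
  have e: "\<phi> f' (\<phi> g x) = \<phi> ?p (\<phi> f x)" "\<phi> f x = \<phi> (inv ?p) (\<phi> f' (\<phi> g x))"
    using c g by (simp_all add: m_assoc inv_mult_group)
  have "\<not> j < j'" using Psi_block[OF j'(2), of j "inv ?p"] Psi(3)[OF p] j j' e(2) by auto
  moreover have "\<not> j' < j" using Psi_block[OF j(2), of j' ?p] p j j' e(1) by auto
  ultimately have "j = j'" by simp
  then have "chi (\<phi> ?p (\<phi> f x)) = chi (\<phi> f x)" "\<phi> f x \<in> V" "\<phi> ?p (\<phi> f x) \<in> V"
    using greedyD[OF j(2)] greedyD[OF j'(2)] e(1) by auto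
  then show ?thesis using chi_sep[OF _ p] by blast
qed

lemma win_2: "p \<in> \<Psi> \<Longrightarrow> q \<in> \<Psi> \<Longrightarrow> p \<otimes> q \<in> win \<Psi> 2"
  using Psi(2) by (force simp: numeral_2_eq_2 set_mult_def)

lemma R_cover:
  assumes x: "x \<in> P"
    and packing: "\<And>Z. \<lbrakk>Z \<subseteq> \<Psi>; \<And>z z'. \<lbrakk>z \<in> Z; z' \<in> Z; z \<noteq> z'\<rbrakk> \<Longrightarrow> z' \<otimes> inv z \<notin> N <#> \<Phi>\<rbrakk> \<Longrightarrow> card Z < K"
  shows "\<exists>c<K. \<exists>f\<in>\<Phi>. x \<in> R c f"
proof (rule ccontr)
  assume "\<not> ?thesis"
  then have no: "\<not> gr j (\<phi> f x)" if "j < C * K" "f \<in> \<Phi>" for j f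
    using that x K mod_less_divisor[OF K, of j] unfolding R_def by blast
  interpret N: normal N \<Gamma> by (rule N)
  have xs: "x \<in> space X" using x by (simp add: P_def)
  have "\<one> \<in> win \<Psi> 2" using win_2[of \<one> \<one>] Phi by auto
  then have "\<phi> (\<one> \<otimes> \<one>) x \<in> V" using x unfolding P_def by force
  then have xV: "x \<in> V" using xs by simp
  define r where "r = chi x"
  have r: "r < C" using chi_less[OF xV] r_def by simp
  have "\<exists>i p. p \<in> \<Psi> \<and> i < C * K \<and> i mod K = c \<and> gr i (\<phi> p x)" if c: "c < K" for c
  proof -
    \<comment> \<open>The only round in which \<open>x\<close> itself could be chosen for class
      \<open>c\<close>.\<close>
    let ?j = "r * K + c"
    have jl: "?j < C * K"
    proof -
      have "?j < Suc r * K" using c by simp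
      also have "\<dots> \<le> C * K" using r by (intro mult_le_mono1) simp
      finally show ?thesis .
    qed
    have d: "?j div K = r" "?j mod K = c" using c by simp_all
    have "\<not> gr ?j x" using no[OF jl Phi(2)] xs by simp
    moreover have "gr ?j x" if nn: "\<not> (\<exists>i p. p \<in> \<Psi> \<and> i < C * K \<and> i mod K = c \<and> gr i (\<phi> p x))"
    proof (rule greedyI[OF xV])
      show "\<not> gr i (\<phi> f x)" if "i < ?j" "f \<in> \<Phi>" for i f
        using no[OF _ that(2)] less_trans[OF that(1) jl] .
      show "\<not> gr i (\<phi> p x)" if "i < ?j" "i mod K = ?j mod K" "p \<in> \<Psi>" for i p
        using nn that(3) less_trans[OF that(1) jl] that(2)[unfolded d(2)] by blast
    qed (metis d(1) r_def)
    ultimately show ?thesis by blast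
  qed
  then obtain i p where ip: "\<And>c. c < K \<Longrightarrow> p c \<in> \<Psi>" "\<And>c. c < K \<Longrightarrow> i c < C * K"
      "\<And>c. c < K \<Longrightarrow> i c mod K = c" "\<And>c. c < K \<Longrightarrow> gr (i c) (\<phi> (p c) x)"
    by metis
  have pc: "\<And>c. c < K \<Longrightarrow> p c \<in> carrier \<Gamma>" using ip(1) Psi(2) by blast
  \<comment> \<open>If two blockers were this close, a \<Phi>-translate of the first would lie in
    the \<open>N\<close>-orbit of the second and be chosen in the same rounds. As different classes
    mean different rounds, whichever was chosen earlier would block the other through
    \<Phi>.\<close>
  have far: "p c' \<otimes> inv (p c) \<notin> N <#> \<Phi>" if c: "c < K" "c' < K" "c \<noteq> c'" for c c'
  proof
    assume "p c' \<otimes> inv (p c) \<in> N <#> \<Phi>"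
    then obtain n f where nf: "n \<in> N" "f \<in> \<Phi>" "p c' \<otimes> inv (p c) = n \<otimes> f" by (auto simp: set_mult_def)
    have cc: "n \<in> carrier \<Gamma>" "f \<in> carrier \<Gamma>" "p c \<in> carrier \<Gamma>" "p c' \<in> carrier \<Gamma>"
      using nf N.subset Phi(1) Psi(2) pc c by auto
    have e: "p c' = n \<otimes> (f \<otimes> p c)"
    proof -
      have "n \<otimes> (f \<otimes> p c) = (n \<otimes> f) \<otimes> p c" using cc by (simp add: m_assoc)
      also have "\<dots> = p c'" unfolding nf(3)[symmetric] using cc by (simp add: m_assoc)
      finally show ?thesis by (rule sym)
    qed
    let ?a = "f \<otimes> p c" and ?a' = "p c'"
    have "?a' \<otimes> inv ?a = n" using e cc by (simp add: m_assoc inv_mult_group)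
    moreover have "?a \<in> win \<Psi> 2" using nf ip(1) c Phi(1) by (intro win_2) auto
    moreover have "?a' \<in> win \<Psi> 2" using win_2[of "p c'" \<one>] ip(1) c Phi cc by auto
    ultimately have sim: "sim (C * K) (\<phi> ?a x) (\<phi> ?a' x)" using nf(1) by (intro sim_translate x) auto
    have sg: "gr l (\<phi> ?a x) = gr l (\<phi> ?a' x)" if "l < C * K" for l
      using sim_greedy[OF sim_le[OF sim, of l]] that by simp
    have ne: "i c \<noteq> i c'" using ip(3) c by metis
    have a: "\<phi> ?a x = \<phi> f (\<phi> (p c) x)" "\<phi> (p c) x = \<phi> (inv f) (\<phi> ?a x)" using cc xs by (simp_all add: m_assoc)
    show False
    proof (cases "i c < i c'")
      case True
      have "gr (i c') (\<phi> ?a x)" using sg ip c by simp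
      from Phi_block[OF this True Phi(3)[OF nf(2)]] show False
        unfolding a(2)[symmetric] using ip(4)[OF c(1)] by blast
    next
      case False
      then have lt: "i c' < i c" using ne by simp
      from Phi_block[OF ip(4)[OF c(1)] lt nf(2)] show False using a(1) sg[of "i c'"] ip c by simp
    qed
  qed
  have inj: "inj_on p {..<K}"
  proof (rule inj_onI, rule ccontr)
    fix c c' assume c: "c \<in> {..<K}" "c' \<in> {..<K}" "p c = p c'" "c \<noteq> c'"
    have "\<one> \<otimes> \<one> \<in> N <#> \<Phi>" unfolding set_mult_def using N.one_closed Phi(2) by blast
    then show False using far[of c c'] c pc by simp
  qed
  have "card (p ` {..<K}) < K"
    using ip(1) far by (intro packing) auto
  then show False using card_image[OF inj] by simp
qed

end

section \<open>Colourings, packing bounds and the passage from \<open>N\<close> to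
  \<open>M\<close>\<close>

context free_borel_action
begin

text \<open>The number of colours has to be chosen before \<open>S\<close>: it determines the number of rounds of the greedy
  choice, and the scale at which the colouring is used grows with that number.\<close>

definition chrom :: "'a set \<Rightarrow> bool" where
  "chrom K \<longleftrightarrow> (\<forall>B. finite B \<and> B \<subseteq> carrier \<Gamma> \<longrightarrow> (\<exists>C::nat. \<forall>S. finite S \<and> S \<subseteq> K \<longrightarrow>
     (\<exists>U. (\<forall>c<C. U c \<in> sets X) \<and> (\<forall>x\<in>space X. \<exists>c<C. x \<in> U c) \<and>
       (\<forall>c<C. \<forall>x\<in>U c. \<forall>b\<in>B. \<forall>s\<in>S. \<phi> (b \<otimes> s) x \<in> U c \<longrightarrow> b \<in> K))))"

text \<open>When \<open>x\<close> has the centre \<open>\<phi> f x\<close> and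
  \<open>\<phi> (b \<otimes> s) x\<close> the centre given by \<open>f'\<close>, the displacement
  \<open>f' \<otimes> (b \<otimes> s) \<otimes> inv f\<close> of the centres lies here, provided
  that \<open>F\<close> is symmetric. The inverses make the set itself symmetric.\<close>

definition block :: "'a set \<Rightarrow> 'a set \<Rightarrow> 'a set \<Rightarrow> 'a set" where
  "block F B S = (F <#> B <#> S <#> F) \<union> (m_inv \<Gamma>) ` (F <#> B <#> S <#> F)"

text \<open>All that is needed of the quotient \<open>M / N\<close>. The bound is uniform in \<open>S\<close>, but \<open>F\<close> may be taken large
  compared to \<open>S\<close>, so this is a doubling condition at one good scale.\<close>

definition packing_bound :: "'a set \<Rightarrow> 'a set \<Rightarrow> 'a set \<Rightarrow> nat \<Rightarrow> bool" where
  "packing_bound N M B \<kappa> \<longleftrightarrow> (\<forall>S. finite S \<and> S \<subseteq> M \<and> \<one> \<in> S \<longrightarrow>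
     (\<exists>F. finite F \<and> F \<subseteq> M \<and> \<one> \<in> F \<and> (\<forall>f\<in>F. inv f \<in> F) \<and>
       (\<forall>Z. Z \<subseteq> block F B S \<and> (\<forall>z\<in>Z. \<forall>z'\<in>Z. z \<noteq> z' \<longrightarrow> z' \<otimes> inv z \<notin> N <#> F) \<longrightarrow> card Z \<le> \<kappa>)))"

lemma packing_boundD:
  assumes "packing_bound N M B \<kappa>" "finite S" "S \<subseteq> M" "\<one> \<in> S"
  shows "\<exists>F. finite F \<and> F \<subseteq> M \<and> \<one> \<in> F \<and> (\<forall>f\<in>F. inv f \<in> F) \<and>
       (\<forall>Z. Z \<subseteq> block F B S \<and> (\<forall>z\<in>Z. \<forall>z'\<in>Z. z \<noteq> z' \<longrightarrow> z' \<otimes> inv z \<notin> N <#> F) \<longrightarrow> card Z \<le> \<kappa>)"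
  by (rule assms(1)[unfolded packing_bound_def, rule_format]) (use assms(2-4) in simp)

lemma chrom_bound:
  assumes "chrom K" "finite B" "B \<subseteq> carrier \<Gamma>"
  obtains C :: nat where "\<And>S. finite S \<Longrightarrow> S \<subseteq> K \<Longrightarrow>
     \<exists>U. (\<forall>c<C. U c \<in> sets X) \<and> (\<forall>x\<in>space X. \<exists>c<C. x \<in> U c) \<and>
       (\<forall>c<C. \<forall>x\<in>U c. \<forall>b\<in>B. \<forall>s\<in>S. \<phi> (b \<otimes> s) x \<in> U c \<longrightarrow> b \<in> K)"
proof -
  have "\<exists>C::nat. \<forall>S. finite S \<and> S \<subseteq> K \<longrightarrow>
     (\<exists>U. (\<forall>c<C. U c \<in> sets X) \<and> (\<forall>x\<in>space X. \<exists>c<C. x \<in> U c) \<and>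
       (\<forall>c<C. \<forall>x\<in>U c. \<forall>b\<in>B. \<forall>s\<in>S. \<phi> (b \<otimes> s) x \<in> U c \<longrightarrow> b \<in> K))"
    by (rule assms(1)[unfolded chrom_def, rule_format]) (use assms(2,3) in simp)
  then show ?thesis by (elim exE) (rule that, drule spec, erule mp, rule conjI)
qed

text \<open>The order of the choices matters. \<open>F\<close> determines \<Psi>, \<Psi> the number
  \<open>C\<close> of colours, \<open>C * K\<close> the length of the windows, the windows the scale
  \<open>S'\<close>, and \<open>S'\<close> the bound \<open>T'\<close>. Only then is the scale
  \<open>S2\<close> of the colouring known, and this is not circular because \<open>C\<close> does
  not depend on it.\<close>

lemma colour_cover:
  assumes N: "N \<lhd> \<Gamma>" and M: "subgroup M \<Gamma>" and NM: "N \<subseteq> M" and ad: "adim X \<phi> N k" and ch: "chrom N"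
    and B: "finite B" "B \<subseteq> carrier \<Gamma>" "\<one> \<in> B" and S: "finite S" "S \<subseteq> M" "\<one> \<in> S"
    and F: "finite F" "F \<subseteq> M" "\<one> \<in> F" "\<forall>f\<in>F. inv f \<in> F"
    and pack: "\<forall>Z. Z \<subseteq> block F B S \<and> (\<forall>z\<in>Z. \<forall>z'\<in>Z. z \<noteq> z' \<longrightarrow> z' \<otimes> inv z \<notin> N <#> F) \<longrightarrow> card Z \<le> \<kappa>"
  shows "\<exists>R. (\<forall>m. \<forall>f\<in>F. m < k * Suc \<kappa> \<longrightarrow> R m f \<in> sets X) \<and>
     (\<forall>x\<in>space X. \<exists>m<k * Suc \<kappa>. \<exists>f\<in>F. x \<in> R m f) \<and>
     (\<forall>m f f' x b s. m < k * Suc \<kappa> \<and> f \<in> F \<and> f' \<in> F \<and> b \<in> B \<and> s \<in> S \<and>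
         x \<in> R m f \<and> \<phi> (b \<otimes> s) x \<in> R m f' \<longrightarrow> f' \<otimes> (b \<otimes> s) \<otimes> inv f \<in> N)"
proof -
  interpret N: normal N \<Gamma> by (rule N)
  interpret M: subgroup M \<Gamma> by (rule M)
  define \<Psi> where "\<Psi> = block F B S"
  define K where "K = Suc \<kappa>"
  have Fc: "F \<subseteq> carrier \<Gamma>" and Sc: "S \<subseteq> carrier \<Gamma>" using F(2) S(2) M.subset by auto
  have bc: "F <#> B <#> S <#> F \<subseteq> carrier \<Gamma>" using Fc Sc B by (intro set_mult_closed)
  have Psi: "finite \<Psi>" "\<Psi> \<subseteq> carrier \<Gamma>" "\<And>p. p \<in> \<Psi> \<Longrightarrow> inv p \<in> \<Psi>"
    using bc F(1) S(1) B(1) unfolding \<Psi>_def block_def by (auto simp: finite_set_mult subset_iff)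
  have inblock: "f' \<otimes> (b \<otimes> s) \<otimes> f \<in> \<Psi>" if "f \<in> F" "f' \<in> F" "b \<in> B" "s \<in> S" for f f' b s
  proof -
    have "f' \<otimes> b \<otimes> s \<otimes> f \<in> F <#> B <#> S <#> F" unfolding set_mult_def using that by blast
    moreover have "f' \<otimes> b \<otimes> s \<otimes> f = f' \<otimes> (b \<otimes> s) \<otimes> f" using that Fc Sc B(2) by (simp add: m_assoc subset_iff)
    ultimately show ?thesis by (simp add: \<Psi>_def block_def)
  qed
  have FP: "F \<subseteq> \<Psi>"
  proof
    fix f assume f: "f \<in> F"
    then have "\<one> \<otimes> (\<one> \<otimes> \<one>) \<otimes> f = f" using Fc by auto
    then show "f \<in> \<Psi>" using inblock[OF f F(3) B(3) S(3)] by simp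
  qed
  obtain C :: nat where C: "\<And>S. finite S \<Longrightarrow> S \<subseteq> N \<Longrightarrow>
     \<exists>U. (\<forall>c<C. U c \<in> sets X) \<and> (\<forall>x\<in>space X. \<exists>c<C. x \<in> U c) \<and>
       (\<forall>c<C. \<forall>x\<in>U c. \<forall>b\<in>\<Psi>. \<forall>s\<in>S. \<phi> (b \<otimes> s) x \<in> U c \<longrightarrow> b \<in> N)"
    by (rule chrom_bound[OF ch Psi(1,2)]) (rule that)
  define W where "W = (\<Union>l\<in>{..C * K}. win \<Psi> l)"
  have W: "finite W" "W \<subseteq> carrier \<Gamma>" using win_subset[OF Psi(2)] by (auto simp: W_def finite_win Psi(1))
  have W2: "finite (win \<Psi> 2)" "win \<Psi> 2 \<subseteq> carrier \<Gamma>" using win_subset[OF Psi(2)] by (auto simp: finite_win Psi(1))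
  \<comment> \<open>The elements of \<open>N\<close> by which two translates in
    \<open>win \<Psi> 2\<close> can differ; \<open>S'\<close> collects their conjugates by window
    elements, as \<open>conj\<close> asks.\<close>
  define A where "A = (\<lambda>(a', a). a' \<otimes> inv a) ` (win \<Psi> 2 \<times> win \<Psi> 2) \<inter> N"
  have A: "finite A" using W2(1) by (simp add: A_def)
  have AI: "a' \<otimes> inv a \<in> A" if "a \<in> win \<Psi> 2" "a' \<in> win \<Psi> 2" "a' \<otimes> inv a \<in> N" for a a'
    using that unfolding A_def by (auto intro!: image_eqI[where x="(a', a)"])
  have AN: "A \<subseteq> N" by (simp add: A_def)
  define S' where "S' = (\<lambda>(w, n). w \<otimes> n \<otimes> inv w) ` (W \<times> A)"
  have S': "finite S'" using W A by (simp add: S'_def)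
  have S'N: "S' \<subseteq> N" using W(2) AN by (auto simp: S'_def intro!: N.inv_op_closed2)
  have S'inv: "inv s \<in> S'" if "s \<in> S'" for s
  proof -
    obtain w n where wn: "w \<in> W" "n \<in> A" "s = w \<otimes> n \<otimes> inv w" using \<open>s \<in> S'\<close> by (auto simp: S'_def)
    then obtain a a' where a: "n = a' \<otimes> inv a" "a \<in> win \<Psi> 2" "a' \<in> win \<Psi> 2" "n \<in> N" by (auto simp: A_def)
    have c: "w \<in> carrier \<Gamma>" "a \<in> carrier \<Gamma>" "a' \<in> carrier \<Gamma>" using wn a W W2 by auto
    have "inv s = w \<otimes> (a \<otimes> inv a') \<otimes> inv w" using c wn(3) a(1) by (simp add: inv_mult_group m_assoc)
    moreover have "a \<otimes> inv a' \<in> A"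
    proof -
      have "a \<otimes> inv a' = inv n" using c a(1) by (simp add: inv_mult_group)
      then have "a \<otimes> inv a' \<in> N" using N.m_inv_closed[OF a(4)] by simp
      then show ?thesis by (rule AI[OF a(3,2)])
    qed
    ultimately show ?thesis using wn(1) unfolding S'_def by (auto intro!: image_eqI[where x="(w, a \<otimes> inv a')"])
  qed
  define Fw where "Fw = W <#> win \<Psi> 2"
  have Fw: "finite Fw" "Fw \<subseteq> carrier \<Gamma>" using W W2 by (auto simp: Fw_def finite_set_mult set_mult_closed)
  obtain T' V where T': "finite T'" "T' \<subseteq> N" and V: "\<And>j. j < k \<Longrightarrow> V j \<in> sets X"
    "\<And>j. j < k \<Longrightarrow> bdd \<phi> S' (V j) T'"
    and win: "\<And>x. x \<in> space X \<Longrightarrow> \<exists>j<k. \<forall>f\<in>Fw. \<phi> f x \<in> V j"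
    by (rule adim_cover_translates[OF N ad S' S'N Fw]) (rule that)
  define S2 where "S2 = (\<lambda>(p, t, t'). inv p \<otimes> t' \<otimes> p \<otimes> inv t) ` (\<Psi> \<times> T' \<times> T')"
  have S2: "finite S2" using Psi(1) T' by (simp add: S2_def)
  have S2N: "S2 \<subseteq> N"
  proof
    fix s assume "s \<in> S2"
    then obtain p t t' where "p \<in> \<Psi>" "t \<in> T'" "t' \<in> T'" "s = inv p \<otimes> t' \<otimes> p \<otimes> inv t" by (auto simp: S2_def)
    then show "s \<in> N" using Psi(2) T'(2) by (auto intro!: N.m_closed N.inv_op_closed1)
  qed
  obtain U where U': "\<forall>c<C. U c \<in> sets X" "\<forall>x\<in>space X. \<exists>c<C. x \<in> U c"
    and Us: "\<forall>c<C. \<forall>x\<in>U c. \<forall>b\<in>\<Psi>. \<forall>s\<in>S2. \<phi> (b \<otimes> s) x \<in> U c \<longrightarrow> b \<in> N"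
    using C[OF S2 S2N] by (elim exE conjE) (rule that)
  have U: "\<And>c. c < C \<Longrightarrow> U c \<in> sets X" "\<And>x. x \<in> space X \<Longrightarrow> \<exists>c<C. x \<in> U c" using U' by simp_all
  have ex: "\<exists>R. (\<forall>c. \<forall>f\<in>F. R c f \<in> sets X) \<and>
      (\<forall>x\<in>space X. (\<forall>f\<in>Fw. \<phi> f x \<in> V i) \<longrightarrow> (\<exists>c<K. \<exists>f\<in>F. x \<in> R c f)) \<and>
      (\<forall>c x f f' g. x \<in> R c f \<and> \<phi> g x \<in> R c f' \<and> g \<in> carrier \<Gamma> \<and> f \<in> F \<and> f' \<in> F \<and>
         f' \<otimes> g \<otimes> inv f \<in> \<Psi> \<longrightarrow> f' \<otimes> g \<otimes> inv f \<in> N)" if i: "i < k" for i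
  proof -
    interpret cs: colour_step \<Gamma> X \<phi> N F \<Psi> S' T' "V i" U C K
    proof
      show "F \<subseteq> \<Psi>" "\<one> \<in> F" "\<And>p. p \<in> F \<Longrightarrow> inv p \<in> F" using FP F by auto
      show "V i \<in> sets X" "bdd \<phi> S' (V i) T'" using V i by auto
      show "S' \<subseteq> carrier \<Gamma>" "T' \<subseteq> carrier \<Gamma>" using S'N T' N.subset by auto
      show "K > 0" by (simp add: K_def)
      show "p \<in> N" if "c < C" "x \<in> U c" "p \<in> \<Psi>" "t \<in> T'" "t' \<in> T'"
        "\<phi> (p \<otimes> (inv p \<otimes> t' \<otimes> p \<otimes> inv t)) x \<in> U c" for c x p t t'
      proof -
        have "inv p \<otimes> t' \<otimes> p \<otimes> inv t \<in> S2" unfolding S2_def using that(3-5) by force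
        then show ?thesis using Us[rule_format, OF that(1,2,3) _ that(6)] by simp
      qed
      show "w \<otimes> (a' \<otimes> inv a) \<otimes> inv w \<in> S'"
        if "l \<le> C * K" "w \<in> win \<Psi> l" "a \<in> win \<Psi> 2" "a' \<in> win \<Psi> 2" "a' \<otimes> inv a \<in> N" for l w a a'
      proof -
        have "w \<in> W" using that by (auto simp: W_def)
        moreover have "a' \<otimes> inv a \<in> A" using that by (intro AI)
        ultimately show ?thesis unfolding S'_def by force
      qed
    qed (use N Psi U S'inv in simp_all)
    have P: "x \<in> cs.P" if "x \<in> space X" "\<forall>f\<in>Fw. \<phi> f x \<in> V i" for x
    proof -
      have "w \<otimes> a \<in> Fw" if "l \<le> C * K" "w \<in> win \<Psi> l" "a \<in> win \<Psi> 2" for l w a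
        using that unfolding Fw_def W_def set_mult_def by blast
      then show ?thesis using that unfolding cs.P_def by simp
    qed
    have cov: "\<exists>c<K. \<exists>f\<in>F. x \<in> cs.R c f" if "x \<in> space X" "\<forall>f\<in>Fw. \<phi> f x \<in> V i" for x
    proof (rule cs.R_cover[OF P[OF that]])
      fix Z assume "Z \<subseteq> \<Psi>" "\<And>z z'. z \<in> Z \<Longrightarrow> z' \<in> Z \<Longrightarrow> z \<noteq> z' \<Longrightarrow> z' \<otimes> inv z \<notin> N <#> F"
      then have "card Z \<le> \<kappa>" using pack[rule_format, of Z] by (simp add: \<Psi>_def)
      then show "card Z < K" by (simp add: K_def)
    qed
    show ?thesis
    proof (rule exI[of _ cs.R], intro conjI allI ballI impI)
      show "cs.R c f \<in> sets X" if "f \<in> F" for c f using cs.R_sets[OF that] .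
      show "\<exists>c<K. \<exists>f\<in>F. x \<in> cs.R c f" if "x \<in> space X" "\<forall>f\<in>Fw. \<phi> f x \<in> V i" for x
        using cov[OF that] .
    qed (elim conjE, rule cs.R_adjacent)
  qed
  have "\<forall>i\<in>{..<k}. \<exists>R. (\<forall>c. \<forall>f\<in>F. R c f \<in> sets X) \<and>
      (\<forall>x\<in>space X. (\<forall>f\<in>Fw. \<phi> f x \<in> V i) \<longrightarrow> (\<exists>c<K. \<exists>f\<in>F. x \<in> R c f)) \<and>
      (\<forall>c x f f' g. x \<in> R c f \<and> \<phi> g x \<in> R c f' \<and> g \<in> carrier \<Gamma> \<and> f \<in> F \<and> f' \<in> F \<and>
         f' \<otimes> g \<otimes> inv f \<in> \<Psi> \<longrightarrow> f' \<otimes> g \<otimes> inv f \<in> N)" using ex by blast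
  from bchoice[OF this] obtain R where R: "\<forall>i\<in>{..<k}. (\<forall>c. \<forall>f\<in>F. R i c f \<in> sets X) \<and>
      (\<forall>x\<in>space X. (\<forall>f\<in>Fw. \<phi> f x \<in> V i) \<longrightarrow> (\<exists>c<K. \<exists>f\<in>F. x \<in> R i c f)) \<and>
      (\<forall>c x f f' g. x \<in> R i c f \<and> \<phi> g x \<in> R i c f' \<and> g \<in> carrier \<Gamma> \<and> f \<in> F \<and> f' \<in> F \<and>
         f' \<otimes> g \<otimes> inv f \<in> \<Psi> \<longrightarrow> f' \<otimes> g \<otimes> inv f \<in> N)" by (elim exE)
  \<comment> \<open>The index \<open>i * K + c\<close> encodes the piece \<open>i\<close> and the
    class \<open>c\<close>.\<close>
  define R' where "R' m = R (m div K) (m mod K)" for m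
  have dv: "m div K < k" if "m < k * K" for m using that by (simp add: less_mult_imp_div_less)
  show ?thesis
  proof (rule exI[of _ R'], intro conjI allI impI ballI)
    fix m f assume "f \<in> F" "m < k * Suc \<kappa>"
    then show "R' m f \<in> sets X" using R dv[of m] unfolding R'_def K_def by blast
  next
    fix x assume x: "x \<in> space X"
    then obtain i where i: "i < k" "\<forall>f\<in>Fw. \<phi> f x \<in> V i" using win by blast
    then obtain c f where c: "c < K" "f \<in> F" "x \<in> R i c f" using R x by (meson lessThan_iff)
    let ?m = "i * K + c"
    have "?m div K = i" "?m mod K = c" using c by simp_all
    moreover have "?m < k * K"
    proof -
      have "?m < Suc i * K" using c by simp
      also have "\<dots> \<le> k * K" using i by (intro mult_le_mono1) simp
      finally show ?thesis .
    qed
    ultimately show "\<exists>m<k * Suc \<kappa>. \<exists>f\<in>F. x \<in> R' m f"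
      using c unfolding R'_def K_def[symmetric] by (intro exI[of _ ?m] conjI bexI[of _ f]) simp_all
  next
    fix m f f' x b s
    assume *: "m < k * Suc \<kappa> \<and> f \<in> F \<and> f' \<in> F \<and> b \<in> B \<and> s \<in> S \<and> x \<in> R' m f \<and> \<phi> (b \<otimes> s) x \<in> R' m f'"
    then have "f' \<otimes> (b \<otimes> s) \<otimes> inv f \<in> \<Psi>" using F(4) by (intro inblock) auto
    moreover have "b \<otimes> s \<in> carrier \<Gamma>" using * B Sc by auto
    moreover have "m div K \<in> {..<k}" using dv[of m] * by (simp add: K_def)
    ultimately show "f' \<otimes> (b \<otimes> s) \<otimes> inv f \<in> N" using R * unfolding R'_def by blast
  qed
qed

text \<open>The classes of centres serve as colours. If \<open>x\<close> and
  \<open>\<phi> (b \<otimes> s) x\<close> have centres of one class, these differ by an element of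
  \<open>N\<close>; since \<open>f\<close>, \<open>f'\<close> and \<open>s\<close> belong to
  \<open>M\<close>, so does \<open>b\<close>. The number of classes comes from \<kappa>, which is
  fixed before \<open>S\<close>.\<close>

lemma chrom_step:
  assumes N: "N \<lhd> \<Gamma>" and M: "subgroup M \<Gamma>" and NM: "N \<subseteq> M" and ad: "adim X \<phi> N k" and ch: "chrom N"
    and pk: "\<And>B. finite B \<Longrightarrow> B \<subseteq> carrier \<Gamma> \<Longrightarrow> \<one> \<in> B \<Longrightarrow> \<exists>\<kappa>. packing_bound N M B \<kappa>"
  shows "chrom M"
  unfolding chrom_def
proof (intro allI impI)
  fix B assume B0: "finite B \<and> B \<subseteq> carrier \<Gamma>"
  define B' where "B' = insert \<one> B"
  have B: "finite B'" "B' \<subseteq> carrier \<Gamma>" "\<one> \<in> B'" "B \<subseteq> B'" using B0 by (auto simp: B'_def)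
  obtain \<kappa> where \<kappa>: "packing_bound N M B' \<kappa>" using pk[OF B(1-3)] by blast
  interpret M: subgroup M \<Gamma> by (rule M)
  show "\<exists>C::nat. \<forall>S. finite S \<and> S \<subseteq> M \<longrightarrow>
     (\<exists>U. (\<forall>c<C. U c \<in> sets X) \<and> (\<forall>x\<in>space X. \<exists>c<C. x \<in> U c) \<and>
       (\<forall>c<C. \<forall>x\<in>U c. \<forall>b\<in>B. \<forall>s\<in>S. \<phi> (b \<otimes> s) x \<in> U c \<longrightarrow> b \<in> M))"
  proof (intro exI[of _ "k * Suc \<kappa>"] allI impI)
    fix S0 assume S0: "finite S0 \<and> S0 \<subseteq> M"
    define S where "S = insert \<one> S0"
    have S: "finite S" "S \<subseteq> M" "\<one> \<in> S" "S0 \<subseteq> S" using S0 by (auto simp: S_def)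
    obtain F where F: "finite F" "F \<subseteq> M" "\<one> \<in> F" "\<forall>f\<in>F. inv f \<in> F"
      and pack: "\<forall>Z. Z \<subseteq> block F B' S \<and> (\<forall>z\<in>Z. \<forall>z'\<in>Z. z \<noteq> z' \<longrightarrow> z' \<otimes> inv z \<notin> N <#> F) \<longrightarrow> card Z \<le> \<kappa>"
      using packing_boundD[OF \<kappa> S(1-3)] by (elim exE conjE) (rule that)
    from colour_cover[OF N M NM ad ch B(1-3) S(1-3) F pack] obtain R where
      R1: "\<forall>m. \<forall>f\<in>F. m < k * Suc \<kappa> \<longrightarrow> R m f \<in> sets X" and
      R2: "\<forall>x\<in>space X. \<exists>m<k * Suc \<kappa>. \<exists>f\<in>F. x \<in> R m f" and
      R3: "\<forall>m f f' x b s. m < k * Suc \<kappa> \<and> f \<in> F \<and> f' \<in> F \<and> b \<in> B' \<and> s \<in> S \<and>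
         x \<in> R m f \<and> \<phi> (b \<otimes> s) x \<in> R m f' \<longrightarrow> f' \<otimes> (b \<otimes> s) \<otimes> inv f \<in> N"
      by (elim exE conjE)
    show "\<exists>U. (\<forall>c<k * Suc \<kappa>. U c \<in> sets X) \<and> (\<forall>x\<in>space X. \<exists>c<k * Suc \<kappa>. x \<in> U c) \<and>
       (\<forall>c<k * Suc \<kappa>. \<forall>x\<in>U c. \<forall>b\<in>B. \<forall>s\<in>S0. \<phi> (b \<otimes> s) x \<in> U c \<longrightarrow> b \<in> M)"
    proof (intro exI[of _ "\<lambda>m. \<Union>f\<in>F. R m f"] conjI allI impI ballI)
      fix c assume "c < k * Suc \<kappa>"
      then show "(\<Union>f\<in>F. R c f) \<in> sets X" using R1 F(1) by (intro sets.finite_UN) auto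
    next
      fix x assume "x \<in> space X"
      from R2[rule_format, OF this] obtain m f where "m < k * Suc \<kappa>" "f \<in> F" "x \<in> R m f"
        by (elim exE conjE bexE) (rule that)
      then show "\<exists>c<k * Suc \<kappa>. x \<in> (\<Union>f\<in>F. R c f)" by (intro exI[of _ m] conjI UN_I[of f])
    next
      fix c x b s assume *: "c < k * Suc \<kappa>" "x \<in> (\<Union>f\<in>F. R c f)" "b \<in> B" "s \<in> S0" "\<phi> (b \<otimes> s) x \<in> (\<Union>f\<in>F. R c f)"
      obtain f where f1: "f \<in> F" "x \<in> R c f" using *(2) by (rule UN_E)
      obtain f' where f2: "f' \<in> F" "\<phi> (b \<otimes> s) x \<in> R c f'" using *(5) by (rule UN_E)
      note f = f1 f2
      have "b \<in> B'" "s \<in> S" using * B S by auto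
      then have "f' \<otimes> (b \<otimes> s) \<otimes> inv f \<in> N" using f *(1) by (intro R3[rule_format, of c f f' b s x] conjI)
      then have n: "f' \<otimes> (b \<otimes> s) \<otimes> inv f \<in> M" using NM by (rule subsetD[rotated])
      have c: "f \<in> M" "f' \<in> M" "s \<in> M" using f F(2) * S0 by auto
      have cc: "f \<in> carrier \<Gamma>" "f' \<in> carrier \<Gamma>" "s \<in> carrier \<Gamma>" "b \<in> carrier \<Gamma>"
        using c M.subset * B0 by auto
      have e: "inv f' \<otimes> (f' \<otimes> (b \<otimes> s) \<otimes> inv f) \<otimes> f \<otimes> inv s = b" using cc by (simp add: m_assoc)
      have "inv f' \<otimes> q \<otimes> f \<otimes> inv s \<in> M" if "q \<in> M" for q
        using c that by (intro M.m_closed M.m_inv_closed)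
      from this[OF n] show "b \<in> M" unfolding e .
    qed
  qed
qed

text \<open>A path at scale \<open>S0\<close> among points of one class is shadowed by its centres,
  which move by elements of \<open>N\<close> from the finite set \<open>S3\<close>. Sorting the
  centres by the pieces for \<open>N\<close> at scale \<open>S3\<close> bounds the shadow, and every
  point is within \<open>F\<close> of its centre. The count is \<open>k * Suc \<kappa>\<close>
  classes times \<open>k\<close> pieces.\<close>

lemma adim_step:
  assumes N: "N \<lhd> \<Gamma>" and M: "subgroup M \<Gamma>" and NM: "N \<subseteq> M" and ad: "adim X \<phi> N k" and ch: "chrom N"
    and pk: "packing_bound N M {\<one>} \<kappa>"
  shows "adim X \<phi> M (k * Suc \<kappa> * k)"
proof (rule adim_indexed[where 'i="nat \<times> nat"])
  interpret N: normal N \<Gamma> by (rule N)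
  interpret M: subgroup M \<Gamma> by (rule M)
  fix S0 assume S0: "finite S0" "S0 \<subseteq> M"
  define S where "S = insert \<one> S0"
  have S: "finite S" "S \<subseteq> M" "\<one> \<in> S" "S0 \<subseteq> S" using S0 by (auto simp: S_def)
  have Sc: "S \<subseteq> carrier \<Gamma>" using S M.subset by auto
  obtain F where F: "finite F" "F \<subseteq> M" "\<one> \<in> F" "\<forall>f\<in>F. inv f \<in> F"
      and pack: "\<forall>Z. Z \<subseteq> block F {\<one>} S \<and> (\<forall>z\<in>Z. \<forall>z'\<in>Z. z \<noteq> z' \<longrightarrow> z' \<otimes> inv z \<notin> N <#> F) \<longrightarrow> card Z \<le> \<kappa>"
      using packing_boundD[OF pk S(1-3)] by (elim exE conjE) (rule that)
  have Fc: "F \<subseteq> carrier \<Gamma>" using F M.subset by auto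
  have "finite {\<one>}" "{\<one>} \<subseteq> carrier \<Gamma>" "\<one> \<in> {\<one>}" by auto
  from colour_cover[OF N M NM ad ch this S(1-3) F pack] obtain R where
      R1: "\<forall>m. \<forall>f\<in>F. m < k * Suc \<kappa> \<longrightarrow> R m f \<in> sets X" and
      R2: "\<forall>x\<in>space X. \<exists>m<k * Suc \<kappa>. \<exists>f\<in>F. x \<in> R m f" and
      R3: "\<forall>m f f' x b s. m < k * Suc \<kappa> \<and> f \<in> F \<and> f' \<in> F \<and> b \<in> {\<one>} \<and> s \<in> S \<and>
         x \<in> R m f \<and> \<phi> (b \<otimes> s) x \<in> R m f' \<longrightarrow> f' \<otimes> (b \<otimes> s) \<otimes> inv f \<in> N"
      by (elim exE conjE)
  define S3 where "S3 = (\<lambda>(f', s, f). f' \<otimes> s \<otimes> inv f) ` (F \<times> S \<times> F) \<inter> N"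
  have S3: "finite S3" "S3 \<subseteq> N" using F S by (auto simp: S3_def)
  obtain T3 V where T3: "finite T3" "T3 \<subseteq> N" and V: "\<And>j. j < k \<Longrightarrow> V j \<in> sets X"
      "\<And>j. j < k \<Longrightarrow> bdd \<phi> S3 (V j) T3" "\<And>x. x \<in> space X \<Longrightarrow> \<exists>j<k. x \<in> V j"
    by (rule adimE[OF ad S3]) (rule that)
  define T where "T = (\<lambda>(f', t, f). inv f' \<otimes> t \<otimes> f) ` (F \<times> T3 \<times> F)"
  have T: "finite T" "T \<subseteq> M"
    using F T3 NM by (auto simp: T_def subset_iff intro!: M.m_closed M.m_inv_closed)
  define W where "W = (\<lambda>(m, l). \<Union>f\<in>F. R m f \<inter> {x \<in> space X. \<phi> f x \<in> V l})"
  have Wsets: "W (m, l) \<in> sets X" if "m < k * Suc \<kappa>" "l < k" for m l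
    unfolding W_def prod.case using that R1 V F Fc
    by (intro sets.finite_UN sets.Int act_vimage) auto
  have Wbdd: "bdd \<phi> S0 (W (m, l)) T" if m: "m < k * Suc \<kappa>" and l: "l < k" for m l
    unfolding bdd_def
  proof (intro allI impI)
    fix x y assume xy: "x \<in> W (m, l) \<and> (x, y) \<in> (step \<phi> S0 (W (m, l)))\<^sup>*"
    then obtain f where f: "f \<in> F" "x \<in> R m f" "\<phi> f x \<in> V l" "x \<in> space X" by (auto simp: W_def)
    have "(x, y) \<in> (step \<phi> S0 (W (m, l)))\<^sup>*" using xy by blast
    then have "y \<in> space X \<and> (\<exists>f'\<in>F. y \<in> R m f' \<and> (\<phi> f x, \<phi> f' y) \<in> (step \<phi> S3 (V l))\<^sup>*)"
    proof (induction rule: rtrancl_induct)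
      case base then show ?case using f by auto
    next
      case (step y z)
      then obtain f' where f': "f' \<in> F" "y \<in> R m f'" "(\<phi> f x, \<phi> f' y) \<in> (step \<phi> S3 (V l))\<^sup>*" and y: "y \<in> space X" by blast
      have yV: "\<phi> f' y \<in> V l" by (rule step_rtrancl_in[OF f'(3) f(3)])
      obtain s where s: "s \<in> S0" "z = \<phi> s y" "z \<in> W (m, l)" using step(2) by (auto simp: step_def)
      then obtain f'' where f'': "f'' \<in> F" "z \<in> R m f''" "\<phi> f'' z \<in> V l" "z \<in> space X" by (auto simp: W_def)
      have c: "f' \<in> carrier \<Gamma>" "f'' \<in> carrier \<Gamma>" "s \<in> carrier \<Gamma>" "s \<in> S" using f' f'' Fc s S Sc by auto
      have "\<phi> (\<one> \<otimes> s) y \<in> R m f''" using f''(2) s(2) c by simp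
      then have "f'' \<otimes> (\<one> \<otimes> s) \<otimes> inv f' \<in> N"
        using m f'(1,2) f''(1) c(4) by (intro R3[rule_format, of m f' f'' \<one> s y] conjI) simp_all
      then have "f'' \<otimes> s \<otimes> inv f' \<in> N" using c by simp
      then have "f'' \<otimes> s \<otimes> inv f' \<in> S3" unfolding S3_def using f'(1) f''(1) c(4) by force
      moreover have "\<phi> f'' z = \<phi> (f'' \<otimes> s \<otimes> inv f') (\<phi> f' y)" using c y s(2) by (simp add: m_assoc)
      ultimately have "(\<phi> f' y, \<phi> f'' z) \<in> step \<phi> S3 (V l)" by (intro stepI[OF yV f''(3)])
      then show ?case using f' f'' rtrancl_into_rtrancl by metis
    qed
    then obtain f' where f': "f' \<in> F" "(\<phi> f x, \<phi> f' y) \<in> (step \<phi> S3 (V l))\<^sup>*" and y: "y \<in> space X" by blast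
    obtain t where t: "t \<in> T3" "\<phi> f' y = \<phi> t (\<phi> f x)" using bddD[OF V(2)[OF l] f(3) f'(2)] by blast
    have c: "f \<in> carrier \<Gamma>" "f' \<in> carrier \<Gamma>" "t \<in> carrier \<Gamma>" using f f' Fc t T3 N.subset by auto
    have "y = \<phi> (inv f') (\<phi> f' y)" using c y by simp
    also have "\<dots> = \<phi> (inv f' \<otimes> t \<otimes> f) x" unfolding t(2) using c f(4) by (simp add: m_assoc)
    finally show "\<exists>t\<in>T. y = \<phi> t x" using t(1) f(1) f'(1) unfolding T_def by force
  qed
  have cov: "\<exists>j\<in>{..<k * Suc \<kappa>} \<times> {..<k}. x \<in> W j" if x: "x \<in> space X" for x
  proof -
    obtain m f where m: "m < k * Suc \<kappa>" "f \<in> F" "x \<in> R m f"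
      using R2[rule_format, OF x] by (elim exE conjE bexE) (rule that)
    then have "\<phi> f x \<in> space X" using Fc x by auto
    then obtain l where l: "l < k" "\<phi> f x \<in> V l" using V(3) by blast
    then have "x \<in> W (m, l)" unfolding W_def using m x by auto
    then show ?thesis using m l by blast
  qed
  show "\<exists>T (I::(nat \<times> nat) set) V. finite T \<and> T \<subseteq> M \<and> finite I \<and> card I \<le> k * Suc \<kappa> * k \<and>
        (\<forall>j\<in>I. V j \<in> sets X \<and> bdd \<phi> S0 (V j) T) \<and> (\<forall>x\<in>space X. \<exists>j\<in>I. x \<in> V j)"
    by (rule exI[of _ T], rule exI[of _ "{..<k * Suc \<kappa>} \<times> {..<k}"], rule exI[of _ W])
       (use T Wsets Wbdd cov in \<open>auto simp: card_cartesian_product\<close>)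
qed

section \<open>The trivial subgroup\<close>

lemma adim_trivial: "adim X \<phi> {\<one>} 1"
  unfolding adim_def
proof (intro allI impI)
  fix S assume S: "finite S \<and> S \<subseteq> {\<one>}"
  have "bdd \<phi> S (space X) {\<one>}" unfolding bdd_def
  proof (intro allI impI)
    fix x y assume xy: "x \<in> space X \<and> (x, y) \<in> (step \<phi> S (space X))\<^sup>*"
    then have "(x, y) \<in> (step \<phi> S (space X))\<^sup>*" by blast
    then have "y = x" by (induction rule: rtrancl_induct) (use S in \<open>auto simp: step_def\<close>)
    then show "\<exists>t\<in>{\<one>}. y = \<phi> t x" using xy by simp
  qed
  then show "\<exists>T V. finite T \<and> T \<subseteq> {\<one>} \<and> (\<forall>j<(1::nat). V j \<in> sets X \<and> bdd \<phi> S (V j) T) \<and>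
     (\<forall>x\<in>space X. \<exists>j<(1::nat). x \<in> V j)"
    by (intro exI[of _ "{\<one>}"] exI[of _ "\<lambda>_. space X"]) simp
qed

text \<open>Colour the points in the order in which a countable separating family discovers them,
  always choosing the least colour not used by a neighbour; the degree bounds the number of colours.\<close>

primrec first_fit :: "'a set \<Rightarrow> (nat \<Rightarrow> 'x set) \<Rightarrow> nat \<Rightarrow> nat \<Rightarrow> 'x set" where
  "first_fit B Q 0 = (\<lambda>c. {})"
| "first_fit B Q (Suc n) = (\<lambda>c. first_fit B Q n c \<union>
     {x \<in> Q n. (\<forall>c'. x \<notin> first_fit B Q n c') \<and> (\<forall>b\<in>B. \<phi> b x \<notin> first_fit B Q n c) \<and>
        (\<forall>c'<c. \<exists>b\<in>B. \<phi> b x \<in> first_fit B Q n c')})"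

text \<open>For the trivial subgroup the task is a proper Borel colouring, with boundedly many
  colours, of the graph that joins each point to its translates by \<open>B\<close>.\<close>

lemma chrom_trivial: "chrom {\<one>}"
  unfolding chrom_def
proof (intro allI impI)
  fix B0 assume B0: "finite B0 \<and> B0 \<subseteq> carrier \<Gamma>"
  define B where "B = (B0 \<union> (m_inv \<Gamma>) ` B0) - {\<one>}"
  have B: "finite B" "B \<subseteq> carrier \<Gamma>" "\<And>b. b \<in> B \<Longrightarrow> b \<noteq> \<one>" using B0 by (auto simp: B_def)
  have Binv: "inv b \<in> B" if "b \<in> B" for b using that B0 by (auto simp: B_def inv_eq_1_iff)
  obtain A :: "nat \<Rightarrow> 'x set" where A: "\<forall>n. A n \<in> sets X"
    "\<forall>x\<in>space X. \<forall>F. finite F \<and> F \<subseteq> space X \<and> x \<notin> F \<longrightarrow> (\<exists>n. x \<in> A n \<and> A n \<inter> F = {})"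
    using separation by (elim exE conjE) (rule that)
  \<comment> \<open>The points of \<open>A n\<close> without neighbours in \<open>A n\<close>. No
    two points of \<open>Q n\<close> are adjacent, so they can be coloured at the same time;
    separating a point from its finitely many neighbours shows that the \<open>Q n\<close> cover the
    space.\<close>
  define Q where "Q n = A n - (\<Union>b\<in>B. {x \<in> space X. \<phi> b x \<in> A n})" for n
  have Qs: "Q n \<in> sets X" for n
    unfolding Q_def using A(1) B by (intro sets.Diff sets.finite_UN act_vimage) auto
  have Qi: "\<phi> b x \<notin> Q n" if "b \<in> B" "x \<in> Q n" "x \<in> space X" for b x n
    using that by (auto simp: Q_def)
  have Qc: "\<exists>n. x \<in> Q n" if x: "x \<in> space X" for x
  proof -
    have "x \<notin> (\<lambda>b. \<phi> b x) ` B"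
    proof
      assume "x \<in> (\<lambda>b. \<phi> b x) ` B"
      then obtain b where b: "x = \<phi> b x" "b \<in> B" by (rule imageE)
      have "b \<in> carrier \<Gamma>" using b(2) B(2) by blast
      from act_free[OF this x b(1)[symmetric]] B(3)[OF b(2)] show False by simp
    qed
    moreover have "finite ((\<lambda>b. \<phi> b x) ` B)" "(\<lambda>b. \<phi> b x) ` B \<subseteq> space X" using B x by auto
    ultimately obtain n where "x \<in> A n" "A n \<inter> (\<lambda>b. \<phi> b x) ` B = {}" using A(2) x by blast
    then show ?thesis unfolding Q_def by blast
  qed
  let ?D = "first_fit B Q"
  \<comment> \<open>The degree of the graph plus one.\<close>
  define C where "C = Suc (card B)"
  have Qsp: "Q n \<subseteq> space X" for n using Qs sets.sets_into_space by auto
  have Dsp: "?D n c \<subseteq> space X" for n c by (induction n) (use Qsp in auto)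
  have disj: "x \<in> ?D n c \<Longrightarrow> x \<in> ?D n c' \<Longrightarrow> c = c'" for n x c c'
  proof (induction n)
    case (Suc n)
    have "\<not> c < c'" "\<not> c' < c" if "x \<notin> ?D n c" "x \<notin> ?D n c'" using Suc.prems that by auto
    then show ?case using Suc by auto
  qed simp
  have ind: "x \<in> ?D n c \<Longrightarrow> b \<in> B \<Longrightarrow> \<phi> b x \<notin> ?D n c" for n x c b
  proof (induction n)
    case (Suc n)
    have x: "x \<in> space X" "b \<in> carrier \<Gamma>" using Suc.prems Dsp[of "Suc n" c] B by (blast+)
    have xx: "\<phi> (inv b) (\<phi> b x) = x" using x by simp
    show ?case
    proof
      assume y: "\<phi> b x \<in> ?D (Suc n) c"
      have "x \<in> ?D n c \<or> x \<in> Q n \<and> (\<forall>b\<in>B. \<phi> b x \<notin> ?D n c)" using Suc.prems(1) by auto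
      moreover have "\<phi> b x \<in> ?D n c \<or> \<phi> b x \<in> Q n \<and> x \<notin> ?D n c"
        using y Binv[OF Suc.prems(2)] xx by (auto simp del: act_act)
      ultimately show False using Suc.IH Suc.prems(2) Qi[OF Suc.prems(2) _ x(1)] by blast
    qed
  qed simp
  have bound: "x \<in> ?D n c \<Longrightarrow> c < C" for n x c
  proof (induction n)
    case (Suc n)
    show ?case
    proof (cases "x \<in> ?D n c")
      case False
      then have x: "\<forall>c'<c. \<exists>b\<in>B. \<phi> b x \<in> ?D n c'" using Suc.prems by auto
      then obtain b where b: "\<And>c'. c' < c \<Longrightarrow> b c' \<in> B \<and> \<phi> (b c') x \<in> ?D n c'" by metis
      have "inj_on b {..<c}" by (rule inj_onI) (metis b disj lessThan_iff)
      then have "card {..<c} \<le> card B" using b B(1) by (intro card_inj_on_le[of b]) auto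
      then show ?thesis by (simp add: C_def)
    qed (use Suc.IH in blast)
  qed simp
  have cov: "x \<in> Q n \<Longrightarrow> \<exists>c. x \<in> ?D (Suc n) c" for x n
  proof (cases "\<exists>c. x \<in> ?D n c")
    case False
    assume x: "x \<in> Q n"
    have ex: "\<exists>c. \<forall>b\<in>B. \<phi> b x \<notin> ?D n c"
    proof (rule ccontr)
      assume "\<not> ?thesis"
      then obtain b where b: "\<And>c. b c \<in> B \<and> \<phi> (b c) x \<in> ?D n c" by metis
      have "inj b" by (rule injI) (metis b disj)
      then show False using B(1) b by (meson finite_subset image_subsetI infinite_UNIV_nat finite_imageD)
    qed
    define c where "c = (LEAST c. \<forall>b\<in>B. \<phi> b x \<notin> ?D n c)"
    have c1: "\<forall>b\<in>B. \<phi> b x \<notin> ?D n c" unfolding c_def by (rule LeastI_ex[OF ex])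
    have c2: "\<forall>c'<c. \<exists>b\<in>B. \<phi> b x \<in> ?D n c'"
    proof (intro allI impI)
      fix c' assume "c' < c"
      then have "\<not> (\<forall>b\<in>B. \<phi> b x \<notin> ?D n c')" unfolding c_def by (rule not_less_Least)
      then show "\<exists>b\<in>B. \<phi> b x \<in> ?D n c'" by simp
    qed
    have "x \<in> ?D (Suc n) c" using x False c1 c2 by simp
    then show ?thesis by (rule exI)
  qed auto
  have Ds: "\<forall>c. ?D n c \<in> sets X" for n
  proof (induction n)
    case (Suc n)
    have eq: "first_fit B Q (Suc n) c = ?D n c \<union> ((Q n - (\<Union>c'. ?D n c')) - (\<Union>b\<in>B. {x \<in> space X. \<phi> b x \<in> ?D n c})) \<inter>
        (space X \<inter> (\<Inter>c'\<in>{..<c}. space X \<inter> (\<Union>b\<in>B. {x \<in> space X. \<phi> b x \<in> ?D n c'})))" for c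
      using Qsp[of n] by (auto simp: subset_iff)
    have m1: "(space X \<inter> (\<Inter>c'\<in>{..<c}. space X \<inter> (\<Union>b\<in>B. {x \<in> space X. \<phi> b x \<in> ?D n c'}))) \<in> sets X" for c
    proof -
      have "(\<Union>b\<in>B. {x \<in> space X. \<phi> b x \<in> ?D n c'}) \<in> sets X" for c'
        using B Suc by (intro sets.finite_UN act_vimage) auto
      then show ?thesis by (induction c) (auto simp: lessThan_Suc Int_assoc intro: sets.Int)
    qed
    have m2: "((Q n - (\<Union>c'. ?D n c')) - (\<Union>b\<in>B. {x \<in> space X. \<phi> b x \<in> ?D n c})) \<in> sets X" for c
      using B Suc Qs by (intro sets.Diff sets.finite_UN sets.countable_UN act_vimage) auto
    show ?case
    proof
      fix c show "?D (Suc n) c \<in> sets X"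
        unfolding eq by (rule sets.Un[OF spec[OF Suc] sets.Int[OF m2 m1]])
    qed
  qed simp
  have mono: "?D n c \<subseteq> ?D m c" if "n \<le> m" for n m c
    using lift_Suc_mono_le[of "\<lambda>n. ?D n c"] that by auto
  show "\<exists>C::nat. \<forall>S. finite S \<and> S \<subseteq> {\<one>} \<longrightarrow>
     (\<exists>U. (\<forall>c<C. U c \<in> sets X) \<and> (\<forall>x\<in>space X. \<exists>c<C. x \<in> U c) \<and>
       (\<forall>c<C. \<forall>x\<in>U c. \<forall>b\<in>B0. \<forall>s\<in>S. \<phi> (b \<otimes> s) x \<in> U c \<longrightarrow> b \<in> {\<one>}))"
  proof (rule exI[of _ C], intro allI impI, rule exI[of _ "\<lambda>c. \<Union>n. ?D n c"], intro conjI allI impI ballI)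
    fix c show "(\<Union>n. ?D n c) \<in> sets X" using Ds by (intro sets.countable_UN) auto
  next
    fix x assume "x \<in> space X"
    then obtain n where "x \<in> Q n" using Qc by blast
    then obtain c where c: "x \<in> ?D (Suc n) c" using cov by blast
    show "\<exists>c<C. x \<in> (\<Union>n. ?D n c)" by (rule exI[of _ c]) (use bound[OF c] c in blast)
  next
    fix S c x b s assume *: "finite S \<and> S \<subseteq> {\<one>}" "x \<in> (\<Union>n. ?D n c)" "b \<in> B0" "s \<in> S" "\<phi> (b \<otimes> s) x \<in> (\<Union>n. ?D n c)"
    obtain n where n: "x \<in> ?D n c" using *(2) by (rule UN_E)
    obtain m where m: "\<phi> (b \<otimes> s) x \<in> ?D m c" using *(5) by (rule UN_E)
    have "s = \<one>" "b \<in> carrier \<Gamma>" using *(1,3,4) B0 by blast+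
    then have e: "b \<otimes> s = b" by simp
    have "x \<in> ?D (max n m) c" "\<phi> b x \<in> ?D (max n m) c"
      using mono[of n "max n m" c] mono[of m "max n m" c] n m e by auto
    then have "b \<notin> B" using ind by blast
    then show "b \<in> {\<one>}" using *(3) by (auto simp: B_def)
  qed
qed

section \<open>Increasing unions\<close>

text \<open>The sets \<open>\<tau> t S\<close> are fixed in advance, so that the scales \<open>\<Sigma> t\<close> may be chosen recursively from them.\<close>

lemma infinitely_often:
  assumes K: "subgroup K \<Gamma>" and ad: "adim X \<phi> K k" and I: "infinite (I :: nat set)"
  shows "\<exists>\<tau>. (\<forall>t S. finite S \<and> S \<subseteq> K \<longrightarrow> finite (\<tau> t S) \<and> \<tau> t S \<subseteq> K) \<and>
    (\<forall>\<Sigma>. (\<forall>t. finite (\<Sigma> t) \<and> \<Sigma> t \<subseteq> K) \<longrightarrow>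
       (\<exists>A. (\<forall>t. A t \<in> sets X \<and> bdd \<phi> (\<Sigma> t) (A t) (\<tau> t (\<Sigma> t))) \<and> (\<forall>x\<in>space X. \<exists>t\<in>I. x \<in> A t)))"
proof -
  interpret K: subgroup K \<Gamma> by (rule K)
  have Kc: "K \<subseteq> carrier \<Gamma>" by (rule K.subset)
  have cK: "countable K" using countable_subset[OF Kc countable_carrier] .
  have nK: "K \<noteq> {}" using K.one_closed by blast
  define D where "D t = from_nat_into K ` {..t}" for t :: nat
  have D: "finite (D t)" "D t \<subseteq> K" for t using from_nat_into[OF nK] by (auto simp: D_def)
  have D_carrier: "g \<in> D t \<Longrightarrow> g \<in> carrier \<Gamma>" for t g using D(2) Kc by blast
  \<comment> \<open>The sets \<open>A t\<close> below arise from pieces by thickening with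
    \<open>D t\<close>; the scale is enlarged in advance to allow for that.\<close>
  define Sc where "Sc t S = D t <#> S <#> (m_inv \<Gamma>) ` D t" for t S
  have Sc: "finite (Sc t S)" "Sc t S \<subseteq> K" if "finite S" "S \<subseteq> K" for t S
  proof -
    show "finite (Sc t S)" using that D by (auto simp: Sc_def finite_set_mult)
    have "(m_inv \<Gamma>) ` D t \<subseteq> K" using D(2) by auto
    then show "Sc t S \<subseteq> K" unfolding Sc_def using that D(2) by (intro set_mult_subset K)
  qed
  have "\<exists>TV. finite (fst TV) \<and> fst TV \<subseteq> K \<and> (\<forall>j<k. snd TV j \<in> sets X \<and> bdd \<phi> (Sc t S) (snd TV j) (fst TV)) \<and>
        (\<forall>x\<in>space X. \<exists>j<k. x \<in> snd TV j)" if "finite S" "S \<subseteq> K" for t S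
  proof -
    have S: "finite S" "S \<subseteq> K" by fact+
    obtain T V where "finite T" "T \<subseteq> K" "\<And>j. j < k \<Longrightarrow> V j \<in> sets X"
      "\<And>j. j < k \<Longrightarrow> bdd \<phi> (Sc t S) (V j) T" "\<And>x. x \<in> space X \<Longrightarrow> \<exists>j<k. x \<in> V j"
      by (rule adimE[OF ad Sc[OF S]]) (rule that)
    then show ?thesis by (intro exI[of _ "(T, V)"]) simp
  qed
  then have "\<forall>p. \<exists>TV. finite (snd p) \<and> snd p \<subseteq> K \<longrightarrow> finite (fst TV) \<and> fst TV \<subseteq> K \<and>
        (\<forall>j<k. snd TV j \<in> sets X \<and> bdd \<phi> (Sc (fst p) (snd p)) (snd TV j) (fst TV)) \<and>
        (\<forall>x\<in>space X. \<exists>j<k. x \<in> snd TV j)"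
    by simp
  from choice[OF this] obtain TV where TV: "\<And>p. finite (snd p) \<and> snd p \<subseteq> K \<longrightarrow> finite (fst (TV p)) \<and> fst (TV p) \<subseteq> K \<and>
        (\<forall>j<k. snd (TV p) j \<in> sets X \<and> bdd \<phi> (Sc (fst p) (snd p)) (snd (TV p) j) (fst (TV p))) \<and>
        (\<forall>x\<in>space X. \<exists>j<k. x \<in> snd (TV p) j)"
    by (elim exE) (rule that, drule spec)
  define T where "T t S = fst (TV (t, S))" for t S
  define V where "V t S = snd (TV (t, S))" for t S
  have T: "finite (T t S)" "T t S \<subseteq> K" if "finite S" "S \<subseteq> K" for t S
    using TV[of "(t, S)"] that by (simp_all add: T_def)
  define \<tau> where "\<tau> t S = (m_inv \<Gamma>) ` D t <#> T t S <#> D t" for t S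
  have \<tau>: "finite (\<tau> t S)" "\<tau> t S \<subseteq> K" if "finite S" "S \<subseteq> K" for t S
  proof -
    show "finite (\<tau> t S)" using T[OF that] D by (auto simp: \<tau>_def finite_set_mult)
    have "(m_inv \<Gamma>) ` D t \<subseteq> K" using D(2) by auto
    then show "\<tau> t S \<subseteq> K" unfolding \<tau>_def using T[OF that] D(2) by (intro set_mult_subset K)
  qed
  have main: "\<exists>A. (\<forall>t. A t \<in> sets X \<and> bdd \<phi> (\<Sigma> t) (A t) (\<tau> t (\<Sigma> t))) \<and> (\<forall>x\<in>space X. \<exists>t\<in>I. x \<in> A t)"
    if Sg: "\<forall>t. finite (\<Sigma> t) \<and> \<Sigma> t \<subseteq> K" for \<Sigma>
  proof -
    define U where "U t = V t (\<Sigma> t)" for t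
    have U: "\<And>j. j < k \<Longrightarrow> U t j \<in> sets X" "\<And>j. j < k \<Longrightarrow> bdd \<phi> (Sc t (\<Sigma> t)) (U t j) (T t (\<Sigma> t))"
      "\<And>x. x \<in> space X \<Longrightarrow> \<exists>j<k. x \<in> U t j" for t
      using TV[of "(t, \<Sigma> t)"] Sg by (simp_all add: U_def T_def V_def)
    \<comment> \<open>Every stage covers the space by \<open>k\<close> pieces, so by the pigeonhole
      principle each point lies in a piece of one fixed index at infinitely many stages of
      \<open>I\<close>.\<close>
    define L where "L j = {x \<in> space X. \<forall>m. \<exists>t\<in>I. m \<le> t \<and> x \<in> U t j}" for j
    have L: "L j \<in> sets X" if j: "j < k" for j
    proof -
      have "L j = space X \<inter> (\<Inter>m. \<Union>t\<in>I \<inter> {m..}. U t j)" by (auto simp: L_def)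
      also have "\<dots> \<in> sets X" using U(1)[OF j]
        by (intro sets.Int sets.top sets.countable_INT sets.countable_UN'' image_subsetI) auto
      finally show ?thesis .
    qed
    have Lcov: "\<exists>j<k. x \<in> L j" if x: "x \<in> space X" for x
    proof (rule ccontr)
      assume "\<not> ?thesis"
      then have "\<forall>j\<in>{..<k}. \<exists>m. \<forall>t\<in>I. m \<le> t \<longrightarrow> x \<notin> U t j" using x by (auto simp: L_def)
      from bchoice[OF this] obtain m where "\<forall>j\<in>{..<k}. \<forall>t\<in>I. m j \<le> t \<longrightarrow> x \<notin> U t j" by (elim exE) (rule that)
      then have m: "\<And>j t. j < k \<Longrightarrow> t \<in> I \<Longrightarrow> m j \<le> t \<Longrightarrow> x \<notin> U t j" by simp
      obtain t where t: "t \<in> I" "(\<Sum>j<k. m j) < t" using I by (meson infinite_nat_iff_unbounded)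
      obtain j where j: "j < k" "x \<in> U t j" using U(3)[OF x] by blast
      have "m j \<le> (\<Sum>j<k. m j)" using j(1) by (intro member_le_sum) auto
      then show False using m[OF j(1) t(1)] j(2) t(2) by simp
    qed
    \<comment> \<open>The index must not change along an orbit of \<open>K\<close>, so each orbit
      takes the least index that recurs infinitely often somewhere on it.\<close>
    define Y where "Y j = {x \<in> space X. (\<exists>g\<in>K. \<phi> g x \<in> L j) \<and> (\<forall>i<j. \<forall>g\<in>K. \<phi> g x \<notin> L i)}" for j
    have hull: "{x \<in> space X. \<exists>g\<in>K. \<phi> g x \<in> L j} \<in> sets X" if j: "j < k" for j
    proof -
      have "{x \<in> space X. \<exists>g\<in>K. \<phi> g x \<in> L j} = (\<Union>g\<in>K. {x \<in> space X. \<phi> g x \<in> L j})" by blast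
      also have "\<dots> \<in> sets X" using L[OF j] cK Kc by (intro sets.countable_UN'' act_vimage) auto
      finally show ?thesis .
    qed
    have Ysets: "Y j \<in> sets X" if j: "j < k" for j
    proof -
      have "Y j = {x \<in> space X. \<exists>g\<in>K. \<phi> g x \<in> L j} - (\<Union>i<j. {x \<in> space X. \<exists>g\<in>K. \<phi> g x \<in> L i})"
        by (auto simp: Y_def)
      also have "\<dots> \<in> sets X" using hull j by (intro sets.Diff sets.finite_UN) auto
      finally show ?thesis .
    qed
    have hull_inv: "(\<exists>g\<in>K. \<phi> g (\<phi> h x) \<in> L j) \<longleftrightarrow> (\<exists>g\<in>K. \<phi> g x \<in> L j)" if h: "h \<in> K" "x \<in> space X" for h x j
    proof
      assume "\<exists>g\<in>K. \<phi> g (\<phi> h x) \<in> L j"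
      then obtain g where g: "g \<in> K" "\<phi> g (\<phi> h x) \<in> L j" by blast
      then have "\<phi> (g \<otimes> h) x \<in> L j" using h Kc by (simp add: subset_iff)
      then show "\<exists>g\<in>K. \<phi> g x \<in> L j" using g h by (intro bexI[of _ "g \<otimes> h"]) auto
    next
      assume "\<exists>g\<in>K. \<phi> g x \<in> L j"
      then obtain g where g: "g \<in> K" "\<phi> g x \<in> L j" by blast
      have c: "g \<in> carrier \<Gamma>" "h \<in> carrier \<Gamma>" using g h Kc by auto
      then have "\<phi> (g \<otimes> inv h) (\<phi> h x) \<in> L j" using g h by (simp add: m_assoc)
      then show "\<exists>g\<in>K. \<phi> g (\<phi> h x) \<in> L j" using g h by (intro bexI[of _ "g \<otimes> inv h"]) auto
    qed
    have Yinv: "\<phi> h x \<in> Y j \<longleftrightarrow> x \<in> Y j" if h: "h \<in> K" "x \<in> space X" for h x j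
    proof -
      have "\<phi> h x \<in> space X" using h Kc by auto
      then show ?thesis unfolding Y_def mem_Collect_eq using hull_inv[OF h] h(2) by meson
    qed
    have Ydisj: "i = j" if "x \<in> Y i" "x \<in> Y j" for i j x
      using that unfolding Y_def by (cases i j rule: linorder_cases) auto
    \<comment> \<open>On \<open>Y j\<close> only pieces of index \<open>j\<close> are used. Since
      \<open>D t\<close> exhausts \<open>K\<close>, the thickening reaches every point whose orbit
      meets \<open>L j\<close>.\<close>
    define A where "A t = (\<Union>j<k. Y j \<inter> (\<Union>g\<in>D t. {x \<in> space X. \<phi> g x \<in> U t j}))" for t
    have "A t \<in> sets X" for t
      unfolding A_def using U(1) Ysets D D_carrier
      by (intro sets.finite_UN sets.Int act_vimage) auto
    moreover have "bdd \<phi> (\<Sigma> t) (A t) (\<tau> t (\<Sigma> t))" for t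
      unfolding bdd_def
    proof (intro allI impI)
      fix x y assume xy: "x \<in> A t \<and> (x, y) \<in> (step \<phi> (\<Sigma> t) (A t))\<^sup>*"
      then obtain j g where j: "j < k" "x \<in> Y j" "g \<in> D t" "\<phi> g x \<in> U t j" "x \<in> space X"
        by (auto simp: A_def)
      have SgK: "\<Sigma> t \<subseteq> K" using Sg by blast
      have "(x, y) \<in> (step \<phi> (\<Sigma> t) (A t))\<^sup>*" using xy by blast
      then have "y \<in> space X \<and> y \<in> Y j \<and> (\<exists>g'\<in>D t. (\<phi> g x, \<phi> g' y) \<in> (step \<phi> (Sc t (\<Sigma> t)) (U t j))\<^sup>*)"
      proof (induction rule: rtrancl_induct)
        case base then show ?case using j by auto
      next
        case (step y z)
        then obtain g' where y: "y \<in> space X" "y \<in> Y j" and g': "g' \<in> D t"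
          "(\<phi> g x, \<phi> g' y) \<in> (step \<phi> (Sc t (\<Sigma> t)) (U t j))\<^sup>*" by blast
        obtain s where s: "s \<in> \<Sigma> t" "z = \<phi> s y" "z \<in> A t" using step(2) by (auto simp: step_def)
        have c: "s \<in> K" "s \<in> carrier \<Gamma>" "g' \<in> carrier \<Gamma>" using s(1) SgK Kc D_carrier[OF g'(1)] by auto
        have zY: "z \<in> Y j" using Yinv[OF c(1) y(1)] y(2) s(2) by simp
        obtain i g'' where i: "i < k" "z \<in> Y i" "g'' \<in> D t" "\<phi> g'' z \<in> U t i" "z \<in> space X"
          using s(3) by (auto simp: A_def)
        have ij: "i = j" using Ydisj[OF i(2) zY] .
        have c': "g'' \<in> carrier \<Gamma>" using i(3) D_carrier by blast
        have "g'' \<otimes> s \<otimes> inv g' \<in> Sc t (\<Sigma> t)"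
          unfolding Sc_def set_mult_def using i(3) s(1) g'(1) by blast
        moreover have "\<phi> g'' z = \<phi> (g'' \<otimes> s \<otimes> inv g') (\<phi> g' y)" using c c' y s(2) by (simp add: m_assoc)
        moreover have "\<phi> g' y \<in> U t j" by (rule step_rtrancl_in[OF g'(2) j(4)])
        ultimately have "(\<phi> g' y, \<phi> g'' z) \<in> step \<phi> (Sc t (\<Sigma> t)) (U t j)"
          using i(4) ij by (intro stepI) auto
        then show ?case using rtrancl_into_rtrancl[OF g'(2)] zY i(3,5) by blast
      qed
      then obtain g' where g': "g' \<in> D t" "(\<phi> g x, \<phi> g' y) \<in> (step \<phi> (Sc t (\<Sigma> t)) (U t j))\<^sup>*" and y: "y \<in> space X"
        by blast
      obtain u where u: "u \<in> T t (\<Sigma> t)" "\<phi> g' y = \<phi> u (\<phi> g x)" using bddD[OF U(2)[OF j(1)] j(4) g'(2)] by blast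
      have "u \<in> K" using u(1) T[of "\<Sigma> t" t] Sg by blast
      then have c: "g \<in> carrier \<Gamma>" "g' \<in> carrier \<Gamma>" "u \<in> carrier \<Gamma>" using j(3) g'(1) D_carrier Kc by auto
      have "y = \<phi> (inv g') (\<phi> g' y)" using c y by simp
      also have "\<dots> = \<phi> (inv g' \<otimes> u \<otimes> g) x" unfolding u(2) using c j(5) by (simp add: m_assoc)
      finally have "y = \<phi> (inv g' \<otimes> u \<otimes> g) x" .
      moreover have "inv g' \<otimes> u \<otimes> g \<in> \<tau> t (\<Sigma> t)"
        unfolding \<tau>_def set_mult_def using g'(1) u(1) j(3) by blast
      ultimately show "\<exists>t\<in>\<tau> t (\<Sigma> t). y = \<phi> t x" by blast
    qed
    moreover have "\<exists>t\<in>I. x \<in> A t" if x: "x \<in> space X" for x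
    proof -
      obtain j0 where j0: "j0 < k" "x \<in> L j0" using Lcov[OF x] by blast
      have "\<phi> \<one> x \<in> L j0" using j0(2) x by simp
      then have "\<exists>g\<in>K. \<phi> g x \<in> L j0" using K.one_closed by (rule bexI)
      then have exj: "\<exists>j. j < k \<and> (\<exists>g\<in>K. \<phi> g x \<in> L j)" using j0(1) by (intro exI[of _ j0] conjI)
      define j where "j = (LEAST j. j < k \<and> (\<exists>g\<in>K. \<phi> g x \<in> L j))"
      have j: "j < k \<and> (\<exists>g\<in>K. \<phi> g x \<in> L j)" unfolding j_def by (rule LeastI_ex[OF exj])
      have "\<not> (i < k \<and> (\<exists>g\<in>K. \<phi> g x \<in> L i))" if "i < j" for i
        using that unfolding j_def by (rule not_less_Least)
      then have xY: "x \<in> Y j" using j x unfolding Y_def by auto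
      obtain g where g: "g \<in> K" "\<phi> g x \<in> L j" using j by blast
      obtain m where m: "from_nat_into K m = g" using g(1) from_nat_into_surj[OF cK] by blast
      obtain t where t: "t \<in> I" "m \<le> t" "\<phi> g x \<in> U t j" using g(2) unfolding L_def by blast
      have "g \<in> D t" unfolding D_def using m t(2) by blast
      then have "x \<in> A t" unfolding A_def using xY j t(3) x by blast
      then show ?thesis using t(1) by blast
    qed
    ultimately show ?thesis by blast
  qed
  show ?thesis by (rule exI[of _ \<tau>]) (use \<tau> main in simp)
qed

end

section \<open>The bounds of the recursion over stages\<close>

locale tower = free_borel_action \<Gamma> X \<phi>
  for \<Gamma> :: "('a, 'm) monoid_scheme" (structure) and X :: "'x measure" and \<phi> +
  fixes H D :: "nat \<Rightarrow> 'a set" and st :: "nat \<Rightarrow> nat" and \<tau> :: "nat \<Rightarrow> 'a set \<Rightarrow> 'a set"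
  assumes H: "\<And>n. subgroup (H n) \<Gamma>" "incseq H"
    and D: "\<And>n. finite (D n)" "\<And>n. D n \<subseteq> H n" "incseq D" "\<And>n. \<one> \<in> D n" "\<And>n g. g \<in> D n \<Longrightarrow> inv g \<in> D n"
      "(\<Union>n. D n) = carrier \<Gamma>"
    and \<tau>: "\<And>t S. finite S \<Longrightarrow> S \<subseteq> H (st t) \<Longrightarrow> finite (\<tau> t S) \<and> \<tau> t S \<subseteq> H (st t)"
begin

text \<open>At stage \<open>t\<close> the level \<open>st t\<close> is treated. The relation \<open>E t n\<close> below identifies points around the
  boundaries \<open>W s\<close> built at the stages \<open>s < t\<close>, so that a boundary built later at a level \<open>n\<close> cannot
  come near those of higher levels; \<open>xi t n\<close> bounds its classes and \<open>expand\<close> the width of the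
  neighbourhoods, which grows as the level decreases from \<open>st s\<close> to \<open>n\<close>.\<close>

primrec expand :: "(nat \<Rightarrow> 'a set) \<Rightarrow> nat \<Rightarrow> nat \<Rightarrow> 'a set" where
  "expand x p 0 = {\<one>}"
| "expand x p (Suc d) = expand x p d \<union> (x (p - d) <#> (D (p - d) <#> D (p - d)) <#> expand x p d)"

text \<open>Two steps of \<open>D n\<close> at the lower levels, because \<open>DW_avoid\<close> has
  to go from a neighbour back to a boundary point and then on across the boundary.\<close>

definition hop :: "nat \<Rightarrow> nat \<Rightarrow> 'a set" where
  "hop p n = (if p \<le> n then D p else D n <#> D n)"

definition gens :: "(nat \<Rightarrow> 'a set) \<Rightarrow> nat \<Rightarrow> 'a set" where
  "gens x p = (let Q = D p \<union> (\<Union>n\<le>p. x n \<union> expand x p (p - n) \<union> hop p n) in Q \<union> (m_inv \<Gamma>) ` Q)"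

text \<open>Five factors because the walk in \<open>touched_anchor\<close> has five legs.\<close>

definition anch :: "(nat \<Rightarrow> 'a set) \<Rightarrow> nat \<Rightarrow> 'a set" where
  "anch x p = gens x p <#> gens x p <#> gens x p <#> gens x p <#> gens x p"

text \<open>The displacement between the anchors of two linked points: back along one anchor, over
  the link, and out along the other.\<close>

definition scale :: "(nat \<Rightarrow> 'a set) \<Rightarrow> nat \<Rightarrow> 'a set" where
  "scale x p = anch x p <#> gens x p <#> anch x p"

text \<open>At levels up to \<open>p\<close> an enlarged class is bounded through its anchors in
  \<open>A t\<close>. At a level above \<open>p\<close> it lies in a class of level \<open>p\<close>
  and inherits the bound found there.\<close>

primrec xi :: "nat \<Rightarrow> nat \<Rightarrow> 'a set" where
  "xi 0 = (\<lambda>n. {\<one>})"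
| "xi (Suc t) = (let p = st t; x = xi t; Q = anch x p <#> \<tau> t (scale x p) <#> anch x p in
     (\<lambda>n. x n \<union> (if n \<le> p then Q \<inter> H n else x p \<union> Q \<inter> H p)))"

lemma H_carrier: "H n \<subseteq> carrier \<Gamma>" using subgroup.subset[OF H(1)] .
lemma H_mono: "m \<le> n \<Longrightarrow> H m \<subseteq> H n" using H(2) by (auto dest: incseqD)
lemma D_mono: "m \<le> n \<Longrightarrow> D m \<subseteq> D n" using D(3) by (auto dest: incseqD)
lemma D_carrier: "D n \<subseteq> carrier \<Gamma>" using D(2) H_carrier by blast
lemma D_subset_H: "m \<le> n \<Longrightarrow> D m \<subseteq> H n" using D(2) H_mono by blast

lemma set_mult_H: "A \<subseteq> H n \<Longrightarrow> B \<subseteq> H n \<Longrightarrow> A <#> B \<subseteq> H n"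
  by (rule set_mult_subset[OF H(1)])

lemma inv_H: "g \<in> H n \<Longrightarrow> inv g \<in> H n" using subgroup.m_inv_closed[OF H(1)] .
lemma one_H: "\<one> \<in> H n" using subgroup.one_closed[OF H(1)] .

lemma hop: "finite (hop p n)" "hop p n \<subseteq> H n" "hop p n \<subseteq> H p" "\<one> \<in> hop p n"
proof -
  show "finite (hop p n)" using D(1) by (simp add: hop_def finite_set_mult)
  show "hop p n \<subseteq> H n" using D_subset_H[of p n] D(2)[of n] by (simp add: hop_def set_mult_H)
  show "hop p n \<subseteq> H p" using D_subset_H[of n p] D(2)[of p] by (simp add: hop_def set_mult_H)
  have "\<one> \<otimes> \<one> \<in> D n <#> D n" unfolding set_mult_def using D(4) by blast
  then show "\<one> \<in> hop p n" using D(4) by (simp add: hop_def)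
qed

lemma hop_sub: "n \<le> p \<Longrightarrow> hop p n \<subseteq> D n <#> D n"
proof -
  assume "n \<le> p"
  moreover have "D n \<subseteq> D n <#> D n"
  proof
    fix d assume d: "d \<in> D n"
    then have "d \<in> carrier \<Gamma>" using D_carrier by blast
    then have "d = d \<otimes> \<one>" by simp
    with d show "d \<in> D n <#> D n" unfolding set_mult_def using D(4) by blast
  qed
  ultimately show ?thesis by (auto simp: hop_def)
qed

lemma expand_props:
  assumes "\<And>n. finite (x n)" "\<And>n. x n \<subseteq> H n"
  shows "finite (expand x p d)" "expand x p d \<subseteq> H p"
proof -
  show "finite (expand x p d)" using assms(1) D(1) by (induction d) (auto simp: finite_set_mult)
  show "expand x p d \<subseteq> H p"
  proof (induction d)
    case (Suc d)
    have "x (p - d) \<subseteq> H p" using assms(2)[of "p - d"] H_mono[of "p - d" p] by auto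
    moreover have "D (p - d) \<subseteq> H p" by (rule D_subset_H) simp
    ultimately show ?case using Suc by (simp add: set_mult_H)
  qed (simp add: one_H)
qed

lemma expand_mono: "d \<le> d' \<Longrightarrow> expand x p d \<subseteq> expand x p d'"
  by (rule lift_Suc_mono_le) auto

lemma one_expand: "\<one> \<in> expand x p d"
  using expand_mono[of 0 d] by auto

lemma gens_props:
  assumes "\<And>n. finite (x n)" "\<And>n. x n \<subseteq> H n"
  shows "finite (gens x p)" "gens x p \<subseteq> H p" "\<one> \<in> gens x p" "g \<in> gens x p \<Longrightarrow> inv g \<in> gens x p"
    "D p \<subseteq> gens x p" "n \<le> p \<Longrightarrow> x n \<subseteq> gens x p" "n \<le> p \<Longrightarrow> expand x p (p - n) \<subseteq> gens x p"
    "n \<le> p \<Longrightarrow> hop p n \<subseteq> gens x p"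
proof -
  define Q where "Q = D p \<union> (\<Union>n\<le>p. x n \<union> expand x p (p - n) \<union> hop p n)"
  have g: "gens x p = Q \<union> (m_inv \<Gamma>) ` Q" unfolding gens_def Q_def Let_def ..
  have fQ: "finite Q" unfolding Q_def using D(1) assms(1) expand_props[OF assms] hop(1) by auto
  have QH: "Q \<subseteq> H p"
  proof -
    have "x n \<subseteq> H p" if "n \<le> p" for n using assms(2) H_mono[OF that] by blast
    then show ?thesis unfolding Q_def using D(2) expand_props(2)[OF assms] hop(3) by (intro Un_least UN_least) auto
  qed
  show "finite (gens x p)" using fQ g by simp
  show "gens x p \<subseteq> H p" using QH inv_H g by auto
  show "\<one> \<in> gens x p" using D(4) unfolding g Q_def by blast
  show "inv g \<in> gens x p" if "g \<in> gens x p"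
    using that QH H_carrier[of p] unfolding g by (auto simp: subset_iff)
  show "D p \<subseteq> gens x p" unfolding g Q_def by blast
  show "n \<le> p \<Longrightarrow> x n \<subseteq> gens x p" unfolding g Q_def by blast
  show "n \<le> p \<Longrightarrow> expand x p (p - n) \<subseteq> gens x p" unfolding g Q_def by blast
  show "n \<le> p \<Longrightarrow> hop p n \<subseteq> gens x p" unfolding g Q_def by blast
qed

lemma anch_props:
  assumes "\<And>n. finite (x n)" "\<And>n. x n \<subseteq> H n"
  shows "finite (anch x p)" "anch x p \<subseteq> H p" "finite (scale x p)" "scale x p \<subseteq> H p"
    "a \<in> anch x p \<Longrightarrow> inv a \<in> anch x p"
proof -
  note g = gens_props[OF assms]
  show *: "finite (anch x p)" "anch x p \<subseteq> H p" unfolding anch_def using g(1,2) by (auto simp: finite_set_mult set_mult_H)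
  then show "finite (scale x p)" "scale x p \<subseteq> H p" unfolding scale_def using g(1,2) by (auto simp: finite_set_mult set_mult_H)
  assume "a \<in> anch x p"
  then obtain q1 q2 q3 q4 q5 where q: "q1 \<in> gens x p" "q2 \<in> gens x p" "q3 \<in> gens x p" "q4 \<in> gens x p" "q5 \<in> gens x p"
    "a = q1 \<otimes> q2 \<otimes> q3 \<otimes> q4 \<otimes> q5" unfolding anch_def set_mult_def by blast
  have "inv a = inv q5 \<otimes> inv q4 \<otimes> inv q3 \<otimes> inv q2 \<otimes> inv q1"
    using q g(2) H_carrier[of p] by (simp add: inv_mult_group m_assoc subset_iff)
  then show "inv a \<in> anch x p" unfolding anch_def by (simp only:) (intro set_multI g(4) q)
qed

lemma xi_props: "finite (xi t n) \<and> xi t n \<subseteq> H n \<and> \<one> \<in> xi t n"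
proof (induction t arbitrary: n)
  case (Suc t)
  have x: "\<And>n. finite (xi t n)" "\<And>n. xi t n \<subseteq> H n" using Suc by auto
  have fQ: "finite (anch (xi t) (st t) <#> \<tau> t (scale (xi t) (st t)) <#> anch (xi t) (st t))"
    using anch_props(1)[OF x] \<tau>[OF anch_props(3,4)[OF x], THEN conjunct1] by (intro finite_set_mult)
  show ?case
  proof (cases "n \<le> st t")
    case True
    then show ?thesis using Suc[of n] fQ by (auto simp: Let_def)
  next
    case False
    then have "H (st t) \<subseteq> H n" by (intro H_mono) simp
    then show ?thesis using False Suc[of n] Suc[of "st t"] fQ by (auto simp: Let_def)
  qed
qed (simp add: one_H)

lemma xi_mono: "xi t n \<subseteq> xi (Suc t) n"
  by (auto simp: Let_def)

abbreviation "Sg t \<equiv> scale (xi t) (st t)"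

end

section \<open>The sets of the stages and the invariants of their links\<close>

locale tower_sets = tower \<Gamma> X \<phi> H D st \<tau>
  for \<Gamma> :: "('a, 'm) monoid_scheme" (structure) and X :: "'x measure" and \<phi> H D st \<tau> +
  fixes A :: "nat \<Rightarrow> 'x set"
  assumes A: "\<And>t. A t \<in> sets X" "\<And>t. bdd \<phi> (Sg t) (A t) (\<tau> t (Sg t))"
    and A_cov: "\<And>n x. x \<in> space X \<Longrightarrow> \<exists>t. st t = n \<and> x \<in> A t"
begin

definition cls :: "('x \<times> 'x) set \<Rightarrow> ('x \<times> 'x) set" where
  "cls r = Id_on (space X) O (r \<union> r\<inverse>)\<^sup>*"

definition sat :: "nat \<Rightarrow> ('x \<times> 'x) set \<Rightarrow> 'x set" where
  "sat t r = {x \<in> space X. \<exists>y\<in>A t. (x, y) \<in> cls r}"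

definition bnd :: "nat \<Rightarrow> 'x set \<Rightarrow> 'x set" where
  "bnd t B = {x \<in> space X. \<exists>h\<in>D (st t). (x \<in> B) \<noteq> (\<phi> h x \<in> B)}"

text \<open>At a level \<open>n\<close> below \<open>st t\<close> a whole neighbourhood of the
  boundary is linked. This keeps later boundaries of level \<open>n\<close> away from the classes
  that the boundary has touched at higher levels.\<close>

definition links :: "nat \<Rightarrow> nat \<Rightarrow> 'x set \<Rightarrow> ('x \<times> 'x) set" where
  "links t n B = {(x, y). x \<in> (\<Union>f\<in>expand (xi t) (st t) (st t - n). \<phi> f ` B) \<and> y \<in> space X \<and>
      (\<exists>h\<in>hop (st t) n. y = \<phi> h x)}"

primrec R :: "nat \<Rightarrow> nat \<Rightarrow> ('x \<times> 'x) set" where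
  "R 0 = (\<lambda>n. {})"
| "R (Suc t) = (\<lambda>n. R t n \<union> links t n (bnd t (sat t (R t (st t)))))"

definition E :: "nat \<Rightarrow> nat \<Rightarrow> ('x \<times> 'x) set" where "E t n = cls (R t n)"
definition Ah :: "nat \<Rightarrow> 'x set" where "Ah t = sat t (R t (st t))"
definition W :: "nat \<Rightarrow> 'x set" where "W t = bnd t (Ah t)"
definition edge :: "nat \<Rightarrow> nat \<Rightarrow> ('x \<times> 'x) set" where "edge t n = links t n (W t)"
text \<open>The region that earlier stages of higher level have closed to a boundary of level
  \<open>p\<close>; \<open>DW_avoid\<close> shows that a boundary built at stage \<open>t\<close>
  respects it.\<close>

definition avoid :: "nat \<Rightarrow> nat \<Rightarrow> 'x set" where
  "avoid t p = (\<Union>s\<in>{s. s < t \<and> p < st s}. \<Union>f\<in>expand (xi s) (st s) (st s - p). \<phi> f ` W s)"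

lemma R_Suc: "R (Suc t) n = R t n \<union> edge t n"
  by (simp add: edge_def W_def Ah_def)

declare R.simps(2) [simp del]

lemma R_iff: "e \<in> R t n \<longleftrightarrow> (\<exists>s<t. e \<in> edge s n)"
  by (induction t) (auto simp: R_Suc less_Suc_eq)

lemma W_space: "W t \<subseteq> space X"
  by (auto simp: W_def bnd_def)

lemma xif: "finite (xi t n)" and xiH: "xi t n \<subseteq> H n" and xi1: "\<one> \<in> xi t n"
  using xi_props by auto

lemma expandH: "expand (xi t) p d \<subseteq> H p"
  by (rule expand_props(2)) (rule xif, rule xiH)

lemma carrierI: "g \<in> H n \<Longrightarrow> g \<in> carrier \<Gamma>" "d \<in> D n \<Longrightarrow> d \<in> carrier \<Gamma>" "d \<in> hop p n \<Longrightarrow> d \<in> carrier \<Gamma>"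
   "e \<in> xi t n \<Longrightarrow> e \<in> carrier \<Gamma>" "f \<in> expand (xi t) p d' \<Longrightarrow> f \<in> carrier \<Gamma>"
  using H_carrier D_carrier hop(2) xiH expandH by blast+

lemma edgeE:
  assumes "(x, y) \<in> edge t n"
  obtains w f h where "w \<in> W t" "f \<in> expand (xi t) (st t) (st t - n)" "h \<in> hop (st t) n" "x = \<phi> f w" "y = \<phi> h x"
    "w \<in> space X" "x \<in> space X" "y \<in> space X"
proof -
  obtain w f h where *: "w \<in> W t" "f \<in> expand (xi t) (st t) (st t - n)" "h \<in> hop (st t) n" "x = \<phi> f w" "y = \<phi> h x"
    using assms by (auto simp: edge_def links_def)
  have "w \<in> space X" using * W_space by blast
  moreover from this have "x \<in> space X" using * carrierI(5) by simp
  moreover from this have "y \<in> space X" using * carrierI(3) by simp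
  ultimately show ?thesis using * by (intro that)
qed

lemma edgeI:
  assumes "w \<in> W t" "f \<in> expand (xi t) (st t) (st t - n)" "h \<in> hop (st t) n"
  shows "(\<phi> f w, \<phi> h (\<phi> f w)) \<in> edge t n"
proof -
  have "w \<in> space X" using assms W_space by blast
  then have "\<phi> h (\<phi> f w) \<in> space X" using assms carrierI(3,5) by (simp del: act_act)
  then show ?thesis using assms unfolding edge_def links_def by blast
qed

text \<open>From level \<open>st t\<close> on, the truncated difference \<open>st t - n\<close> is
  0, so only \<open>W t\<close> itself is linked. The links then do not depend on \<open>n\<close>,
  which lets paths be transferred from one level to another.\<close>

lemma edge_ge:
  assumes "st t \<le> n"
  shows "edge t n = {(x, y). x \<in> W t \<and> (\<exists>h\<in>D (st t). y = \<phi> h x)}"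
proof -
  have "\<phi> \<one> ` W t = W t" using W_space by force
  then show ?thesis using assms W_space[THEN subsetD] carrierI(2) by (auto simp: edge_def links_def hop_def)
qed

lemma R_space: "(x, y) \<in> R t n \<Longrightarrow> x \<in> space X \<and> y \<in> space X"
  by (auto simp: R_iff elim: edgeE)

lemma E_path:
  assumes "(x, y) \<in> E t n"
  shows "x \<in> space X" "(x, y) \<in> (R t n \<union> (R t n)\<inverse>)\<^sup>*"
  using assms by (auto simp: E_def cls_def)

lemma E_I: "x \<in> space X \<Longrightarrow> (x, y) \<in> (R t n \<union> (R t n)\<inverse>)\<^sup>* \<Longrightarrow> (x, y) \<in> E t n"
  by (auto simp: E_def cls_def)

lemma path_space: "(x, y) \<in> (R t n \<union> (R t n)\<inverse>)\<^sup>* \<Longrightarrow> x \<in> space X \<Longrightarrow> y \<in> space X"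
  by (induction rule: rtrancl_induct) (auto dest: R_space)

lemma E_space: "(x, y) \<in> E t n \<Longrightarrow> y \<in> space X"
  using path_space E_path by blast

lemma E_refl: "x \<in> space X \<Longrightarrow> (x, x) \<in> E t n"
  by (auto intro: E_I)

lemma E_sym: "(x, y) \<in> E t n \<Longrightarrow> (y, x) \<in> E t n"
proof -
  assume *: "(x, y) \<in> E t n"
  have "sym ((R t n \<union> (R t n)\<inverse>)\<^sup>*)" by (intro sym_rtrancl sym_Un_converse)
  then have "(y, x) \<in> (R t n \<union> (R t n)\<inverse>)\<^sup>*" using E_path(2)[OF *] by (rule symD)
  then show ?thesis using E_space[OF *] by (intro E_I)
qed

lemma E_trans: "(x, y) \<in> E t n \<Longrightarrow> (y, z) \<in> E t n \<Longrightarrow> (x, z) \<in> E t n"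
  by (meson E_I E_path rtrancl_trans)

lemma E_edge: "s < t \<Longrightarrow> (x, y) \<in> edge s n \<Longrightarrow> (x, y) \<in> E t n"
proof -
  assume *: "s < t" "(x, y) \<in> edge s n"
  then have r: "(x, y) \<in> R t n" by (auto simp: R_iff)
  then show ?thesis using R_space[OF r] by (intro E_I r_into_rtrancl) auto
qed

lemma E_R: "(x, y) \<in> R t n \<union> (R t n)\<inverse> \<Longrightarrow> (x, y) \<in> E t n"
proof -
  assume *: "(x, y) \<in> R t n \<union> (R t n)\<inverse>"
  then have "x \<in> space X" using R_space by blast
  then show ?thesis using r_into_rtrancl[OF *] by (rule E_I)
qed

lemma E_mono: "(x, y) \<in> E t n \<Longrightarrow> (x, y) \<in> E (Suc t) n"
proof -
  assume *: "(x, y) \<in> E t n"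
  have "(R t n \<union> (R t n)\<inverse>)\<^sup>* \<subseteq> (R (Suc t) n \<union> (R (Suc t) n)\<inverse>)\<^sup>*"
    by (rule rtrancl_mono) (auto simp: R_Suc)
  then show ?thesis using E_path[OF *] by (intro E_I) blast+
qed

lemma E_orbit: "(x, y) \<in> E t n \<Longrightarrow> \<exists>g\<in>H n. y = \<phi> g x"
proof -
  assume E: "(x, y) \<in> E t n"
  note x = E_path(1)[OF E]
  have "(x, y) \<in> (R t n \<union> (R t n)\<inverse>)\<^sup>*" by (rule E_path(2)[OF E])
  then show ?thesis
  proof (induction rule: rtrancl_induct)
    case base
    show ?case by (rule bexI[OF _ one_H]) (simp add: x)
  next
    case (step y z)
    then obtain g where g: "g \<in> H n" "y = \<phi> g x" by blast
    obtain h where h: "h \<in> H n" "z = \<phi> h y"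
    proof -
      from step(2) consider "(y, z) \<in> R t n" | "(z, y) \<in> R t n" by blast
      then show ?thesis
      proof cases
        case 1
        then obtain s where "(y, z) \<in> edge s n" by (auto simp: R_iff)
        then show ?thesis by (rule edgeE) (use that hop(2) in blast)
      next
        case 2
        then obtain s where "(z, y) \<in> edge s n" by (auto simp: R_iff)
        then obtain h where h: "h \<in> hop (st s) n" "y = \<phi> h z" "z \<in> space X" by (rule edgeE)
        then have "z = \<phi> (inv h) y" using carrierI(3) by simp
        moreover have "inv h \<in> H n" using h(1) hop(2) inv_H by blast
        ultimately show ?thesis by (intro that)
      qed
    qed
    have "z = \<phi> (h \<otimes> g) x" using g h x carrierI(1) by simp
    then show ?case using g h subgroup.m_closed[OF H(1)] by blast
  qed
qed

lemma Ah_sat: "(x, y) \<in> E t (st t) \<Longrightarrow> x \<in> Ah t \<longleftrightarrow> y \<in> Ah t"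
proof -
  have *: "x \<in> Ah t \<longleftrightarrow> x \<in> space X \<and> (\<exists>a\<in>A t. (x, a) \<in> E t (st t))" for x
    by (auto simp: Ah_def sat_def E_def)
  assume E: "(x, y) \<in> E t (st t)"
  show ?thesis unfolding * using E_path(1)[OF E] E_space[OF E] E_trans[OF E] E_trans[OF E_sym[OF E]] by blast
qed

lemma Ah_iff: "x \<in> Ah t \<longleftrightarrow> (\<exists>a\<in>A t. (x, a) \<in> E t (st t))"
  by (auto simp: Ah_def sat_def E_def cls_def)

lemma A_Ah: "A t \<subseteq> Ah t"
proof
  fix x assume x: "x \<in> A t"
  then have "x \<in> space X" using A(1) sets.sets_into_space by blast
  then show "x \<in> Ah t" using x E_refl by (auto simp: Ah_iff)
qed

definition DW :: "nat \<Rightarrow> 'x set" where "DW t = (\<Union>h\<in>D (st t). \<phi> h ` W t)"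

lemma DW_near:
  assumes "u \<in> DW t"
  obtains w h where "w \<in> W t" "h \<in> D (st t)" "u = \<phi> h w" "w \<in> space X"
  using assms W_space by (auto simp: DW_def)

lemma W_cases:
  assumes "w \<in> W t"
  obtains h where "h \<in> D (st t)" "w \<in> Ah t \<or> \<phi> h w \<in> Ah t" "(w \<in> Ah t) \<noteq> (\<phi> h w \<in> Ah t)" "w \<in> space X"
  using assms by (auto simp: W_def bnd_def)

text \<open>Around a point that has been linked at an earlier stage of a higher level, the links cover
  the whole neighbourhood, so that the saturated set cannot have a boundary there.\<close>

lemma DW_avoid:
  assumes u: "u \<in> DW t"
  shows "u \<notin> avoid t (st t)"
proof
  assume "u \<in> avoid t (st t)"
  then obtain s f v where s: "s < t" "st t < st s" "f \<in> expand (xi s) (st s) (st s - st t)" "v \<in> W s" "u = \<phi> f v"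
    by (auto simp: avoid_def)
  obtain w h where w: "w \<in> W t" "h \<in> D (st t)" "u = \<phi> h w" "w \<in> space X" by (rule DW_near[OF u])
  obtain h' where h': "h' \<in> D (st t)" "(w \<in> Ah t) \<noteq> (\<phi> h' w \<in> Ah t)" by (rule W_cases[OF w(1)])
  have c: "h \<in> carrier \<Gamma>" "h' \<in> carrier \<Gamma>" using w h' carrierI(2) by blast+
  have us: "u \<in> space X" using w c by simp
  have link: "(u, \<phi> k u) \<in> E t (st t)" if "k \<in> D (st t) <#> D (st t)" for k
  proof (rule E_edge[OF s(1)])
    show "(u, \<phi> k u) \<in> edge s (st t)" unfolding s(5)
      by (rule edgeI[OF s(4,3)]) (use that s(2) in \<open>simp add: hop_def\<close>)
  qed
  have "inv h \<in> D (st t)" using D(5) w(2) .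
  then have "h' \<otimes> inv h \<in> D (st t) <#> D (st t)" "\<one> \<otimes> inv h \<in> D (st t) <#> D (st t)"
    unfolding set_mult_def using h'(1) D(4) by blast+
  moreover have "\<phi> (h' \<otimes> inv h) u = \<phi> h' w" "\<phi> (\<one> \<otimes> inv h) u = w" using w c by (simp_all add: m_assoc)
  ultimately have "(u, \<phi> h' w) \<in> E t (st t)" "(u, w) \<in> E t (st t)" using link by metis+
  then show False using Ah_sat h'(2) by blast
qed

text \<open>Marks the classes that the links of stage \<open>t\<close> may enlarge; by
  \<open>E_Suc_cases\<close> all others remain as they are.\<close>

definition touched :: "nat \<Rightarrow> nat \<Rightarrow> 'x \<Rightarrow> bool" where
  "touched t n x \<longleftrightarrow> (\<exists>u\<in>Field (edge t n). (x, u) \<in> E t n)"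

lemma Field_space: "u \<in> Field (edge t n) \<Longrightarrow> u \<in> space X"
  unfolding Field_def by (auto elim: edgeE)

lemma touched_Field: "u \<in> Field (edge t n) \<Longrightarrow> touched t n u"
  unfolding touched_def using Field_space E_refl by blast

lemma touched_E: "touched t n x \<Longrightarrow> (y, x) \<in> E t n \<Longrightarrow> touched t n y"
  unfolding touched_def using E_trans by blast

lemma E_Suc_cases: "(x, y) \<in> E (Suc t) n \<Longrightarrow> (x, y) \<in> E t n \<or> touched t n x \<and> touched t n y"
proof -
  assume E: "(x, y) \<in> E (Suc t) n"
  note x = E_path(1)[OF E]
  have "(x, y) \<in> (R (Suc t) n \<union> (R (Suc t) n)\<inverse>)\<^sup>*" by (rule E_path(2)[OF E])
  then show ?thesis
  proof (induction rule: rtrancl_induct)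
    case base show ?case using E_refl[OF x] by blast
  next
    case (step y z)
    from step(2) consider "(y, z) \<in> R t n \<union> (R t n)\<inverse>" | "(y, z) \<in> edge t n \<union> (edge t n)\<inverse>"
      by (auto simp: R_Suc)
    then show ?case
    proof cases
      case 1
      then have yz: "(y, z) \<in> E t n" by (rule E_R)
      then show ?thesis using step(3) E_trans touched_E E_sym by blast
    next
      case 2
      then have "y \<in> Field (edge t n)" "z \<in> Field (edge t n)" by (auto simp: Field_def)
      then have "touched t n y" "touched t n z" using touched_Field by blast+
      then show ?thesis using step(3) touched_E by blast
    qed
  qed
qed

lemma touched_E_Suc: "touched t n x \<Longrightarrow> (x, y) \<in> E (Suc t) n \<Longrightarrow> touched t n y"
  using E_Suc_cases touched_E E_sym by blast

lemma Field_DW: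
  assumes n: "st t \<le> n" and u: "u \<in> Field (edge t n)"
  shows "u \<in> DW t"
proof -
  obtain w h where *: "w \<in> W t" "h \<in> D (st t)" "u = w \<or> u = \<phi> h w"
    using u unfolding edge_ge[OF n] Field_def by blast
  have "w \<in> space X" using *(1) W_space by blast
  then have "\<phi> \<one> w = w" by simp
  then have "w \<in> DW t" using *(1) D(4) unfolding DW_def by force
  then show ?thesis using * unfolding DW_def by blast
qed

definition bounded_stage :: "nat \<Rightarrow> bool" where
  "bounded_stage t \<longleftrightarrow> (\<forall>n x y. (x, y) \<in> E t n \<longrightarrow> (\<exists>g\<in>xi t n. y = \<phi> g x))"

text \<open>Once a class at level \<open>n\<close> contains a link that comes from a level above
  \<open>p\<close>, for some \<open>p < n\<close>, the whole class is closed to boundaries of level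
  \<open>p\<close>. This is the invariant behind \<open>E_low\<close>.\<close>

definition avoid_stage :: "nat \<Rightarrow> bool" where
  "avoid_stage t \<longleftrightarrow> (\<forall>n p s z z' y. p < n \<and> s < t \<and> p < st s \<and> (z, z') \<in> edge s n \<and> (z, y) \<in> E t n \<longrightarrow> y \<in> avoid t p)"

lemma boundedD: "bounded_stage t \<Longrightarrow> (x, y) \<in> E t n \<Longrightarrow> \<exists>g\<in>xi t n. y = \<phi> g x"
  unfolding bounded_stage_def by simp

lemma avoidD: "avoid_stage t \<Longrightarrow> p < n \<Longrightarrow> s < t \<Longrightarrow> p < st s \<Longrightarrow> (z, z') \<in> edge s n \<Longrightarrow> (z, y) \<in> E t n \<Longrightarrow> y \<in> avoid t p"
  unfolding avoid_stage_def by blast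

lemma avoid_mono: "avoid t p \<subseteq> avoid (Suc t) p"
  unfolding avoid_def by (intro UN_mono) auto

text \<open>If the class of \<open>u\<close> at level \<open>n\<close> contained a link from a level
  above \<open>st t\<close>, the invariant would put \<open>u\<close> into
  \<open>avoid t (st t)\<close>, against \<open>DW_avoid\<close>. So only links from levels up to
  \<open>st t\<close> occur, and these are the same at the levels \<open>n\<close> and
  \<open>st t\<close>.\<close>

lemma E_low:
  assumes av: "avoid_stage t" and n: "st t < n" and u: "u \<in> DW t" and E: "(u, y) \<in> E t n"
  shows "(u, y) \<in> E t (st t)"
proof -
  have us: "u \<in> space X" by (rule E_path(1)[OF E])
  have "(u, y) \<in> (R t n \<union> (R t n)\<inverse>)\<^sup>*" by (rule E_path(2)[OF E])
  then show ?thesis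
  proof (induction rule: rtrancl_induct)
    case base show ?case by (rule E_refl[OF us])
  next
    case (step y z)
    have uy: "(u, y) \<in> E t n" using us step(1) by (rule E_I)
    have yz: "(y, z) \<in> E t n" using step(2) by (rule E_R)
    have uz: "(u, z) \<in> E t n" using E_trans[OF uy yz] .
    obtain s a b where s: "s < t" "(a, b) \<in> edge s n" "(a, b) = (y, z) \<or> (a, b) = (z, y)"
      using step(2) by (auto simp: R_iff)
    have au: "(a, u) \<in> E t n" using s(3) E_sym[OF uy] E_sym[OF uz] by auto
    have le: "st s \<le> st t"
    proof (rule ccontr)
      assume "\<not> ?thesis"
      then have "u \<in> avoid t (st t)" using avoidD[OF av n s(1) _ s(2) au] by simp
      then show False using DW_avoid[OF u] by blast
    qed
    then have "(a, b) \<in> edge s (st t)" using s(2) n by (simp add: edge_ge)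
    then have "(a, b) \<in> E t (st t)" by (rule E_edge[OF s(1)])
    then have "(y, z) \<in> E t (st t)" using s(3) E_sym by blast
    with step(3) show ?case by (rule E_trans)
  qed
qed

end

context free_borel_action
begin

text \<open>Separation makes the graph of a group element measurable: \<open>y\<close> equals
  \<open>\<phi> g x\<close> iff every set of the countable family that contains
  \<open>\<phi> g x\<close> contains \<open>y\<close>. The relation is then a countable union of
  graphs over Borel sets.\<close>

lemma bor_pair_sets:
  assumes E: "bor E"
  shows "E \<in> sets (X \<Otimes>\<^sub>M X)"
proof -
  obtain Q :: "nat \<Rightarrow> 'x set" where Q: "\<forall>n. Q n \<in> sets X"
    "\<forall>x\<in>space X. \<forall>F. finite F \<and> F \<subseteq> space X \<and> x \<notin> F \<longrightarrow> (\<exists>n. x \<in> Q n \<and> Q n \<inter> F = {})"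
    using separation by (elim exE conjE) (rule that)
  have Qsep: "\<exists>n. x \<in> Q n \<and> y \<notin> Q n" if "x \<in> space X" "y \<in> space X" "x \<noteq> y" for x y
    using Q(2)[rule_format, of x "{y}"] that by auto
  define gr where "gr g = {x \<in> space X. (x, \<phi> g x) \<in> E} \<times> space X -
      (\<Union>n. {x \<in> space X. \<phi> g x \<in> Q n} \<times> (space X - Q n))" for g
  have "E = (\<Union>g\<in>carrier \<Gamma>. gr g)"
  proof (intro subset_antisym subsetI)
    fix e assume e: "e \<in> E"
    obtain x y where xy: "e = (x, y)" by (cases e)
    then obtain g where g: "g \<in> carrier \<Gamma>" "y = \<phi> g x" "x \<in> space X" using borD[OF E] e by blast
    then have "e \<in> gr g" using e xy by (auto simp: gr_def)
    then show "e \<in> (\<Union>g\<in>carrier \<Gamma>. gr g)" using g(1) by blast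
  next
    fix e assume "e \<in> (\<Union>g\<in>carrier \<Gamma>. gr g)"
    then obtain g where g: "g \<in> carrier \<Gamma>" "e \<in> gr g" by (rule UN_E)
    obtain x y where xy: "e = (x, y)" by (cases e)
    have x: "x \<in> space X" "y \<in> space X" "(x, \<phi> g x) \<in> E" "\<And>n. \<phi> g x \<in> Q n \<Longrightarrow> y \<in> Q n"
      using g(2) xy by (auto simp: gr_def)
    then have "\<phi> g x = y" using Qsep[of "\<phi> g x" y] g(1) act_closed by blast
    then show "e \<in> E" using x xy by simp
  qed
  moreover have "gr g \<in> sets (X \<Otimes>\<^sub>M X)" if "g \<in> carrier \<Gamma>" for g
    unfolding gr_def using bor_sets[OF E that] Q(1) act_vimage[OF _ that]
    by (intro sets.Diff sets.countable_UN' pair_measureI) auto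
  ultimately show ?thesis using countable_carrier by (auto intro!: sets.countable_UN'')
qed

end

context tower_sets
begin

lemmas gensI = gens_props[of "xi t" for t, OF xif xiH]
lemmas anchI = anch_props[of "xi t" for t, OF xif xiH]

text \<open>Walk from \<open>x\<close> to a linked point by a class bound, back over the link, out
  of the neighbourhood to the boundary point \<open>w\<close>, across the boundary into
  \<open>Ah t\<close>, and through a class into \<open>A t\<close>.\<close>

lemma touched_anchor:
  assumes b: "bounded_stage t" and n: "n \<le> st t" and x: "touched t n x"
  shows "\<exists>\<alpha>\<in>anch (xi t) (st t). \<phi> \<alpha> x \<in> A t"
proof -
  let ?G = "gens (xi t) (st t)"
  obtain u where u: "u \<in> Field (edge t n)" "(x, u) \<in> E t n" using x unfolding touched_def by blast
  obtain e where e: "e \<in> xi t n" "u = \<phi> e x" using boundedD[OF b u(2)] by blast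
  have xs: "x \<in> space X" by (rule E_path(1)[OF u(2)])
  obtain z z' where zz: "(z, z') \<in> edge t n" "u = z \<or> u = z'" using u(1) unfolding Field_def by blast
  obtain w f h where wf: "w \<in> W t" "f \<in> expand (xi t) (st t) (st t - n)" "h \<in> hop (st t) n" "z = \<phi> f w"
      "z' = \<phi> h z" "w \<in> space X" "z \<in> space X"
    by (rule edgeE[OF zz(1)])
  obtain k where k: "k \<in> hop (st t) n" "u = \<phi> k z"
  proof (cases "u = z")
    case True
    then show ?thesis using that[of \<one>] hop(4) wf(7) by simp
  next
    case False
    then show ?thesis using that[OF wf(3)] zz(2) wf(5) by simp
  qed
  obtain d where d: "d \<in> D (st t)" "\<phi> d w \<in> Ah t"
  proof -
    obtain h' where h': "h' \<in> D (st t)" "w \<in> Ah t \<or> \<phi> h' w \<in> Ah t" by (rule W_cases[OF wf(1)])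
    show ?thesis
    proof (cases "w \<in> Ah t")
      case True
      then show ?thesis using that[of \<one>] D(4) wf(6) by simp
    next
      case False
      then show ?thesis using that[OF h'(1)] h'(2) by simp
    qed
  qed
  obtain a where a: "a \<in> A t" "(\<phi> d w, a) \<in> E t (st t)" using d(2) unfolding Ah_iff by blast
  obtain g where g: "g \<in> xi t (st t)" "a = \<phi> g (\<phi> d w)" using boundedD[OF b a(2)] by blast
  have c: "e \<in> carrier \<Gamma>" "f \<in> carrier \<Gamma>" "k \<in> carrier \<Gamma>" "d \<in> carrier \<Gamma>" "g \<in> carrier \<Gamma>"
    using e(1) wf(2) k(1) d(1) g(1) carrierI by blast+
  have "w = \<phi> (inv f) (\<phi> (inv k) u)" unfolding k(2) wf(4) using c wf(6) by (simp add: m_assoc)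
  then have "a = \<phi> g (\<phi> d (\<phi> (inv f) (\<phi> (inv k) (\<phi> e x))))" using g(2) e(2) by simp
  also have "\<dots> = \<phi> (g \<otimes> d \<otimes> inv f \<otimes> inv k \<otimes> e) x" using c xs by (simp add: m_assoc)
  finally have "\<phi> (g \<otimes> d \<otimes> inv f \<otimes> inv k \<otimes> e) x \<in> A t" using a(1) by simp
  moreover have "g \<otimes> d \<otimes> inv f \<otimes> inv k \<otimes> e \<in> anch (xi t) (st t)"
    unfolding anch_def
  proof (intro set_multI)
    show "g \<in> ?G" using gensI(6)[of "st t" "st t" t] g(1) by blast
    show "d \<in> ?G" using gensI(5) d(1) by blast
    show "inv f \<in> ?G" using gensI(7)[OF n] wf(2) by (intro gensI(4)) blast
    show "inv k \<in> ?G" using gensI(8)[OF n] k(1) by (intro gensI(4)) blast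
    show "e \<in> ?G" using gensI(6)[OF n] e(1) by blast
  qed
  ultimately show ?thesis by (rule bexI)
qed

text \<open>Every point of a touched class has an anchor in \<open>A t\<close>, and the anchors
  along a path form a path in \<open>A t\<close> at scale \<open>Sg t\<close>, where
  \<open>A t\<close> is bounded. There is no circularity: the lengths of the anchors are measured by
  the bounds \<open>xi t\<close> of the stage before.\<close>

lemma bounded_low:
  assumes b: "bounded_stage t" and n: "n \<le> st t" and xy: "(x, y) \<in> E (Suc t) n"
  shows "\<exists>g\<in>xi (Suc t) n. y = \<phi> g x"
  using E_Suc_cases[OF xy]
proof
  assume "(x, y) \<in> E t n"
  then show ?thesis using boundedD[OF b] xi_mono by blast
next
  let ?G = "gens (xi t) (st t)"
  assume "touched t n x \<and> touched t n y"
  then have tx: "touched t n x" by blast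
  obtain \<alpha> where \<alpha>: "\<alpha> \<in> anch (xi t) (st t)" "\<phi> \<alpha> x \<in> A t" using touched_anchor[OF b n tx] by blast
  have xs: "x \<in> space X" by (rule E_path(1)[OF xy])
  have "(x, y) \<in> (R (Suc t) n \<union> (R (Suc t) n)\<inverse>)\<^sup>*" by (rule E_path(2)[OF xy])
  then have "\<exists>\<beta>\<in>anch (xi t) (st t). (\<phi> \<alpha> x, \<phi> \<beta> y) \<in> (step \<phi> (Sg t) (A t))\<^sup>*"
  proof (induction rule: rtrancl_induct)
    case base
    show ?case by (rule bexI[OF _ \<alpha>(1)]) simp
  next
    case (step y z)
    then obtain \<beta> where \<beta>: "\<beta> \<in> anch (xi t) (st t)" "(\<phi> \<alpha> x, \<phi> \<beta> y) \<in> (step \<phi> (Sg t) (A t))\<^sup>*" by blast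
    have xy: "(x, y) \<in> E (Suc t) n" by (rule E_I[OF xs step(1)])
    have yz: "(y, z) \<in> E (Suc t) n" by (rule E_R[OF step(2)])
    have ys: "y \<in> space X" by (rule E_path(1)[OF yz])
    have "touched t n z" by (rule touched_E_Suc[OF tx E_trans[OF xy yz]])
    from touched_anchor[OF b n this] obtain \<beta>' where \<beta>': "\<beta>' \<in> anch (xi t) (st t)" "\<phi> \<beta>' z \<in> A t" by blast
    obtain l where l: "l \<in> ?G" "z = \<phi> l y"
    proof -
      from step(2) consider "(y, z) \<in> R t n \<union> (R t n)\<inverse>" | "(y, z) \<in> edge t n" | "(z, y) \<in> edge t n"
        by (auto simp: R_Suc)
      then show ?thesis
      proof cases
        case 1
        then obtain g where "g \<in> xi t n" "z = \<phi> g y" using boundedD[OF b E_R] by blast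
        then show ?thesis using that gensI(6)[OF n] by blast
      next
        case 2
        then obtain h where "h \<in> hop (st t) n" "z = \<phi> h y" by (rule edgeE)
        then show ?thesis using that gensI(8)[OF n] by blast
      next
        case 3
        then obtain h where h: "h \<in> hop (st t) n" "y = \<phi> h z" "z \<in> space X" by (rule edgeE)
        then have "z = \<phi> (inv h) y" using carrierI(3) by simp
        moreover have "inv h \<in> ?G" using gensI(8)[OF n] h(1) by (intro gensI(4)) blast
        ultimately show ?thesis by (intro that)
      qed
    qed
    have c: "l \<in> carrier \<Gamma>" "\<beta> \<in> carrier \<Gamma>" "\<beta>' \<in> carrier \<Gamma>"
      using l(1) gensI(2) \<beta>(1) \<beta>'(1) anchI(2) H_carrier by blast+
    have "\<phi> \<beta>' z = \<phi> (\<beta>' \<otimes> l \<otimes> inv \<beta>) (\<phi> \<beta> y)" unfolding l(2) using c ys by (simp add: m_assoc)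
    moreover have "\<beta>' \<otimes> l \<otimes> inv \<beta> \<in> Sg t" unfolding scale_def
      by (intro set_multI \<beta>'(1) l(1) anchI(5) \<beta>(1))
    moreover have "\<phi> \<beta> y \<in> A t" by (rule step_rtrancl_in[OF \<beta>(2) \<alpha>(2)])
    ultimately have "(\<phi> \<beta> y, \<phi> \<beta>' z) \<in> step \<phi> (Sg t) (A t)" using \<beta>'(2) by (intro stepI)
    with \<beta>(2) have "(\<phi> \<alpha> x, \<phi> \<beta>' z) \<in> (step \<phi> (Sg t) (A t))\<^sup>*" by (rule rtrancl_into_rtrancl)
    then show ?case using \<beta>'(1) by (rule bexI)
  qed
  then obtain \<beta> where \<beta>: "\<beta> \<in> anch (xi t) (st t)" "(\<phi> \<alpha> x, \<phi> \<beta> y) \<in> (step \<phi> (Sg t) (A t))\<^sup>*" by blast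
  obtain u where u: "u \<in> \<tau> t (Sg t)" "\<phi> \<beta> y = \<phi> u (\<phi> \<alpha> x)" using bddD[OF A(2) \<alpha>(2) \<beta>(2)] by blast
  have "u \<in> H (st t)" using u(1) \<tau>[OF anchI(3,4)] by blast
  then have c: "u \<in> carrier \<Gamma>" "\<alpha> \<in> carrier \<Gamma>" "\<beta> \<in> carrier \<Gamma>" using \<alpha>(1) \<beta>(1) anchI(2) H_carrier by blast+
  have ys: "y \<in> space X" by (rule E_space[OF xy])
  have "y = \<phi> (inv \<beta>) (\<phi> \<beta> y)" using c ys by simp
  also have "\<dots> = \<phi> (inv \<beta> \<otimes> u \<otimes> \<alpha>) x" unfolding u(2) using c xs by (simp add: m_assoc)
  finally have y: "y = \<phi> (inv \<beta> \<otimes> u \<otimes> \<alpha>) x" .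
  \<comment> \<open>By freeness the element found above is the one of \<open>H n\<close> that moves
    \<open>x\<close> to \<open>y\<close>, so the intersection with \<open>H n\<close> in
    \<open>xi\<close> loses nothing.\<close>
  obtain g where g: "g \<in> H n" "y = \<phi> g x" using E_orbit[OF xy] by blast
  have "inv \<beta> \<otimes> u \<otimes> \<alpha> = g"
    by (rule act_eqD[of _ _ x]) (use c g xs y carrierI(1) in auto)
  then have "inv \<beta> \<otimes> u \<otimes> \<alpha> \<in> H n" using g(1) by simp
  moreover have "inv \<beta> \<otimes> u \<otimes> \<alpha> \<in> anch (xi t) (st t) <#> \<tau> t (Sg t) <#> anch (xi t) (st t)"
    by (intro set_multI anchI(5) \<beta>(1) u(1) \<alpha>(1))
  ultimately have "inv \<beta> \<otimes> u \<otimes> \<alpha> \<in> xi (Suc t) n" using n by (simp add: Let_def)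
  with y show ?thesis by (rule bexI)
qed

lemma xi_Suc_high: "st t < n \<Longrightarrow> xi (Suc t) (st t) \<subseteq> xi (Suc t) n"
  by (auto simp: Let_def)

lemma touched_low:
  assumes av: "avoid_stage t" and n: "st t < n" and y: "touched t n y" and yz: "(y, z) \<in> E t n"
  shows "(y, z) \<in> E t (st t)" "\<exists>u\<in>DW t. (u, y) \<in> E t (st t)"
proof -
  obtain u where u: "u \<in> Field (edge t n)" "(y, u) \<in> E t n" using y unfolding touched_def by blast
  have ud: "u \<in> DW t" using Field_DW[OF _ u(1)] n by simp
  have uy: "(u, y) \<in> E t n" by (rule E_sym[OF u(2)])
  have 1: "(u, y) \<in> E t (st t)" by (rule E_low[OF av n ud uy])
  moreover have "(u, z) \<in> E t (st t)" by (rule E_low[OF av n ud E_trans[OF uy yz]])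
  ultimately show "(y, z) \<in> E t (st t)" using E_sym E_trans by blast
  show "\<exists>u\<in>DW t. (u, y) \<in> E t (st t)" using ud 1 by blast
qed

text \<open>Above level \<open>st t\<close>, a touched class is held together by old classes and new
  links that all occur at level \<open>st t\<close> as well, so the bound for that level
  applies.\<close>

lemma bounded_Suc:
  assumes b: "bounded_stage t" and av: "avoid_stage t"
  shows "bounded_stage (Suc t)"
  unfolding bounded_stage_def
proof (intro allI impI)
  fix n x y assume xy: "(x, y) \<in> E (Suc t) n"
  show "\<exists>g\<in>xi (Suc t) n. y = \<phi> g x"
  proof (cases "n \<le> st t")
    case True
    then show ?thesis by (rule bounded_low[OF b _ xy])
  next
    case False
    then have n: "st t < n" by simp
    from E_Suc_cases[OF xy] show ?thesis
    proof
      assume "(x, y) \<in> E t n"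
      then show ?thesis using boundedD[OF b] xi_mono by blast
    next
      assume "touched t n x \<and> touched t n y"
      then have tx: "touched t n x" by blast
      have xs: "x \<in> space X" by (rule E_path(1)[OF xy])
      have "(x, y) \<in> (R (Suc t) n \<union> (R (Suc t) n)\<inverse>)\<^sup>*" by (rule E_path(2)[OF xy])
      then have "(x, y) \<in> E (Suc t) (st t)"
      proof (induction rule: rtrancl_induct)
        case base show ?case by (rule E_refl[OF xs])
      next
        case (step y z)
        have xy: "(x, y) \<in> E (Suc t) n" by (rule E_I[OF xs step(1)])
        have ty: "touched t n y" by (rule touched_E_Suc[OF tx xy])
        from step(2) consider "(y, z) \<in> R t n \<union> (R t n)\<inverse>" | "(y, z) \<in> edge t n \<union> (edge t n)\<inverse>"
          by (auto simp: R_Suc)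
        then have "(y, z) \<in> E (Suc t) (st t)"
        proof cases
          case 1
          then have "(y, z) \<in> E t n" by (rule E_R)
          then show ?thesis using touched_low(1)[OF av n ty] E_mono by blast
        next
          case 2
          then have "(y, z) \<in> edge t (st t) \<union> (edge t (st t))\<inverse>" using n by (simp add: edge_ge)
          then show ?thesis using E_edge[of t "Suc t" _ _ "st t"] E_sym by blast
        qed
        with step(3) show ?case by (rule E_trans)
      qed
      from bounded_low[OF b order_refl this] show ?thesis using xi_Suc_high[OF n] by blast
    qed
  qed
qed

text \<open>A point of a touched class is separated from \<open>W t\<close> by a class bound, a hop
  and a neighbourhood. This is the product by which \<open>expand\<close> grows from one level to
  the next, so the point falls into the neighbourhood linked at any lower level. Above
  \<open>st t\<close> the class is viewed at level \<open>st t\<close>; there, if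
  \<open>p \<ge> st t\<close>, the assumed link from a level above \<open>p\<close> would contradict
  \<open>DW_avoid\<close>.\<close>

lemma avoid_Suc:
  assumes b: "bounded_stage t" and av: "avoid_stage t"
  shows "avoid_stage (Suc t)"
  unfolding avoid_stage_def
proof (intro allI impI)
  fix n p s z z' y
  assume *: "p < n \<and> s < Suc t \<and> p < st s \<and> (z, z') \<in> edge s n \<and> (z, y) \<in> E (Suc t) n"
  have near: "y' \<in> avoid (Suc t) p" if "m \<le> st t" "p < m" "e \<in> xi t m" "h \<in> D m <#> D m"
     "f \<in> expand (xi t) (st t) (st t - m)" "w \<in> W t" "y' = \<phi> (e \<otimes> h \<otimes> f) w" for m e h f w y'
  proof -
    have "e \<otimes> h \<otimes> f \<in> xi t m <#> (D m <#> D m) <#> expand (xi t) (st t) (st t - m)"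
      using that by (intro set_multI)
    moreover have "st t - (st t - m) = m" using that(1) by simp
    ultimately have "e \<otimes> h \<otimes> f \<in> expand (xi t) (st t) (Suc (st t - m))" by simp
    \<comment> \<open>The strict inequality \<open>p < m\<close> leaves room for the extra
      layer.\<close>
    moreover have "Suc (st t - m) \<le> st t - p" using that by simp
    ultimately have "e \<otimes> h \<otimes> f \<in> expand (xi t) (st t) (st t - p)" using expand_mono by blast
    moreover have "t \<in> {s. s < Suc t \<and> p < st s}" using that(1,2) by simp
    ultimately show ?thesis unfolding avoid_def that(7) using that(6) by blast
  qed
  show "y \<in> avoid (Suc t) p"
  proof (cases "s < t \<and> (z, y) \<in> E t n")
    case True
    then have "y \<in> avoid t p" using * avoidD[OF av, of p n s z z' y] by blast
    then show ?thesis using avoid_mono by blast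
  next
    case False
    have tz: "touched t n z"
    proof (cases "s < t")
      case True
      then show ?thesis using False * E_Suc_cases by blast
    next
      case sF: False
      then have "s = t" using * by simp
      then have "z \<in> Field (edge t n)" using * by (auto simp: Field_def)
      then show ?thesis by (rule touched_Field)
    qed
    have ty: "touched t n y" using touched_E_Suc[OF tz] * by blast
    show ?thesis
    proof (cases "n \<le> st t")
      case n: True
      obtain u where u: "u \<in> Field (edge t n)" "(y, u) \<in> E t n" using ty unfolding touched_def by blast
      obtain e where e: "e \<in> xi t n" "y = \<phi> e u" using boundedD[OF b E_sym[OF u(2)]] by blast
      obtain a a' where aa: "(a, a') \<in> edge t n" "u = a \<or> u = a'" using u(1) unfolding Field_def by blast
      obtain w f h where wf: "w \<in> W t" "f \<in> expand (xi t) (st t) (st t - n)" "h \<in> hop (st t) n" "a = \<phi> f w"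
        "a' = \<phi> h a" "w \<in> space X" "a \<in> space X"
        by (rule edgeE[OF aa(1)])
      obtain k where k: "k \<in> hop (st t) n" "u = \<phi> k a"
      proof (cases "u = a")
        case True
        then show ?thesis using that[of \<one>] hop(4) wf(7) by simp
      next
        case False
        then show ?thesis using that[OF wf(3)] aa(2) wf(5) by simp
      qed
      have c: "e \<in> carrier \<Gamma>" "k \<in> carrier \<Gamma>" "f \<in> carrier \<Gamma>" using e k wf carrierI by blast+
      have "y = \<phi> (e \<otimes> k \<otimes> f) w" unfolding e(2) k(2) wf(4) using c wf(6) by (simp add: m_assoc)
      then show ?thesis using near[OF n _ e(1) _ wf(2,1)] k(1) hop_sub[OF n] * by blast
    next
      case False
      then have n: "st t < n" by simp
      show ?thesis
      proof (cases "p < st t")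
        case True
        have "y \<in> space X" using * E_space by blast
        then obtain u where u: "u \<in> DW t" "(u, y) \<in> E t (st t)"
          using touched_low(2)[OF av n ty E_refl] by blast
        obtain e where e: "e \<in> xi t (st t)" "y = \<phi> e u" using boundedD[OF b u(2)] by blast
        obtain w h where w: "w \<in> W t" "h \<in> D (st t)" "u = \<phi> h w" "w \<in> space X" by (rule DW_near[OF u(1)])
        have c: "e \<in> carrier \<Gamma>" "h \<in> carrier \<Gamma>" using e w carrierI by blast+
        have "y = \<phi> (e \<otimes> h \<otimes> \<one>) w" unfolding e(2) w(3) using c w(4) by simp
        moreover have "h \<in> D (st t) <#> D (st t)" using w(2) hop_sub[of "st t" "st t"] by (auto simp: hop_def)
        ultimately show ?thesis using near[OF order_refl True e(1) _ _ w(1)] by (simp add: one_expand)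
      next
        case False
        have "s \<noteq> t" using * False by auto
        then have s: "s < t" "st t < st s" using * False by auto
        obtain u where u: "u \<in> Field (edge t n)" "(z, u) \<in> E t n" using tz unfolding touched_def by blast
        have "u \<in> DW t" using Field_DW[OF _ u(1)] n by simp
        moreover have "u \<in> avoid t (st t)" using avoidD[OF av n s] * u(2) by blast
        ultimately show ?thesis using DW_avoid by blast
      qed
    qed
  qed
qed

lemma stages: "bounded_stage t \<and> avoid_stage t"
proof (induction t)
  case 0
  have "E 0 n = Id_on (space X)" for n by (simp add: E_def cls_def)
  then show ?case by (auto simp: bounded_stage_def avoid_stage_def)
qed (use bounded_Suc avoid_Suc in blast)

text \<open>Each point of \<open>Ah t\<close> shares a class with a point of \<open>A t\<close>, so
  a path in \<open>Ah t\<close> is shadowed by a path in \<open>A t\<close> at scale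
  \<open>Sg t\<close>.\<close>

lemma Ah_bdd: "\<exists>T. finite T \<and> bdd \<phi> (D (st t)) (Ah t) T"
proof -
  let ?G = "gens (xi t) (st t)"
  note b = conjunct1[OF stages[of t]]
  define T where "T = (m_inv \<Gamma>) ` ?G <#> \<tau> t (Sg t) <#> ?G"
  have "finite T" unfolding T_def using gensI(1) \<tau>[OF anchI(3,4)] by (intro finite_set_mult finite_imageI) auto
  moreover have "bdd \<phi> (D (st t)) (Ah t) T"
    unfolding bdd_def
  proof (intro allI impI)
    fix x y assume xy: "x \<in> Ah t \<and> (x, y) \<in> (step \<phi> (D (st t)) (Ah t))\<^sup>*"
    have near: "\<exists>e\<in>?G. \<phi> e y \<in> A t" if "y \<in> Ah t" for y
    proof -
      obtain a where a: "a \<in> A t" "(y, a) \<in> E t (st t)" using \<open>y \<in> Ah t\<close> unfolding Ah_iff by blast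
      obtain e where "e \<in> xi t (st t)" "a = \<phi> e y" using boundedD[OF b a(2)] by blast
      then show ?thesis using gensI(6)[of "st t" "st t" t] a(1) by blast
    qed
    have Asp: "y \<in> space X" if "y \<in> Ah t" for y using that E_path(1) unfolding Ah_iff by blast
    obtain e where e: "e \<in> ?G" "\<phi> e x \<in> A t" using near xy by blast
    have "(x, y) \<in> (step \<phi> (D (st t)) (Ah t))\<^sup>*" using xy by blast
    then have "y \<in> Ah t \<and> (\<exists>e'\<in>?G. (\<phi> e x, \<phi> e' y) \<in> (step \<phi> (Sg t) (A t))\<^sup>*)"
    proof (induction rule: rtrancl_induct)
      case base
      show ?case using xy e(1) by blast
    next
      case (step y z)
      then obtain e' where e': "e' \<in> ?G" "(\<phi> e x, \<phi> e' y) \<in> (step \<phi> (Sg t) (A t))\<^sup>*" by blast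
      obtain d where d: "d \<in> D (st t)" "z = \<phi> d y" "z \<in> Ah t" "y \<in> Ah t" using step(2) by (auto simp: step_def)
      obtain e'' where e'': "e'' \<in> ?G" "\<phi> e'' z \<in> A t" using near[OF d(3)] by blast
      have c: "e' \<in> carrier \<Gamma>" "e'' \<in> carrier \<Gamma>" "d \<in> carrier \<Gamma>"
        using e'(1) e''(1) gensI(2) H_carrier d(1) carrierI by blast+
      have m: "\<one> \<in> ?G" by (rule gensI(3))
      \<comment> \<open>A single class bound is padded with units to the five factors of
        \<open>anch\<close>.\<close>
      have "\<one> \<otimes> \<one> \<otimes> \<one> \<otimes> \<one> \<otimes> e'' \<in> anch (xi t) (st t)" unfolding anch_def by (intro set_multI m e''(1))
      then have a1: "e'' \<in> anch (xi t) (st t)" using c by simp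
      have "\<one> \<otimes> \<one> \<otimes> \<one> \<otimes> \<one> \<otimes> e' \<in> anch (xi t) (st t)" unfolding anch_def by (intro set_multI m e'(1))
      then have a2: "e' \<in> anch (xi t) (st t)" using c by simp
      have "d \<in> ?G" using d(1) gensI(5) by blast
      then have "e'' \<otimes> d \<otimes> inv e' \<in> Sg t" unfolding scale_def by (intro set_multI a1 anchI(5) a2)
      moreover have "\<phi> e'' z = \<phi> (e'' \<otimes> d \<otimes> inv e') (\<phi> e' y)" unfolding d(2) using c Asp[OF d(4)] by (simp add: m_assoc)
      moreover have "\<phi> e' y \<in> A t" by (rule step_rtrancl_in[OF e'(2) e(2)])
      ultimately have "(\<phi> e' y, \<phi> e'' z) \<in> step \<phi> (Sg t) (A t)" using e''(2) by (intro stepI)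
      with e'(2) have "(\<phi> e x, \<phi> e'' z) \<in> (step \<phi> (Sg t) (A t))\<^sup>*" by (rule rtrancl_into_rtrancl)
      then show ?case using e''(1) d(3) by blast
    qed
    then obtain e' where e': "e' \<in> ?G" "(\<phi> e x, \<phi> e' y) \<in> (step \<phi> (Sg t) (A t))\<^sup>*" "y \<in> Ah t" by blast
    obtain u where u: "u \<in> \<tau> t (Sg t)" "\<phi> e' y = \<phi> u (\<phi> e x)" using bddD[OF A(2) e(2) e'(2)] by blast
    have "u \<in> H (st t)" using u(1) \<tau>[OF anchI(3,4)] by blast
    then have c: "u \<in> carrier \<Gamma>" "e \<in> carrier \<Gamma>" "e' \<in> carrier \<Gamma>" using e(1) e'(1) gensI(2) H_carrier by blast+
    have "y = \<phi> (inv e') (\<phi> e' y)" using c Asp[OF e'(3)] by simp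
    also have "\<dots> = \<phi> (inv e' \<otimes> u \<otimes> e) x" unfolding u(2) using c Asp xy by (simp add: m_assoc)
    finally have "y = \<phi> (inv e' \<otimes> u \<otimes> e) x" .
    moreover have "inv e' \<otimes> u \<otimes> e \<in> T" unfolding T_def using e'(1) by (intro set_multI imageI u(1) e(1))
    ultimately show "\<exists>t\<in>T. y = \<phi> t x" by (rule bexI)
  qed
  ultimately show ?thesis by blast
qed

text \<open>The earlier set cuts the pair, so \<open>x\<close> is one of its boundary points and the
  pair gets linked at level \<open>st t\<close>. The later set is saturated under these links and
  cannot separate the pair.\<close>

lemma cut_once:
  assumes s: "s < t" "st s \<noteq> st t" and d: "d \<in> D (min (st s) (st t))" and x: "x \<in> space X"
    and cut: "(x \<in> Ah s) \<noteq> (\<phi> d x \<in> Ah s)"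
  shows "x \<in> Ah t \<longleftrightarrow> \<phi> d x \<in> Ah t"
proof -
  have d2: "d \<in> D (st s)" "d \<in> D (st t)" using d D_mono[of "min (st s) (st t)" "st s"] D_mono[of "min (st s) (st t)" "st t"] by auto
  have "x \<in> W s" using x cut d2(1) by (auto simp: W_def bnd_def)
  moreover have "d \<in> hop (st s) (st t)"
    using d2 hop_sub[of "st t" "st t"] by (auto simp: hop_def)
  ultimately have "(\<phi> \<one> x, \<phi> d (\<phi> \<one> x)) \<in> edge s (st t)" by (intro edgeI one_expand)
  then have "(x, \<phi> d x) \<in> edge s (st t)" using x by simp
  from Ah_sat[OF E_edge[OF s(1) this]] show ?thesis .
qed

section \<open>Borel measurability of the stages, and the partitions of the levels\<close>

lemma bor_cls: "bor r \<Longrightarrow> bor (cls r)"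
  unfolding cls_def by (intro bor_rtrancl bor_Un bor_converse)

lemma sat_sets: "bor r \<Longrightarrow> sat t r \<in> sets X"
  unfolding sat_def by (rule bor_vimage[OF bor_cls A(1)])

lemma bnd_sets: "B \<in> sets X \<Longrightarrow> bnd t B \<in> sets X"
proof -
  assume B: "B \<in> sets X"
  have Bs: "B \<subseteq> space X" using B sets.sets_into_space by blast
  have "bnd t B = (\<Union>h\<in>D (st t). (B - {x \<in> space X. \<phi> h x \<in> B}) \<union> ({x \<in> space X. \<phi> h x \<in> B} - B))"
    using Bs by (auto simp: bnd_def)
  also have "\<dots> \<in> sets X" using B D(1) carrierI(2)
    by (intro sets.finite_UN sets.Un sets.Diff act_vimage) auto
  finally show ?thesis .
qed

lemma links_bor: "B \<in> sets X \<Longrightarrow> bor (links t n B)"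
  unfolding links_def
  using expand_props(1)[of "xi t", OF xif xiH] carrierI(3,5) sets.top[of X]
  by (intro bor_graph sets.finite_UN act_image_sets) auto

lemma R_bor: "bor (R t n)"
proof (induction t arbitrary: n)
  case 0
  show ?case by (simp add: bor_def)
next
  case (Suc t)
  show ?case unfolding R.simps(2) by (intro bor_Un Suc links_bor bnd_sets sat_sets)
qed

lemma Ah_sets: "Ah t \<in> sets X"
  unfolding Ah_def by (intro sat_sets R_bor)

text \<open>The parts of different levels cut a given pair \<open>(x, \<phi> g x)\<close> at most once, since the boundaries are
  disjoint; so the intersections of tails of the sequence of parts exhaust the orbit equivalence.\<close>

definition lev :: "nat \<Rightarrow> 'x set" where
  "lev t = Ah t - (\<Union>s\<in>{s. s < t \<and> st s = st t}. Ah s)"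

definition parts :: "nat \<Rightarrow> ('x \<times> 'x) set" where
  "parts n = Id_on (space X) O (\<Union>t\<in>{t. st t = n}. step \<phi> (D n) (lev t))\<^sup>*"

lemma lev_sets: "lev t \<in> sets X"
  unfolding lev_def by (intro sets.Diff sets.finite_UN Ah_sets) auto

lemma lev_space: "lev t \<subseteq> space X"
  using lev_sets sets.sets_into_space by blast

lemma lev_disjoint: "x \<in> lev s \<Longrightarrow> x \<in> lev t \<Longrightarrow> st s = st t \<Longrightarrow> s = t"
  by (cases s t rule: linorder_cases) (auto simp: lev_def)

lemma lev_cov:
  assumes "x \<in> space X" obtains t where "st t = n" "x \<in> lev t"
proof -
  have ex: "\<exists>t. st t = n \<and> x \<in> Ah t" using A_cov[OF assms, of n] A_Ah by blast
  define t where "t = (LEAST t. st t = n \<and> x \<in> Ah t)"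
  have "st t = n \<and> x \<in> Ah t" unfolding t_def by (rule LeastI_ex[OF ex])
  moreover have "\<not> (st s = n \<and> x \<in> Ah s)" if "s < t" for s using that unfolding t_def by (rule not_less_Least)
  ultimately show ?thesis by (intro that[of t]) (auto simp: lev_def)
qed

lemma parts_bor: "bor (parts n)"
  unfolding parts_def using D_carrier lev_sets by (intro bor_rtrancl bor_UN bor_step) auto

lemma parts_equiv: "equiv (space X) (parts n)"
proof (rule equivI)
  show "parts n \<subseteq> space X \<times> space X" using borD[OF parts_bor] by fast
  show "refl_on (space X) (parts n)" by (auto simp: refl_on_def parts_def)
  let ?r = "\<Union>t\<in>{t. st t = n}. step \<phi> (D n) (lev t)"
  have "sym ?r"
  proof (rule symI)
    fix x y assume "(x, y) \<in> ?r"
    then obtain t where t: "st t = n" "(x, y) \<in> step \<phi> (D n) (lev t)" by blast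
    then obtain d where d: "d \<in> D n" "y = \<phi> d x" "x \<in> lev t" "y \<in> lev t" by (auto simp: step_def)
    then have "x = \<phi> (inv d) y" using lev_space carrierI(2) by (simp add: subset_iff)
    then have "(y, x) \<in> step \<phi> (D n) (lev t)" using d D(5)[OF d(1)] by (intro stepI)
    then show "(y, x) \<in> ?r" using t(1) by blast
  qed
  then have "sym (?r\<^sup>*)" by (rule sym_rtrancl)
  show "sym (parts n)"
  proof (rule symI)
    fix x y assume xy: "(x, y) \<in> parts n"
    then have "(y, x) \<in> ?r\<^sup>*" using \<open>sym (?r\<^sup>*)\<close> by (auto simp: parts_def dest: symD)
    moreover have "y \<in> space X" using borD[OF parts_bor xy] by blast
    ultimately show "(y, x) \<in> parts n" by (auto simp: parts_def)
  qed
  show "trans (parts n)" by (rule transI) (auto simp: parts_def)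
qed

lemma parts_finite: "finite (parts n `` {x})"
proof (cases "x \<in> space X")
  case False
  then have "parts n `` {x} = {}" by (auto simp: parts_def)
  then show ?thesis by simp
next
  case True
  obtain t where t: "st t = n" "x \<in> lev t" by (rule lev_cov[OF True])
  obtain T where T: "finite T" "bdd \<phi> (D n) (Ah t) T" using Ah_bdd[of t] t(1) by blast
  have "parts n `` {x} \<subseteq> (\<lambda>g. \<phi> g x) ` T"
  proof
    fix y assume "y \<in> parts n `` {x}"
    then have "(x, y) \<in> (\<Union>t\<in>{t. st t = n}. step \<phi> (D n) (lev t))\<^sup>*" by (auto simp: parts_def)
    \<comment> \<open>The parts of one level are disjoint, so a path through them never leaves the
      part in which it starts.\<close>
    then have "y \<in> lev t \<and> (x, y) \<in> (step \<phi> (D n) (lev t))\<^sup>*"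
    proof (induction rule: rtrancl_induct)
      case base show ?case using t(2) by simp
    next
      case (step y z)
      then obtain t' where t': "st t' = n" "(y, z) \<in> step \<phi> (D n) (lev t')" by blast
      then have yz: "y \<in> lev t'" "z \<in> lev t'" by (auto simp: step_def)
      then have "t' = t" using step(3) t(1) t'(1) lev_disjoint by blast
      then show ?case using step(3) t'(2) yz(2) by (auto intro: rtrancl_into_rtrancl)
    qed
    then have "(x, y) \<in> (step \<phi> (D n) (lev t))\<^sup>*" by blast
    moreover have "bdd \<phi> (D n) (lev t) T" using T(2) by (rule bdd_mono) (auto simp: lev_def)
    ultimately obtain g where "g \<in> T" "y = \<phi> g x" using bddD t(2) by metis
    then show "y \<in> (\<lambda>g. \<phi> g x) ` T" by blast
  qed
  then show ?thesis using T(1) finite_subset by blast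
qed

lemma parts_cut:
  assumes x: "x \<in> space X" and d: "d \<in> D n" and "(x, \<phi> d x) \<notin> parts n"
  shows "\<exists>t. st t = n \<and> (x \<in> Ah t) \<noteq> (\<phi> d x \<in> Ah t)"
proof (rule ccontr)
  assume "\<not> ?thesis"
  then have *: "\<And>t. st t = n \<Longrightarrow> x \<in> Ah t \<longleftrightarrow> \<phi> d x \<in> Ah t" by blast
  obtain t where t: "st t = n" "x \<in> lev t" by (rule lev_cov[OF x])
  then have "\<phi> d x \<in> lev t" using * by (auto simp: lev_def)
  then have "(x, \<phi> d x) \<in> step \<phi> (D n) (lev t)" using t(2) d by (intro stepI) auto
  then have "(x, \<phi> d x) \<in> parts n" using t(1) x unfolding parts_def by blast
  then show False using assms(3) by blast
qed

lemma parts_cut_once: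
  assumes x: "x \<in> space X" and d: "d \<in> D (min n m)" and nm: "n \<noteq> m"
    and "(x, \<phi> d x) \<notin> parts n" "(x, \<phi> d x) \<notin> parts m"
  shows False
proof -
  have dn: "d \<in> D n" "d \<in> D m" using d D_mono[of "min n m" n] D_mono[of "min n m" m] by auto
  obtain s where s: "st s = n" "(x \<in> Ah s) \<noteq> (\<phi> d x \<in> Ah s)" using parts_cut[OF x dn(1) assms(4)] by blast
  obtain t where t: "st t = m" "(x \<in> Ah t) \<noteq> (\<phi> d x \<in> Ah t)" using parts_cut[OF x dn(2) assms(5)] by blast
  have "s \<noteq> t" using s t nm by auto
  then consider "s < t" | "t < s" by linarith
  then show False
  proof cases
    case 1
    then show False using cut_once[OF 1 _ _ x s(2)] s(1) t nm d by simp
  next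
    case 2
    then show False using cut_once[OF 2 _ _ x t(2)] s t(1) nm d by (simp add: min.commute)
  qed
qed

theorem tower_hyperfinite: "hyperfinite X (orbit_equivalence \<Gamma> X \<phi>)"
proof -
  define F where "F n = (\<Inter>m\<in>{n..}. parts m)" for n
  have Fbor: "bor (F n)" for n unfolding F_def by (intro bor_INT parts_bor) auto
  have Feq: "equiv (space X) (F n)" for n
  proof (rule equivI)
    show "F n \<subseteq> space X \<times> space X" using borD[OF Fbor] by fast
    show "refl_on (space X) (F n)" using parts_equiv by (auto simp: F_def equiv_def refl_on_def)
    show "sym (F n)" using parts_equiv by (auto simp: F_def equiv_def intro!: symI dest: symD)
    have "trans (parts m)" for m using parts_equiv by (simp add: equiv_def)
    then show "trans (F n)" unfolding F_def by (intro trans_INTER ballI)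
  qed
  have Ffin: "finite (F n `` {x})" for n x
    by (rule finite_subset[OF _ parts_finite[of n x]]) (auto simp: F_def)
  have Forb: "orbit_equivalence \<Gamma> X \<phi> = (\<Union>n. F n)"
  proof (intro subset_antisym subsetI)
    fix e assume "e \<in> orbit_equivalence \<Gamma> X \<phi>"
    then obtain x g where x: "x \<in> space X" "g \<in> carrier \<Gamma>" "e = (x, \<phi> g x)" by (auto simp: orbit_equivalence_def)
    obtain n where n: "g \<in> D n" using x(2) D(6) by blast
    \<comment> \<open>\<open>g\<close> belongs to \<open>D a\<close> for all
      \<open>a \<ge> n\<close>, so from level \<open>n\<close> on at most one partition cuts the
      pair.\<close>
    have cut: "a = b" if "n \<le> a" "n \<le> b" "(x, \<phi> g x) \<notin> parts a" "(x, \<phi> g x) \<notin> parts b" for a b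
    proof (rule ccontr)
      assume "a \<noteq> b"
      moreover have "g \<in> D (min a b)" using n D_mono[of n "min a b"] that by auto
      ultimately show False using parts_cut_once[OF x(1)] that by blast
    qed
    show "e \<in> (\<Union>n. F n)"
    proof (cases "\<exists>a\<ge>n. (x, \<phi> g x) \<notin> parts a")
      case True
      then obtain a where a: "n \<le> a" "(x, \<phi> g x) \<notin> parts a" by blast
      have "(x, \<phi> g x) \<in> parts b" if "Suc a \<le> b" for b using cut[OF a(1) _ a(2), of b] that a(1) by fastforce
      then have "e \<in> F (Suc a)" unfolding F_def x(3) by blast
      then show ?thesis by blast
    next
      case False
      then have "e \<in> F n" unfolding F_def x(3) by blast
      then show ?thesis by blast
    qed
  next
    fix e assume "e \<in> (\<Union>n. F n)"
    then obtain n where n: "e \<in> F n" by blast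
    obtain x y where e: "e = (x, y)" by (cases e)
    then have "x \<in> space X" "y \<in> space X" "\<exists>g\<in>carrier \<Gamma>. y = \<phi> g x" using borD[OF Fbor] n by blast+
    then show "e \<in> orbit_equivalence \<Gamma> X \<phi>" unfolding orbit_equivalence_def e by auto
  qed
  have inc: "incseq F"
    unfolding F_def by (rule incseq_SucI) (intro INT_anti_mono, auto)
  have "equiv (space X) (orbit_equivalence \<Gamma> X \<phi>)"
  proof (rule equivI)
    show "orbit_equivalence \<Gamma> X \<phi> \<subseteq> space X \<times> space X" by (auto simp: orbit_equivalence_def)
    show "refl_on (space X) (orbit_equivalence \<Gamma> X \<phi>)"
      by (auto simp: orbit_equivalence_def refl_on_def intro!: bexI[of _ \<one>])
    show "sym (orbit_equivalence \<Gamma> X \<phi>)"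
      by (rule symI) (auto simp: orbit_equivalence_def intro!: bexI[of _ "inv _"])
    show "trans (orbit_equivalence \<Gamma> X \<phi>)"
    proof (rule transI)
      fix x y z assume "(x, y) \<in> orbit_equivalence \<Gamma> X \<phi>" "(y, z) \<in> orbit_equivalence \<Gamma> X \<phi>"
      then obtain g h where "g \<in> carrier \<Gamma>" "h \<in> carrier \<Gamma>" "x \<in> space X" "y = \<phi> g x" "z = \<phi> h y"
        by (auto simp: orbit_equivalence_def)
      then show "(x, z) \<in> orbit_equivalence \<Gamma> X \<phi>"
        by (auto simp: orbit_equivalence_def intro!: bexI[of _ "h \<otimes> g"])
    qed
  qed
  then show ?thesis unfolding hyperfinite_def borel_equivalence_def finite_classes_def
    using inc Feq Fbor bor_pair_sets Ffin Forb by blast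
qed

end

section \<open>Hyperfiniteness of increasing unions\<close>

context free_borel_action
begin

theorem hyperfinite_union:
  assumes H: "\<And>n. subgroup (H n) \<Gamma>" "incseq H" "carrier \<Gamma> = (\<Union>n. H n)"
    and ad: "\<And>n. adim X \<phi> (H n) (k n)"
  shows "hyperfinite X (orbit_equivalence \<Gamma> X \<phi>)"
proof -
  have nc: "carrier \<Gamma> \<noteq> {}" by auto
  define e where "e = from_nat_into (carrier \<Gamma>)"
  define D where "D n = insert \<one> ({e i | i. i \<le> n \<and> e i \<in> H n} \<union> {inv (e i) | i. i \<le> n \<and> e i \<in> H n})" for n
  \<comment> \<open>Every level is the first component of infinitely many pairs, hence treated
    infinitely often.\<close>
  define st where "st t = fst (prod_decode t)" for t
  have inf: "infinite {t. st t = n}" for n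
  proof -
    have "(\<lambda>m. prod_encode (n, m)) ` UNIV \<subseteq> {t. st t = n}" by (auto simp: st_def)
    moreover have "inj (\<lambda>m. prod_encode (n, m))" by (auto simp: inj_on_def)
    ultimately show ?thesis using finite_imageD finite_subset infinite_UNIV_nat by metis
  qed
  have Hm: "m \<le> n \<Longrightarrow> H m \<subseteq> H n" for m n using H(2) by (auto dest: incseqD)
  have ec: "e i \<in> carrier \<Gamma>" for i unfolding e_def by (rule from_nat_into[OF nc])
  have "\<forall>n. \<exists>\<tau>. (\<forall>t S. finite S \<and> S \<subseteq> H n \<longrightarrow> finite (\<tau> t S) \<and> \<tau> t S \<subseteq> H n) \<and>
    (\<forall>\<Sigma>. (\<forall>t. finite (\<Sigma> t) \<and> \<Sigma> t \<subseteq> H n) \<longrightarrow>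
       (\<exists>A. (\<forall>t. A t \<in> sets X \<and> bdd \<phi> (\<Sigma> t) (A t) (\<tau> t (\<Sigma> t))) \<and> (\<forall>x\<in>space X. \<exists>t\<in>{t. st t = n}. x \<in> A t)))"
    using infinitely_often[OF H(1) ad inf] by (intro allI)
  from choice[OF this] obtain \<tau> where \<tau>: "\<forall>n. (\<forall>t S. finite S \<and> S \<subseteq> H n \<longrightarrow> finite (\<tau> n t S) \<and> \<tau> n t S \<subseteq> H n) \<and>
    (\<forall>\<Sigma>. (\<forall>t. finite (\<Sigma> t) \<and> \<Sigma> t \<subseteq> H n) \<longrightarrow>
       (\<exists>A. (\<forall>t. A t \<in> sets X \<and> bdd \<phi> (\<Sigma> t) (A t) (\<tau> n t (\<Sigma> t))) \<and> (\<forall>x\<in>space X. \<exists>t\<in>{t. st t = n}. x \<in> A t)))"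
    by (elim exE) (rule that)
  interpret T: tower \<Gamma> X \<phi> H D st "\<lambda>t. \<tau> (st t) t"
  proof (intro tower.intro tower_axioms.intro free_borel_action_axioms)
    show "subgroup (H n) \<Gamma>" "incseq H" for n using H by auto
    show "finite (D n)" for n unfolding D_def by auto
    show "D n \<subseteq> H n" for n using subgroup.one_closed[OF H(1)] subgroup.m_inv_closed[OF H(1)] by (auto simp: D_def)
    show "incseq D"
    proof (rule incseq_SucI)
      fix n show "D n \<subseteq> D (Suc n)" using Hm[of n "Suc n"] by (force simp: D_def)
    qed
    show "\<one> \<in> D n" for n by (simp add: D_def)
    show "inv g \<in> D n" if "g \<in> D n" for n g using that ec by (auto simp: D_def)
    show "(\<Union>n. D n) = carrier \<Gamma>"
    proof (intro subset_antisym subsetI)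
      fix g assume "g \<in> (\<Union>n. D n)"
      then show "g \<in> carrier \<Gamma>" using ec by (auto simp: D_def)
    next
      fix g assume g: "g \<in> carrier \<Gamma>"
      obtain i where i: "e i = g" using from_nat_into_surj[OF countable_carrier g] e_def by blast
      obtain m where m: "g \<in> H m" using g H(3) by blast
      have "e i \<in> H (max i m)" using i m Hm[of m "max i m"] by auto
      then have "g \<in> D (max i m)" using i by (auto simp: D_def)
      then show "g \<in> (\<Union>n. D n)" by blast
    qed
    show "finite (\<tau> (st t) t S) \<and> \<tau> (st t) t S \<subseteq> H (st t)" if "finite S" "S \<subseteq> H (st t)" for t S
      using \<tau> that by blast
  qed
  have "\<exists>A. (\<forall>t. A t \<in> sets X \<and> (st t = n \<longrightarrow> bdd \<phi> (T.Sg t) (A t) (\<tau> (st t) t (T.Sg t)))) \<and>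
      (\<forall>x\<in>space X. \<exists>t\<in>{t. st t = n}. x \<in> A t)" for n
  proof -
    \<comment> \<open>For level \<open>n\<close> a scale inside \<open>H n\<close> has to be given
      at every stage; at stages of other levels the empty scale serves.\<close>
    define \<Sigma> where "\<Sigma> t = (if st t = n then T.Sg t else {})" for t
    have "finite (T.Sg t) \<and> T.Sg t \<subseteq> H (st t)" for t
      by (intro conjI T.anch_props(3,4)) (use T.xi_props in auto)
    then have "\<forall>t. finite (\<Sigma> t) \<and> \<Sigma> t \<subseteq> H n" by (auto simp: \<Sigma>_def)
    then have "\<exists>A. (\<forall>t. A t \<in> sets X \<and> bdd \<phi> (\<Sigma> t) (A t) (\<tau> n t (\<Sigma> t))) \<and> (\<forall>x\<in>space X. \<exists>t\<in>{t. st t = n}. x \<in> A t)"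
      using \<tau>[rule_format, of n, THEN conjunct2, rule_format, of \<Sigma>] by simp
    then obtain A where A: "\<forall>t. A t \<in> sets X \<and> bdd \<phi> (\<Sigma> t) (A t) (\<tau> n t (\<Sigma> t))"
      "\<forall>x\<in>space X. \<exists>t\<in>{t. st t = n}. x \<in> A t"
      by (elim exE conjE) (rule that)
    have "bdd \<phi> (T.Sg t) (A t) (\<tau> (st t) t (T.Sg t))" if "st t = n" for t
      using A(1)[rule_format, of t, THEN conjunct2] that by (simp add: \<Sigma>_def)
    then show ?thesis using A by (intro exI[of _ A]) blast
  qed
  then have "\<forall>n. \<exists>A. (\<forall>t. A t \<in> sets X \<and> (st t = n \<longrightarrow> bdd \<phi> (T.Sg t) (A t) (\<tau> (st t) t (T.Sg t)))) \<and>
      (\<forall>x\<in>space X. \<exists>t\<in>{t. st t = n}. x \<in> A t)" by (rule allI)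
  from choice[OF this] obtain A where A: "\<forall>n. (\<forall>t. A n t \<in> sets X \<and> (st t = n \<longrightarrow> bdd \<phi> (T.Sg t) (A n t) (\<tau> (st t) t (T.Sg t)))) \<and>
      (\<forall>x\<in>space X. \<exists>t\<in>{t. st t = n}. x \<in> A n t)" by (elim exE) (rule that)
  interpret TS: tower_sets \<Gamma> X \<phi> H D st "\<lambda>t. \<tau> (st t) t" "\<lambda>t. A (st t) t"
  proof (intro tower_sets.intro tower_sets_axioms.intro T.tower_axioms)
    show "A (st t) t \<in> sets X" for t using A by simp
    show "bdd \<phi> (T.Sg t) (A (st t) t) (\<tau> (st t) t (T.Sg t))" for t using A by simp
    show "\<exists>t. st t = n \<and> x \<in> A (st t) t" if "x \<in> space X" for n x
      using A[rule_format, of n, THEN conjunct2, rule_format, OF that] by auto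
  qed
  show ?thesis by (rule TS.tower_hyperfinite)
qed

section \<open>Packing bounds for the admissible quotients\<close>

text \<open>Moving \<open>b\<close> to the right turns
  \<open>f \<otimes> b \<otimes> s \<otimes> f'\<close> into an element of this form, with the
  conjugate of \<open>s\<close> by \<open>b\<close> in place of \<open>s\<close>, times
  \<open>b\<close>.\<close>

definition reach :: "'a set \<Rightarrow> 'a set \<Rightarrow> 'a \<Rightarrow> 'a set" where
  "reach F S b = (\<lambda>(f, s, f'). f \<otimes> s \<otimes> (b \<otimes> f' \<otimes> inv b)) ` (F \<times> S \<times> F)"

lemma reachE:
  assumes "m \<in> reach F S b"
  obtains f s f' where "f \<in> F" "s \<in> S" "f' \<in> F" "m = f \<otimes> s \<otimes> (b \<otimes> f' \<otimes> inv b)"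
  using assms by (auto simp: reach_def)

lemma reachI: "f \<in> F \<Longrightarrow> s \<in> S \<Longrightarrow> f' \<in> F \<Longrightarrow> f \<otimes> s \<otimes> (b \<otimes> f' \<otimes> inv b) \<in> reach F S b"
  by (auto simp: reach_def intro!: image_eqI[where x="(f, s, f')" for f s f'])

text \<open>Points of the block have the form \<open>m \<otimes> b\<close> with \<open>m\<close> in
  \<open>reach\<close>, and for equal \<open>b\<close> the quotient
  \<open>z' \<otimes> inv z\<close> does not see \<open>b\<close>. A separated set therefore injects
  into pairs of an element of \<open>B'\<close> and a label.\<close>

lemma packing_boundI:
  assumes M: "M \<lhd> \<Gamma>" and B: "finite B" "B \<subseteq> carrier \<Gamma>" and B': "B' = B \<union> (m_inv \<Gamma>) ` B"
    and main: "\<And>S. finite S \<Longrightarrow> S \<subseteq> M \<Longrightarrow> \<exists>F (L::'l set) lab. finite F \<and> F \<subseteq> M \<and> \<one> \<in> F \<and> (\<forall>f\<in>F. inv f \<in> F) \<and>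
       finite L \<and> card L \<le> \<kappa> \<and> (\<forall>b\<in>B'. \<forall>m\<in>reach F S b. lab m \<in> L) \<and>
       (\<forall>b\<in>B'. \<forall>m\<in>reach F S b. \<forall>m'\<in>reach F S b. lab m = lab m' \<longrightarrow> m' \<otimes> inv m \<in> N <#> F)"
  shows "packing_bound N M B (card B' * \<kappa>)"
  unfolding packing_bound_def
proof (intro allI impI)
  interpret M: normal M \<Gamma> by (rule M)
  fix S assume S: "finite S \<and> S \<subseteq> M \<and> \<one> \<in> S"
  have B'c: "B' \<subseteq> carrier \<Gamma>" "finite B'" using B by (auto simp: B')
  \<comment> \<open>The middle factor of a product is the conjugate of \<open>s\<close> by
    \<open>b\<close>; for the inverse of a product it is \<open>inv s\<close>, and
    \<open>inv b\<close> takes the place of \<open>b\<close>.\<close>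
  define S' where "S' = (\<lambda>(b, s). b \<otimes> s \<otimes> inv b) ` (B \<times> S) \<union> (m_inv \<Gamma>) ` S"
  have S': "finite S'" "S' \<subseteq> M" using S B by (auto simp: S'_def intro!: M.inv_op_closed2)
  obtain F and L :: "'l set" and lab where F: "finite F" "F \<subseteq> M" "\<one> \<in> F" "\<forall>f\<in>F. inv f \<in> F"
    and L: "finite L" "card L \<le> \<kappa>" "\<forall>b\<in>B'. \<forall>m\<in>reach F S' b. lab m \<in> L"
    "\<forall>b\<in>B'. \<forall>m\<in>reach F S' b. \<forall>m'\<in>reach F S' b. lab m = lab m' \<longrightarrow> m' \<otimes> inv m \<in> N <#> F"
    using main[OF S'] by (elim exE conjE) (rule that)
  have Fc: "f \<in> carrier \<Gamma>" if "f \<in> F" for f using that F(2) M.subset by blast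
  have Sc: "s \<in> carrier \<Gamma>" if "s \<in> S" for s using that S M.subset by blast
  have S'c: "s \<in> carrier \<Gamma>" if "s \<in> S'" for s using that S'(2) M.subset by blast
  have rc: "reach F S' b \<subseteq> carrier \<Gamma>" if "b \<in> B'" for b
  proof -
    have "b \<in> carrier \<Gamma>" using that B'c by blast
    then show ?thesis using Fc S'c by (auto simp: reach_def)
  qed
  have dec: "\<exists>bm. fst bm \<in> B' \<and> snd bm \<in> reach F S' (fst bm) \<and> z = snd bm \<otimes> fst bm" if z: "z \<in> block F B S" for z
  proof -
    have raw: "\<exists>f b s f'. f \<in> F \<and> b \<in> B \<and> s \<in> S \<and> f' \<in> F \<and> y = f \<otimes> b \<otimes> s \<otimes> f'" if "y \<in> F <#> B <#> S <#> F" for y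
      using that by (elim set_multE) blast
    from z consider "z \<in> F <#> B <#> S <#> F" | y where "y \<in> F <#> B <#> S <#> F" "z = inv y"
      unfolding block_def by blast
    then show ?thesis
    proof cases
      case 1
      then obtain f b s f' where *: "f \<in> F" "b \<in> B" "s \<in> S" "f' \<in> F" "z = f \<otimes> b \<otimes> s \<otimes> f'" using raw by blast
      have c: "b \<in> carrier \<Gamma>" using * B by blast
      have "b \<otimes> s \<otimes> inv b \<in> S'" using * by (auto simp: S'_def)
      then have "f \<otimes> (b \<otimes> s \<otimes> inv b) \<otimes> (b \<otimes> f' \<otimes> inv b) \<in> reach F S' b" using * by (intro reachI)
      moreover have "z = f \<otimes> (b \<otimes> s \<otimes> inv b) \<otimes> (b \<otimes> f' \<otimes> inv b) \<otimes> b"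
        using c Fc[OF *(1)] Fc[OF *(4)] Sc[OF *(3)] *(5) by (simp add: m_assoc)
      ultimately show ?thesis using *(2) by (intro exI[of _ "(b, f \<otimes> (b \<otimes> s \<otimes> inv b) \<otimes> (b \<otimes> f' \<otimes> inv b))"]) (simp add: B')
    next
      case 2
      then obtain f b s f' where *: "f \<in> F" "b \<in> B" "s \<in> S" "f' \<in> F" "y = f \<otimes> b \<otimes> s \<otimes> f'" using raw by blast
      have c: "b \<in> carrier \<Gamma>" using * B by blast
      have "inv s \<in> S'" using * by (auto simp: S'_def)
      then have "inv f' \<otimes> inv s \<otimes> (inv b \<otimes> inv f \<otimes> inv (inv b)) \<in> reach F S' (inv b)" using * F(4) by (intro reachI) auto
      moreover have "z = inv f' \<otimes> inv s \<otimes> (inv b \<otimes> inv f \<otimes> inv (inv b)) \<otimes> inv b"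
        using c Fc[OF *(1)] Fc[OF *(4)] Sc[OF *(3)] *(5) 2(2) by (simp add: m_assoc inv_mult_group)
      ultimately show ?thesis using *(2) by (intro exI[of _ "(inv b, inv f' \<otimes> inv s \<otimes> (inv b \<otimes> inv f \<otimes> inv (inv b)))"]) (simp add: B')
    qed
  qed
  show "\<exists>F. finite F \<and> F \<subseteq> M \<and> \<one> \<in> F \<and> (\<forall>f\<in>F. inv f \<in> F) \<and>
       (\<forall>Z. Z \<subseteq> block F B S \<and> (\<forall>z\<in>Z. \<forall>z'\<in>Z. z \<noteq> z' \<longrightarrow> z' \<otimes> inv z \<notin> N <#> F) \<longrightarrow> card Z \<le> card B' * \<kappa>)"
  proof (rule exI[of _ F], intro conjI F allI impI)
    fix Z assume Z: "Z \<subseteq> block F B S \<and> (\<forall>z\<in>Z. \<forall>z'\<in>Z. z \<noteq> z' \<longrightarrow> z' \<otimes> inv z \<notin> N <#> F)"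
    have "\<forall>z\<in>Z. \<exists>bm. fst bm \<in> B' \<and> snd bm \<in> reach F S' (fst bm) \<and> z = snd bm \<otimes> fst bm"
      using dec Z by blast
    from bchoice[OF this] obtain bm where bm: "\<forall>z\<in>Z. fst (bm z) \<in> B' \<and> snd (bm z) \<in> reach F S' (fst (bm z)) \<and>
        z = snd (bm z) \<otimes> fst (bm z)" by (elim exE) (rule that)
    define h where "h z = (fst (bm z), lab (snd (bm z)))" for z
    have "inj_on h Z"
    proof (rule inj_onI, rule ccontr)
      fix z z' assume zz: "z \<in> Z" "z' \<in> Z" "h z = h z'" "z \<noteq> z'"
      define b m m' where "b = fst (bm z)" "m = snd (bm z)" "m' = snd (bm z')"
      have b': "fst (bm z') = b" "lab m = lab m'" using zz(3) by (auto simp: h_def b_m_m'_def)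
      have m: "b \<in> B'" "m \<in> reach F S' b" "m' \<in> reach F S' b" "z = m \<otimes> b" "z' = m' \<otimes> b"
        using bspec[OF bm zz(1)] bspec[OF bm zz(2)] b'(1) unfolding b_m_m'_def by simp_all
      have c: "b \<in> carrier \<Gamma>" "m \<in> carrier \<Gamma>" "m' \<in> carrier \<Gamma>" using m(1-3) rc B'c by blast+
      have "z' \<otimes> inv z = m' \<otimes> inv m" unfolding m(4,5) using c by (simp add: m_assoc inv_mult_group)
      moreover have "m' \<otimes> inv m \<in> N <#> F" using L(4)[rule_format, OF m(1-3) b'(2)] .
      ultimately show False using conjunct2[OF Z, rule_format, OF zz(1,2,4)] by simp
    qed
    moreover have "h ` Z \<subseteq> B' \<times> L" using bm L(3) by (auto simp: h_def)
    ultimately have "card Z \<le> card (B' \<times> L)" using L(1) B'c(2) by (intro card_inj_on_le) auto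
    also have "\<dots> = card B' * card L" by (rule card_cartesian_product)
    also have "\<dots> \<le> card B' * \<kappa>" using L(2) by simp
    finally show "card Z \<le> card B' * \<kappa>" .
  qed
qed

text \<open>When all of \<open>reach\<close> lies in a normal subgroup that is finite modulo
  \<open>N\<close>, \<open>F\<close> can be chosen to cover that subgroup modulo \<open>N\<close>,
  and a single label is enough.\<close>

lemma packing_locally_finite:
  assumes M: "M \<lhd> \<Gamma>" and B: "finite B" "B \<subseteq> carrier \<Gamma>"
    and main: "\<And>S. finite S \<Longrightarrow> S \<subseteq> M \<Longrightarrow> \<exists>L F. L \<lhd> \<Gamma> \<and> S \<subseteq> L \<and> L \<subseteq> M \<and> finite F \<and> F \<subseteq> L \<and> L \<subseteq> N <#> F"
  shows "\<exists>\<kappa>. packing_bound N M B \<kappa>"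
proof -
  define B' where "B' = B \<union> (m_inv \<Gamma>) ` B"
  have B'c: "b \<in> carrier \<Gamma>" if "b \<in> B'" for b using that B by (auto simp: B'_def)
  interpret M: normal M \<Gamma> by (rule M)
  have "packing_bound N M B (card B' * 1)"
  proof (rule packing_boundI[where 'l=unit, OF M B B'_def])
    fix S assume S: "finite S" "S \<subseteq> M"
    obtain L F0 where L: "L \<lhd> \<Gamma>" "S \<subseteq> L" "L \<subseteq> M" "finite F0" "F0 \<subseteq> L" "L \<subseteq> N <#> F0"
      using main[OF S] by blast
    interpret L: normal L \<Gamma> by (rule L(1))
    define F where "F = insert \<one> (F0 \<union> (m_inv \<Gamma>) ` F0)"
    have F: "finite F" "F \<subseteq> L" "\<one> \<in> F" using L by (auto simp: F_def)
    have Finv: "inv f \<in> F" if "f \<in> F" for f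
      using that L(5) L.subset by (auto simp: F_def subset_iff)
    have LF: "L \<subseteq> N <#> F"
    proof
      fix l assume "l \<in> L"
      then have "l \<in> N <#> F0" using L(6) by blast
      then show "l \<in> N <#> F" by (elim set_multE) (auto simp: F_def intro: set_multI)
    qed
    have rL: "reach F S b \<subseteq> L" if "b \<in> B'" for b
      using F(2) L(2) B'c[OF that] by (auto simp: reach_def intro!: L.m_closed L.inv_op_closed2)
    have "m' \<otimes> inv m \<in> N <#> F" if "b \<in> B'" "m \<in> reach F S b" "m' \<in> reach F S b" for b m m'
    proof -
      have "m' \<otimes> inv m \<in> L" using rL[OF that(1)] that(2,3) by (intro L.m_closed L.m_inv_closed) auto
      then show ?thesis using LF by blast
    qed
    then show "\<exists>F (L::unit set) lab. finite F \<and> F \<subseteq> M \<and> \<one> \<in> F \<and> (\<forall>f\<in>F. inv f \<in> F) \<and>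
       finite L \<and> card L \<le> 1 \<and> (\<forall>b\<in>B'. \<forall>m\<in>reach F S b. lab m \<in> L) \<and>
       (\<forall>b\<in>B'. \<forall>m\<in>reach F S b. \<forall>m'\<in>reach F S b. lab m = lab m' \<longrightarrow> m' \<otimes> inv m \<in> N <#> F)"
      using F L(3) Finv by (intro exI[of _ F] exI[of _ "{()}"] exI[of _ "\<lambda>_. ()"]) auto
  qed
  then show ?thesis by blast
qed

end

text \<open>\<pi> is left abstract so that it may be the projection to cosets or its composition
  with an isomorphism onto the lamplighter group.\<close>

locale quotient_step = free_borel_action \<Gamma> X \<phi>
  for \<Gamma> :: "('a, 'm) monoid_scheme" (structure) and X :: "'x measure" and \<phi> +
  fixes N M :: "'a set" and Q :: "('q, 'r) monoid_scheme" and \<pi> :: "'a \<Rightarrow> 'q"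
  assumes N: "N \<lhd> \<Gamma>" and M: "M \<lhd> \<Gamma>" and NM: "N \<subseteq> M" and Q: "group Q"
    and pi_hom: "\<And>m m'. m \<in> M \<Longrightarrow> m' \<in> M \<Longrightarrow> \<pi> (m \<otimes> m') = \<pi> m \<otimes>\<^bsub>Q\<^esub> \<pi> m'"
    and pi_onto: "\<pi> ` M = carrier Q"
    and pi_ker: "\<And>m. m \<in> M \<Longrightarrow> \<pi> m = \<one>\<^bsub>Q\<^esub> \<longleftrightarrow> m \<in> N"
begin

sublocale Q: group Q by (rule Q)
sublocale M: normal M \<Gamma> by (rule M)
sublocale N: normal N \<Gamma> by (rule N)

lemma pi_closed: "m \<in> M \<Longrightarrow> \<pi> m \<in> carrier Q"
  unfolding pi_onto[symmetric] by (rule imageI)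

lemma pi_surj:
  assumes "q \<in> carrier Q" obtains m where "m \<in> M" "q = \<pi> m"
  using assms unfolding pi_onto[symmetric] by (elim imageE) (rule that)

lemma pi_one: "\<pi> \<one> = \<one>\<^bsub>Q\<^esub>"
  using pi_ker[OF M.one_closed] N.one_closed by simp

lemma pi_inv: "m \<in> M \<Longrightarrow> \<pi> (inv m) = inv\<^bsub>Q\<^esub> (\<pi> m)"
proof -
  assume m: "m \<in> M"
  have "\<pi> (inv m) \<otimes>\<^bsub>Q\<^esub> \<pi> m = \<pi> (inv m \<otimes> m)" using m by (intro pi_hom[symmetric] M.m_inv_closed)
  also have "\<dots> = \<one>\<^bsub>Q\<^esub>" using m M.subset pi_one by (simp add: subset_iff)
  finally show ?thesis using m pi_closed M.m_inv_closed by (intro Q.inv_equality[symmetric]) auto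
qed

lemma pi_eq: "m \<in> M \<Longrightarrow> m' \<in> M \<Longrightarrow> \<pi> m = \<pi> m' \<longleftrightarrow> m' \<otimes> inv m \<in> N"
proof -
  assume m: "m \<in> M" "m' \<in> M"
  have "m' \<otimes> inv m \<in> N \<longleftrightarrow> \<pi> (m' \<otimes> inv m) = \<one>\<^bsub>Q\<^esub>" using m by (intro pi_ker[symmetric] M.m_closed M.m_inv_closed)
  also have "\<pi> (m' \<otimes> inv m) = \<pi> m' \<otimes>\<^bsub>Q\<^esub> inv\<^bsub>Q\<^esub> (\<pi> m)" using m by (simp add: pi_hom pi_inv)
  also have "\<dots> = \<one>\<^bsub>Q\<^esub> \<longleftrightarrow> \<pi> m = \<pi> m'"
  proof
    assume "\<pi> m' \<otimes>\<^bsub>Q\<^esub> inv\<^bsub>Q\<^esub> (\<pi> m) = \<one>\<^bsub>Q\<^esub>"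
    then have "inv\<^bsub>Q\<^esub> (inv\<^bsub>Q\<^esub> (\<pi> m)) = \<pi> m'" using m pi_closed by (intro Q.inv_equality) auto
    then show "\<pi> m = \<pi> m'" unfolding Q.inv_inv[OF pi_closed[OF m(1)]] .
  next
    assume e: "\<pi> m = \<pi> m'"
    show "\<pi> m' \<otimes>\<^bsub>Q\<^esub> inv\<^bsub>Q\<^esub> (\<pi> m) = \<one>\<^bsub>Q\<^esub>" unfolding e by (rule Q.r_inv[OF pi_closed[OF m(2)]])
  qed
  finally show ?thesis by blast
qed

lemma pi_eq_cosetI:
  assumes m: "m \<in> M" and f: "f \<in> F" and F: "F \<subseteq> M" and e: "\<pi> m = \<pi> f"
  shows "m \<in> N <#> F"
proof -
  have fM: "f \<in> M" by (rule subsetD[OF F f])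
  have "\<pi> f = \<pi> m" by (rule e[symmetric])
  then have "m \<otimes> inv f \<in> N" by (rule iffD1[OF pi_eq[OF fM m]])
  then have "m \<otimes> inv f \<otimes> f \<in> N <#> F" using f by (rule set_multI)
  moreover have "m \<otimes> inv f \<otimes> f = m"
    using M.mem_carrier[OF m] M.mem_carrier[OF fM] by (simp add: m_assoc)
  ultimately show ?thesis by (simp only:)
qed

lemma lift_finite:
  assumes "finite T" "T \<subseteq> carrier Q" "\<one>\<^bsub>Q\<^esub> \<in> T" "\<And>t. t \<in> T \<Longrightarrow> inv\<^bsub>Q\<^esub> t \<in> T"
  obtains F where "finite F" "F \<subseteq> M" "\<pi> ` F = T" "\<one> \<in> F" "\<forall>f\<in>F. inv f \<in> F"
proof -
  have "\<forall>t\<in>T. \<exists>m. m \<in> M \<and> \<pi> m = t"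
  proof
    fix t assume "t \<in> T"
    then have "t \<in> carrier Q" using assms(2) by (rule subsetD[rotated])
    then obtain m where "m \<in> M" "t = \<pi> m" by (rule pi_surj)
    then show "\<exists>m. m \<in> M \<and> \<pi> m = t" by (intro exI[of _ m]) simp
  qed
  from bchoice[OF this] obtain r where r: "\<forall>t\<in>T. r t \<in> M \<and> \<pi> (r t) = t" by (elim exE) (rule that)
  define F where "F = insert \<one> (r ` T \<union> (m_inv \<Gamma>) ` r ` T)"
  show ?thesis
  proof (rule that[of F])
    show "finite F" "\<one> \<in> F" using assms(1) by (auto simp: F_def)
    show "F \<subseteq> M" using r by (auto simp: F_def)
    show "\<forall>f\<in>F. inv f \<in> F" using r M.subset by (auto simp: F_def subset_iff)
    have "\<pi> (r t) = t" "\<pi> (inv (r t)) \<in> T" if "t \<in> T" for t using r that assms(4) pi_inv by auto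
    then show "\<pi> ` F = T" using assms(3) pi_one by (auto simp: F_def image_Un image_image)
  qed
qed

text \<open>Conjugation by \<open>g\<close> on the quotient; the choice of the representative is immaterial.\<close>

definition conjQ :: "'a \<Rightarrow> 'q \<Rightarrow> 'q" where
  "conjQ g q = \<pi> (g \<otimes> (SOME m. m \<in> M \<and> \<pi> m = q) \<otimes> inv g)"

lemma conjQ_pi:
  assumes g: "g \<in> carrier \<Gamma>" and m: "m \<in> M"
  shows "conjQ g (\<pi> m) = \<pi> (g \<otimes> m \<otimes> inv g)"
proof -
  define m' where "m' = (SOME m'. m' \<in> M \<and> \<pi> m' = \<pi> m)"
  have m': "m' \<in> M \<and> \<pi> m' = \<pi> m" unfolding m'_def by (rule someI[of _ m]) (use m in simp)
  have c: "m \<in> carrier \<Gamma>" "m' \<in> carrier \<Gamma>" using m m' M.subset by auto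
  have "m \<otimes> inv m' \<in> N" using pi_eq[of m' m] m m' by simp
  then have "g \<otimes> (m \<otimes> inv m') \<otimes> inv g \<in> N" using g by (rule N.inv_op_closed2[rotated])
  moreover have "g \<otimes> (m \<otimes> inv m') \<otimes> inv g = (g \<otimes> m \<otimes> inv g) \<otimes> inv (g \<otimes> m' \<otimes> inv g)"
    using g c by (simp add: m_assoc inv_mult_group)
  ultimately have "\<pi> (g \<otimes> m' \<otimes> inv g) = \<pi> (g \<otimes> m \<otimes> inv g)"
    using pi_eq[of "g \<otimes> m' \<otimes> inv g" "g \<otimes> m \<otimes> inv g"] g m m' M.inv_op_closed2 by auto
  then show ?thesis unfolding conjQ_def m'_def .
qed

lemma conjQ_hom:
  assumes g: "g \<in> carrier \<Gamma>" shows "conjQ g \<in> hom Q Q"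
proof (rule homI)
  fix q assume "q \<in> carrier Q"
  then obtain m where "m \<in> M" "q = \<pi> m" by (rule pi_surj)
  then show "conjQ g q \<in> carrier Q" using conjQ_pi[OF g] pi_closed M.inv_op_closed2[OF g] by auto
next
  fix q q' assume "q \<in> carrier Q" "q' \<in> carrier Q"
  then obtain m m' where m: "m \<in> M" "q = \<pi> m" "m' \<in> M" "q' = \<pi> m'" by (elim pi_surj)
  have c: "m \<in> carrier \<Gamma>" "m' \<in> carrier \<Gamma>" using m M.subset by auto
  have "g \<otimes> (m \<otimes> m') \<otimes> inv g = (g \<otimes> m \<otimes> inv g) \<otimes> (g \<otimes> m' \<otimes> inv g)" using g c by (simp add: m_assoc)
  then have "conjQ g (\<pi> (m \<otimes> m')) = \<pi> (g \<otimes> m \<otimes> inv g) \<otimes>\<^bsub>Q\<^esub> \<pi> (g \<otimes> m' \<otimes> inv g)"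
    unfolding conjQ_pi[OF g M.m_closed[OF m(1,3)]] using g m by (simp only: pi_hom M.inv_op_closed2)
  then show "conjQ g (q \<otimes>\<^bsub>Q\<^esub> q') = conjQ g q \<otimes>\<^bsub>Q\<^esub> conjQ g q'"
    using g m by (simp add: conjQ_pi pi_hom)
qed

lemma conjQ_inverse: "g \<in> carrier \<Gamma> \<Longrightarrow> q \<in> carrier Q \<Longrightarrow> conjQ g (conjQ (inv g) q) = q"
proof -
  assume g: "g \<in> carrier \<Gamma>" and q: "q \<in> carrier Q"
  obtain m where m: "m \<in> M" "q = \<pi> m" by (rule pi_surj[OF q])
  then have "m \<in> carrier \<Gamma>" using M.subset by auto
  then have "g \<otimes> (inv g \<otimes> m \<otimes> inv (inv g)) \<otimes> inv g = m" using g by (simp add: m_assoc)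
  moreover have "inv g \<otimes> m \<otimes> inv (inv g) \<in> M" using g m by (intro M.inv_op_closed2) auto
  ultimately show ?thesis using g m by (simp add: conjQ_pi del: inv_inv)
qed

lemma conjQ_iso:
  assumes g: "g \<in> carrier \<Gamma>" shows "conjQ g \<in> iso Q Q"
proof -
  have inv: "conjQ (inv g) (conjQ g q) = q" if "q \<in> carrier Q" for q
    using conjQ_inverse[of "inv g" q] g that by simp
  have cl: "conjQ h q \<in> carrier Q" if "h \<in> carrier \<Gamma>" "q \<in> carrier Q" for h q
    using conjQ_hom[OF that(1)] that(2) by (auto simp: hom_def)
  have "bij_betw (conjQ g) (carrier Q) (carrier Q)"
    by (rule bij_betw_byWitness[where f'="conjQ (inv g)"]) (use g inv conjQ_inverse cl in auto)
  then show ?thesis using conjQ_hom[OF g] by (simp add: iso_def)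
qed

section \<open>Finite quotients and unions of finite characteristic subgroups\<close>

lemma packing_finite:
  assumes fin: "finite (carrier Q)" and B: "finite B" "B \<subseteq> carrier \<Gamma>"
  shows "\<exists>\<kappa>. packing_bound N M B \<kappa>"
proof (rule packing_locally_finite[OF M B])
  fix S assume S: "finite S" "S \<subseteq> M"
  obtain F where F: "finite F" "F \<subseteq> M" "\<pi> ` F = carrier Q" "\<one> \<in> F" "\<forall>f\<in>F. inv f \<in> F"
    by (rule lift_finite[OF fin order_refl]) auto
  have "M \<subseteq> N <#> F"
  proof
    fix m assume m: "m \<in> M"
    then have "\<pi> m \<in> \<pi> ` F" using F(3) pi_closed by simp
    then obtain f where "f \<in> F" "\<pi> m = \<pi> f" by blast
    then show "m \<in> N <#> F" using m F(2) by (intro pi_eq_cosetI)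
  qed
  then show "\<exists>L F. L \<lhd> \<Gamma> \<and> S \<subseteq> L \<and> L \<subseteq> M \<and> finite F \<and> F \<subseteq> L \<and> L \<subseteq> N <#> F"
    using M S F by (intro exI[of _ M] exI[of _ F]) simp
qed

lemma preimage_normal:
  assumes K: "subgroup K Q" and inv: "\<And>g. g \<in> carrier \<Gamma> \<Longrightarrow> conjQ g ` K \<subseteq> K"
  shows "{m \<in> M. \<pi> m \<in> K} \<lhd> \<Gamma>"
proof (rule normal_invI)
  interpret K: subgroup K Q by (rule K)
  show "subgroup {m \<in> M. \<pi> m \<in> K} \<Gamma>"
  proof
    show "{m \<in> M. \<pi> m \<in> K} \<subseteq> carrier \<Gamma>" using M.subset by auto
  qed (auto simp: pi_hom pi_inv pi_one intro: K.m_closed K.m_inv_closed)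
  fix g h assume gh: "g \<in> carrier \<Gamma>" "h \<in> {m \<in> M. \<pi> m \<in> K}"
  then have "\<pi> (g \<otimes> h \<otimes> inv g) \<in> K" using inv[OF gh(1)] conjQ_pi[OF gh(1), of h] by (auto simp: image_subset_iff)
  then show "g \<otimes> h \<otimes> inv g \<in> {m \<in> M. \<pi> m \<in> K}" using gh M.inv_op_closed2 by auto
qed

text \<open>Elements of \<Gamma> act on \<open>Q\<close> by automorphisms, so the preimage of a
  characteristic subgroup is normal in \<Gamma>. Conjugating by elements of \<open>B\<close>
  therefore never leaves a subgroup that is finite modulo \<open>N\<close>.\<close>

lemma packing_characteristic:
  assumes ch: "union_of_finite_characteristic Q" and B: "finite B" "B \<subseteq> carrier \<Gamma>"
  shows "\<exists>\<kappa>. packing_bound N M B \<kappa>"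
proof (rule packing_locally_finite[OF M B])
  fix S assume S: "finite S" "S \<subseteq> M"
  obtain K where K: "incseq K" "\<forall>n::nat. finite (K n) \<and> characteristic_subgroup (K n) Q" "carrier Q = (\<Union>n. K n)"
    using ch unfolding union_of_finite_characteristic_def by blast
  have "\<exists>n. \<pi> ` S \<subseteq> K n"
    using S
  proof (induction S rule: finite_induct)
    case (insert s S)
    then obtain n where n: "\<pi> ` S \<subseteq> K n" by auto
    obtain m where m: "\<pi> s \<in> K m" using insert.prems pi_closed K(3) by blast
    have "K n \<subseteq> K (max n m)" "K m \<subseteq> K (max n m)" using incseqD[OF K(1)] by simp_all
    then show ?case using n m by (intro exI[of _ "max n m"]) auto
  qed simp
  then obtain n where n: "\<pi> ` S \<subseteq> K n" by blast
  have Kn: "finite (K n)" "subgroup (K n) Q" "\<And>f. f \<in> iso Q Q \<Longrightarrow> f ` K n = K n"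
    using K(2) by (auto simp: characteristic_subgroup_def)
  interpret Kn: subgroup "K n" Q by (rule Kn(2))
  define L where "L = {m \<in> M. \<pi> m \<in> K n}"
  have L: "L \<lhd> \<Gamma>" unfolding L_def by (rule preimage_normal[OF Kn(2)]) (use Kn(3) conjQ_iso in auto)
  obtain F where F: "finite F" "F \<subseteq> M" "\<pi> ` F = K n" "\<one> \<in> F" "\<forall>f\<in>F. inv f \<in> F"
    by (rule lift_finite[OF Kn(1) Kn.subset Kn.one_closed Kn.m_inv_closed])
  have "L \<subseteq> N <#> F"
  proof
    fix m assume m: "m \<in> L"
    then have "\<pi> m \<in> \<pi> ` F" using F(3) by (simp add: L_def)
    then obtain f where "f \<in> F" "\<pi> m = \<pi> f" by blast
    then show "m \<in> N <#> F" using m F(2) by (intro pi_eq_cosetI) (auto simp: L_def)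
  qed
  moreover have "F \<subseteq> L" using F by (auto simp: L_def)
  moreover have "S \<subseteq> L" using S n by (auto simp: L_def)
  ultimately show "\<exists>L F. L \<lhd> \<Gamma> \<and> S \<subseteq> L \<and> L \<subseteq> M \<and> finite F \<and> F \<subseteq> L \<and> L \<subseteq> N <#> F"
    using L F(1) by (intro exI[of _ L] exI[of _ F]) (auto simp: L_def)
qed

end

section \<open>Arithmetic for the packing bounds, and packing in rational coordinates\<close>

lemma common_denominator: "finite (T :: rat set) \<Longrightarrow> \<exists>d::int. d > 0 \<and> (\<forall>r\<in>T. of_int d * r \<in> \<int>)"
proof (induction T rule: finite_induct)
  case empty
  show ?case by (rule exI[of _ 1]) simp
next
  case (insert r T)
  then obtain d :: int where d: "d > 0" "\<forall>r\<in>T. of_int d * r \<in> \<int>" by blast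
  obtain a b where ab: "quotient_of r = (a, b)" by (cases "quotient_of r")
  have b: "b > 0" by (rule quotient_of_denom_pos[OF ab])
  have "r = of_int a / of_int b" by (rule quotient_of_div[OF ab])
  then have rb: "of_int b * r = of_int a" using b by simp
  have "of_int (b * d) * s \<in> \<int>" if "s \<in> insert r T" for s
  proof (cases "s = r")
    case True
    have "of_int (b * d) * r = of_int d * (of_int b * r)" by simp
    also have "\<dots> \<in> \<int>" unfolding rb by simp
    finally show ?thesis using True by simp
  next
    case False
    then have "of_int d * s \<in> \<int>" using d that by blast
    then have "of_int b * (of_int d * s) \<in> \<int>" by (rule Ints_mult[OF Ints_of_int])
    then show ?thesis by (simp only: of_int_mult mult.assoc)
  qed
  then show ?case using b d(1) by (intro exI[of _ "b * d"]) auto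
qed

lemma floor_eq_imp_close:
  fixes a b :: rat
  assumes "\<lfloor>a\<rfloor> = \<lfloor>b\<rfloor>" shows "\<bar>b - a\<bar> \<le> 1"
proof -
  have "of_int \<lfloor>a\<rfloor> \<le> a" "a < of_int \<lfloor>a\<rfloor> + 1" "of_int \<lfloor>a\<rfloor> \<le> b" "b < of_int \<lfloor>a\<rfloor> + 1"
    using floor_correct[of a] floor_correct[of b] assms by simp_all
  then show ?thesis by linarith
qed

text \<open>Otherwise \<open>f (8 ^ i)\<close> would be at least \<open>8 ^ ((d + 1) * i)\<close>,
  which eventually exceeds every multiple of \<open>8 ^ (d * i)\<close>.\<close>

lemma polynomial_doubling:
  fixes f :: "nat \<Rightarrow> nat"
  assumes f1: "f 1 \<ge> 1" and c: "\<And>r. r \<ge> 1 \<Longrightarrow> real (f r) \<le> c * real r ^ d"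
  shows "\<exists>r\<ge>1. f (8 * r) \<le> 8 ^ (d + 1) * f r"
proof (rule ccontr)
  assume "\<not> ?thesis"
  then have *: "f (8 * r) \<ge> 8 ^ (d + 1) * f r" if "r \<ge> 1" for r using that nat_le_linear[of "f (8 * r)"] by blast
  have "f (8 ^ i) \<ge> (8 ^ (d + 1)) ^ i" for i
  proof (induction i)
    case (Suc i)
    have "(8 ^ (d + 1)) ^ Suc i \<le> 8 ^ (d + 1) * f (8 ^ i)" using Suc by simp
    also have "\<dots> \<le> f (8 * 8 ^ i)" by (rule *) simp
    finally show ?case by simp
  qed (use f1 in simp)
  then have "(8 ^ (d + 1)) ^ i \<le> c * (8 ^ i) ^ d" for i
  proof -
    have "real ((8 ^ (d + 1)) ^ i) \<le> real (f (8 ^ i))" using \<open>\<And>i. f (8 ^ i) \<ge> (8 ^ (d + 1)) ^ i\<close> of_nat_le_iff by blast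
    also have "\<dots> \<le> c * real (8 ^ i) ^ d" by (rule c) simp
    finally show ?thesis by simp
  qed
  then have "(8::real) ^ i \<le> c" for i
  proof -
    have "(8 ^ (d + 1)) ^ i = (8::real) ^ ((d + 1) * i)" by (rule power_mult[symmetric])
    also have "(d + 1) * i = i + i * d" by simp
    also have "(8::real) ^ (i + i * d) = 8 ^ i * 8 ^ (i * d)" by (rule power_add)
    also have "(8::real) ^ (i * d) = (8 ^ i) ^ d" by (rule power_mult)
    finally have "8 ^ i * (8 ^ i) ^ d \<le> c * (8 ^ i) ^ d"
      using \<open>\<And>i. (8 ^ (d + 1)) ^ i \<le> c * (8 ^ i) ^ d\<close>[of i] by (simp only:)
    then show ?thesis by (rule mult_right_le_imp_le) simp
  qed
  moreover obtain i where "c < (8::real) ^ i" using real_arch_pow[of 8 c] by auto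
  ultimately show False using not_le by blast
qed

context free_borel_action
begin

text \<open>\<open>F\<close> represents, modulo \<open>N\<close>, the box of radius \<open>R\<close>
  among the vectors with denominator \<open>q\<close>. Conjugation by \<open>b\<close> enlarges the
  radius at most by the factor \<open>c\<close> and the denominator by \<delta>, and both depend
  only on \<open>B\<close>. So an element of \<open>reach\<close> is determined, up to an element of
  the box, by a cell of size \<open>R\<close> and a residue modulo \<delta> in each
  coordinate.\<close>

lemma packing_coordinates:
  fixes \<theta> :: "'a \<Rightarrow> 'j \<Rightarrow> rat"
  assumes M: "M \<lhd> \<Gamma>" and J: "finite J"
    and add: "\<And>m m' i. m \<in> M \<Longrightarrow> m' \<in> M \<Longrightarrow> i \<in> J \<Longrightarrow> \<theta> (m \<otimes> m') i = \<theta> m i + \<theta> m' i"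
    and ker: "\<And>m. m \<in> M \<Longrightarrow> (\<And>i. i \<in> J \<Longrightarrow> \<theta> m i = 0) \<Longrightarrow> m \<in> N"
    and lin: "\<And>b. b \<in> carrier \<Gamma> \<Longrightarrow> \<exists>\<beta>. \<forall>m\<in>M. \<forall>i\<in>J. \<theta> (b \<otimes> m \<otimes> inv b) i = (\<Sum>j\<in>J. \<beta> i j * \<theta> m j)"
    and B: "finite B" "B \<subseteq> carrier \<Gamma>"
  shows "\<exists>\<kappa>. packing_bound N M B \<kappa>"
proof -
  interpret M: normal M \<Gamma> by (rule M)
  have Mc: "m \<in> carrier \<Gamma>" if "m \<in> M" for m using that M.subset by blast
  define B' where "B' = B \<union> (m_inv \<Gamma>) ` B"
  have B': "finite B'" "\<And>b. b \<in> B' \<Longrightarrow> b \<in> carrier \<Gamma>" using B by (auto simp: B'_def)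
  have "\<forall>b\<in>B'. \<exists>\<beta>. \<forall>m\<in>M. \<forall>i\<in>J. \<theta> (b \<otimes> m \<otimes> inv b) i = (\<Sum>j\<in>J. \<beta> i j * \<theta> m j)" using lin B'(2) by blast
  from bchoice[OF this] obtain \<beta> where
    \<beta>: "\<forall>b\<in>B'. \<forall>m\<in>M. \<forall>i\<in>J. \<theta> (b \<otimes> m \<otimes> inv b) i = (\<Sum>j\<in>J. \<beta> b i j * \<theta> m j)" by (elim exE) (rule that)
  have "finite ((\<lambda>(b, i, j). \<beta> b i j) ` (B' \<times> J \<times> J))" using B' J by simp
  from common_denominator[OF this] obtain \<delta> :: int where \<delta>: "\<delta> > 0" "\<forall>r\<in>(\<lambda>(b, i, j). \<beta> b i j) ` (B' \<times> J \<times> J). of_int \<delta> * r \<in> \<int>"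
    by blast
  have \<delta>b: "of_int \<delta> * \<beta> b i j \<in> \<int>" if "b \<in> B'" "i \<in> J" "j \<in> J" for b i j using \<delta>(2) that by force
  define c where "c = \<lceil>\<Sum>b\<in>B'. \<Sum>i\<in>J. \<Sum>j\<in>J. \<bar>\<beta> b i j\<bar>\<rceil>"
  have cb: "(\<Sum>j\<in>J. \<bar>\<beta> b i j\<bar>) \<le> of_int c" if "b \<in> B'" "i \<in> J" for b i
  proof -
    have "(\<Sum>j\<in>J. \<bar>\<beta> b i j\<bar>) \<le> (\<Sum>i\<in>J. \<Sum>j\<in>J. \<bar>\<beta> b i j\<bar>)"
      using J that by (intro member_le_sum[of i J]) (auto intro!: sum_nonneg)
    also have "\<dots> \<le> (\<Sum>b\<in>B'. \<Sum>i\<in>J. \<Sum>j\<in>J. \<bar>\<beta> b i j\<bar>)"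
      using B' that by (intro member_le_sum[of b B']) (auto intro!: sum_nonneg)
    also have "\<dots> \<le> of_int c" unfolding c_def by (rule le_of_int_ceiling)
    finally show ?thesis .
  qed
  \<comment> \<open>In units of \<open>R\<close>, the factors \<open>f\<close> and \<open>s\<close>
    contribute at most 1 each and the conjugate at most \<open>c\<close>; the range
    \<open>c + 3\<close> leaves one unit to spare.\<close>
  define L where "L = J \<rightarrow>\<^sub>E ({-(c + 3)..c + 3} \<times> {0..<\<delta>})"
  have L: "finite L" unfolding L_def using J by (intro finite_PiE) auto
  have "packing_bound N M B (card B' * card L)"
  proof (rule packing_boundI[where 'l="'j \<Rightarrow> int \<times> int", OF M B B'_def])
    fix S assume S: "finite S" "S \<subseteq> M"
    have "finite ((\<lambda>(s, i). \<theta> s i) ` (S \<times> J))" using S J by simp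
    from common_denominator[OF this] obtain q :: int where q: "q > 0" "\<forall>r\<in>(\<lambda>(s, i). \<theta> s i) ` (S \<times> J). of_int q * r \<in> \<int>"
      by blast
    \<comment> \<open>The summand 1 makes \<open>R\<close> positive, so that one may divide by
      it.\<close>
    define R where "R = \<lceil>1 + (\<Sum>s\<in>S. \<Sum>i\<in>J. \<bar>\<theta> s i\<bar>)\<rceil>"
    have Rs: "1 + (\<Sum>s\<in>S. \<Sum>i\<in>J. \<bar>\<theta> s i\<bar>) \<le> of_int R" unfolding R_def by (rule le_of_int_ceiling)
    have sn: "0 \<le> (\<Sum>s\<in>S. \<Sum>i\<in>J. \<bar>\<theta> s i\<bar>)" by (intro sum_nonneg) auto
    have R1: "(of_int R :: rat) \<ge> 1" using Rs sn by linarith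
    have Sb: "\<bar>\<theta> s i\<bar> \<le> of_int R" if "s \<in> S" "i \<in> J" for s i
    proof -
      have "\<bar>\<theta> s i\<bar> \<le> (\<Sum>i\<in>J. \<bar>\<theta> s i\<bar>)" using J that by (intro member_le_sum[of i J]) auto
      also have "\<dots> \<le> (\<Sum>s\<in>S. \<Sum>i\<in>J. \<bar>\<theta> s i\<bar>)" using S that by (intro member_le_sum[of s S]) (auto intro!: sum_nonneg)
      finally show ?thesis using Rs by linarith
    qed
    define G where "G = {m \<in> M. \<forall>i\<in>J. of_int q * \<theta> m i \<in> \<int> \<and> \<bar>\<theta> m i\<bar> \<le> of_int R}"
    have \<theta>1: "\<theta> \<one> i = 0" if "i \<in> J" for i using add[OF M.one_closed M.one_closed that] by simp
    have \<theta>inv: "\<theta> (inv m) i = - \<theta> m i" if "m \<in> M" "i \<in> J" for m i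
      using add[OF that(1) M.m_inv_closed[OF that(1)] that(2)] \<theta>1[OF that(2)] Mc[OF that(1)] by simp
    have Gi: "of_int q * \<theta> x i \<in> \<int>" if "x \<in> G" "i \<in> J" for x i using that by (simp add: G_def)
    have SG: "S \<subseteq> G" using S Sb q by (force simp: G_def)
    have G1: "\<one> \<in> G" using \<theta>1 R1 by (auto simp: G_def)
    have Ginv: "inv m \<in> G" if "m \<in> G" for m using that \<theta>inv by (auto simp: G_def)
    define vec where "vec m = restrict (\<theta> m) J" for m
    have "vec ` G \<subseteq> J \<rightarrow>\<^sub>E (\<lambda>k. of_int k / of_int q) ` {- (q * R)..q * R}"
    proof (rule image_subsetI)
      fix m assume m: "m \<in> G"
      have "\<theta> m i \<in> (\<lambda>k. of_int k / of_int q) ` {- (q * R)..q * R}" if i: "i \<in> J" for i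
      proof -
        obtain k where k: "of_int q * \<theta> m i = of_int k" using m i by (auto simp: G_def elim: Ints_cases)
        have "\<bar>of_int q * \<theta> m i\<bar> \<le> of_int q * of_int R"
          unfolding abs_mult using m i q(1) by (intro mult_mono) (auto simp: G_def)
        then have "\<bar>of_int k :: rat\<bar> \<le> of_int (q * R)" unfolding k by simp
        then have "\<bar>k\<bar> \<le> q * R" by (metis of_int_abs of_int_le_iff)
        moreover have "\<theta> m i = of_int k / of_int q" using k q(1) by (simp add: field_simps)
        ultimately show ?thesis by (intro image_eqI[of _ _ k]) (simp_all add: abs_le_iff)
      qed
      then show "vec m \<in> J \<rightarrow>\<^sub>E (\<lambda>k. of_int k / of_int q) ` {- (q * R)..q * R}" by (simp add: vec_def)
    qed
    moreover have "finite (J \<rightarrow>\<^sub>E (\<lambda>k. of_int k / of_int q :: rat) ` {- (q * R)..q * R})" using J by (intro finite_PiE) auto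
    ultimately have fv: "finite (vec ` G)" by (rule finite_subset)
    have "\<forall>v\<in>vec ` G. \<exists>m. m \<in> G \<and> vec m = v" by blast
    from bchoice[OF this] obtain r where r: "\<forall>v\<in>vec ` G. r v \<in> G \<and> vec (r v) = v" by (elim exE) (rule that)
    define F where "F = insert \<one> (r ` vec ` G \<union> (m_inv \<Gamma>) ` r ` vec ` G)"
    have GM: "G \<subseteq> M" by (auto simp: G_def)
    have FG: "F \<subseteq> G" using r G1 Ginv by (auto simp: F_def)
    have F: "finite F" "F \<subseteq> M" "\<one> \<in> F" "\<forall>f\<in>F. inv f \<in> F"
    proof -
      show "finite F" "\<one> \<in> F" using fv by (auto simp: F_def)
      show "F \<subseteq> M" using FG GM by blast
      have "inv (inv (r v)) = r v" if "v \<in> vec ` G" for v using r that GM Mc by (metis inv_inv subsetD)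
      then show "\<forall>f\<in>F. inv f \<in> F" unfolding F_def by auto
    qed
    have GF: "m \<in> N <#> F" if m: "m \<in> G" for m
    proof -
      define f where "f = r (vec m)"
      have f: "f \<in> G" "vec f = vec m" "f \<in> F" using r m by (auto simp: f_def F_def)
      have fM: "f \<in> M" "m \<in> M" using f m GM by auto
      have "\<theta> f i = \<theta> m i" if "i \<in> J" for i using f(2) that unfolding vec_def by (metis restrict_apply')
      then have "\<theta> (m \<otimes> inv f) i = 0" if "i \<in> J" for i
        using add[OF fM(2) M.m_inv_closed[OF fM(1)] that] \<theta>inv[OF fM(1) that] that by simp
      then have "m \<otimes> inv f \<in> N" using fM by (intro ker) auto
      then have "m \<otimes> inv f \<otimes> f \<in> N <#> F" using f(3) by (rule set_multI)
      then show ?thesis using Mc fM by (simp add: m_assoc)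
    qed
    \<comment> \<open>Equal first entries leave a difference of at most \<open>R\<close>; equal
      residues make the difference of the scaled coordinates divisible by \<delta>, so that the
      denominator \<open>q\<close> suffices.\<close>
    define lab where "lab m = (\<lambda>i\<in>J. (\<lfloor>\<theta> m i / of_int R\<rfloor>, \<lfloor>of_int (\<delta> * q) * \<theta> m i\<rfloor> mod \<delta>))" for m
    have rch: "m \<in> M \<and> (\<forall>i\<in>J. of_int (\<delta> * q) * \<theta> m i \<in> \<int> \<and> \<bar>\<theta> m i\<bar> \<le> of_int (c + 2) * of_int R)"
      if b: "b \<in> B'" and m: "m \<in> reach F S b" for b m
    proof -
      obtain f s f' where fs: "f \<in> F" "s \<in> S" "f' \<in> F" "m = f \<otimes> s \<otimes> (b \<otimes> f' \<otimes> inv b)" using m by (rule reachE)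
      have fG: "f \<in> G" "s \<in> G" "f' \<in> G" using fs FG SG by auto
      then have fM: "f \<in> M" "s \<in> M" "f' \<in> M" "b \<otimes> f' \<otimes> inv b \<in> M" using GM M.inv_op_closed2[OF B'(2)[OF b]] by auto
      have \<theta>m: "\<theta> m i = \<theta> f i + \<theta> s i + (\<Sum>j\<in>J. \<beta> b i j * \<theta> f' j)" if i: "i \<in> J" for i
        unfolding fs(4) using fM i \<beta> b by (simp add: add)
      have "of_int (\<delta> * q) * \<theta> m i \<in> \<int> \<and> \<bar>\<theta> m i\<bar> \<le> of_int (c + 2) * of_int R" if i: "i \<in> J" for i
      proof
        have e: "of_int (\<delta> * q) * \<theta> m i = of_int \<delta> * (of_int q * \<theta> f i) + of_int \<delta> * (of_int q * \<theta> s i) +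
            (\<Sum>j\<in>J. (of_int \<delta> * \<beta> b i j) * (of_int q * \<theta> f' j))"
          unfolding \<theta>m[OF i] by (simp add: algebra_simps sum_distrib_left)
        show "of_int (\<delta> * q) * \<theta> m i \<in> \<int>" unfolding e
          by (intro Ints_add Ints_sum Ints_mult[OF Ints_of_int Gi] Ints_mult[OF \<delta>b[OF b i] Gi] fG i)
        have "\<bar>\<Sum>j\<in>J. \<beta> b i j * \<theta> f' j\<bar> \<le> (\<Sum>j\<in>J. \<bar>\<beta> b i j\<bar> * \<bar>\<theta> f' j\<bar>)"
          using sum_abs[of "\<lambda>j. \<beta> b i j * \<theta> f' j" J] by (simp add: abs_mult)
        also have "\<dots> \<le> (\<Sum>j\<in>J. \<bar>\<beta> b i j\<bar> * of_int R)"
          using fG by (intro sum_mono mult_left_mono) (auto simp: G_def)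
        also have "\<dots> = (\<Sum>j\<in>J. \<bar>\<beta> b i j\<bar>) * of_int R" by (simp add: sum_distrib_right)
        also have "\<dots> \<le> of_int c * of_int R" using cb[OF b i] R1 by (intro mult_right_mono) auto
        finally have "\<bar>\<Sum>j\<in>J. \<beta> b i j * \<theta> f' j\<bar> \<le> of_int c * of_int R" .
        moreover have "\<bar>\<theta> f i\<bar> \<le> of_int R" "\<bar>\<theta> s i\<bar> \<le> of_int R" using fG i by (auto simp: G_def)
        ultimately have "\<bar>\<theta> m i\<bar> \<le> of_int R + of_int R + of_int c * of_int R" unfolding \<theta>m[OF i] by linarith
        also have "\<dots> = of_int (c + 2) * of_int R" by (simp add: algebra_simps)
        finally show "\<bar>\<theta> m i\<bar> \<le> of_int (c + 2) * of_int R" .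
      qed
      moreover have "m \<in> M" unfolding fs(4) by (rule M.m_closed[OF M.m_closed[OF fM(1,2)] fM(4)])
      ultimately show ?thesis by blast
    qed
    have labL: "lab m \<in> L" if bm: "b \<in> B'" "m \<in> reach F S b" for b m
    proof -
      have "(\<lfloor>\<theta> m i / of_int R\<rfloor>, \<lfloor>of_int (\<delta> * q) * \<theta> m i\<rfloor> mod \<delta>) \<in> {-(c + 3)..c + 3} \<times> {0..<\<delta>}" if i: "i \<in> J" for i
      proof -
        have b: "\<bar>\<theta> m i\<bar> \<le> of_int (c + 2) * of_int R" using rch[OF bm] i by blast
        have "\<theta> m i / of_int R \<le> of_int (c + 2)" "- of_int (c + 2) \<le> \<theta> m i / of_int R"
          using b R1 by (auto simp: field_simps abs_le_iff)
        then have "\<lfloor>\<theta> m i / of_int R\<rfloor> \<le> c + 2" "- (c + 2) \<le> \<lfloor>\<theta> m i / of_int R\<rfloor>"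
          by (simp_all add: floor_le_iff le_floor_iff)
        then show ?thesis using \<delta>(1) by simp
      qed
      then show ?thesis unfolding lab_def L_def by (intro restrict_PiE_iff[THEN iffD2]) blast
    qed
    have labI: "m' \<otimes> inv m \<in> N <#> F" if b: "b \<in> B'" and m: "m \<in> reach F S b" "m' \<in> reach F S b" "lab m = lab m'" for b m m'
    proof (rule GF)
      have mM: "m \<in> M" "m' \<in> M" using rch[OF b] m by blast+
      have "of_int q * \<theta> (m' \<otimes> inv m) i \<in> \<int> \<and> \<bar>\<theta> (m' \<otimes> inv m) i\<bar> \<le> of_int R" if i: "i \<in> J" for i
      proof
        have e: "\<theta> (m' \<otimes> inv m) i = \<theta> m' i - \<theta> m i" using add[OF mM(2) M.m_inv_closed[OF mM(1)] i] \<theta>inv[OF mM(1) i] by simp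
        have "lab m i = lab m' i" using m(3) by simp
        then have l: "\<lfloor>\<theta> m i / of_int R\<rfloor> = \<lfloor>\<theta> m' i / of_int R\<rfloor>"
          "\<lfloor>of_int (\<delta> * q) * \<theta> m i\<rfloor> mod \<delta> = \<lfloor>of_int (\<delta> * q) * \<theta> m' i\<rfloor> mod \<delta>" using i by (simp_all add: lab_def)
        have "\<bar>\<theta> m' i / of_int R - \<theta> m i / of_int R\<bar> \<le> 1" using l(1)
          by (rule floor_eq_imp_close)
        then have "\<bar>(\<theta> m' i - \<theta> m i) / of_int R\<bar> \<le> 1" by (simp add: diff_divide_distrib)
        then show "\<bar>\<theta> (m' \<otimes> inv m) i\<bar> \<le> of_int R" unfolding e using R1 by (simp add: abs_divide field_simps)
        obtain a where a: "of_int (\<delta> * q) * \<theta> m i = of_int a" using rch[OF b m(1)] i by (auto elim!: Ints_cases)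
        obtain a' where a': "of_int (\<delta> * q) * \<theta> m' i = of_int a'" using rch[OF b m(2)] i by (auto elim!: Ints_cases)
        have "a' mod \<delta> = a mod \<delta>" using l(2) unfolding a a' by simp
        then obtain k where k: "a' - a = \<delta> * k" by (metis mod_eq_dvd_iff dvd_def)
        have "of_int \<delta> * (of_int q * (\<theta> m' i - \<theta> m i)) = (of_int (a' - a) :: rat)"
          using a a' by (simp add: algebra_simps)
        also have "\<dots> = of_int \<delta> * of_int k" unfolding k by simp
        finally have "of_int q * (\<theta> m' i - \<theta> m i) = of_int k" using \<delta>(1) by simp
        then show "of_int q * \<theta> (m' \<otimes> inv m) i \<in> \<int>" unfolding e by simp
      qed
      then show "m' \<otimes> inv m \<in> G" unfolding G_def using mM by simp
    qed
    show "\<exists>F (L'::('j \<Rightarrow> int \<times> int) set) lab. finite F \<and> F \<subseteq> M \<and> \<one> \<in> F \<and> (\<forall>f\<in>F. inv f \<in> F) \<and>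
       finite L' \<and> card L' \<le> card L \<and> (\<forall>b\<in>B'. \<forall>m\<in>reach F S b. lab m \<in> L') \<and>
       (\<forall>b\<in>B'. \<forall>m\<in>reach F S b. \<forall>m'\<in>reach F S b. lab m = lab m' \<longrightarrow> m' \<otimes> inv m \<in> N <#> F)"
      by (rule exI[of _ F], rule exI[of _ L], rule exI[of _ lab])
         (intro conjI F L order_refl ballI impI labL labI; assumption)
  qed
  then show ?thesis by blast
qed

end

section \<open>Quotients of polynomial growth\<close>

context group
begin

lemma set_power_closed: "T \<subseteq> carrier G \<Longrightarrow> set_power G T r \<subseteq> carrier G"
  by (induction r) (auto simp: set_mult_closed)

lemma set_power_finite: "finite T \<Longrightarrow> finite (set_power G T r)"
  by (induction r) (auto simp: set_mult_def)

lemma set_power_add: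
  assumes "T \<subseteq> carrier G"
  shows "set_power G T (r + s) = set_power G T r <#> set_power G T s"
proof (induction s)
  case 0
  have "set_power G T r <#> {\<one>} = set_power G T r"
    using set_power_closed[OF assms, of r] by (auto simp: set_mult_def subset_iff)
  then show ?case by simp
next
  case (Suc s)
  have "set_power G T (r + Suc s) = (set_power G T r <#> set_power G T s) <#> T" using Suc by simp
  also have "\<dots> = set_power G T r <#> (set_power G T s <#> T)"
    by (intro set_mult_assoc set_power_closed assms)
  finally show ?case by simp
qed

lemma set_power_mult:
  assumes "T \<subseteq> carrier G" "a \<in> set_power G T r" "b \<in> set_power G T s"
  shows "a \<otimes> b \<in> set_power G T (r + s)"
  unfolding set_power_add[OF assms(1)] set_mult_def using assms by blast

lemma set_power_mono:
  assumes "T \<subseteq> carrier G" "\<one> \<in> T" "r \<le> s"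
  shows "set_power G T r \<subseteq> set_power G T s"
proof (rule lift_Suc_mono_le[OF _ assms(3)])
  fix n show "set_power G T n \<subseteq> set_power G T (Suc n)"
  proof
    fix x assume x: "x \<in> set_power G T n"
    have "x \<in> carrier G" by (rule subsetD[OF set_power_closed[OF assms(1)] x])
    then have "x = x \<otimes> \<one>" by simp
    then show "x \<in> set_power G T (Suc n)" using x assms(2) unfolding set_power.simps set_mult_def by blast
  qed
qed

lemma set_power_1: "T \<subseteq> carrier G \<Longrightarrow> set_power G T 1 = T"
  by (auto simp: set_mult_def subset_iff)

lemma set_power_inv:
  assumes T: "T \<subseteq> carrier G" "\<And>t. t \<in> T \<Longrightarrow> inv t \<in> T"
  shows "x \<in> set_power G T r \<Longrightarrow> inv x \<in> set_power G T r"
proof (induction r arbitrary: x)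
  case (Suc r)
  then obtain a t where at: "a \<in> set_power G T r" "t \<in> T" "x = a \<otimes> t" by (auto simp: set_mult_def)
  have "a \<in> carrier G" "t \<in> carrier G" using at set_power_closed[OF T(1)] T(1) by auto
  then have "inv x = inv t \<otimes> inv a" using at by (simp add: inv_mult_group)
  moreover have "inv t \<in> set_power G T 1" using T at set_power_1[OF T(1)] by simp
  ultimately have "inv x \<in> set_power G T (1 + r)"
    using set_power_mult[OF T(1) _ Suc.IH[OF at(1)], of "inv t" 1] by (simp only:)
  then show ?case by (simp only: plus_1_eq_Suc)
qed auto

lemma set_power_subgroup: "set_power (G\<lparr>carrier := K\<rparr>) T r = set_power G T r"
  by (induction r) (auto simp: set_mult_def)

end

context quotient_step
begin

text \<open>\<open>F\<close> lifts the ball of radius \<open>2 * r\<close>, so the translates of the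
  ball of radius \<open>r\<close> by the images of a separated set are disjoint. They lie in the
  ball of radius \<open>6 * r\<close>, hence in that of radius \<open>8 * r\<close>, which a good
  \<open>r\<close> makes at most \<open>8 ^ (d + 1)\<close> times larger. The exponent
  \<open>d\<close> serves all finitely generated subgroups, so the bound does not depend on
  \<open>S\<close>.\<close>

lemma packing_growth:
  assumes gr: "uniform_local_polynomial_growth Q"
  shows "\<exists>\<kappa>. packing_bound N M {\<one>} \<kappa>"
proof -
  obtain d where d: "\<And>K. subgroup K Q \<Longrightarrow> finitely_generated_group (Q\<lparr>carrier := K\<rparr>) \<Longrightarrow>
          \<exists>d'\<le>d. polynomial_volume_growth (Q\<lparr>carrier := K\<rparr>) d'"
    using gr unfolding uniform_local_polynomial_growth_def by (elim exE) (rule that, drule spec, erule mp, rule conjI)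
  have "packing_bound N M {\<one>} (8 ^ (d + 1))"
    unfolding packing_bound_def
  proof (intro allI impI)
    fix S assume S: "finite S \<and> S \<subseteq> M \<and> \<one> \<in> S"
    define T where "T = insert \<one>\<^bsub>Q\<^esub> (\<pi> ` S \<union> (m_inv Q) ` \<pi> ` S)"
    have T: "finite T" "T \<subseteq> carrier Q" "\<one>\<^bsub>Q\<^esub> \<in> T" "\<And>t. t \<in> T \<Longrightarrow> inv\<^bsub>Q\<^esub> t \<in> T" "\<pi> ` S \<subseteq> T"
      using S pi_closed by (auto simp: T_def)
    define K where "K = generate Q T"
    have K: "subgroup K Q" "T \<subseteq> K" unfolding K_def using Q.generate_is_subgroup[OF T(2)] generate.incl by auto
    have gK: "generate (Q\<lparr>carrier := K\<rparr>) T = K" unfolding K_def[symmetric]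
      using Q.generate_consistent[OF K(2,1)] by (simp add: K_def)
    have "finitely_generated_group (Q\<lparr>carrier := K\<rparr>)"
      unfolding finitely_generated_group_def using T(1) K(2) gK by (intro exI[of _ T]) simp
    from d[OF K(1) this] obtain d' where d': "d' \<le> d" "volume_growth_le (Q\<lparr>carrier := K\<rparr>) d'"
      unfolding polynomial_volume_growth_def by blast
    have "\<forall>b\<in>T. inv\<^bsub>Q\<lparr>carrier := K\<rparr>\<^esub> b \<in> T"
      using Q.m_inv_consistent[OF K(1)] K(2) T(4) by (auto simp: subset_iff)
    then obtain c where c: "c > 0" "\<forall>r\<ge>1. real (card (set_power (Q\<lparr>carrier := K\<rparr>) T r)) \<le> c * real r ^ d'"
      using d'(2)[unfolded volume_growth_le_def, rule_format, of T] T(1,3) K(2) gK by auto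
    let ?P = "set_power Q T"
    have Pc: "?P r \<subseteq> carrier Q" "finite (?P r)" for r
      using Q.set_power_closed[OF T(2)] Q.set_power_finite[OF T(1)] by auto
    have one: "\<one>\<^bsub>Q\<^esub> \<in> ?P r" for r using Q.set_power_mono[OF T(2,3), of 0 r] by simp
    have "real (card (?P r)) \<le> c * real r ^ d" if "r \<ge> 1" for r
    proof -
      have "real (card (?P r)) \<le> c * real r ^ d'" using c(2) that Q.set_power_subgroup by simp
      also have "\<dots> \<le> c * real r ^ d" using c(1) d'(1) that by (intro mult_left_mono power_increasing) auto
      finally show ?thesis .
    qed
    moreover have "card (?P 1) \<ge> 1" using one[of 1] Pc(2)[of 1] by (metis One_nat_def Suc_leI card_gt_0_iff empty_iff)
    ultimately obtain r where r: "r \<ge> 1" "card (?P (8 * r)) \<le> 8 ^ (d + 1) * card (?P r)"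
      using polynomial_doubling[of "\<lambda>r. card (?P r)" c d] by blast
    obtain F where F: "finite F" "F \<subseteq> M" "\<pi> ` F = ?P (2 * r)" "\<one> \<in> F" "\<forall>f\<in>F. inv f \<in> F"
      by (rule lift_finite[OF Pc(2,1) one Q.set_power_inv[OF T(2,4)]])
    \<comment> \<open>The radius \<open>2 * r + 1 + 2 * r\<close> is at most \<open>5 * r\<close>
      because \<open>r \<ge> 1\<close>.\<close>
    have bl: "z \<in> M \<and> \<pi> z \<in> ?P (5 * r)" if z: "z \<in> block F {\<one>} S" for z
    proof -
      have raw: "y \<in> M \<and> \<pi> y \<in> ?P (5 * r)" if "y \<in> F <#> {\<one>} <#> S <#> F" for y
      proof -
        have "\<exists>f s f'. f \<in> F \<and> s \<in> S \<and> f' \<in> F \<and> y = f \<otimes> \<one> \<otimes> s \<otimes> f'" using that by (elim set_multE) blast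
        then obtain f s f' where y: "f \<in> F" "s \<in> S" "f' \<in> F" "y = f \<otimes> \<one> \<otimes> s \<otimes> f'" by (elim exE conjE)
        have m: "f \<in> M" "s \<in> M" "f' \<in> M" using y F(2) S by auto
        have y': "y = f \<otimes> s \<otimes> f'" using y(4) m M.subset by (simp add: subset_iff)
        have "\<pi> f \<in> ?P (2 * r)" "\<pi> f' \<in> ?P (2 * r)" using y(1,3) F(3) by blast+
        moreover have "\<pi> s \<in> ?P 1" using y(2) T(5) Q.set_power_1[OF T(2)] by auto
        ultimately have "\<pi> f \<otimes>\<^bsub>Q\<^esub> \<pi> s \<otimes>\<^bsub>Q\<^esub> \<pi> f' \<in> ?P (2 * r + 1 + 2 * r)"
          by (intro Q.set_power_mult[OF T(2)])
        moreover have "?P (2 * r + 1 + 2 * r) \<subseteq> ?P (5 * r)" using r(1) by (intro Q.set_power_mono[OF T(2,3)]) simp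
        moreover have "\<pi> y = \<pi> f \<otimes>\<^bsub>Q\<^esub> \<pi> s \<otimes>\<^bsub>Q\<^esub> \<pi> f'" unfolding y' using m by (simp add: pi_hom)
        moreover have "y \<in> M" unfolding y' by (rule M.m_closed[OF M.m_closed[OF m(1,2)] m(3)])
        ultimately show ?thesis by auto
      qed
      from z consider "z \<in> F <#> {\<one>} <#> S <#> F" | y where "y \<in> F <#> {\<one>} <#> S <#> F" "z = inv y"
        unfolding block_def by blast
      then show ?thesis
      proof cases
        case 1 then show ?thesis by (rule raw)
      next
        case 2
        then show ?thesis using raw[OF 2(1)] Q.set_power_inv[OF T(2,4)] pi_inv by auto
      qed
    qed
    show "\<exists>F. finite F \<and> F \<subseteq> M \<and> \<one> \<in> F \<and> (\<forall>f\<in>F. inv f \<in> F) \<and>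
       (\<forall>Z. Z \<subseteq> block F {\<one>} S \<and> (\<forall>z\<in>Z. \<forall>z'\<in>Z. z \<noteq> z' \<longrightarrow> z' \<otimes> inv z \<notin> N <#> F) \<longrightarrow> card Z \<le> 8 ^ (d + 1))"
    proof (rule exI[of _ F], intro conjI F allI impI)
      fix Z assume Z: "Z \<subseteq> block F {\<one>} S \<and> (\<forall>z\<in>Z. \<forall>z'\<in>Z. z \<noteq> z' \<longrightarrow> z' \<otimes> inv z \<notin> N <#> F)"
      have Zb: "z \<in> M" "\<pi> z \<in> ?P (5 * r)" if "z \<in> Z" for z using bl Z that by auto
      define h where "h = (\<lambda>(z, a). a \<otimes>\<^bsub>Q\<^esub> \<pi> z)"
      have "inj_on h (Z \<times> ?P r)"
      proof (rule inj_onI)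
        fix p p' assume p: "p \<in> Z \<times> ?P r" "p' \<in> Z \<times> ?P r" "h p = h p'"
        obtain z a z' a' where e: "p = (z, a)" "p' = (z', a')" by (cases p, cases p')
        have za: "z \<in> Z" "z' \<in> Z" "a \<in> ?P r" "a' \<in> ?P r" "a \<otimes>\<^bsub>Q\<^esub> \<pi> z = a' \<otimes>\<^bsub>Q\<^esub> \<pi> z'" using p e by (auto simp: h_def)
        have c: "a \<in> carrier Q" "a' \<in> carrier Q" "\<pi> z \<in> carrier Q" "\<pi> z' \<in> carrier Q"
          using za Pc pi_closed Zb by auto
        have "z = z'"
        proof (rule ccontr)
          assume ne: "z \<noteq> z'"
          have "\<pi> z' = inv\<^bsub>Q\<^esub> a' \<otimes>\<^bsub>Q\<^esub> (a' \<otimes>\<^bsub>Q\<^esub> \<pi> z')" using c by (simp add: Q.m_assoc[symmetric])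
          then have z': "\<pi> z' = inv\<^bsub>Q\<^esub> a' \<otimes>\<^bsub>Q\<^esub> (a \<otimes>\<^bsub>Q\<^esub> \<pi> z)" unfolding za(5) .
          have "\<pi> (z' \<otimes> inv z) = \<pi> z' \<otimes>\<^bsub>Q\<^esub> inv\<^bsub>Q\<^esub> (\<pi> z)" using Zb za(1,2) by (simp add: pi_hom pi_inv)
          also have "\<dots> = inv\<^bsub>Q\<^esub> a' \<otimes>\<^bsub>Q\<^esub> a" unfolding z' using c by (simp add: Q.m_assoc)
          also have "\<dots> \<in> ?P (r + r)" using za(3,4) by (intro Q.set_power_mult[OF T(2)] Q.set_power_inv[OF T(2,4)])
          finally have "\<pi> (z' \<otimes> inv z) \<in> \<pi> ` F" unfolding F(3) mult_2 .
          then obtain f where "f \<in> F" "\<pi> (z' \<otimes> inv z) = \<pi> f" by blast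
          then have "z' \<otimes> inv z \<in> N <#> F" using Zb za(1,2) F(2) by (intro pi_eq_cosetI) auto
          then show False using conjunct2[OF Z, rule_format, OF za(1,2) ne] by blast
        qed
        moreover from this have "a = a'" using za(5) c by simp
        ultimately show "p = p'" using e by simp
      qed
      moreover have "h ` (Z \<times> ?P r) \<subseteq> ?P (8 * r)"
      proof
        fix y assume "y \<in> h ` (Z \<times> ?P r)"
        then obtain z a where za: "z \<in> Z" "a \<in> ?P r" "y = a \<otimes>\<^bsub>Q\<^esub> \<pi> z" by (auto simp: h_def)
        have "y \<in> ?P (r + 5 * r)" unfolding za(3) by (rule Q.set_power_mult[OF T(2) za(2) Zb(2)[OF za(1)]])
        moreover have "?P (r + 5 * r) \<subseteq> ?P (8 * r)" by (intro Q.set_power_mono[OF T(2,3)]) simp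
        ultimately show "y \<in> ?P (8 * r)" by blast
      qed
      ultimately have "card (Z \<times> ?P r) \<le> card (?P (8 * r))" using Pc(2) by (intro card_inj_on_le)
      then have "card Z * card (?P r) \<le> 8 ^ (d + 1) * card (?P r)"
        unfolding card_cartesian_product using r(2) by (rule order_trans)
      moreover have "card (?P r) > 0" using one[of r] Pc(2)[of r] card_gt_0_iff by blast
      ultimately show "card Z \<le> 8 ^ (d + 1)" by (rule mult_right_le_imp_le)
    qed
  qed
  then show ?thesis by blast
qed

end

locale lamplighter_step = quotient_step \<Gamma> X \<phi> N "carrier \<Gamma>" lamplighter_group \<pi>
  for \<Gamma> :: "('a, 'm) monoid_scheme" (structure) and X :: "'x measure" and \<phi> N \<pi>
begin

\<comment> \<open>with \<open>M = carrier \<Gamma>\<close> this rule loops\<close>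
declare M.mem_carrier [simp del]

section \<open>The lamplighter group\<close>

definition lamps :: "'a \<Rightarrow> int \<Rightarrow> int" where "lamps m = fst (\<pi> m)"
definition pos :: "'a \<Rightarrow> int" where "pos m = snd (\<pi> m)"
definition base :: "'a set" where "base = {m \<in> carrier \<Gamma>. pos m = 0}"

lemma lamps_range: "m \<in> carrier \<Gamma> \<Longrightarrow> lamps m x = 0 \<or> lamps m x = 1"
proof -
  assume "m \<in> carrier \<Gamma>"
  then have "\<pi> m \<in> carrier lamplighter_group" by (rule pi_closed)
  then have "lamps m x \<in> {0..<2}"
    by (auto simp: lamps_def lamplighter_group_def wreath_product_def PiE_def Pi_def carrier_integer_mod_group integer_group_def)
  then show ?thesis by auto
qed

lemma lamps_finite: "m \<in> carrier \<Gamma> \<Longrightarrow> finite {x. lamps m x \<noteq> 0}"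
proof -
  assume "m \<in> carrier \<Gamma>"
  then have "\<pi> m \<in> carrier lamplighter_group" by (rule pi_closed)
  then show ?thesis
    by (auto simp: lamps_def lamplighter_group_def wreath_product_def integer_group_def integer_mod_group_def)
qed

lemma pi_mult:
  assumes "m \<in> carrier \<Gamma>" "m' \<in> carrier \<Gamma>"
  shows "lamps (m \<otimes> m') x = (lamps m x + lamps m' (x - pos m)) mod 2" "pos (m \<otimes> m') = pos m + pos m'"
proof -
  have "inv\<^bsub>integer_group\<^esub> b = - b" for b by simp
  moreover have "\<pi> (m \<otimes> m') = \<pi> m \<otimes>\<^bsub>lamplighter_group\<^esub> \<pi> m'" using assms by (rule pi_hom)
  ultimately show "lamps (m \<otimes> m') x = (lamps m x + lamps m' (x - pos m)) mod 2" "pos (m \<otimes> m') = pos m + pos m'"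
    by (auto simp: lamps_def pos_def lamplighter_group_def wreath_product_def integer_group_def
          integer_mod_group_def split: prod.splits)
qed

lemma pi_unit: "lamps \<one> x = 0" "pos \<one> = 0"
  using pi_one by (auto simp: lamps_def pos_def lamplighter_group_def wreath_product_def integer_group_def
          integer_mod_group_def)

lemma pos_inv: "m \<in> carrier \<Gamma> \<Longrightarrow> pos (inv m) = - pos m"
  using pi_mult(2)[of m "inv m"] pi_unit by simp

lemma pos_conj: "b \<in> carrier \<Gamma> \<Longrightarrow> m \<in> carrier \<Gamma> \<Longrightarrow> pos (b \<otimes> m \<otimes> inv b) = pos m"
  by (simp add: pi_mult pos_inv)

lemma pi_eqI: "\<lbrakk>\<And>x. lamps m x = lamps m' x; pos m = pos m'\<rbrakk> \<Longrightarrow> \<pi> m = \<pi> m'"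
  by (auto simp: lamps_def pos_def intro!: prod_eqI)

lemma base_normal: "base \<lhd> \<Gamma>"
proof (rule normal_invI)
  show "subgroup base \<Gamma>" by unfold_locales (auto simp: base_def pi_mult pi_unit pos_inv)
qed (auto simp: base_def pos_conj)

lemma N_base: "N \<subseteq> base"
proof
  fix n assume n: "n \<in> N"
  have "n \<in> carrier \<Gamma>" by (rule N.mem_carrier[OF n])
  moreover from iffD2[OF pi_ker[OF this] n] have "\<pi> n = \<pi> \<one>" unfolding pi_one .
  ultimately have "n \<in> carrier \<Gamma>" "\<pi> n = \<pi> \<one>" by blast+
  then show "n \<in> base" using pi_unit by (simp add: base_def pos_def)
qed

lemma lamps_inv: "m \<in> base \<Longrightarrow> lamps (inv m) x = lamps m x"
proof -
  assume m: "m \<in> base"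
  then have c: "m \<in> carrier \<Gamma>" "inv m \<in> carrier \<Gamma>" "pos m = 0" by (auto simp: base_def)
  have "(lamps m x + lamps (inv m) x) mod 2 = 0" using pi_mult(1)[OF c(1,2), of x] c pi_unit(1) by simp
  then show ?thesis using lamps_range[OF c(1), of x] lamps_range[OF c(2), of x] by auto
qed

lemma lamps_conj:
  assumes b: "b \<in> carrier \<Gamma>" and m: "m \<in> base"
  shows "lamps (b \<otimes> m \<otimes> inv b) x = lamps m (x - pos b)"
proof -
  let ?n = "b \<otimes> m \<otimes> inv b"
  have c: "m \<in> carrier \<Gamma>" "?n \<in> carrier \<Gamma>" "pos ?n = 0" using b m by (auto simp: base_def pos_conj)
  \<comment> \<open>Comparing the lamps of both sides of this equation avoids those of
    \<open>inv b\<close>; the lamps of \<open>b\<close> cancel modulo 2.\<close>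
  have "?n \<otimes> b = b \<otimes> m" using b c(1) by (simp add: m_assoc)
  then have "(lamps ?n x + lamps b x) mod 2 = (lamps b x + lamps m (x - pos b)) mod 2"
    using pi_mult(1)[OF c(2) b, of x] pi_mult(1)[OF b c(1), of x] c(3) by simp
  then show ?thesis
    using lamps_range[OF b, of x] lamps_range[OF c(1), of "x - pos b"] lamps_range[OF c(2), of x] by auto
qed

text \<open>\<open>F\<close> represents the configurations of lamps inside \<open>{-r..r}\<close>.
  Conjugation by \<open>b\<close> shifts the lamps by \<open>pos b\<close>, so elements of
  \<open>reach\<close> have their lamps within distance \<open>r + w\<close>. At most
  \<open>w\<close> positions on either side lie outside the central interval, and \<open>w\<close>
  depends only on \<open>B\<close>; the label records these.\<close>

lemma packing_lamps:
  assumes B: "finite B" "B \<subseteq> carrier \<Gamma>"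
  shows "\<exists>\<kappa>. packing_bound N base B \<kappa>"
proof -
  interpret L: normal base \<Gamma> by (rule base_normal)
  have Lc: "m \<in> carrier \<Gamma>" if "m \<in> base" for m using that L.subset by blast
  define B' where "B' = B \<union> (m_inv \<Gamma>) ` B"
  have B': "finite B'" "\<And>b. b \<in> B' \<Longrightarrow> b \<in> carrier \<Gamma>" using B by (auto simp: B'_def)
  define w where "w = (\<Sum>b\<in>B'. \<bar>pos b\<bar>)"
  have w: "\<bar>pos b\<bar> \<le> w" if "b \<in> B'" for b unfolding w_def using B'(1) that by (intro member_le_sum) auto
  define K where "K = Pow {1..w} \<times> Pow {1..w}"
  have "packing_bound N base B (card B' * card K)"
  proof (rule packing_boundI[where 'l="int set \<times> int set", OF base_normal B B'_def])
    fix S assume S: "finite S" "S \<subseteq> base"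
    define A where "A = (\<Union>s\<in>S. {x. lamps s x \<noteq> 0})"
    have A: "finite A" using S Lc lamps_finite by (auto simp: A_def)
    define r where "r = (\<Sum>x\<in>A. \<bar>x\<bar>)"
    have r: "\<bar>x\<bar> \<le> r" if "s \<in> S" "lamps s x \<noteq> 0" for s x
      unfolding r_def using A that by (intro member_le_sum) (auto simp: A_def)
    define G where "G = {m \<in> base. \<forall>x. lamps m x \<noteq> 0 \<longrightarrow> \<bar>x\<bar> \<le> r}"
    have SG: "S \<subseteq> G" using S r by (auto simp: G_def)
    have G1: "\<one> \<in> G" using pi_unit by (auto simp: G_def)
    have Ginv: "inv m \<in> G" if "m \<in> G" for m using that by (auto simp: G_def lamps_inv)
    have "lamps ` G \<subseteq> (\<lambda>A x. if x \<in> A then 1 else 0) ` Pow {-r..r}"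
    proof (rule image_subsetI)
      fix m assume m: "m \<in> G"
      then have "lamps m = (\<lambda>x. if x \<in> {x. lamps m x \<noteq> 0} then 1 else 0)"
        using lamps_range[of m] Lc by (force simp: G_def)
      moreover have "{x. lamps m x \<noteq> 0} \<in> Pow {-r..r}" using m by (force simp: G_def)
      ultimately show "lamps m \<in> (\<lambda>A x. if x \<in> A then 1 else 0) ` Pow {-r..r}" by (rule image_eqI)
    qed
    then have fl: "finite (lamps ` G)" by (rule finite_subset) simp
    have "\<forall>v\<in>lamps ` G. \<exists>m. m \<in> G \<and> lamps m = v" by blast
    from bchoice[OF this] obtain p where p: "\<forall>v\<in>lamps ` G. p v \<in> G \<and> lamps (p v) = v" by (elim exE) (rule that)
    define F where "F = insert \<one> (p ` lamps ` G \<union> (m_inv \<Gamma>) ` p ` lamps ` G)"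
    have GM: "G \<subseteq> base" by (auto simp: G_def)
    have FG: "F \<subseteq> G" using p G1 Ginv by (auto simp: F_def)
    have F: "finite F" "F \<subseteq> base" "\<one> \<in> F" "\<forall>f\<in>F. inv f \<in> F"
    proof -
      show "finite F" "\<one> \<in> F" using fl by (auto simp: F_def)
      show "F \<subseteq> base" using FG GM by blast
      have "inv (inv (p v)) = p v" if "v \<in> lamps ` G" for v
      proof -
        have "p v \<in> carrier \<Gamma>" using p that GM Lc by blast
        then show ?thesis by simp
      qed
      then show "\<forall>f\<in>F. inv f \<in> F" unfolding F_def by auto
    qed
    have GF: "m \<in> N <#> F" if m: "m \<in> G" for m
    proof -
      define f where "f = p (lamps m)"
      have f: "f \<in> G" "lamps f = lamps m" "f \<in> F" using p m by (auto simp: f_def F_def)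
      have b: "f \<in> base" "m \<in> base" by (rule subsetD[OF GM f(1)], rule subsetD[OF GM m])
      have p0: "pos m = 0" "pos f = 0" using b unfolding base_def by blast+
      have "\<pi> m = \<pi> f" by (rule pi_eqI) (simp_all only: f(2) p0)
      moreover have "F \<subseteq> carrier \<Gamma>" using F(2) L.subset by (rule order_trans)
      ultimately show ?thesis using Lc[OF b(2)] f(3) by (intro pi_eq_cosetI)
    qed
    define lab where "lab m = ({i \<in> {1..w}. lamps m (r + i) \<noteq> 0}, {i \<in> {1..w}. lamps m (- r - i) \<noteq> 0})" for m
    have rch: "m \<in> base \<and> (\<forall>x. lamps m x \<noteq> 0 \<longrightarrow> \<bar>x\<bar> \<le> r + w)" if b: "b \<in> B'" and m: "m \<in> reach F S b" for b m
    proof -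
      obtain f s f' where fs: "f \<in> F" "s \<in> S" "f' \<in> F" "m = f \<otimes> s \<otimes> (b \<otimes> f' \<otimes> inv b)" using m by (rule reachE)
      have fG: "f \<in> G" "s \<in> G" "f' \<in> G" using fs FG SG by auto
      then have fM: "f \<in> base" "s \<in> base" "f' \<in> base" "b \<otimes> f' \<otimes> inv b \<in> base" "f \<otimes> s \<in> base"
        using GM L.inv_op_closed2[OF B'(2)[OF b]] by auto
      have p0: "pos f = 0" "pos (f \<otimes> s) = 0" using fM(1,5) unfolding base_def by blast+
      have l: "lamps m x = ((lamps f x + lamps s x) mod 2 + lamps f' (x - pos b)) mod 2" for x
        unfolding fs(4) pi_mult(1)[OF Lc[OF fM(5)] Lc[OF fM(4)]] pi_mult(1)[OF Lc[OF fM(1)] Lc[OF fM(2)]]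
          p0 diff_0_right lamps_conj[OF B'(2)[OF b] fM(3)] ..
      have "\<bar>x\<bar> \<le> r + w" if "lamps m x \<noteq> 0" for x
      proof -
        have "lamps f x \<noteq> 0 \<or> lamps s x \<noteq> 0 \<or> lamps f' (x - pos b) \<noteq> 0" using that unfolding l by auto
        then have "\<bar>x\<bar> \<le> r \<or> \<bar>x - pos b\<bar> \<le> r" using fG by (auto simp: G_def)
        then show ?thesis using w[OF b] by linarith
      qed
      moreover have "m \<in> base" unfolding fs(4) by (rule L.m_closed[OF fM(5,4)])
      ultimately show ?thesis by blast
    qed
    have labK: "lab m \<in> K" for m by (auto simp: lab_def K_def)
    have labI: "m' \<otimes> inv m \<in> N <#> F" if b: "b \<in> B'" and m: "m \<in> reach F S b" "m' \<in> reach F S b" "lab m = lab m'" for b m m'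
    proof (rule GF)
      have mb: "m \<in> base" "m' \<in> base" "inv m \<in> base"
        using rch[OF b m(1)] rch[OF b m(2)] L.m_inv_closed by blast+
      have p0: "pos m' = 0" using mb(2) unfolding base_def by blast
      have l: "lamps (m' \<otimes> inv m) x = (lamps m' x + lamps m x) mod 2" for x
        unfolding pi_mult(1)[OF Lc[OF mb(2)] Lc[OF mb(3)]] lamps_inv[OF mb(1)] p0 by simp
      have "\<bar>x\<bar> \<le> r" if x: "lamps (m' \<otimes> inv m) x \<noteq> 0" for x
      proof (rule ccontr)
        assume nr: "\<not> ?thesis"
        have ne: "(lamps m x \<noteq> 0) \<noteq> (lamps m' x \<noteq> 0)"
          using x unfolding l using lamps_range[OF Lc[OF mb(1)], of x] lamps_range[OF Lc[OF mb(2)], of x] by auto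
        then have xb: "\<bar>x\<bar> \<le> r + w" using rch[OF b m(1)] rch[OF b m(2)] by blast
        show False
        proof (cases "x > 0")
          case True
          then have "x - r \<in> {1..w}" using nr xb by auto
          then have "(lamps m (r + (x - r)) \<noteq> 0) = (lamps m' (r + (x - r)) \<noteq> 0)"
            using m(3) unfolding lab_def by blast
          then show False using ne by simp
        next
          case False
          then have "- x - r \<in> {1..w}" using nr xb by auto
          then have "(lamps m (- r - (- x - r)) \<noteq> 0) = (lamps m' (- r - (- x - r)) \<noteq> 0)"
            using m(3) unfolding lab_def by blast
          then show False using ne by simp
        qed
      qed
      then show "m' \<otimes> inv m \<in> G" unfolding G_def using mb L.m_closed by blast
    qed
    have "finite K" by (simp add: K_def)
    then show "\<exists>F (L'::(int set \<times> int set) set) lab. finite F \<and> F \<subseteq> base \<and> \<one> \<in> F \<and> (\<forall>f\<in>F. inv f \<in> F) \<and>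
       finite L' \<and> card L' \<le> card K \<and> (\<forall>b\<in>B'. \<forall>m\<in>reach F S b. lab m \<in> L') \<and>
       (\<forall>b\<in>B'. \<forall>m\<in>reach F S b. \<forall>m'\<in>reach F S b. lab m = lab m' \<longrightarrow> m' \<otimes> inv m \<in> N <#> F)"
      by - (rule exI[of _ F], rule exI[of _ K], rule exI[of _ lab],
        intro conjI F order_refl ballI impI labK labI; assumption)
  qed
  then show ?thesis by blast
qed

text \<open>\<open>pos\<close> is a homomorphism to the integers with kernel \<open>base\<close>,
  and conjugation does not change it, so it serves as the single rational coordinate.\<close>

lemma packing_shift: "\<exists>\<kappa>. packing_bound base (carrier \<Gamma>) {\<one>} \<kappa>"
proof (rule packing_coordinates[where J="{()}" and \<theta>="\<lambda>m _. of_int (pos m)", OF M])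
  show "\<exists>\<beta>. \<forall>m\<in>carrier \<Gamma>. \<forall>i\<in>{()}. rat_of_int (pos (b \<otimes> m \<otimes> inv b)) = (\<Sum>j\<in>{()}. \<beta> i j * rat_of_int (pos m))"
    if "b \<in> carrier \<Gamma>" for b
    by (rule exI[of _ "\<lambda>_ _. 1"]) (use that in \<open>simp add: pos_conj\<close>)
qed (auto simp: base_def pi_mult)

end

section \<open>Rational coordinates on torsion-free abelian groups of finite rank\<close>

text \<open>By induction on the functionals: the functions killed by \<open>e\<close> are separated
  from 0 by the others, and one \<open>g\<close> with \<open>e g \<noteq> 0\<close> supplements a
  finite set that generates them.\<close>

lemma finite_span_functions:
  fixes \<H> :: "('a \<Rightarrow> rat) set" and E :: "(('a \<Rightarrow> rat) \<Rightarrow> rat) set"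
  assumes "finite E"
    and "\<And>f g c. f \<in> \<H> \<Longrightarrow> g \<in> \<H> \<Longrightarrow> (\<lambda>x. f x + c * g x) \<in> \<H>"
    and "\<And>e f g c. e \<in> E \<Longrightarrow> f \<in> \<H> \<Longrightarrow> g \<in> \<H> \<Longrightarrow> e (\<lambda>x. f x + c * g x) = e f + c * e g"
    and "\<And>f. f \<in> \<H> \<Longrightarrow> (\<forall>e\<in>E. e f = 0) \<Longrightarrow> f = (\<lambda>_. 0)"
  shows "\<exists>J. finite J \<and> J \<subseteq> \<H> \<and> (\<forall>f\<in>\<H>. \<exists>\<beta>. \<forall>x. f x = (\<Sum>j\<in>J. \<beta> j * j x))"
  using assms
proof (induction E arbitrary: \<H> rule: finite_induct)
  case empty
  have "f = (\<lambda>_. 0)" if "f \<in> \<H>" for f using empty.prems(3)[OF that] by simp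
  then show ?case by (intro exI[of _ "{}"]) auto
next
  case (insert e E)
  define \<H>' where "\<H>' = {f \<in> \<H>. e f = 0}"
  have "\<exists>J. finite J \<and> J \<subseteq> \<H>' \<and> (\<forall>f\<in>\<H>'. \<exists>\<beta>. \<forall>x. f x = (\<Sum>j\<in>J. \<beta> j * j x))"
  proof (rule insert.IH)
    show "(\<lambda>x. f x + c * g x) \<in> \<H>'" if "f \<in> \<H>'" "g \<in> \<H>'" for f g c
      using that insert.prems(1)[of f g c] insert.prems(2)[of e f g c] by (simp add: \<H>'_def)
    show "e' (\<lambda>x. f x + c * g x) = e' f + c * e' g" if "e' \<in> E" "f \<in> \<H>'" "g \<in> \<H>'" for e' f g c
      using that insert.prems(2)[of e' f g c] by (simp add: \<H>'_def)
    show "f = (\<lambda>_. 0)" if "f \<in> \<H>'" "\<forall>e\<in>E. e f = 0" for f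
      using that insert.prems(3)[of f] by (simp add: \<H>'_def)
  qed
  then obtain J where J: "finite J" "J \<subseteq> \<H>'" "\<forall>f\<in>\<H>'. \<exists>\<beta>. \<forall>x. f x = (\<Sum>j\<in>J. \<beta> j * j x)"
    by (elim exE conjE) (rule that)
  show ?case
  proof (cases "\<H>' = \<H>")
    case True
    then show ?thesis using J by (intro exI[of _ J]) simp
  next
    case False
    then obtain g where g: "g \<in> \<H>" "e g \<noteq> 0" by (auto simp: \<H>'_def)
    have gJ: "g \<notin> J" using J(2) g(2) by (auto simp: \<H>'_def)
    have "\<exists>\<beta>. \<forall>x. f x = (\<Sum>j\<in>insert g J. \<beta> j * j x)" if f: "f \<in> \<H>" for f
    proof -
      define c where "c = e f / e g"
      have "(\<lambda>x. f x + (- c) * g x) \<in> \<H>'"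
        using insert.prems(1)[OF f g(1), of "- c"] insert.prems(2)[OF _ f g(1), of e "- c"] g(2)
        by (simp add: \<H>'_def c_def)
      then obtain \<beta> where \<beta>: "\<forall>x. f x + (- c) * g x = (\<Sum>j\<in>J. \<beta> j * j x)" using J(3) by meson
      have "f x = (\<Sum>j\<in>insert g J. (\<beta>(g := c)) j * j x)" for x
      proof -
        have "(\<Sum>j\<in>J. (\<beta>(g := c)) j * j x) = (\<Sum>j\<in>J. \<beta> j * j x)" using gJ by (intro sum.cong) auto
        then show ?thesis using \<beta>[rule_format, of x] J(1) gJ by (simp add: algebra_simps)
      qed
      then show ?thesis by (intro exI[of _ "\<beta>(g := c)"] allI)
    qed
    then show ?thesis using J g by (intro exI[of _ "insert g J"]) (auto simp: \<H>'_def)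
  qed
qed

definition rat_hom :: "('a, 'm) monoid_scheme \<Rightarrow> ('a \<Rightarrow> rat) \<Rightarrow> bool" where
  "rat_hom G f \<longleftrightarrow> (\<forall>x\<in>carrier G. \<forall>y\<in>carrier G. f (x \<otimes>\<^bsub>G\<^esub> y) = f x + f y)"

text \<open>Partial homomorphisms are represented by their graphs, so that Zorn's lemma applies to inclusion.\<close>

definition partial_rat_hom :: "('a, 'm) monoid_scheme \<Rightarrow> ('a \<times> rat) set \<Rightarrow> bool" where
  "partial_rat_hom G g \<longleftrightarrow> g \<subseteq> carrier G \<times> UNIV \<and> (\<one>\<^bsub>G\<^esub>, 0) \<in> g \<and>
     (\<forall>x q y r. (x, q) \<in> g \<and> (y, r) \<in> g \<longrightarrow> (x \<otimes>\<^bsub>G\<^esub> y, q + r) \<in> g) \<and>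
     (\<forall>x q. (x, q) \<in> g \<longrightarrow> (inv\<^bsub>G\<^esub> x, - q) \<in> g) \<and> (\<forall>q. (\<one>\<^bsub>G\<^esub>, q) \<in> g \<longrightarrow> q = 0)"

section \<open>Extension of rational homomorphisms\<close>

context comm_group
begin

lemma partial_rat_hom_int_pow:
  assumes g: "partial_rat_hom G g" and x: "(x, q) \<in> g"
  shows "(x [^] (k::int), of_int k * q) \<in> g"
proof -
  have mul: "\<And>x q y r. (x, q) \<in> g \<Longrightarrow> (y, r) \<in> g \<Longrightarrow> (x \<otimes> y, q + r) \<in> g"
    and inv: "\<And>x q. (x, q) \<in> g \<Longrightarrow> (inv x, - q) \<in> g" and one: "(\<one>, 0) \<in> g" and sub: "g \<subseteq> carrier G \<times> UNIV"
    using g unfolding partial_rat_hom_def by blast+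
  have xc: "x \<in> carrier G" using x sub by blast
  have n: "(x [^] n, of_nat n * q) \<in> g" for n :: nat
  proof (induction n)
    case (Suc n)
    have "(x [^] n \<otimes> x, of_nat n * q + q) \<in> g" by (rule mul[OF Suc x])
    then show ?case by (simp add: algebra_simps)
  qed (use one in simp)
  show ?thesis
  proof (cases k)
    case (nonneg n)
    then show ?thesis using n[of n] by (simp add: int_pow_int)
  next
    case (neg n)
    have "(inv (x [^] Suc n), - (of_nat (Suc n) * q)) \<in> g" by (rule inv[OF n])
    moreover have "x [^] (- int (Suc n)) = inv (x [^] Suc n)" using xc by (simp only: int_pow_neg int_pow_int)
    ultimately show ?thesis unfolding neg by (simp only: of_int_minus of_int_of_nat_eq mult_minus_left)
  qed
qed

text \<open>The value at \<open>x\<close> is forced as soon as some power \<open>x [^] k0\<close>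
  with \<open>k0 \<noteq> 0\<close> has a value \<open>q0\<close>, and division in the rationals
  provides it; otherwise 0 will do.\<close>

lemma partial_rat_hom_extend:
  assumes g: "partial_rat_hom G g" and x: "x \<in> carrier G"
  shows "\<exists>g'. partial_rat_hom G g' \<and> g \<subseteq> g' \<and> (\<exists>q. (x, q) \<in> g')"
proof -
  have mul: "\<And>x q y r. (x, q) \<in> g \<Longrightarrow> (y, r) \<in> g \<Longrightarrow> (x \<otimes> y, q + r) \<in> g"
    and inv: "\<And>x q. (x, q) \<in> g \<Longrightarrow> (inv x, - q) \<in> g" and one: "(\<one>, 0) \<in> g" and sub: "g \<subseteq> carrier G \<times> UNIV"
    and uniq: "\<And>q. (\<one>, q) \<in> g \<Longrightarrow> q = 0"
    using g unfolding partial_rat_hom_def by blast+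
  have "\<exists>r. \<forall>(k::int) q. (x [^] k, q) \<in> g \<longrightarrow> q = of_int k * r"
  proof (cases "\<exists>(k0::int) q0. k0 \<noteq> 0 \<and> (x [^] k0, q0) \<in> g")
    case True
    then obtain k0 :: int and q0 where k0: "k0 \<noteq> 0" "(x [^] k0, q0) \<in> g" by blast
    have "q = of_int k * (q0 / of_int k0)" if "(x [^] k, q) \<in> g" for k :: int and q
    proof -
      \<comment> \<open>The two values are compared at the common power
        \<open>x [^] (k * k0)\<close>.\<close>
      have 1: "(x [^] (k * k0), of_int k0 * q) \<in> g"
        using partial_rat_hom_int_pow[OF g that, of k0] x by (simp add: int_pow_pow)
      have "(x [^] (k0 * k), of_int k * q0) \<in> g"
        using partial_rat_hom_int_pow[OF g k0(2), of k] x by (simp add: int_pow_pow)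
      then have "(inv (x [^] (k * k0)), - (of_int k * q0)) \<in> g" by (intro inv) (simp add: mult.commute)
      then have "(x [^] (k * k0) \<otimes> inv (x [^] (k * k0)), of_int k0 * q + - (of_int k * q0)) \<in> g" by (rule mul[OF 1])
      then have "(\<one>, of_int k0 * q + - (of_int k * q0)) \<in> g" using x by (simp add: r_inv)
      then have "of_int k0 * q = of_int k * q0" using uniq by fastforce
      then show ?thesis using k0(1) by (simp add: field_simps)
    qed
    then show ?thesis by blast
  next
    case False
    have "q = of_int k * 0" if "(x [^] k, q) \<in> g" for k :: int and q
    proof -
      have "k = 0" using False that by blast
      then show ?thesis using that uniq by simp
    qed
    then show ?thesis by blast
  qed
  then obtain r where r: "\<And>(k::int) q. (x [^] k, q) \<in> g \<Longrightarrow> q = of_int k * r" by blast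
  define g' where "g' = {(d \<otimes> x [^] (k::int), q + of_int k * r) | d q k. (d, q) \<in> g}"
  have g'I: "(d \<otimes> x [^] (k::int), q + of_int k * r) \<in> g'" if "(d, q) \<in> g" for d q k
    using that unfolding g'_def by blast
  have g'E: "\<exists>d q k. (d, q) \<in> g \<and> d \<in> carrier G \<and> y = d \<otimes> x [^] (k::int) \<and> s = q + of_int k * r" if "(y, s) \<in> g'" for y s
    using that sub unfolding g'_def by blast
  have gg': "g \<subseteq> g'"
  proof (rule subrelI)
    fix d q assume d: "(d, q) \<in> g"
    then have "d \<in> carrier G" using sub by blast
    then show "(d, q) \<in> g'" using g'I[OF d, of 0] by simp
  qed
  have "partial_rat_hom G g'"
    unfolding partial_rat_hom_def
  proof (intro conjI allI impI)
    show "g' \<subseteq> carrier G \<times> UNIV"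
    proof (rule subrelI)
      fix y s assume "(y, s) \<in> g'"
      then obtain d q and k :: int where "d \<in> carrier G" "y = d \<otimes> x [^] k" using g'E by blast
      then show "(y, s) \<in> carrier G \<times> UNIV" using x by simp
    qed
    show "(\<one>, 0) \<in> g'" using gg' one by blast
  next
    fix y s z t assume "(y, s) \<in> g' \<and> (z, t) \<in> g'"
    then obtain d q k d' q' k' where *: "(d, q) \<in> g" "d \<in> carrier G" "y = d \<otimes> x [^] (k::int)" "s = q + of_int k * r"
      "(d', q') \<in> g" "d' \<in> carrier G" "z = d' \<otimes> x [^] (k'::int)" "t = q' + of_int k' * r" using g'E by meson
    have "y \<otimes> z = d \<otimes> d' \<otimes> x [^] (k + k')" unfolding *(3,7) using *(2,6) x by (simp add: int_pow_mult m_ac)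
    moreover have "s + t = q + q' + of_int (k + k') * r" using *(4,8) by (simp add: algebra_simps)
    ultimately show "(y \<otimes> z, s + t) \<in> g'" using g'I[OF mul[OF *(1,5)], of "k + k'"] by simp
  next
    fix y s assume "(y, s) \<in> g'"
    then obtain d q k where *: "(d, q) \<in> g" "d \<in> carrier G" "y = d \<otimes> x [^] (k::int)" "s = q + of_int k * r" using g'E by meson
    have "inv y = inv d \<otimes> x [^] (- k)" unfolding *(3) using *(2) x by (simp add: inv_mult int_pow_neg)
    moreover have "- s = - q + of_int (- k) * r" using *(4) by simp
    ultimately show "(inv y, - s) \<in> g'" using g'I[OF inv[OF *(1)], of "- k"] by simp
  next
    fix s assume "(\<one>, s) \<in> g'"
    then obtain d q k where *: "(d, q) \<in> g" "d \<in> carrier G" "\<one> = d \<otimes> x [^] (k::int)" "s = q + of_int k * r" using g'E by meson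
    have "inv d = x [^] k" using *(2,3) x by (intro inv_equality) (simp_all add: m_comm)
    then have "(x [^] k, - q) \<in> g" using inv[OF *(1)] by simp
    then show "s = 0" using r *(4) by fastforce
  qed
  moreover have "(x, r) \<in> g'" using g'I[OF one, of 1] x by simp
  ultimately show ?thesis using gg' by blast
qed

lemma rat_hom_extension:
  assumes g0: "partial_rat_hom G g0"
  shows "\<exists>f. rat_hom G f \<and> (\<forall>(x, q)\<in>g0. f x = q)"
proof -
  define \<A> where "\<A> = {g. partial_rat_hom G g \<and> g0 \<subseteq> g}"
  have "\<exists>M\<in>\<A>. \<forall>X\<in>\<A>. M \<subseteq> X \<longrightarrow> X = M"
  proof (rule subset_Zorn_nonempty)
    show "\<A> \<noteq> {}" using g0 by (auto simp: \<A>_def)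
    fix \<C> assume C: "\<C> \<noteq> {}" "subset.chain \<A> \<C>"
    then have CA: "\<C> \<subseteq> \<A>" and ch: "\<And>a b. a \<in> \<C> \<Longrightarrow> b \<in> \<C> \<Longrightarrow> a \<subseteq> b \<or> b \<subseteq> a"
      by (auto simp: subset_chain_def)
    have P: "partial_rat_hom G c" if "c \<in> \<C>" for c using that CA by (auto simp: \<A>_def)
    obtain c0 where c0: "c0 \<in> \<C>" using C(1) by blast
    have "partial_rat_hom G (\<Union>\<C>)"
      unfolding partial_rat_hom_def
    proof (intro conjI allI impI)
      show "\<Union>\<C> \<subseteq> carrier G \<times> UNIV" using P unfolding partial_rat_hom_def by blast
      have "(\<one>, 0) \<in> c0" using P[OF c0] unfolding partial_rat_hom_def by blast
      then show "(\<one>, 0) \<in> \<Union>\<C>" using c0 by blast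
    next
      fix x q y r assume "(x, q) \<in> \<Union>\<C> \<and> (y, r) \<in> \<Union>\<C>"
      then obtain a b where "a \<in> \<C>" "b \<in> \<C>" "(x, q) \<in> a" "(y, r) \<in> b" by blast
      then obtain c where c: "c \<in> \<C>" "(x, q) \<in> c" "(y, r) \<in> c" using ch[of a b] by blast
      have "(x \<otimes> y, q + r) \<in> c" using P[OF c(1)] c(2,3) unfolding partial_rat_hom_def by blast
      then show "(x \<otimes> y, q + r) \<in> \<Union>\<C>" using c(1) by blast
    next
      fix x q assume "(x, q) \<in> \<Union>\<C>"
      then obtain c where c: "c \<in> \<C>" "(x, q) \<in> c" by blast
      have "(inv x, - q) \<in> c" using P[OF c(1)] c(2) unfolding partial_rat_hom_def by blast
      then show "(inv x, - q) \<in> \<Union>\<C>" using c(1) by blast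
    next
      fix q assume "(\<one>, q) \<in> \<Union>\<C>"
      then obtain c where c: "c \<in> \<C>" "(\<one>, q) \<in> c" by blast
      then show "q = 0" using P[OF c(1)] unfolding partial_rat_hom_def by blast
    qed
    moreover have "g0 \<subseteq> \<Union>\<C>" using c0 CA by (auto simp: \<A>_def)
    ultimately show "\<Union>\<C> \<in> \<A>" by (simp add: \<A>_def)
  qed
  then obtain M where M: "partial_rat_hom G M" "g0 \<subseteq> M" and max: "\<And>X. X \<in> \<A> \<Longrightarrow> M \<subseteq> X \<Longrightarrow> X = M"
    by (auto simp: \<A>_def)
  have mul: "\<And>x q y r. (x, q) \<in> M \<Longrightarrow> (y, r) \<in> M \<Longrightarrow> (x \<otimes> y, q + r) \<in> M"
    and inv: "\<And>x q. (x, q) \<in> M \<Longrightarrow> (inv x, - q) \<in> M" and sub: "M \<subseteq> carrier G \<times> UNIV"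
    and uniq: "\<And>q. (\<one>, q) \<in> M \<Longrightarrow> q = 0"
    using M(1) unfolding partial_rat_hom_def by blast+
  have tot: "\<exists>q. (x, q) \<in> M" if x: "x \<in> carrier G" for x
  proof -
    obtain g' q where g': "partial_rat_hom G g'" "M \<subseteq> g'" "(x, q) \<in> g'"
      using partial_rat_hom_extend[OF M(1) x] by blast
    have "g' \<in> \<A>" using g' M(2) by (simp add: \<A>_def)
    then have "g' = M" using max g'(2) by blast
    then show ?thesis using g'(3) by blast
  qed
  have sv: "q = r" if "(x, q) \<in> M" "(x, r) \<in> M" for x q r
  proof -
    have "(x \<otimes> inv x, q + - r) \<in> M" by (rule mul[OF that(1) inv[OF that(2)]])
    moreover have "x \<in> carrier G" using that(1) sub by blast
    ultimately have "(\<one>, q + - r) \<in> M" by simp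
    then show ?thesis using uniq by fastforce
  qed
  define f where "f x = (THE q. (x, q) \<in> M)" for x
  have f: "f x = q" if "(x, q) \<in> M" for x q unfolding f_def using that sv by blast
  have "rat_hom G f"
    unfolding rat_hom_def
  proof (intro ballI)
    fix x y assume "x \<in> carrier G" "y \<in> carrier G"
    then obtain q r where "(x, q) \<in> M" "(y, r) \<in> M" using tot by blast
    then show "f (x \<otimes> y) = f x + f y" using f[OF mul] f by simp
  qed
  then show ?thesis using f M(2) by blast
qed

text \<open>The map that sends \<open>a [^] k\<close> to \<open>k\<close> is single-valued because
  \<open>a\<close> has infinite order; it is then extended to the whole group.\<close>

lemma rat_hom_separates:
  assumes tf: "\<And>a n. a \<in> carrier G \<Longrightarrow> (n::nat) > 0 \<Longrightarrow> a [^] n = \<one> \<Longrightarrow> a = \<one>" and a: "a \<in> carrier G" "a \<noteq> \<one>"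
  shows "\<exists>f. rat_hom G f \<and> f a \<noteq> 0"
proof -
  have tfi: "k = 0" if k: "a [^] (k::int) = \<one>" for k
  proof (rule ccontr)
    assume "k \<noteq> 0"
    have "a [^] (\<bar>k\<bar>) = \<one>" using k a(1) by (cases "k \<ge> 0") (simp_all add: int_pow_neg)
    then have "a [^] (nat \<bar>k\<bar>) = \<one>" using int_pow_int[of G a "nat \<bar>k\<bar>"] by simp
    then show False using tf[OF a(1), of "nat \<bar>k\<bar>"] \<open>k \<noteq> 0\<close> a(2) by simp
  qed
  define g0 where "g0 = {(a [^] (k::int), of_int k :: rat) | k. True}"
  have "partial_rat_hom G g0"
    unfolding partial_rat_hom_def
  proof (intro conjI allI impI)
    show "g0 \<subseteq> carrier G \<times> UNIV" using a by (auto simp: g0_def)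
    show "(\<one>, 0) \<in> g0" unfolding g0_def using a by (auto intro!: exI[of _ 0])
  next
    fix x q y r assume "(x, q) \<in> g0 \<and> (y, r) \<in> g0"
    then obtain k l :: int where "x = a [^] k" "q = of_int k" "y = a [^] l" "r = of_int l" by (auto simp: g0_def)
    then show "(x \<otimes> y, q + r) \<in> g0" unfolding g0_def using a by (auto simp: int_pow_mult intro!: exI[of _ "k + l"])
  next
    fix x q assume "(x, q) \<in> g0"
    then obtain k :: int where "x = a [^] k" "q = of_int k" by (auto simp: g0_def)
    then show "(inv x, - q) \<in> g0" unfolding g0_def using a by (auto simp: int_pow_neg intro!: exI[of _ "- k"])
  next
    fix q assume "(\<one>, q) \<in> g0"
    then show "q = 0" using tfi by (auto simp: g0_def)
  qed
  from rat_hom_extension[OF this] obtain f where f: "rat_hom G f" "\<forall>(x, q)\<in>g0. f x = q" by blast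
  have "(a, 1) \<in> g0" unfolding g0_def using a(1) by (auto intro!: exI[of _ 1])
  then have "f a = 1" using f(2) by fastforce
  then show ?thesis using f(1) by auto
qed

end

section \<open>The tensor product with the rationals as a vector space\<close>

lemma field_rat_ring: "field rat_ring"
proof -
  have "cring rat_ring"
  proof (rule cringI)
    show "abelian_group rat_ring"
    proof (rule abelian_groupI)
      show "\<exists>y\<in>carrier rat_ring. y \<oplus>\<^bsub>rat_ring\<^esub> x = \<zero>\<^bsub>rat_ring\<^esub>" if "x \<in> carrier rat_ring" for x
        by (rule bexI[of _ "- x"]) (auto simp: rat_ring_def)
    qed (auto simp: rat_ring_def)
    show "Group.comm_monoid rat_ring" by unfold_locales (auto simp: rat_ring_def)
  qed (auto simp: rat_ring_def algebra_simps)
  then show ?thesis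
  proof (rule cring.cring_fieldI)
    have "x \<in> Units rat_ring \<longleftrightarrow> x \<noteq> 0" for x
    proof
      assume "x \<in> Units rat_ring"
      then show "x \<noteq> 0" by (auto simp: Units_def rat_ring_def)
    next
      assume "x \<noteq> 0"
      then show "x \<in> Units rat_ring" unfolding Units_def
        by (auto simp: rat_ring_def intro!: exI[of _ "inverse x"])
    qed
    then show "Units rat_ring = carrier rat_ring - {\<zero>\<^bsub>rat_ring\<^esub>}" by (auto simp: rat_ring_def)
  qed
qed

text \<open>The scalar action of \<open>rat_tensor\<close> before the passage to cosets.\<close>

definition symbol_scale :: "rat \<Rightarrow> ((rat \<times> 'a) \<Rightarrow>\<^sub>0 int) \<Rightarrow> ((rat \<times> 'a) \<Rightarrow>\<^sub>0 int)" where
  "symbol_scale q = frag_extend (\<lambda>(p, a). frag_of (q * p, a))"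

text \<open>For a homomorphism \<open>f\<close> this is the linear form that it induces on the
  tensor product, read on formal sums of symbols.\<close>

definition symbol_eval :: "('a \<Rightarrow> rat) \<Rightarrow> ((rat \<times> 'a) \<Rightarrow>\<^sub>0 int) \<Rightarrow> rat" where
  "symbol_eval f c = (\<Sum>k\<in>Poly_Mapping.keys c. of_int (Poly_Mapping.lookup c k) * (fst k * f (snd k)))"

lemma symbol_scale_diff: "symbol_scale q (c - d) = symbol_scale q c - symbol_scale q d"
  by (simp add: symbol_scale_def frag_extend_diff)

lemma symbol_scale_add: "symbol_scale q (c + d) = symbol_scale q c + symbol_scale q d"
  by (simp add: symbol_scale_def frag_extend_add)

lemma symbol_scale_0: "symbol_scale q 0 = 0"
  by (simp add: symbol_scale_def)

lemma symbol_scale_of: "symbol_scale q (frag_of (p, a)) = frag_of (q * p, a)"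
  by (simp add: symbol_scale_def)

lemma symbol_eval_superset:
  "finite S \<Longrightarrow> Poly_Mapping.keys c \<subseteq> S \<Longrightarrow>
     symbol_eval f c = (\<Sum>k\<in>S. of_int (Poly_Mapping.lookup c k) * (fst k * f (snd k)))"
  unfolding symbol_eval_def by (rule sum.mono_neutral_left) (auto simp: in_keys_iff)

lemma symbol_eval_diff: "symbol_eval f (c - d) = symbol_eval f c - symbol_eval f d"
proof -
  let ?S = "Poly_Mapping.keys c \<union> Poly_Mapping.keys d"
  have "Poly_Mapping.keys (c - d) \<subseteq> ?S" by (rule keys_diff)
  then show ?thesis
    using symbol_eval_superset[of ?S c f] symbol_eval_superset[of ?S d f] symbol_eval_superset[of ?S "c - d" f]
    by (simp add: lookup_minus sum_subtractf[symmetric] algebra_simps)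
qed

lemma symbol_eval_0: "symbol_eval f 0 = 0"
  by (simp add: symbol_eval_def)

lemma symbol_eval_add: "symbol_eval f (c + d) = symbol_eval f c + symbol_eval f d"
  using symbol_eval_diff[of f "c + d" d] by simp

lemma symbol_eval_of: "symbol_eval f (frag_of (p, a)) = p * f a"
  by (simp add: symbol_eval_def)

lemma symbol_induct:
  assumes "Poly_Mapping.keys c \<subseteq> S" "P 0" "\<And>p a. (p, a) \<in> S \<Longrightarrow> P (frag_of (p, a))"
    "\<And>c d. P c \<Longrightarrow> P d \<Longrightarrow> P (c - d)"
  shows "P c"
  using assms(1) by (rule frag_induction) (use assms(2-4) in auto)

lemma symbol_eval_scale: "symbol_eval f (symbol_scale q c) = q * symbol_eval f c"
  by (rule symbol_induct[of c UNIV])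
    (simp_all add: symbol_scale_0 symbol_eval_0 symbol_scale_of symbol_eval_of symbol_scale_diff symbol_eval_diff algebra_simps)

lemma symbol_scale_scale: "symbol_scale q (symbol_scale r c) = symbol_scale (q * r) c"
  by (rule symbol_induct[of c UNIV])
    (simp_all add: symbol_scale_0 symbol_scale_of symbol_scale_diff mult.assoc)

lemma symbol_scale_1: "symbol_scale 1 c = c"
  by (rule symbol_induct[of c UNIV])
    (simp_all add: symbol_scale_0 symbol_scale_of symbol_scale_diff)

lemma symbol_eval_linear: "symbol_eval (\<lambda>x. f x + c * g x) d = symbol_eval f d + c * symbol_eval g d"
  by (simp add: symbol_eval_def sum_distrib_left sum.distrib[symmetric] algebra_simps)

context comm_group
begin

abbreviation "Sym \<equiv> free_Abelian_group ((UNIV :: rat set) \<times> carrier G)"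
abbreviation "Rel \<equiv> rat_tensor_relations G"

definition tensor_gens :: "((rat \<times> 'a) \<Rightarrow>\<^sub>0 int) set" where
  "tensor_gens = {frag_of (p + q, a) - frag_of (p, a) - frag_of (q, a) | p q a. a \<in> carrier G} \<union>
      {frag_of (p, a \<otimes> b) - frag_of (p, a) - frag_of (p, b) | p a b. a \<in> carrier G \<and> b \<in> carrier G}"

lemma Rel_eq: "Rel = generate Sym tensor_gens"
  by (simp add: rat_tensor_relations_def tensor_gens_def)

lemma tensor_gens_carrier: "tensor_gens \<subseteq> carrier Sym"
proof
  fix c assume "c \<in> tensor_gens"
  then consider p q a where "a \<in> carrier G" "c = frag_of (p + q, a) - frag_of (p, a) - frag_of (q, a)"
    | p a b where "a \<in> carrier G" "b \<in> carrier G" "c = frag_of (p, a \<otimes> b) - frag_of (p, a) - frag_of (p, b)"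
    unfolding tensor_gens_def by blast
  then show "c \<in> carrier Sym"
  proof cases
    case 1
    then show ?thesis using keys_diff[of "frag_of (p + q, a) - frag_of (p, a)" "frag_of (q, a)"]
        keys_diff[of "frag_of (p + q, a)" "frag_of (p, a)"] by auto
  next
    case 2
    then show ?thesis using keys_diff[of "frag_of (p, a \<otimes> b) - frag_of (p, a)" "frag_of (p, b)"]
        keys_diff[of "frag_of (p, a \<otimes> b)" "frag_of (p, a)"] by auto
  qed
qed

lemma Rel_subgroup: "subgroup Rel Sym"
  unfolding Rel_eq by (rule group.generate_is_subgroup[OF group_free_Abelian_group tensor_gens_carrier])

lemma Rel_carrier: "c \<in> Rel \<Longrightarrow> c \<in> carrier Sym"
  using subgroup.subset[OF Rel_subgroup] by blast

lemma Rel_0: "0 \<in> Rel"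
  using subgroup.one_closed[OF Rel_subgroup] by simp

lemma Rel_add: "c \<in> Rel \<Longrightarrow> d \<in> Rel \<Longrightarrow> c + d \<in> Rel"
  using subgroup.m_closed[OF Rel_subgroup, of c d] by simp

lemma Rel_minus: "c \<in> Rel \<Longrightarrow> - c \<in> Rel"
  using subgroup.m_inv_closed[OF Rel_subgroup, of c] Rel_carrier[of c] by simp

lemma Rel_diff: "c \<in> Rel \<Longrightarrow> d \<in> Rel \<Longrightarrow> c - d \<in> Rel"
  using Rel_add[OF _ Rel_minus, of c d] by simp

lemma Rel_gens: "c \<in> tensor_gens \<Longrightarrow> c \<in> Rel"
  unfolding Rel_eq by (rule generate.incl)

text \<open>With the help of 0, negatives and sums are differences, so closure under subtraction is
  enough.\<close>

lemma Rel_induct: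
  assumes "c \<in> Rel" "P 0" "\<And>c. c \<in> tensor_gens \<Longrightarrow> P c" "\<And>c d. P c \<Longrightarrow> P d \<Longrightarrow> P (c - d)"
  shows "P c"
proof -
  have m: "P (- c)" if "P c" for c using assms(4)[OF assms(2) that] by simp
  have a: "P (c + d)" if "P c" "P d" for c d using assms(4)[OF that(1) m[OF that(2)]] by simp
  show ?thesis using assms(1) unfolding Rel_eq
  proof (induction rule: generate.induct)
    case (inv h)
    have "Poly_Mapping.keys h \<subseteq> UNIV \<times> carrier G"
      using subsetD[OF tensor_gens_carrier inv] by (simp only: carrier_free_Abelian_group_iff)
    then show ?case using m[OF assms(3)[OF inv]] by simp
  qed (use assms(2,3) a in simp_all)
qed

lemma Rel_scale: "c \<in> Rel \<Longrightarrow> symbol_scale q c \<in> Rel"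
proof (erule Rel_induct)
  show "symbol_scale q 0 \<in> Rel" by (simp add: symbol_scale_0 Rel_0)
  fix c assume "c \<in> tensor_gens"
  then consider p r a where "a \<in> carrier G" "c = frag_of (p + r, a) - frag_of (p, a) - frag_of (r, a)"
    | p a b where "a \<in> carrier G" "b \<in> carrier G" "c = frag_of (p, a \<otimes> b) - frag_of (p, a) - frag_of (p, b)"
    unfolding tensor_gens_def by blast
  then show "symbol_scale q c \<in> Rel"
  proof cases
    case 1
    have "symbol_scale q c = frag_of (q * p + q * r, a) - frag_of (q * p, a) - frag_of (q * r, a)"
      by (simp only: 1(2) symbol_scale_diff symbol_scale_of distrib_left)
    then show ?thesis using 1(1) by (intro Rel_gens) (auto simp: tensor_gens_def)
  next
    case 2
    have "symbol_scale q c = frag_of (q * p, a \<otimes> b) - frag_of (q * p, a) - frag_of (q * p, b)"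
      by (simp only: 2(3) symbol_scale_diff symbol_scale_of)
    then show ?thesis using 2(1,2) by (intro Rel_gens) (auto simp: tensor_gens_def)
  qed
qed (simp add: symbol_scale_diff Rel_diff)

lemma Rel_eval: "c \<in> Rel \<Longrightarrow> rat_hom G f \<Longrightarrow> symbol_eval f c = 0"
proof (erule Rel_induct)
  assume f: "rat_hom G f"
  fix c assume "c \<in> tensor_gens"
  then consider p r a where "a \<in> carrier G" "c = frag_of (p + r, a) - frag_of (p, a) - frag_of (r, a)"
    | p a b where "a \<in> carrier G" "b \<in> carrier G" "c = frag_of (p, a \<otimes> b) - frag_of (p, a) - frag_of (p, b)"
    unfolding tensor_gens_def by blast
  then show "symbol_eval f c = 0"
  proof cases
    case 1
    show ?thesis unfolding 1(2) symbol_eval_diff symbol_eval_of by (simp add: algebra_simps)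
  next
    case 2
    have "f (a \<otimes> b) = f a + f b" using f 2(1,2) unfolding rat_hom_def by blast
    then show ?thesis unfolding 2(3) symbol_eval_diff symbol_eval_of by (simp add: algebra_simps)
  qed
qed (simp_all add: symbol_eval_diff symbol_eval_0)

lemma scale_carrier: "c \<in> carrier Sym \<Longrightarrow> symbol_scale q c \<in> carrier Sym"
proof -
  assume "c \<in> carrier Sym"
  then have "Poly_Mapping.keys c \<subseteq> UNIV \<times> carrier G" by simp
  then show ?thesis
  proof (rule symbol_induct)
    fix c d assume "symbol_scale q c \<in> carrier Sym" "symbol_scale q d \<in> carrier Sym"
    then show "symbol_scale q (c - d) \<in> carrier Sym"
      unfolding symbol_scale_diff using keys_diff[of "symbol_scale q c" "symbol_scale q d"] by auto
  qed (auto simp: symbol_scale_0 symbol_scale_of)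
qed

text \<open>On a symbol this difference is a relator of the first kind. Distributivity in the scalar
  fails for formal sums and holds only modulo the relations.\<close>

lemma scale_add_left: "c \<in> carrier Sym \<Longrightarrow> symbol_scale (q + r) c - symbol_scale q c - symbol_scale r c \<in> Rel"
proof -
  assume "c \<in> carrier Sym"
  then have "Poly_Mapping.keys c \<subseteq> UNIV \<times> carrier G" by simp
  then show ?thesis
  proof (rule symbol_induct)
    fix p a assume "(p, a) \<in> (UNIV :: rat set) \<times> carrier G"
    then have "frag_of (q * p + r * p, a) - frag_of (q * p, a) - frag_of (r * p, a) \<in> Rel"
      by (intro Rel_gens) (auto simp: tensor_gens_def)
    then show "symbol_scale (q + r) (frag_of (p, a)) - symbol_scale q (frag_of (p, a)) - symbol_scale r (frag_of (p, a)) \<in> Rel"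
      by (simp add: symbol_scale_of algebra_simps)
  next
    fix c d assume "symbol_scale (q + r) c - symbol_scale q c - symbol_scale r c \<in> Rel"
      "symbol_scale (q + r) d - symbol_scale q d - symbol_scale r d \<in> Rel"
    from Rel_diff[OF this] show "symbol_scale (q + r) (c - d) - symbol_scale q (c - d) - symbol_scale r (c - d) \<in> Rel"
      by (simp add: symbol_scale_diff algebra_simps)
  qed (simp add: symbol_scale_0 Rel_0)
qed

definition tc :: "((rat \<times> 'a) \<Rightarrow>\<^sub>0 int) \<Rightarrow> ((rat \<times> 'a) \<Rightarrow>\<^sub>0 int) set" where
  "tc c = Rel #>\<^bsub>Sym\<^esub> c"

lemma tc_mem: "x \<in> tc c \<longleftrightarrow> x - c \<in> Rel"
proof
  assume "x \<in> tc c"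
  then obtain r where "r \<in> Rel" "x = r + c" unfolding tc_def r_coset_def by auto
  then show "x - c \<in> Rel" by simp
next
  assume "x - c \<in> Rel"
  moreover have "x = (x - c) \<otimes>\<^bsub>Sym\<^esub> c" by simp
  ultimately show "x \<in> tc c" unfolding tc_def r_coset_def by blast
qed

lemma tc_eq: "tc c = tc d \<longleftrightarrow> c - d \<in> Rel"
proof
  assume "tc c = tc d"
  moreover have "c \<in> tc c" by (simp add: tc_mem Rel_0)
  ultimately show "c - d \<in> Rel" by (simp add: tc_mem)
next
  assume cd: "c - d \<in> Rel"
  have "x - c \<in> Rel \<longleftrightarrow> x - d \<in> Rel" for x
    using Rel_add[OF _ cd, of "x - c"] Rel_diff[OF _ cd, of "x - d"] by auto
  then show "tc c = tc d" by (auto simp: tc_mem)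
qed

abbreviation "T \<equiv> rat_tensor G"

lemma T_carrier: "carrier T = tc ` carrier Sym"
  by (auto simp: rat_tensor_def rat_tensor_group_def carrier_FactGroup tc_def)

lemma T_add: "c \<in> carrier Sym \<Longrightarrow> d \<in> carrier Sym \<Longrightarrow> tc c \<oplus>\<^bsub>T\<^esub> tc d = tc (c + d)"
proof -
  assume c: "c \<in> carrier Sym" "d \<in> carrier Sym"
  have "Rel \<lhd> Sym" using comm_group.normal_iff_subgroup[OF abelian_free_Abelian_group] Rel_subgroup by blast
  then have "(Rel #>\<^bsub>Sym\<^esub> c) <#>\<^bsub>Sym\<^esub> (Rel #>\<^bsub>Sym\<^esub> d) = Rel #>\<^bsub>Sym\<^esub> (c \<otimes>\<^bsub>Sym\<^esub> d)"
    using c by (rule normal.rcos_sum)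
  then show ?thesis by (simp add: rat_tensor_def rat_tensor_group_def FactGroup_def tc_def)
qed

lemma T_zero: "\<zero>\<^bsub>T\<^esub> = tc 0"
proof -
  have "Rel = tc 0" by (auto simp: tc_mem)
  then show ?thesis by (simp add: rat_tensor_def rat_tensor_group_def FactGroup_def)
qed

text \<open>Scaling preserves the relations, so all members of a coset contribute the same coset to
  the union that defines scalar multiplication.\<close>

lemma T_smult: "q \<odot>\<^bsub>T\<^esub> tc c = tc (symbol_scale q c)"
proof -
  have s: "tc (symbol_scale q x) = tc (symbol_scale q c)" if "x \<in> tc c" for x
    using Rel_scale[of "x - c" q] that by (simp add: tc_mem tc_eq symbol_scale_diff)
  have "q \<odot>\<^bsub>T\<^esub> tc c = (\<Union>x\<in>tc c. tc (symbol_scale q x))"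
    by (simp add: rat_tensor_def symbol_scale_def tc_def)
  also have "\<dots> = tc (symbol_scale q c)"
  proof -
    have "c \<in> tc c" by (simp add: tc_mem Rel_0)
    then show ?thesis using s by blast
  qed
  finally show ?thesis .
qed

lemma T_cases:
  assumes "C \<in> carrier T" obtains c where "c \<in> carrier Sym" "C = tc c"
  using assms unfolding T_carrier by (elim imageE) (rule that)

lemma Sym_add: "c \<in> carrier Sym \<Longrightarrow> d \<in> carrier Sym \<Longrightarrow> c + d \<in> carrier Sym"
  using keys_add[of c d] by auto

lemma T_tc: "c \<in> carrier Sym \<Longrightarrow> tc c \<in> carrier T"
  unfolding T_carrier by (rule imageI)

lemma T_abelian: "abelian_group T"
proof (rule abelian_groupI)
  show "\<zero>\<^bsub>T\<^esub> \<in> carrier T" unfolding T_zero by (intro T_tc) simp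
  fix x assume "x \<in> carrier T"
  then obtain c where c: "c \<in> carrier Sym" "x = tc c" by (rule T_cases)
  have z: "0 \<in> carrier Sym" by simp
  show "\<zero>\<^bsub>T\<^esub> \<oplus>\<^bsub>T\<^esub> x = x" unfolding T_zero c(2) T_add[OF z c(1)] by simp
  have n: "- c \<in> carrier Sym" using c(1) by simp
  show "\<exists>y\<in>carrier T. y \<oplus>\<^bsub>T\<^esub> x = \<zero>\<^bsub>T\<^esub>"
    by (rule bexI[OF _ T_tc[OF n]]) (simp only: c(2) T_add[OF n c(1)] T_zero left_minus)
  fix y assume "y \<in> carrier T"
  then obtain d where d: "d \<in> carrier Sym" "y = tc d" by (rule T_cases)
  show "x \<oplus>\<^bsub>T\<^esub> y \<in> carrier T" unfolding c(2) d(2) T_add[OF c(1) d(1)] by (intro T_tc Sym_add c d)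
  show "x \<oplus>\<^bsub>T\<^esub> y = y \<oplus>\<^bsub>T\<^esub> x" unfolding c(2) d(2) T_add[OF c(1) d(1)] T_add[OF d(1) c(1)] by (simp only: add.commute)
  fix z assume "z \<in> carrier T"
  then obtain e where e: "e \<in> carrier Sym" "z = tc e" by (rule T_cases)
  show "x \<oplus>\<^bsub>T\<^esub> y \<oplus>\<^bsub>T\<^esub> z = x \<oplus>\<^bsub>T\<^esub> (y \<oplus>\<^bsub>T\<^esub> z)"
    unfolding c(2) d(2) e(2) T_add[OF c(1) d(1)] T_add[OF d(1) e(1)] T_add[OF Sym_add[OF c(1) d(1)] e(1)]
      T_add[OF c(1) Sym_add[OF d(1) e(1)]] by (simp only: add.assoc)
qed

lemma T_vectorspace: "vectorspace rat_ring T"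
proof -
  have "Module.module rat_ring T"
  proof (rule moduleI)
    show "cring rat_ring" using field_rat_ring by (simp add: field_def domain_def)
    show "abelian_group T" by (rule T_abelian)
    fix a b :: rat and x y assume "x \<in> carrier T" "y \<in> carrier T"
    then obtain c d where c: "c \<in> carrier Sym" "x = tc c" and d: "d \<in> carrier Sym" "y = tc d"
      by (elim T_cases)
    note s = scale_carrier[OF c(1)] scale_carrier[OF d(1)]
    show "a \<odot>\<^bsub>T\<^esub> x \<in> carrier T" unfolding c(2) T_smult by (intro T_tc s)
    show "(a \<oplus>\<^bsub>rat_ring\<^esub> b) \<odot>\<^bsub>T\<^esub> x = a \<odot>\<^bsub>T\<^esub> x \<oplus>\<^bsub>T\<^esub> b \<odot>\<^bsub>T\<^esub> x"
      unfolding c(2) T_smult T_add[OF s(1) s(1)] tc_eq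
      using scale_add_left[OF c(1), of a b] by (simp add: rat_ring_def algebra_simps)
    show "a \<odot>\<^bsub>T\<^esub> (x \<oplus>\<^bsub>T\<^esub> y) = a \<odot>\<^bsub>T\<^esub> x \<oplus>\<^bsub>T\<^esub> a \<odot>\<^bsub>T\<^esub> y"
      unfolding c(2) d(2) T_add[OF c(1) d(1)] T_smult T_add[OF s] symbol_scale_add ..
    show "(a \<otimes>\<^bsub>rat_ring\<^esub> b) \<odot>\<^bsub>T\<^esub> x = a \<odot>\<^bsub>T\<^esub> (b \<odot>\<^bsub>T\<^esub> x)"
      unfolding c(2) T_smult symbol_scale_scale by (simp add: rat_ring_def)
    show "\<one>\<^bsub>rat_ring\<^esub> \<odot>\<^bsub>T\<^esub> x = x" unfolding c(2) T_smult by (simp add: rat_ring_def symbol_scale_1)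
  qed
  then show ?thesis using field_rat_ring by (simp add: vectorspace_def)
qed

text \<open>A homomorphism to the rationals extends to a linear form on the tensor product; hence it is
  determined by finitely many rational numbers if the tensor product is finitely spanned.\<close>

lemma rat_hom_determined:
  assumes span: "LinearCombinations.module.span rat_ring T (tc ` B) = carrier T" and B: "B \<subseteq> carrier Sym"
    and f: "rat_hom G f" and van: "\<And>c. c \<in> B \<Longrightarrow> symbol_eval f c = 0" and a: "a \<in> carrier G"
  shows "f a = 0"
proof -
  interpret V: vectorspace rat_ring T by (rule T_vectorspace)
  \<comment> \<open>Linear combinations of spanning classes are again represented by formal sums on
    which the form vanishes.\<close>
  have fin: "(\<Oplus>\<^bsub>T\<^esub>v\<in>A. b v \<odot>\<^bsub>T\<^esub> v) \<in> tc ` {c \<in> carrier Sym. symbol_eval f c = 0}"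
    if "finite A" "A \<subseteq> tc ` B" for A and b :: "_ \<Rightarrow> rat"
    using that
  proof (induction A rule: finite_induct)
    case empty
    have "\<zero>\<^bsub>T\<^esub> \<in> tc ` {c \<in> carrier Sym. symbol_eval f c = 0}"
      unfolding T_zero by (rule imageI) (simp add: symbol_eval_0)
    then show ?case by simp
  next
    case (insert v A)
    have in_car: "b w \<odot>\<^bsub>T\<^esub> w \<in> carrier T" if "w \<in> insert v A" for w
    proof -
      have "w \<in> tc ` B" using insert.prems that by (rule subsetD)
      then obtain c where c: "w = tc c" "c \<in> B" by (rule imageE)
      show ?thesis unfolding c(1) T_smult by (intro T_tc scale_carrier subsetD[OF B] c(2))
    qed
    have "v \<in> tc ` B" using insert.prems by (rule subsetD) simp
    then obtain c where c: "v = tc c" "c \<in> B" by (rule imageE)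
    obtain d where d: "d \<in> carrier Sym" "symbol_eval f d = 0" "(\<Oplus>\<^bsub>T\<^esub>v\<in>A. b v \<odot>\<^bsub>T\<^esub> v) = tc d"
    proof -
      have "A \<subseteq> tc ` B" using insert.prems by (rule order_trans[OF subset_insertI])
      from insert.IH[OF this] obtain d where
        "(\<Oplus>\<^bsub>T\<^esub>v\<in>A. b v \<odot>\<^bsub>T\<^esub> v) = tc d" "d \<in> {c \<in> carrier Sym. symbol_eval f c = 0}" by (rule imageE)
      then show ?thesis by (intro that[of d]) simp_all
    qed
    have cs: "symbol_scale (b v) c \<in> carrier Sym" by (intro scale_carrier subsetD[OF B] c(2))
    have "(\<Oplus>\<^bsub>T\<^esub>v\<in>insert v A. b v \<odot>\<^bsub>T\<^esub> v) = b v \<odot>\<^bsub>T\<^esub> v \<oplus>\<^bsub>T\<^esub> (\<Oplus>\<^bsub>T\<^esub>v\<in>A. b v \<odot>\<^bsub>T\<^esub> v)"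
      using insert.hyps in_car by (intro V.finsum_insert) auto
    also have "\<dots> = tc (symbol_scale (b v) c + d)"
      unfolding d(3) using T_add[OF cs d(1)] by (simp only: c(1) T_smult)
    finally have e: "(\<Oplus>\<^bsub>T\<^esub>v\<in>insert v A. b v \<odot>\<^bsub>T\<^esub> v) = tc (symbol_scale (b v) c + d)" .
    have "symbol_eval f (symbol_scale (b v) c + d) = 0"
      using van[OF c(2)] d(2) by (simp add: symbol_eval_add symbol_eval_scale)
    then show ?case unfolding e using Sym_add[OF cs d(1)] by (intro imageI) simp
  qed
  have fa: "frag_of (1, a) \<in> carrier Sym" using a by simp
  have "tc (frag_of (1, a)) \<in> LinearCombinations.module.span rat_ring T (tc ` B)"
    unfolding span by (rule T_tc[OF fa])
  then obtain b A where A: "finite A" "A \<subseteq> tc ` B" "tc (frag_of (1, a)) = V.lincomb b A"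
    unfolding V.span_def mem_Collect_eq by (elim exE conjE) (rule that)
  have "V.lincomb b A \<in> tc ` {c \<in> carrier Sym. symbol_eval f c = 0}"
    unfolding V.lincomb_def by (rule fin[OF A(1,2)])
  then obtain c where c0: "V.lincomb b A = tc c" "c \<in> {c \<in> carrier Sym. symbol_eval f c = 0}" by (rule imageE)
  have c: "symbol_eval f c = 0" "tc (frag_of (1, a)) = tc c" using c0(2) unfolding A(3) c0(1) by blast+
  have "symbol_eval f (frag_of (1, a) - c) = 0" using c(2) Rel_eval[OF _ f] by (simp only: tc_eq)
  then show ?thesis using c(1) by (simp add: symbol_eval_diff symbol_eval_of)
qed

text \<open>A homomorphism to the rationals is determined by its values on representatives of a
  finite spanning set of the tensor product, so finitely many homomorphisms, collected in
  \<open>J\<close>, generate all of them. Any element other than the unit is detected by some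
  homomorphism, hence by \<open>J\<close>; and an endomorphism \<open>c\<close> acts linearly
  because each \<open>i \<circ> c\<close> is again a homomorphism.\<close>

theorem rat_coordinates:
  assumes tf: "\<And>a n. a \<in> carrier G \<Longrightarrow> (n::nat) > 0 \<Longrightarrow> a [^] n = \<one> \<Longrightarrow> a = \<one>" and fr: "finite_rat_rank G"
  shows "\<exists>J. finite J \<and> (\<forall>j\<in>J. rat_hom G j) \<and> (\<forall>x\<in>carrier G. (\<forall>j\<in>J. j x = 0) \<longrightarrow> x = \<one>) \<and>
     (\<forall>c\<in>hom G G. \<exists>\<beta>. \<forall>x\<in>carrier G. \<forall>i\<in>J. i (c x) = (\<Sum>j\<in>J. \<beta> i j * j x))"
proof -
  obtain B0 where B0: "finite B0" "B0 \<subseteq> carrier T" "LinearCombinations.module.span rat_ring T B0 = carrier T"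
    using fr unfolding finite_rat_rank_def vectorspace.fin_dim_def[OF T_vectorspace]
    by (elim exE conjE) (rule that)
  obtain B where B: "B \<subseteq> carrier Sym" "finite B" "B0 = tc ` B"
    using finite_subset_image[OF B0(1) B0(2)[unfolded T_carrier]] by (elim exE conjE bexE) (rule that)
  \<comment> \<open>Extended by 0 outside the group, so that a homomorphism that vanishes on the
    group is the zero function, as \<open>finite_span_functions\<close> asks.\<close>
  define \<H> where "\<H> = {f. rat_hom G f \<and> (\<forall>x. x \<notin> carrier G \<longrightarrow> f x = 0)}"
  have "\<exists>J. finite J \<and> J \<subseteq> \<H> \<and> (\<forall>f\<in>\<H>. \<exists>\<beta>. \<forall>x. f x = (\<Sum>j\<in>J. \<beta> j * j x))"
  proof (rule finite_span_functions[of "(\<lambda>c f. symbol_eval f c) ` B"])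
    show "finite ((\<lambda>c f. symbol_eval f c) ` B)" using B(2) by simp
    show "(\<lambda>x. f x + c * g x) \<in> \<H>" if "f \<in> \<H>" "g \<in> \<H>" for f g c
      using that by (auto simp: \<H>_def rat_hom_def algebra_simps)
    show "e (\<lambda>x. f x + c * g x) = e f + c * e g" if "e \<in> (\<lambda>c f. symbol_eval f c) ` B" for e f g c
    proof -
      from that obtain d where "e = (\<lambda>f. symbol_eval f d)" by (rule imageE)
      then show ?thesis by (simp only: symbol_eval_linear)
    qed
    show "f = (\<lambda>_. 0)" if f: "f \<in> \<H>" "\<forall>e\<in>(\<lambda>c f. symbol_eval f c) ` B. e f = 0" for f
    proof
      fix x show "f x = 0"
      proof (cases "x \<in> carrier G")
        case True
        show ?thesis
        proof (rule rat_hom_determined[OF B0(3)[unfolded B(3)] B(1) _ _ True])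
          show "rat_hom G f" using f(1) unfolding \<H>_def by simp
          show "symbol_eval f c = 0" if "c \<in> B" for c by (rule bspec[OF f(2) imageI[OF that]])
        qed
      qed (use f in \<open>simp add: \<H>_def\<close>)
    qed
  qed
  then obtain J where J: "finite J" "J \<subseteq> \<H>" "\<forall>f\<in>\<H>. \<exists>\<beta>. \<forall>x. f x = (\<Sum>j\<in>J. \<beta> j * j x)"
    by (elim exE conjE) (rule that)
  have cut: "\<exists>\<beta>. \<forall>x\<in>carrier G. f x = (\<Sum>j\<in>J. \<beta> j * j x)" if f: "rat_hom G f" for f
  proof -
    have "(\<lambda>x. if x \<in> carrier G then f x else 0) \<in> \<H>" using f by (auto simp: \<H>_def rat_hom_def)
    from bspec[OF J(3) this] obtain \<beta> where \<beta>: "\<forall>x. (if x \<in> carrier G then f x else 0) = (\<Sum>j\<in>J. \<beta> j * j x)"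
      by (elim exE) (rule that)
    show ?thesis
    proof (rule exI[of _ \<beta>], rule ballI)
      fix x assume "x \<in> carrier G"
      then show "f x = (\<Sum>j\<in>J. \<beta> j * j x)" using \<beta>[rule_format, of x] by simp
    qed
  qed
  have "x = \<one>" if x: "x \<in> carrier G" "\<forall>j\<in>J. j x = 0" for x
  proof (rule ccontr)
    assume ne: "x \<noteq> \<one>"
    have "\<exists>f. rat_hom G f \<and> f x \<noteq> 0" by (rule rat_hom_separates[OF _ x(1) ne]) (rule tf)
    then obtain f where f: "rat_hom G f" "f x \<noteq> 0" by blast
    obtain \<beta> where "\<forall>x\<in>carrier G. f x = (\<Sum>j\<in>J. \<beta> j * j x)" using cut[OF f(1)] by (elim exE) (rule that)
    from bspec[OF this x(1)] have "f x = (\<Sum>j\<in>J. \<beta> j * j x)" .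
    also have "\<dots> = 0" using x(2) by (intro sum.neutral) simp
    finally show False using f(2) by contradiction
  qed
  moreover have "\<exists>\<beta>. \<forall>x\<in>carrier G. \<forall>i\<in>J. i (c x) = (\<Sum>j\<in>J. \<beta> i j * j x)" if c: "c \<in> hom G G" for c
  proof -
    have "\<forall>i\<in>J. \<exists>\<beta>. \<forall>x\<in>carrier G. i (c x) = (\<Sum>j\<in>J. \<beta> j * j x)"
    proof
      fix i assume "i \<in> J"
      then have "rat_hom G i" using J(2) by (auto simp: \<H>_def)
      then have "rat_hom G (\<lambda>x. i (c x))" using c by (auto simp: rat_hom_def hom_def Pi_def)
      then show "\<exists>\<beta>. \<forall>x\<in>carrier G. i (c x) = (\<Sum>j\<in>J. \<beta> j * j x)" by (rule cut)
    qed
    from bchoice[OF this] obtain \<beta> where "\<forall>i\<in>J. \<forall>x\<in>carrier G. i (c x) = (\<Sum>j\<in>J. \<beta> i j * j x)" by (elim exE) (rule that)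
    then show ?thesis by blast
  qed
  ultimately show ?thesis using J(1,2) by (intro exI[of _ J]) (auto simp: \<H>_def)
qed

end

section \<open>Descent along the normal series\<close>

context quotient_step
begin

text \<open>\<open>conjQ b\<close> is an endomorphism of \<open>Q\<close>, so it acts by a rational
  matrix in the coordinates \<open>J\<close>.\<close>

lemma packing_torsion_free:
  assumes tf: "torsion_free_abelian Q" and fr: "finite_rat_rank Q"
    and B: "finite B" "B \<subseteq> carrier \<Gamma>"
  shows "\<exists>\<kappa>. packing_bound N M B \<kappa>"
proof -
  interpret QC: comm_group Q using tf by (simp add: torsion_free_abelian_def)
  have tf': "a = \<one>\<^bsub>Q\<^esub>" if "a \<in> carrier Q" "(n::nat) > 0" "a [^]\<^bsub>Q\<^esub> n = \<one>\<^bsub>Q\<^esub>" for a n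
    by (rule tf[unfolded torsion_free_abelian_def, THEN conjunct2, rule_format, of a n]) (use that in auto)
  have "\<exists>J. finite J \<and> (\<forall>j\<in>J. rat_hom Q j) \<and> (\<forall>x\<in>carrier Q. (\<forall>j\<in>J. j x = 0) \<longrightarrow> x = \<one>\<^bsub>Q\<^esub>) \<and>
     (\<forall>c\<in>hom Q Q. \<exists>\<beta>. \<forall>x\<in>carrier Q. \<forall>i\<in>J. i (c x) = (\<Sum>j\<in>J. \<beta> i j * j x))"
    by (rule QC.rat_coordinates[OF _ fr]) (rule tf')
  then obtain J where J: "finite J" "\<forall>j\<in>J. rat_hom Q j"
    "\<forall>x\<in>carrier Q. (\<forall>j\<in>J. j x = 0) \<longrightarrow> x = \<one>\<^bsub>Q\<^esub>"
    "\<forall>c\<in>hom Q Q. \<exists>\<beta>. \<forall>x\<in>carrier Q. \<forall>i\<in>J. i (c x) = (\<Sum>j\<in>J. \<beta> i j * j x)"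
    by (elim exE conjE) (rule that)
  show ?thesis
  proof (rule packing_coordinates[where \<theta>="\<lambda>m i. i (\<pi> m)", OF M J(1) _ _ _ B])
    fix m m' i assume m: "m \<in> M" "m' \<in> M" and i: "i \<in> J"
    show "i (\<pi> (m \<otimes> m')) = i (\<pi> m) + i (\<pi> m')"
      unfolding pi_hom[OF m]
      by (rule bspec[OF J(2) i, unfolded rat_hom_def, rule_format, OF pi_closed[OF m(1)] pi_closed[OF m(2)]])
  next
    fix m assume m: "m \<in> M" and z: "\<And>i. i \<in> J \<Longrightarrow> i (\<pi> m) = 0"
    have "\<pi> m = \<one>\<^bsub>Q\<^esub>" by (rule bspec[OF J(3) pi_closed[OF m], THEN mp]) (intro ballI z)
    then show "m \<in> N" by (rule iffD1[OF pi_ker[OF m]])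
  next
    fix b assume b: "b \<in> carrier \<Gamma>"
    obtain \<beta> where \<beta>: "\<forall>x\<in>carrier Q. \<forall>i\<in>J. i (conjQ b x) = (\<Sum>j\<in>J. \<beta> i j * j x)"
      using bspec[OF J(4) conjQ_hom[OF b]] by (elim exE) (rule that)
    show "\<exists>\<beta>. \<forall>m\<in>M. \<forall>i\<in>J. i (\<pi> (b \<otimes> m \<otimes> inv b)) = (\<Sum>j\<in>J. \<beta> i j * j (\<pi> m))"
    proof (rule exI[of _ \<beta>], intro ballI)
      fix m i assume m: "m \<in> M" and i: "i \<in> J"
      show "i (\<pi> (b \<otimes> m \<otimes> inv b)) = (\<Sum>j\<in>J. \<beta> i j * j (\<pi> m))"
        using \<beta>[rule_format, OF pi_closed[OF m] i] unfolding conjQ_pi[OF b m] .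
    qed
  qed
qed

lemma packing_star:
  assumes "star_quotient Q" "finite B" "B \<subseteq> carrier \<Gamma>"
  shows "\<exists>\<kappa>. packing_bound N M B \<kappa>"
  using assms(1) unfolding star_quotient_def
proof (elim disjE conjE)
  assume "finite (carrier Q)" then show ?thesis by (rule packing_finite[OF _ assms(2,3)])
next
  assume "union_of_finite_characteristic Q" then show ?thesis by (rule packing_characteristic[OF _ assms(2,3)])
next
  assume "torsion_free_abelian Q" "finite_rat_rank Q" then show ?thesis by (rule packing_torsion_free[OF _ _ assms(2,3)])
qed

end

context free_borel_action
begin

lemma quotient_step_Mod:
  assumes N: "N \<lhd> \<Gamma>" and M: "M \<lhd> \<Gamma>" and NM: "N \<subseteq> M"
  shows "quotient_step \<Gamma> X \<phi> N M (\<Gamma>\<lparr>carrier := M\<rparr> Mod N) (\<lambda>m. N #> m)"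
proof -
  interpret N: normal N \<Gamma> by (rule N)
  interpret M: normal M \<Gamma> by (rule M)
  have NM': "normal N (\<Gamma>\<lparr>carrier := M\<rparr>)" by (rule normal_restrict_supergroup[OF M.is_subgroup N NM])
  show ?thesis
  proof (rule quotient_step.intro[OF free_borel_action_axioms quotient_step_axioms.intro[OF N M NM]])
    show "group (\<Gamma>\<lparr>carrier := M\<rparr> Mod N)" by (rule normal.factorgroup_is_group[OF NM'])
    show "N #> (m \<otimes> m') = (N #> m) \<otimes>\<^bsub>\<Gamma>\<lparr>carrier := M\<rparr> Mod N\<^esub> (N #> m')" if "m \<in> M" "m' \<in> M" for m m'
      using N.rcos_sum[of m m'] M.subset that by (auto simp: subset_iff set_mult_def)
    show "(#>) N ` M = carrier (\<Gamma>\<lparr>carrier := M\<rparr> Mod N)"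
      by (simp add: carrier_FactGroup r_coset_def)
    show "N #> m = \<one>\<^bsub>\<Gamma>\<lparr>carrier := M\<rparr> Mod N\<^esub> \<longleftrightarrow> m \<in> N" if "m \<in> M" for m
      using coset_join1[of N m] coset_join2[of m N] N.is_subgroup M.subset that by (auto simp: subset_iff)
  qed
qed

text \<open>Both invariants climb from the trivial term towards the top. The climb stops at index 1,
  because across the top quotient only the packing bound for \<open>B = {\<one>}\<close> is at hand
  in general, which does not yield \<open>chrom\<close>.\<close>

lemma adim_series:
  assumes Nn: "N n = {\<one>}" and nor: "\<forall>i\<le>n. N i \<lhd> \<Gamma>" and dec: "\<forall>i<n. N (Suc i) \<subseteq> N i"
    and q: "\<forall>i<n. 0 < i \<longrightarrow> star_quotient (\<Gamma>\<lparr>carrier := N i\<rparr> Mod N (Suc i))" and i: "0 < i" "i \<le> n"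
  shows "chrom (N i) \<and> (\<exists>k. adim X \<phi> (N i) k)"
  using i(2,1)
proof (induction i rule: inc_induct)
  case base
  show ?case unfolding Nn using chrom_trivial adim_trivial by blast
next
  case (step m)
  from step.IH obtain k where k: "chrom (N (Suc m))" "adim X \<phi> (N (Suc m)) k" by auto
  have nm: "N (Suc m) \<lhd> \<Gamma>" "N m \<lhd> \<Gamma>" "N (Suc m) \<subseteq> N m" using step.hyps nor dec by auto
  interpret S: quotient_step \<Gamma> X \<phi> "N (Suc m)" "N m" "\<Gamma>\<lparr>carrier := N m\<rparr> Mod N (Suc m)" "\<lambda>x. N (Suc m) #> x"
    by (rule quotient_step_Mod[OF nm])
  have pk: "\<exists>\<kappa>. packing_bound (N (Suc m)) (N m) B \<kappa>" if "finite B" "B \<subseteq> carrier \<Gamma>" for B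
    by (rule S.packing_star[OF _ that]) (use q step in simp)
  obtain \<kappa> where "packing_bound (N (Suc m)) (N m) {\<one>} \<kappa>" using pk[of "{\<one>}"] by auto
  then have "adim X \<phi> (N m) (k * Suc \<kappa> * k)" by (rule adim_step[OF nm(1) S.M.is_subgroup nm(3) k(2,1)])
  moreover have "chrom (N m)" by (rule chrom_step[OF nm(1) S.M.is_subgroup nm(3) k(2,1)]) (rule pk)
  ultimately show ?case by blast
qed

lemma lamplighter_one_idem:
  "\<one>\<^bsub>lamplighter_group\<^esub> \<otimes>\<^bsub>lamplighter_group\<^esub> \<one>\<^bsub>lamplighter_group\<^esub> = \<one>\<^bsub>lamplighter_group\<^esub>"
  "\<one>\<^bsub>lamplighter_group\<^esub> \<in> carrier lamplighter_group"
  by (auto simp: lamplighter_group_def wreath_product_def integer_mod_group_def integer_group_def)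

text \<open>Two extension steps: from \<open>N\<close> to \<open>base\<close>, the elements that do
  not move the lamplighter, and from \<open>base\<close> to the whole group. The first must also
  deliver a colouring, so \<open>packing_lamps\<close> is applied for arbitrary
  \<open>B\<close>.\<close>

lemma adim_lamplighter:
  assumes N: "N \<lhd> \<Gamma>" and ad: "adim X \<phi> N k" and ch: "chrom N"
    and iso: "\<Gamma> Mod N \<cong> lamplighter_group"
  shows "\<exists>k. adim X \<phi> (carrier \<Gamma>) k"
proof -
  interpret N: normal N \<Gamma> by (rule N)
  have cs: "subgroup (carrier \<Gamma>) \<Gamma>" "carrier \<Gamma> \<lhd> \<Gamma>"
    using subgroup_self by (simp_all add: normal_inv_iff)
  interpret Q: quotient_step \<Gamma> X \<phi> N "carrier \<Gamma>" "\<Gamma> Mod N" "\<lambda>x. N #> x"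
    using quotient_step_Mod[OF N cs(2) N.subset] by simp
  obtain \<psi> where psi: "\<psi> \<in> iso (\<Gamma> Mod N) lamplighter_group" using iso by (auto simp: is_iso_def)
  have L: "group lamplighter_group"
  proof -
    \<comment> \<open>The image under an isomorphism is a group with the image of the unit as its
      unit. The declared unit of the lamplighter group is idempotent, hence equal to it.\<close>
    let ?L = "lamplighter_group\<lparr>one := \<psi> \<one>\<^bsub>\<Gamma> Mod N\<^esub>\<rparr>" and ?e = "\<one>\<^bsub>lamplighter_group\<^esub>"
    interpret L': group ?L by (rule Q.Q.iso_imp_img_group[OF psi])
    have "?e \<otimes>\<^bsub>?L\<^esub> ?e = ?e" "?e \<in> carrier ?L" by (simp_all add: lamplighter_one_idem)
    then have "?e = \<one>\<^bsub>?L\<^esub>" using L'.l_cancel_one'[of ?e ?e] by simp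
    then have "?L = lamplighter_group" by simp
    then show ?thesis using L'.is_group by (simp only:)
  qed
  interpret L: group lamplighter_group by (rule L)
  interpret h: group_hom "\<Gamma> Mod N" lamplighter_group \<psi>
    using psi by unfold_locales (simp add: iso_def)
  have inj: "inj_on \<psi> (carrier (\<Gamma> Mod N))" "\<psi> ` carrier (\<Gamma> Mod N) = carrier lamplighter_group"
    using psi by (auto simp: iso_def bij_betw_def)
  interpret S: lamplighter_step \<Gamma> X \<phi> N "\<lambda>x. \<psi> (N #> x)"
  proof (rule lamplighter_step.intro, rule quotient_step.intro[OF free_borel_action_axioms],
      rule quotient_step_axioms.intro[OF N cs(2) N.subset L])
    show "\<psi> (N #> (m \<otimes> m')) = \<psi> (N #> m) \<otimes>\<^bsub>lamplighter_group\<^esub> \<psi> (N #> m')"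
      if m: "m \<in> carrier \<Gamma>" "m' \<in> carrier \<Gamma>" for m m'
      unfolding Q.pi_hom[OF m] by (rule h.hom_mult[OF Q.pi_closed[OF m(1)] Q.pi_closed[OF m(2)]])
    show "(\<lambda>x. \<psi> (N #> x)) ` carrier \<Gamma> = carrier lamplighter_group"
      unfolding inj(2)[symmetric] Q.pi_onto[symmetric] by (rule image_image[symmetric])
    show "\<psi> (N #> m) = \<one>\<^bsub>lamplighter_group\<^esub> \<longleftrightarrow> m \<in> N" if m: "m \<in> carrier \<Gamma>" for m
    proof -
      have "\<psi> (N #> m) = \<one>\<^bsub>lamplighter_group\<^esub> \<longleftrightarrow> \<psi> (N #> m) = \<psi> \<one>\<^bsub>\<Gamma> Mod N\<^esub>" by (simp only: h.hom_one)
      also have "\<dots> \<longleftrightarrow> N #> m = \<one>\<^bsub>\<Gamma> Mod N\<^esub>" by (rule inj_on_eq_iff[OF inj(1) Q.pi_closed[OF m] Q.Q.one_closed])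
      also have "\<dots> \<longleftrightarrow> m \<in> N" by (rule Q.pi_ker[OF m])
      finally show ?thesis .
    qed
  qed
  have sb: "subgroup S.base \<Gamma>" by (rule normal_imp_subgroup[OF S.base_normal])
  have pk: "\<exists>\<kappa>. packing_bound N S.base B \<kappa>" if "finite B" "B \<subseteq> carrier \<Gamma>" for B
    by (rule S.packing_lamps[OF that])
  obtain \<kappa> where "packing_bound N S.base {\<one>} \<kappa>" using pk[of "{\<one>}"] by auto
  then have ad': "adim X \<phi> S.base (k * Suc \<kappa> * k)" by (rule adim_step[OF N sb S.N_base ad ch])
  have ch': "chrom S.base" by (rule chrom_step[OF N sb S.N_base ad ch]) (rule pk)
  obtain \<kappa>' where "packing_bound S.base (carrier \<Gamma>) {\<one>} \<kappa>'" using S.packing_shift by blast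
  from adim_step[OF S.base_normal cs(1) _ ad' ch' this] show ?thesis
    using subgroup.subset[OF sb] by blast
qed

theorem adim_star_group:
  assumes "star_group \<Gamma>"
  shows "\<exists>k. adim X \<phi> (carrier \<Gamma>) k"
proof -
  obtain n N where *: "N 0 = carrier \<Gamma>" "N n = {\<one>}" "\<forall>i\<le>n. N i \<lhd> \<Gamma>"
    and s: "\<forall>i<n. N (Suc i) \<subseteq> N i \<and>
           (if i = 0 then star_top_quotient (\<Gamma>\<lparr>carrier := N i\<rparr> Mod N (Suc i))
            else star_quotient (\<Gamma>\<lparr>carrier := N i\<rparr> Mod N (Suc i)))"
    using assms unfolding star_group_def by (elim exE conjE) (rule that)
  have dec: "\<forall>i<n. N (Suc i) \<subseteq> N i" and q: "\<forall>i<n. 0 < i \<longrightarrow> star_quotient (\<Gamma>\<lparr>carrier := N i\<rparr> Mod N (Suc i))"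
    using s by auto
  show ?thesis
  proof (cases n)
    case 0
    then have "carrier \<Gamma> = {\<one>}" using *(1,2) by simp
    then show ?thesis using adim_trivial by (intro exI[of _ 1]) (simp only:)
  next
    case (Suc n')
    have top: "star_top_quotient (\<Gamma>\<lparr>carrier := N 0\<rparr> Mod N (Suc 0))" using s Suc by (auto dest: spec[of _ 0])
    obtain k where k: "chrom (N (Suc 0))" "adim X \<phi> (N (Suc 0)) k"
      using adim_series[OF *(2,3) dec q, of "Suc 0"] Suc by auto
    have N1: "N (Suc 0) \<lhd> \<Gamma>" "N 0 \<lhd> \<Gamma>" "N (Suc 0) \<subseteq> N 0" using *(3) dec Suc by auto
    have sub: "subgroup (N 0) \<Gamma>" by (rule normal_imp_subgroup[OF N1(2)])
    interpret S: quotient_step \<Gamma> X \<phi> "N (Suc 0)" "N 0" "\<Gamma>\<lparr>carrier := N 0\<rparr> Mod N (Suc 0)" "\<lambda>x. N (Suc 0) #> x"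
      by (rule quotient_step_Mod[OF N1])
    have fin: ?thesis if "\<exists>\<kappa>. packing_bound (N (Suc 0)) (N 0) {\<one>} \<kappa>"
    proof -
      from that obtain \<kappa> where "packing_bound (N (Suc 0)) (N 0) {\<one>} \<kappa>" by blast
      from adim_step[OF N1(1) sub N1(3) k(2,1) this] show ?thesis unfolding *(1) by blast
    qed
    show ?thesis using top unfolding star_top_quotient_def
    proof (elim disjE)
      assume "star_quotient (\<Gamma>\<lparr>carrier := N 0\<rparr> Mod N (Suc 0))"
      then show ?thesis by (intro fin S.packing_star) auto
    next
      assume "uniform_local_polynomial_growth (\<Gamma>\<lparr>carrier := N 0\<rparr> Mod N (Suc 0))"
      then show ?thesis by (intro fin S.packing_growth)
    next
      assume "\<Gamma>\<lparr>carrier := N 0\<rparr> Mod N (Suc 0) \<cong> lamplighter_group"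
      then show ?thesis unfolding *(1) by (intro adim_lamplighter[OF N1(1) k(2,1)]) simp
    qed
  qed
qed

end

section \<open>From the hypotheses of the theorem to the working assumptions\<close>

lemma standard_borel_separation:
  fixes X :: "'x measure"
  assumes "standard_borel X"
  shows "\<exists>A :: nat \<Rightarrow> 'x set. (\<forall>n. A n \<in> sets X) \<and>
    (\<forall>x\<in>space X. \<forall>F. finite F \<and> F \<subseteq> space X \<and> x \<notin> F \<longrightarrow> (\<exists>n. x \<in> A n \<and> A n \<inter> F = {}))"
proof -
  obtain T where T: "completely_metrizable_space T" "second_countable T" "topspace T = space X"
      "sets X = sigma_sets (topspace T) {U. openin T U}"
    using assms unfolding standard_borel_def by (elim exE conjE) (rule that)
  have "t1_space T"
    using T(1) by (intro Hausdorff_imp_t1_space metrizable_imp_Hausdorff_space completely_metrizable_imp_metrizable_space)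
  then have t1: "closedin T F" if "finite F" "F \<subseteq> space X" for F
    using that T(3) by (simp add: t1_space_closedin_finite)
  obtain \<B> where B: "countable \<B>" "\<forall>V\<in>\<B>. openin T V"
      "\<forall>U x. openin T U \<and> x \<in> U \<longrightarrow> (\<exists>V\<in>\<B>. x \<in> V \<and> V \<subseteq> U)"
    using T(2) unfolding second_countable_def by (elim exE conjE) (rule that)
  \<comment> \<open>The empty set is added so that the family is nonempty and
    \<open>from_nat_into\<close> enumerates it.\<close>
  define A where "A = from_nat_into (insert {} \<B>)"
  have rA: "range A = insert {} \<B>" unfolding A_def using B(1) by (intro range_from_nat_into) auto
  show ?thesis
  proof (intro exI[of _ A] conjI allI ballI impI)
    fix n
    have "A n \<in> insert {} \<B>" unfolding rA[symmetric] by (rule rangeI)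
    then have "openin T (A n)" using B(2) by auto
    then show "A n \<in> sets X" unfolding T(4) by (intro sigma_sets.Basic) simp
  next
    fix x F assume x: "x \<in> space X" and F: "finite F \<and> F \<subseteq> space X \<and> x \<notin> F"
    \<comment> \<open>Finite sets are closed in a T1 space; a basic open set around \<open>x\<close>
      inside this complement is the one sought.\<close>
    have "openin T (topspace T - F)" using t1[of F] F by (intro openin_diff openin_topspace) auto
    moreover have "x \<in> topspace T - F" using x F T(3) by simp
    ultimately have "\<exists>V\<in>\<B>. x \<in> V \<and> V \<subseteq> topspace T - F" by (intro B(3)[rule_format] conjI)
    then obtain V where V: "V \<in> \<B>" "x \<in> V" "V \<subseteq> topspace T - F" by (elim bexE conjE) (rule that)
    have "V \<in> range A" unfolding rA using V(1) by (rule insertI2)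
    then obtain n where "V = A n" by (rule rangeE)
    then show "\<exists>n. x \<in> A n \<and> A n \<inter> F = {}" using V(2,3) by (intro exI[of _ n]) auto
  qed
qed

lemma free_borel_actionI:
  fixes X :: "'x measure"
  assumes G: "group G" "countable (carrier G)" and X: "standard_borel X"
    and act: "borel_action G X \<phi>" "free_action G X \<phi>"
  shows "free_borel_action G X \<phi>"
proof -
  interpret group G by (rule G(1))
  interpret A: group_action G "space X" \<phi> using act(1) by (simp add: borel_action_def)
  show ?thesis
  proof (unfold_locales, fact G(2))
    show "\<phi> g x \<in> space X" if "g \<in> carrier G" "x \<in> space X" for g x
      by (rule A.element_image[OF that refl])
    show "\<phi> \<one>\<^bsub>G\<^esub> x = x" if "x \<in> space X" for x
      by (rule A.id_eq_one[THEN fun_cong, of x, symmetric, THEN trans]) (use that in simp)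
    show "\<phi> (g \<otimes>\<^bsub>G\<^esub> h) x = \<phi> g (\<phi> h x)" if "g \<in> carrier G" "h \<in> carrier G" "x \<in> space X" for g h x
      by (rule A.composition_rule[OF that(3,1,2)])
    show "g = \<one>\<^bsub>G\<^esub>" if "g \<in> carrier G" "x \<in> space X" "\<phi> g x = x" for g x
      using act(2) that unfolding free_action_def by blast
    show "\<phi> g \<in> measurable X X" if g: "g \<in> carrier G" for g
    proof -
      have "(\<lambda>x. (g, x)) \<in> measurable X (count_space (carrier G) \<Otimes>\<^sub>M X)" using g by simp
      from measurable_compose[OF this, of "\<lambda>(g, x). \<phi> g x" X] act(1) show ?thesis by (simp add: borel_action_def)
    qed
    show "\<exists>A :: nat \<Rightarrow> 'x set. (\<forall>n. A n \<in> sets X) \<and>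
      (\<forall>x\<in>space X. \<forall>F. finite F \<and> F \<subseteq> space X \<and> x \<notin> F \<longrightarrow> (\<exists>n. x \<in> A n \<and> A n \<inter> F = {}))"
      by (rule standard_borel_separation[OF X])
  qed
qed

lemma free_borel_action_subgroup:
  assumes act: "free_borel_action G X \<phi>" and H: "subgroup H G"
  shows "free_borel_action (G\<lparr>carrier := H\<rparr>) X \<phi>"
proof -
  interpret G: free_borel_action G X \<phi> by (rule act)
  interpret H: subgroup H G by (rule H)
  interpret K: group "G\<lparr>carrier := H\<rparr>" by (rule H.subgroup_is_group[OF G.is_group])
  show ?thesis
    using G.act_closed G.act_one G.act_mult G.act_free G.act_measurable G.separation
      countable_subset[OF H.subset G.countable_carrier]
    by unfold_locales auto
qed

theorem corollary1p11:
  fixes G :: "('g, 'm) monoid_scheme"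
    and H :: "nat \<Rightarrow> 'g set"
    and X :: "'x measure"
    and \<phi> :: "'g \<Rightarrow> 'x \<Rightarrow> 'x"
  assumes "group G"
    and "\<And>n. subgroup (H n) G"
    and "incseq H"
    and "carrier G = (\<Union>n. H n)"
    and "\<And>n. star_group (G\<lparr>carrier := H n\<rparr>)"
    and "standard_borel X"
    and "borel_action G X \<phi>"
    and "free_action G X \<phi>"
  shows "hyperfinite X (orbit_equivalence G X \<phi>)"
proof -
  have "countable (H n)" for n using assms(5)[of n] by (simp add: star_group_def)
  then have "countable (carrier G)" unfolding assms(4) by simp
  then interpret free_borel_action G X \<phi> by (rule free_borel_actionI[OF assms(1) _ assms(6-8)])
  \<comment> \<open>\<open>adim\<close> mentions only the set \<open>H n\<close>, so what is proved
    for the group on \<open>H n\<close> is a statement about the subgroup of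
    \<open>G\<close>.\<close>
  have "\<exists>k. adim X \<phi> (H n) k" for n
    using free_borel_action.adim_star_group[OF free_borel_action_subgroup[OF free_borel_action_axioms assms(2)] assms(5), of n]
    by simp
  then have "\<forall>n. \<exists>k. adim X \<phi> (H n) k" ..
  from choice[OF this] obtain k where k: "\<forall>n. adim X \<phi> (H n) (k n)" by (rule exE)
  show ?thesis by (rule hyperfinite_union[OF assms(2-4) k[rule_format]])
qed

end
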